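(* Let $L$ be a finite-dimensional Lie algebra over a field $\mathbb{F}$ of prime characteristic $p$, let $M$ be a finite-dimensional $L$-module, and let $\mathfrak{L}$ be a $p$-envelope of $L$ with $\dim_{\mathbb{F}}\mathfrak{L}/L<\infty$. Then, for every non-negative integer $n$, there is an isomorphism $$H^n(\mathfrak{L},M)\cong\bigoplus_{i+j=n}\Lambda^i(\mathfrak{L}/L)\otimes_{\mathbb{F}}H^j(L,M)$$ of $\mathbb{F}$-vector spaces.
   Context: $H^n(\cdot,M)$ denotes ordinary (Chevalley-Eilenberg) Lie algebra cohomology; $\Lambda^i$ is the $i$-th exterior power of a vector space. A $p$-envelope of a Lie algebra $L$ over a field of characteristic $p$ is a triple $(\mathfrak{L},(\cdot)^{[p]},\iota)$ where $\mathfrak{L}$ is a restricted Lie algebra with $p$-mapping $(\cdot)^{[p]}$ and $\iota:L\to\mathfrak{L}$ is an injective Lie algebra homomorphism such that the smallest restricted subalgebra ($p$-subalgebra) of $\mathfrak{L}$ containing $\iota(L)$ is $\mathfrak{L}$ itself; $L$ is identified with $\iota(L)$, and $\mathfrak{L}/L$ is the quotient vector space. Module structure: let $\hat L$ be the universal $p$-envelope of $L$, i.e. the restricted Lie subalgebra of the universal enveloping algebra $U(L)$ (with $p$-mapping $u\mapsto u^p$) generated by $L$, and $\hat\iota:L\to\hat L$ the inclusion. Every $L$-module $M$ is a $U(L)$-module, hence an $\hat L$-module. There exists a Lie algebra homomorphism $\phi:\mathfrak{L}\to\hat L$ with $\phi\circ\iota=\hat\iota$; fix any such $\phi$. Then $M$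 is regarded as an $\mathfrak{L}$-module via $\phi$, extending the action of $L$. *)

theory Defs
  imports "Jordan_Normal_Form.Missing_VectorSpace" "HOL-Algebra.QuotRing" "HOL-Computational_Algebra.Primes"
begin

hide_const (open) Multiset.mult  (* clashes with the ring field *)

text \<open>
  A vector space over \<open>K\<close> is a record \<open>V\<close> with \<^term>\<open>vectorspace K V\<close>. The record type of modules
  extends that of rings; the fields \<^const>\<open>mult\<close> and \<^const>\<open>one\<close> of a mere vector space carry no
  meaning, and are filled with arbitrary values below.
\<close>

definition has_char :: "('k, 'e) ring_scheme \<Rightarrow> nat \<Rightarrow> bool"
  where "has_char K p \<longleftrightarrow> (\<forall>n::nat. [n] \<cdot>\<^bsub>K\<^esub> \<one>\<^bsub>K\<^esub> = \<zero>\<^bsub>K\<^esub> \<longleftrightarrow> p dvd n)"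

definition vs_iso ::
    "('k, 'e) ring_scheme \<Rightarrow> ('k, 'a, 'r) module_scheme \<Rightarrow> ('k, 'b, 's) module_scheme \<Rightarrow> bool"
  where "vs_iso K V W \<longleftrightarrow> (\<exists>f. linear_map K V W f \<and> bij_betw f (carrier V) (carrier W))"


section \<open>Linear constructions\<close>

text \<open>
  The quotient space \<open>V/W\<close>, on the set of cosets. Its ring fields are those of
  \<^term>\<open>V Quot W\<close>, so that for an associative algebra \<open>V\<close> and a two-sided ideal \<open>W\<close> this is also
  the quotient algebra.
\<close>
definition quot_space :: "('k, 'v, 'r) module_scheme \<Rightarrow> 'v set \<Rightarrow> ('k, 'v set) module"
  where "quot_space V W =
    \<lparr>carrier = a_rcosets\<^bsub>V\<^esub> W, mult = rcoset_mult V W, one = W +>\<^bsub>V\<^esub> \<one>\<^bsub>V\<^esub>, zero = W, add = set_add V,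
     smult = (\<lambda>a X. \<Union>x\<in>X. W +>\<^bsub>V\<^esub> (a \<odot>\<^bsub>V\<^esub> x))\<rparr>"

definition free_space :: "('k, 'e) ring_scheme \<Rightarrow> 's set \<Rightarrow> ('k, 's \<Rightarrow> 'k) module"
  where "free_space K S =
    \<lparr>carrier = {f. (\<forall>x. f x \<in> carrier K) \<and> (\<forall>x. x \<notin> S \<longrightarrow> f x = \<zero>\<^bsub>K\<^esub>) \<and> finite {x. f x \<noteq> \<zero>\<^bsub>K\<^esub>}},
     mult = (\<lambda>f g x. \<zero>\<^bsub>K\<^esub>), one = (\<lambda>x. \<zero>\<^bsub>K\<^esub>),
     zero = (\<lambda>x. \<zero>\<^bsub>K\<^esub>), add = (\<lambda>f g x. f x \<oplus>\<^bsub>K\<^esub> g x), smult = (\<lambda>a f x. a \<otimes>\<^bsub>K\<^esub> f x)\<rparr>"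

definition free_gen :: "('k, 'e) ring_scheme \<Rightarrow> 's \<Rightarrow> 's \<Rightarrow> 'k"
  where "free_gen K s = (\<lambda>x. if x = s then \<one>\<^bsub>K\<^esub> else \<zero>\<^bsub>K\<^esub>)"

definition tuples :: "('a, 'r) ring_scheme \<Rightarrow> nat \<Rightarrow> 'a list set"
  where "tuples V n = {xs. length xs = n \<and> set xs \<subseteq> carrier V}"

definition tensor_rels ::
    "('k, 'e) ring_scheme \<Rightarrow> ('k, 'a, 'r) module_scheme \<Rightarrow> ('k, 'b, 's) module_scheme \<Rightarrow>
     ('a \<times> 'b \<Rightarrow> 'k) set"
  where "tensor_rels K V W =
    (let F = free_space K (carrier V \<times> carrier W); e = free_gen K in
      {e (x \<oplus>\<^bsub>V\<^esub> y, w) \<ominus>\<^bsub>F\<^esub> (e (x, w) \<oplus>\<^bsub>F\<^esub> e (y, w)) | x y w.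
         x \<in> carrier V \<and> y \<in> carrier V \<and> w \<in> carrier W}
      \<union> {e (v, x \<oplus>\<^bsub>W\<^esub> y) \<ominus>\<^bsub>F\<^esub> (e (v, x) \<oplus>\<^bsub>F\<^esub> e (v, y)) | v x y.
         v \<in> carrier V \<and> x \<in> carrier W \<and> y \<in> carrier W}
      \<union> {e (a \<odot>\<^bsub>V\<^esub> v, w) \<ominus>\<^bsub>F\<^esub> (a \<odot>\<^bsub>F\<^esub> e (v, w)) | a v w.
         a \<in> carrier K \<and> v \<in> carrier V \<and> w \<in> carrier W}
      \<union> {e (v, a \<odot>\<^bsub>W\<^esub> w) \<ominus>\<^bsub>F\<^esub> (a \<odot>\<^bsub>F\<^esub> e (v, w)) | a v w.
         a \<in> carrier K \<and> v \<in> carrier V \<and> w \<in> carrier W})"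

definition tensor_space ::
    "('k, 'e) ring_scheme \<Rightarrow> ('k, 'a, 'r) module_scheme \<Rightarrow> ('k, 'b, 's) module_scheme \<Rightarrow>
     ('k, ('a \<times> 'b \<Rightarrow> 'k) set) module"
  where "tensor_space K V W =
    (let F = free_space K (carrier V \<times> carrier W)
     in quot_space F (LinearCombinations.module.span K F (tensor_rels K V W)))"

definition exterior_rels ::
    "('k, 'e) ring_scheme \<Rightarrow> nat \<Rightarrow> ('k, 'a, 'r) module_scheme \<Rightarrow> ('a list \<Rightarrow> 'k) set"
  where "exterior_rels K n V =
    (let F = free_space K (tuples V n); e = free_gen K in
      {e (xs[i := x \<oplus>\<^bsub>V\<^esub> y]) \<ominus>\<^bsub>F\<^esub> (e (xs[i := x]) \<oplus>\<^bsub>F\<^esub> e (xs[i := y])) | xs i x y.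
         xs \<in> tuples V n \<and> i < n \<and> x \<in> carrier V \<and> y \<in> carrier V}
      \<union> {e (xs[i := a \<odot>\<^bsub>V\<^esub> x]) \<ominus>\<^bsub>F\<^esub> (a \<odot>\<^bsub>F\<^esub> e (xs[i := x])) | xs i a x.
         xs \<in> tuples V n \<and> i < n \<and> a \<in> carrier K \<and> x \<in> carrier V}
      \<union> {e xs | xs. xs \<in> tuples V n \<and> \<not> distinct xs})"

definition exterior_power ::
    "('k, 'e) ring_scheme \<Rightarrow> nat \<Rightarrow> ('k, 'a, 'r) module_scheme \<Rightarrow> ('k, ('a list \<Rightarrow> 'k) set) module"
  where "exterior_power K n V =
    (let F = free_space K (tuples V n)
     in quot_space F (LinearCombinations.module.span K F (exterior_rels K n V)))"

definition dsum :: "'i set \<Rightarrow> ('i \<Rightarrow> ('k, 'v, 'r) module_scheme) \<Rightarrow> ('k, 'i \<Rightarrow> 'v) module"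
  where "dsum I V =
    \<lparr>carrier = {f \<in> \<Pi>\<^sub>E i\<in>I. carrier (V i). finite {i \<in> I. f i \<noteq> \<zero>\<^bsub>V i\<^esub>}},
     mult = (\<lambda>f g. \<lambda>i\<in>I. \<zero>\<^bsub>V i\<^esub>), one = (\<lambda>i\<in>I. \<zero>\<^bsub>V i\<^esub>),
     zero = (\<lambda>i\<in>I. \<zero>\<^bsub>V i\<^esub>), add = (\<lambda>f g. \<lambda>i\<in>I. f i \<oplus>\<^bsub>V i\<^esub> g i),
     smult = (\<lambda>a f. \<lambda>i\<in>I. a \<odot>\<^bsub>V i\<^esub> f i)\<rparr>"


section \<open>Lie algebras and their modules\<close>

record ('k, 'a) lie_algebra = "('k, 'a) module" +
  bracket :: "'a \<Rightarrow> 'a \<Rightarrow> 'a"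

locale lie_algebra = L?: vectorspace K L
  for K :: "('k, 'e) ring_scheme" and L :: "('k, 'a, 'r) lie_algebra_scheme" +
  assumes bracket_closed: "x \<in> carrier L \<Longrightarrow> y \<in> carrier L \<Longrightarrow> bracket L x y \<in> carrier L"
    and bracket_add_left: "x \<in> carrier L \<Longrightarrow> y \<in> carrier L \<Longrightarrow> z \<in> carrier L \<Longrightarrow>
      bracket L (x \<oplus>\<^bsub>L\<^esub> y) z = bracket L x z \<oplus>\<^bsub>L\<^esub> bracket L y z"
    and bracket_add_right: "x \<in> carrier L \<Longrightarrow> y \<in> carrier L \<Longrightarrow> z \<in> carrier L \<Longrightarrow>
      bracket L x (y \<oplus>\<^bsub>L\<^esub> z) = bracket L x y \<oplus>\<^bsub>L\<^esub> bracket L x z"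
    and bracket_smult_left: "a \<in> carrier K \<Longrightarrow> x \<in> carrier L \<Longrightarrow> y \<in> carrier L \<Longrightarrow>
      bracket L (a \<odot>\<^bsub>L\<^esub> x) y = a \<odot>\<^bsub>L\<^esub> bracket L x y"
    and bracket_smult_right: "a \<in> carrier K \<Longrightarrow> x \<in> carrier L \<Longrightarrow> y \<in> carrier L \<Longrightarrow>
      bracket L x (a \<odot>\<^bsub>L\<^esub> y) = a \<odot>\<^bsub>L\<^esub> bracket L x y"
    and bracket_self: "x \<in> carrier L \<Longrightarrow> bracket L x x = \<zero>\<^bsub>L\<^esub>"
    and jacobi: "x \<in> carrier L \<Longrightarrow> y \<in> carrier L \<Longrightarrow> z \<in> carrier L \<Longrightarrow>
      bracket L x (bracket L y z) \<oplus>\<^bsub>L\<^esub> bracket L y (bracket L z x) \<oplus>\<^bsub>L\<^esub> bracket L z (bracket L x y)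
        = \<zero>\<^bsub>L\<^esub>"

definition lie_hom ::
    "('k, 'e) ring_scheme \<Rightarrow> ('k, 'a, 'r) lie_algebra_scheme \<Rightarrow> ('k, 'b, 's) lie_algebra_scheme \<Rightarrow>
     ('a \<Rightarrow> 'b) set"
  where "lie_hom K L L' =
    {f \<in> module_hom K L L'. \<forall>x\<in>carrier L. \<forall>y\<in>carrier L. f (bracket L x y) = bracket L' (f x) (f y)}"

locale lie_module = lie_algebra K L + M?: vectorspace K M
  for K :: "('k, 'e) ring_scheme" and L :: "('k, 'a, 'r) lie_algebra_scheme"
    and M :: "('k, 'm, 's) module_scheme" +
  fixes act :: "'a \<Rightarrow> 'm \<Rightarrow> 'm"
  assumes act_closed: "x \<in> carrier L \<Longrightarrow> m \<in> carrier M \<Longrightarrow> act x m \<in> carrier M"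
    and act_add_left: "x \<in> carrier L \<Longrightarrow> y \<in> carrier L \<Longrightarrow> m \<in> carrier M \<Longrightarrow>
      act (x \<oplus>\<^bsub>L\<^esub> y) m = act x m \<oplus>\<^bsub>M\<^esub> act y m"
    and act_add_right: "x \<in> carrier L \<Longrightarrow> m \<in> carrier M \<Longrightarrow> m' \<in> carrier M \<Longrightarrow>
      act x (m \<oplus>\<^bsub>M\<^esub> m') = act x m \<oplus>\<^bsub>M\<^esub> act x m'"
    and act_smult_left: "a \<in> carrier K \<Longrightarrow> x \<in> carrier L \<Longrightarrow> m \<in> carrier M \<Longrightarrow>
      act (a \<odot>\<^bsub>L\<^esub> x) m = a \<odot>\<^bsub>M\<^esub> act x m"
    and act_smult_right: "a \<in> carrier K \<Longrightarrow> x \<in> carrier L \<Longrightarrow> m \<in> carrier M \<Longrightarrow>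
      act x (a \<odot>\<^bsub>M\<^esub> m) = a \<odot>\<^bsub>M\<^esub> act x m"
    and act_bracket: "x \<in> carrier L \<Longrightarrow> y \<in> carrier L \<Longrightarrow> m \<in> carrier M \<Longrightarrow>
      act (bracket L x y) m = act x (act y m) \<ominus>\<^bsub>M\<^esub> act y (act x m)"


section \<open>Restricted Lie algebras and $p$-envelopes\<close>

text \<open>
  \<open>ad_coeff L x y k i\<close> is the coefficient of $T^i$ in $(\mathrm{ad}(xT + y))^k(x)$, computed in
  $L \otimes K[T]$.
\<close>
primrec ad_coeff :: "('k, 'a, 'r) lie_algebra_scheme \<Rightarrow> 'a \<Rightarrow> 'a \<Rightarrow> nat \<Rightarrow> nat \<Rightarrow> 'a" where
  "ad_coeff L x y 0 i = (if i = 0 then x else \<zero>\<^bsub>L\<^esub>)"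
| "ad_coeff L x y (Suc k) i =
     (case i of 0 \<Rightarrow> \<zero>\<^bsub>L\<^esub> | Suc j \<Rightarrow> bracket L x (ad_coeff L x y k j)) \<oplus>\<^bsub>L\<^esub>
     bracket L y (ad_coeff L x y k i)"

text \<open>
  The terms $s_i(x,y)$ in the $p$-th power of a sum, given by
  $(\mathrm{ad}(xT + y))^{p-1}(x) = \sum_{i=1}^{p-1} i\, s_i(x,y)\, T^{i-1}$.
\<close>
definition jacobson_term ::
    "('k, 'e) ring_scheme \<Rightarrow> ('k, 'a, 'r) lie_algebra_scheme \<Rightarrow> nat \<Rightarrow> 'a \<Rightarrow> 'a \<Rightarrow> nat \<Rightarrow> 'a"
  where "jacobson_term K L p x y i =
    (inv\<^bsub>K\<^esub> ([i] \<cdot>\<^bsub>K\<^esub> \<one>\<^bsub>K\<^esub>)) \<odot>\<^bsub>L\<^esub> ad_coeff L x y (p - 1) (i - 1)"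

locale restricted_lie_algebra = lie_algebra K L
  for K :: "('k, 'e) ring_scheme" and L :: "('k, 'a, 'r) lie_algebra_scheme" +
  fixes p :: nat and pmap :: "'a \<Rightarrow> 'a"
  assumes prime_p: "prime p" and char_p: "has_char K p"
    and pmap_closed: "x \<in> carrier L \<Longrightarrow> pmap x \<in> carrier L"
    and bracket_pmap: "x \<in> carrier L \<Longrightarrow> y \<in> carrier L \<Longrightarrow>
      bracket L (pmap x) y = (bracket L x ^^ p) y"
    and pmap_smult: "a \<in> carrier K \<Longrightarrow> x \<in> carrier L \<Longrightarrow>
      pmap (a \<odot>\<^bsub>L\<^esub> x) = (a [^]\<^bsub>K\<^esub> p) \<odot>\<^bsub>L\<^esub> pmap x"
    and pmap_add: "x \<in> carrier L \<Longrightarrow> y \<in> carrier L \<Longrightarrow>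
      pmap (x \<oplus>\<^bsub>L\<^esub> y) = pmap x \<oplus>\<^bsub>L\<^esub> pmap y \<oplus>\<^bsub>L\<^esub> finsum L (jacobson_term K L p x y) {1..<p}"

definition p_subalgebra ::
    "('k, 'e) ring_scheme \<Rightarrow> ('k, 'a, 'r) lie_algebra_scheme \<Rightarrow> ('a \<Rightarrow> 'a) \<Rightarrow> 'a set \<Rightarrow> bool"
  where "p_subalgebra K L pmap S \<longleftrightarrow>
    VectorSpace.subspace K S L \<and> (\<forall>x\<in>S. \<forall>y\<in>S. bracket L x y \<in> S) \<and> (\<forall>x\<in>S. pmap x \<in> S)"

definition p_hull ::
    "('k, 'e) ring_scheme \<Rightarrow> ('k, 'a, 'r) lie_algebra_scheme \<Rightarrow> ('a \<Rightarrow> 'a) \<Rightarrow> 'a set \<Rightarrow> 'a set"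
  where "p_hull K L pmap X = \<Inter> {S. p_subalgebra K L pmap S \<and> X \<subseteq> S}"

definition p_envelope ::
    "('k, 'e) ring_scheme \<Rightarrow> nat \<Rightarrow> ('k, 'a, 'r) lie_algebra_scheme \<Rightarrow>
     ('k, 'b, 's) lie_algebra_scheme \<Rightarrow> ('b \<Rightarrow> 'b) \<Rightarrow> ('a \<Rightarrow> 'b) \<Rightarrow> bool"
  where "p_envelope K p L G pmap \<iota> \<longleftrightarrow>
    lie_algebra K L \<and> restricted_lie_algebra K G p pmap \<and>
    \<iota> \<in> lie_hom K L G \<and> inj_on \<iota> (carrier L) \<and>
    p_hull K G pmap (\<iota> ` carrier L) = carrier G"


section \<open>The universal enveloping algebra and the universal $p$-envelope\<close>

text \<open>
  The free associative unital algebra on \<open>S\<close>: the space on the words over \<open>S\<close>, with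
  concatenation extended bilinearly.
\<close>
definition free_algebra :: "('k, 'e) ring_scheme \<Rightarrow> 's set \<Rightarrow> ('k, 's list \<Rightarrow> 'k) module"
  where "free_algebra K S = (free_space K (lists S))
    \<lparr>mult := (\<lambda>f g w. finsum K (\<lambda>i. f (take i w) \<otimes>\<^bsub>K\<^esub> g (drop i w)) {..length w}),
     one := free_gen K []\<rparr>"

text \<open>
  $U(L)$ is the tensor algebra of \<open>L\<close> modulo $xy - yx - [x,y]$. The tensor algebra is the free
  algebra on the underlying set of \<open>L\<close> modulo the linear relations of \<open>L\<close>; both quotients are
  taken at once.
\<close>
definition uea_rels ::
    "('k, 'e) ring_scheme \<Rightarrow> ('k, 'a, 'r) lie_algebra_scheme \<Rightarrow> ('a list \<Rightarrow> 'k) set"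
  where "uea_rels K L =
    (let A = free_algebra K (carrier L); e = (\<lambda>x. free_gen K [x]) in
      {e (x \<oplus>\<^bsub>L\<^esub> y) \<ominus>\<^bsub>A\<^esub> (e x \<oplus>\<^bsub>A\<^esub> e y) | x y. x \<in> carrier L \<and> y \<in> carrier L}
      \<union> {e (a \<odot>\<^bsub>L\<^esub> x) \<ominus>\<^bsub>A\<^esub> (a \<odot>\<^bsub>A\<^esub> e x) | a x. a \<in> carrier K \<and> x \<in> carrier L}
      \<union> {(e x \<otimes>\<^bsub>A\<^esub> e y \<ominus>\<^bsub>A\<^esub> e y \<otimes>\<^bsub>A\<^esub> e x) \<ominus>\<^bsub>A\<^esub> e (bracket L x y) | x y.
         x \<in> carrier L \<and> y \<in> carrier L})"

definition uea_ideal ::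
    "('k, 'e) ring_scheme \<Rightarrow> ('k, 'a, 'r) lie_algebra_scheme \<Rightarrow> ('a list \<Rightarrow> 'k) set"
  where "uea_ideal K L = genideal (free_algebra K (carrier L)) (uea_rels K L)"

definition uea ::
    "('k, 'e) ring_scheme \<Rightarrow> ('k, 'a, 'r) lie_algebra_scheme \<Rightarrow> ('k, ('a list \<Rightarrow> 'k) set) module"
  where "uea K L = quot_space (free_algebra K (carrier L)) (uea_ideal K L)"

definition uea_incl ::
    "('k, 'e) ring_scheme \<Rightarrow> ('k, 'a, 'r) lie_algebra_scheme \<Rightarrow> 'a \<Rightarrow> ('a list \<Rightarrow> 'k) set"
  where "uea_incl K L x = uea_ideal K L +>\<^bsub>free_algebra K (carrier L)\<^esub> free_gen K [x]"

definition commutator_lie :: "('k, 'a, 'r) module_scheme \<Rightarrow> ('k, 'a) lie_algebra"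
  where "commutator_lie A =
    \<lparr>carrier = carrier A, mult = mult A, one = one A, zero = zero A, add = add A, smult = smult A,
     bracket = (\<lambda>x y. x \<otimes>\<^bsub>A\<^esub> y \<ominus>\<^bsub>A\<^esub> y \<otimes>\<^bsub>A\<^esub> x)\<rparr>"

definition universal_p_envelope ::
    "('k, 'e) ring_scheme \<Rightarrow> nat \<Rightarrow> ('k, 'a, 'r) lie_algebra_scheme \<Rightarrow>
     ('k, ('a list \<Rightarrow> 'k) set) lie_algebra"
  where "universal_p_envelope K p L =
    (let U = commutator_lie (uea K L)
     in U\<lparr>carrier := p_hull K U (\<lambda>u. u [^]\<^bsub>uea K L\<^esub> p) (uea_incl K L ` carrier L)\<rparr>)"

text \<open>
  An action of \<open>L\<close> on \<open>M\<close> extends to the free algebra by letting a word act as the composition of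
  the actions of its letters. For a Lie module this action vanishes on the ideal defining $U(L)$,
  so it takes the same value at all elements of a coset \<open>u\<close>, which is the action of \<open>u\<close>.
\<close>
definition free_act ::
    "('k, 'e) ring_scheme \<Rightarrow> ('k, 'm, 's) module_scheme \<Rightarrow> ('a \<Rightarrow> 'm \<Rightarrow> 'm) \<Rightarrow>
     ('a list \<Rightarrow> 'k) \<Rightarrow> 'm \<Rightarrow> 'm"
  where "free_act K M act f m = finsum M (\<lambda>w. f w \<odot>\<^bsub>M\<^esub> foldr act w m) {w. f w \<noteq> \<zero>\<^bsub>K\<^esub>}"

definition uea_act ::
    "('k, 'e) ring_scheme \<Rightarrow> ('k, 'm, 's) module_scheme \<Rightarrow> ('a \<Rightarrow> 'm \<Rightarrow> 'm) \<Rightarrow>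
     ('a list \<Rightarrow> 'k) set \<Rightarrow> 'm \<Rightarrow> 'm"
  where "uea_act K M act u m = the_elem ((\<lambda>f. free_act K M act f m) ` u)"


section \<open>Chevalley--Eilenberg cohomology\<close>

definition cochains ::
    "('k, 'e) ring_scheme \<Rightarrow> ('k, 'a, 'r) module_scheme \<Rightarrow> ('k, 'm, 's) module_scheme \<Rightarrow> nat \<Rightarrow>
     ('a list \<Rightarrow> 'm) set"
  where "cochains K L M n = {f \<in> tuples L n \<rightarrow>\<^sub>E carrier M.
    (\<forall>xs\<in>tuples L n. \<forall>i<n. \<forall>x\<in>carrier L. \<forall>y\<in>carrier L.
       f (xs[i := x \<oplus>\<^bsub>L\<^esub> y]) = f (xs[i := x]) \<oplus>\<^bsub>M\<^esub> f (xs[i := y])) \<and>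
    (\<forall>xs\<in>tuples L n. \<forall>i<n. \<forall>a\<in>carrier K. \<forall>x\<in>carrier L.
       f (xs[i := a \<odot>\<^bsub>L\<^esub> x]) = a \<odot>\<^bsub>M\<^esub> f (xs[i := x])) \<and>
    (\<forall>xs\<in>tuples L n. \<not> distinct xs \<longrightarrow> f xs = \<zero>\<^bsub>M\<^esub>)}"

definition cochain_space ::
    "('k, 'e) ring_scheme \<Rightarrow> ('k, 'a, 'r) module_scheme \<Rightarrow> ('k, 'm, 's) module_scheme \<Rightarrow> nat \<Rightarrow>
     ('k, 'a list \<Rightarrow> 'm) module"
  where "cochain_space K L M n =
    \<lparr>carrier = cochains K L M n,
     mult = (\<lambda>f g. \<lambda>xs\<in>tuples L n. \<zero>\<^bsub>M\<^esub>), one = (\<lambda>xs\<in>tuples L n. \<zero>\<^bsub>M\<^esub>),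
     zero = (\<lambda>xs\<in>tuples L n. \<zero>\<^bsub>M\<^esub>), add = (\<lambda>f g. \<lambda>xs\<in>tuples L n. f xs \<oplus>\<^bsub>M\<^esub> g xs),
     smult = (\<lambda>a f. \<lambda>xs\<in>tuples L n. a \<odot>\<^bsub>M\<^esub> f xs)\<rparr>"

definition del_nth :: "nat \<Rightarrow> 'a list \<Rightarrow> 'a list"
  where "del_nth i xs = take i xs @ drop (Suc i) xs"

definition alt_sign :: "('m, 's) ring_scheme \<Rightarrow> nat \<Rightarrow> 'm \<Rightarrow> 'm"
  where "alt_sign M k v = (if even k then v else \<ominus>\<^bsub>M\<^esub> v)"

text \<open>
  $(df)(x_0,\dots,x_n) = \sum_i (-1)^i x_i f(\dots,\hat{x}_i,\dots)
    + \sum_{i<j} (-1)^{i+j} f([x_i,x_j],\dots,\hat{x}_i,\dots,\hat{x}_j,\dots)$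
\<close>
definition ce_diff ::
    "('k, 'a, 'r) lie_algebra_scheme \<Rightarrow> ('k, 'm, 's) module_scheme \<Rightarrow> ('a \<Rightarrow> 'm \<Rightarrow> 'm) \<Rightarrow> nat \<Rightarrow>
     ('a list \<Rightarrow> 'm) \<Rightarrow> 'a list \<Rightarrow> 'm"
  where "ce_diff L M act n f = (\<lambda>xs\<in>tuples L (Suc n).
    finsum M (\<lambda>i. alt_sign M i (act (xs ! i) (f (del_nth i xs)))) {..n} \<oplus>\<^bsub>M\<^esub>
    finsum M (\<lambda>(i, j). alt_sign M (i + j) (f (bracket L (xs ! i) (xs ! j) # del_nth i (del_nth j xs))))
      {(i, j). i < j \<and> j \<le> n})"

definition cocycles ::
    "('k, 'e) ring_scheme \<Rightarrow> ('k, 'a, 'r) lie_algebra_scheme \<Rightarrow> ('k, 'm, 's) module_scheme \<Rightarrow>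
     ('a \<Rightarrow> 'm \<Rightarrow> 'm) \<Rightarrow> nat \<Rightarrow> ('a list \<Rightarrow> 'm) set"
  where "cocycles K L M act n =
    {f \<in> cochains K L M n. ce_diff L M act n f = \<zero>\<^bsub>cochain_space K L M (Suc n)\<^esub>}"

definition coboundaries ::
    "('k, 'e) ring_scheme \<Rightarrow> ('k, 'a, 'r) lie_algebra_scheme \<Rightarrow> ('k, 'm, 's) module_scheme \<Rightarrow>
     ('a \<Rightarrow> 'm \<Rightarrow> 'm) \<Rightarrow> nat \<Rightarrow> ('a list \<Rightarrow> 'm) set"
  where "coboundaries K L M act n =
    (case n of 0 \<Rightarrow> {\<zero>\<^bsub>cochain_space K L M 0\<^esub>} | Suc k \<Rightarrow> ce_diff L M act k ` cochains K L M k)"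

definition ce_cohomology ::
    "('k, 'e) ring_scheme \<Rightarrow> nat \<Rightarrow> ('k, 'a, 'r) lie_algebra_scheme \<Rightarrow> ('k, 'm, 's) module_scheme \<Rightarrow>
     ('a \<Rightarrow> 'm \<Rightarrow> 'm) \<Rightarrow> ('k, ('a list \<Rightarrow> 'm) set) module"
  where "ce_cohomology K n L M act =
    quot_space ((cochain_space K L M n)\<lparr>carrier := cocycles K L M act n\<rparr>)
      (coboundaries K L M act n)"

end

(* For a subalgebra H of the p-envelope G containing L and an element x outside H with [x, H] inside H,
   a cochain on H + Kx is a pair of cochains on H, and its differential is (df, theta_x f - dg), where
   theta_x is the action of x on cochains. If theta_x is trivial on H^*(H, M), this gives
   H^n(H + Kx, M) = H^n(H, M) + H^(n-1)(H, M). Since [G, G] lies in L, adding the d = dim G/L missing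
   directions one by one gives dim H^n(G, M) = sum_i (d choose i) dim H^(n-i)(L, M), the dimension of the
   right-hand side.
   Triviality of theta_y for y in G: the elements u of U(L) for which some g in G makes theta_(ad g, u)
   trivial on cohomology and [u, l] = [g, l] on a faithful L-module form a p-subalgebra containing L
   (Cartan's formula for L; Frobenius for commuting operators for the p-power), so they contain phi(y).
   Faithfulness gives [g - y, L] = 0, and then ad g = ad y because centralizers are p-subalgebras. *)
theory Submission
  imports Defs "HOL-Library.Function_Algebras"
begin

text \<open>The map \<phi> is only a Lie homomorphism, so the image of a p-th power in G need not be
  the p-th power in U(L), and the set of y in G with theta_y trivial on cohomology is not visibly
  closed under the p-map. Therefore the closure argument runs in U(L), where the p-map is an honest
  power, and each u carries along some g in G: u acts on the coefficients, ad g on the arguments.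
  The g found for \<phi>(y) need not be y; it only has the same ad. The two are compared through
  operators on a faithful L-module, as M may fail to be faithful; that module comes from the
  Poincare-Birkhoff-Witt construction. Cartan's formula covers only elements of L, because
  contraction with y makes sense only on subalgebras that contain y. The p-th power of theta is
  computed one argument at a time, hence forms are functions on lists and the differential is a
  recursion. All cohomology spaces involved being finite-dimensional, equality of dimensions yields
  the isomorphism, with no choice of splittings. Values of cochains are embedded into the type-class
  ring \<open>amb\<close>, where sums and signs can be rearranged freely.\<close>

text \<open>
  \<open>'a amb\<close> is the product of all (not necessarily unital) commutative rings carried by subsets of
  \<open>'a\<close>. Every record-based abelian group or commutative ring on \<open>'a\<close> is a direct factor of it, so
  that identities between finite sums can be checked in a type-class ring.
\<close>

definition rng :: "'a ring => bool"
 where "rng R \<longleftrightarrow> abelian_group R & (ALL x:carrier R. ALL y:carrier R. x \<otimes>\<^bsub>R\<^esub> y : carrier R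
  & x \<otimes>\<^bsub>R\<^esub> y = y \<otimes>\<^bsub>R\<^esub> x & (ALL z:carrier R. (x \<otimes>\<^bsub>R\<^esub> y) \<otimes>\<^bsub>R\<^esub> z = x \<otimes>\<^bsub>R\<^esub> (y \<otimes>\<^bsub>R\<^esub> z)
  & (x \<oplus>\<^bsub>R\<^esub> y) \<otimes>\<^bsub>R\<^esub> z = x \<otimes>\<^bsub>R\<^esub> z \<oplus>\<^bsub>R\<^esub> y \<otimes>\<^bsub>R\<^esub> z))"

lemma rngD:
 assumes "rng R"
 shows "abelian_group R"
  and "x : carrier R ==> y : carrier R ==> x \<otimes>\<^bsub>R\<^esub> y : carrier R"
  and "x : carrier R ==> y : carrier R ==> x \<otimes>\<^bsub>R\<^esub> y = y \<otimes>\<^bsub>R\<^esub> x"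
  and "x : carrier R ==> y : carrier R ==> z : carrier R ==>
  (x \<otimes>\<^bsub>R\<^esub> y) \<otimes>\<^bsub>R\<^esub> z = x \<otimes>\<^bsub>R\<^esub> (y \<otimes>\<^bsub>R\<^esub> z)"
  and "x : carrier R ==> y : carrier R ==> z : carrier R ==>
  (x \<oplus>\<^bsub>R\<^esub> y) \<otimes>\<^bsub>R\<^esub> z = x \<otimes>\<^bsub>R\<^esub> z \<oplus>\<^bsub>R\<^esub> y \<otimes>\<^bsub>R\<^esub> z"
 using assms unfolding rng_def by blast+

text \<open>Pinning the coordinate at records that are not rings to \<open>undefined\<close> makes
  two elements equal as soon as they agree at all genuine rings.\<close>

typedef 'a amb = "{f :: 'a ring => 'a. ALL R. f R : (if rng R then carrier R else {undefined})}"
 by (rule exI[of _ "%R. if rng R then zero R else undefined"])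
  (simp add: abelian_monoid.zero_closed abelian_group.axioms(1) rngD(1))

setup_lifting type_definition_amb

instantiation amb :: (type) comm_ring
begin

lift_definition zero_amb :: "'a amb" is "%R. if rng R then zero R else undefined"
 by (simp add: abelian_monoid.zero_closed abelian_group.axioms(1) rngD(1))

lift_definition plus_amb :: "'a amb => 'a amb => 'a amb"
 is "%f g R. if rng R then f R \<oplus>\<^bsub>R\<^esub> g R else undefined"
 by (metis abelian_monoid.a_closed abelian_group.axioms(1) rngD(1) singletonI)

lift_definition uminus_amb :: "'a amb => 'a amb"
 is "%f R. if rng R then \<ominus>\<^bsub>R\<^esub> f R else undefined"
 by (metis abelian_group.a_inv_closed rngD(1) singletonI)

lift_definition minus_amb :: "'a amb => 'a amb => 'a amb"
 is "%f g R. if rng R then f R \<ominus>\<^bsub>R\<^esub> g R else undefined"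
 by (metis abelian_group.minus_closed rngD(1) singletonI)

lift_definition times_amb :: "'a amb => 'a amb => 'a amb"
 is "%f g R. if rng R then f R \<otimes>\<^bsub>R\<^esub> g R else undefined"
 by (metis rngD(2) singletonI)

lemma Rep_amb_carrier: "rng R ==> Rep_amb a R : carrier R"
 using Rep_amb[of a] by (auto dest: spec[of _ R])

lemma amb_eqI: "(!!R. rng R ==> Rep_amb a R = Rep_amb b R) ==> a = b"
 by (rule Rep_amb_inject[THEN iffD1], rule ext)
  (metis (mono_tags, lifting) Rep_amb mem_Collect_eq singletonD)

lemma Rep_amb_simps:
 assumes "rng R"
 shows "Rep_amb 0 R = zero R" "Rep_amb (a + b) R = Rep_amb a R \<oplus>\<^bsub>R\<^esub> Rep_amb b R"
  "Rep_amb (- a) R = \<ominus>\<^bsub>R\<^esub> Rep_amb a R" "Rep_amb (a - b) R = Rep_amb a R \<ominus>\<^bsub>R\<^esub> Rep_amb b R"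
  "Rep_amb (a * b) R = Rep_amb a R \<otimes>\<^bsub>R\<^esub> Rep_amb b R"
 using assms by (simp_all add: zero_amb.rep_eq plus_amb.rep_eq uminus_amb.rep_eq minus_amb.rep_eq times_amb.rep_eq)

instance
proof
 fix a b c :: "'a amb"
 have abmon: "!!R. rng R ==> abelian_monoid R"
  by (auto simp: rng_def abelian_group_def)
 note S = Rep_amb_simps Rep_amb_carrier
 note A = abelian_monoid.a_assoc[OF abmon] abelian_monoid.a_comm[OF abmon]
  abelian_monoid.l_zero[OF abmon] abelian_group.l_neg[OF rngD(1)]
 show "a * b * c = a * (b * c)" by (rule amb_eqI) (simp add: S rngD(4))
 show "a * b = b * a" by (rule amb_eqI) (simp add: S, rule rngD(3); simp add: S)
 show "(a + b) * c = a * c + b * c" by (rule amb_eqI) (simp add: S rngD(5))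
 show "a + b + c = a + (b + c)" by (rule amb_eqI) (simp add: S A)
 show "a + b = b + a" by (rule amb_eqI) (simp add: S, rule A(2); simp add: S)
 show "0 + a = a" by (rule amb_eqI) (simp add: S A)
 show "- a + a = 0" by (rule amb_eqI) (simp add: S A)
 show "a - b = a + - b" by (rule amb_eqI) (simp add: S a_minus_def)
qed

end

definition pick :: "'a ring => 'a amb => 'a"
 where "pick R F = Rep_amb F R"

text \<open>The inclusion of the factor \<open>R\<close>, with all other coordinates zero. An
  argument outside the carrier goes to zero, so a function can be embedded pointwise without regard
  to its domain.\<close>

lift_definition embed :: "'a ring => 'a => 'a amb"
 is "%R x R'. if rng R' then (if R' = R & x : carrier R then x else \<zero>\<^bsub>R'\<^esub>) else undefined"
 by (simp add: abelian_monoid.zero_closed abelian_group.axioms(1) rngD(1))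

locale rng_emb =
 fixes R :: "'a ring"
 assumes rng: "rng R"
begin

interpretation abelian_group R using rng by (rule rngD(1))

lemma Rep_embed: "rng R' ==> Rep_amb (embed R x) R' = (if R' = R & x : carrier R then x else \<zero>\<^bsub>R'\<^esub>)"
 by (simp add: embed.rep_eq)

lemma proj_closed [simp]: "pick R F : carrier R"
 by (simp add: pick_def Rep_amb_carrier rng)

lemma proj_embed [simp]: "x : carrier R ==> pick R (embed R x) = x"
 by (simp add: pick_def Rep_embed rng)

lemma proj_hom:
 "pick R 0 = zero R" "pick R (F + G) = pick R F \<oplus>\<^bsub>R\<^esub> pick R G" "pick R (- F) = \<ominus>\<^bsub>R\<^esub> pick R F"
 "pick R (F - G) = pick R F \<ominus>\<^bsub>R\<^esub> pick R G" "pick R (F * G) = pick R F \<otimes>\<^bsub>R\<^esub> pick R G"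
 by (simp_all add: pick_def rng Rep_amb_simps)

lemma embed_eqI: "(!!R'. rng R' ==> R' ~= R ==> Rep_amb a R' = \<zero>\<^bsub>R'\<^esub>) ==> Rep_amb a R = x ==> embed R x = a"
 using rng by (intro amb_eqI) (auto simp: Rep_embed Rep_amb_carrier)

lemma rng_zero: "rng R' ==> \<zero>\<^bsub>R'\<^esub> \<oplus>\<^bsub>R'\<^esub> \<zero>\<^bsub>R'\<^esub> = \<zero>\<^bsub>R'\<^esub>" "rng R' ==> \<ominus>\<^bsub>R'\<^esub> \<zero>\<^bsub>R'\<^esub> = \<zero>\<^bsub>R'\<^esub>"
 "rng R' ==> \<zero>\<^bsub>R'\<^esub> \<otimes>\<^bsub>R'\<^esub> \<zero>\<^bsub>R'\<^esub> = \<zero>\<^bsub>R'\<^esub>"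
proof -
 assume r: "rng R'"
 interpret R': abelian_group R' using r by (rule rngD(1))
 show "\<zero>\<^bsub>R'\<^esub> \<oplus>\<^bsub>R'\<^esub> \<zero>\<^bsub>R'\<^esub> = \<zero>\<^bsub>R'\<^esub>" "\<ominus>\<^bsub>R'\<^esub> \<zero>\<^bsub>R'\<^esub> = \<zero>\<^bsub>R'\<^esub>" by simp_all
 have c: "\<zero>\<^bsub>R'\<^esub> \<otimes>\<^bsub>R'\<^esub> \<zero>\<^bsub>R'\<^esub> : carrier R'" by (simp add: rngD(2)[OF r])
 have "\<zero>\<^bsub>R'\<^esub> \<otimes>\<^bsub>R'\<^esub> \<zero>\<^bsub>R'\<^esub> = \<zero>\<^bsub>R'\<^esub> \<otimes>\<^bsub>R'\<^esub> \<zero>\<^bsub>R'\<^esub> \<oplus>\<^bsub>R'\<^esub> \<zero>\<^bsub>R'\<^esub> \<otimes>\<^bsub>R'\<^esub> \<zero>\<^bsub>R'\<^esub>"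
  using rngD(5)[OF r, of "\<zero>\<^bsub>R'\<^esub>" "\<zero>\<^bsub>R'\<^esub>" "\<zero>\<^bsub>R'\<^esub>"] by simp
 then show "\<zero>\<^bsub>R'\<^esub> \<otimes>\<^bsub>R'\<^esub> \<zero>\<^bsub>R'\<^esub> = \<zero>\<^bsub>R'\<^esub>" using c by (metis R'.add.r_cancel_one)
qed

lemma embed_zero [simp]: "embed R \<zero>\<^bsub>R\<^esub> = 0"
 by (rule embed_eqI) (simp_all add: Rep_amb_simps rng)

lemma embed_add: "x : carrier R ==> y : carrier R ==> embed R (x \<oplus>\<^bsub>R\<^esub> y) = embed R x + embed R y"
 by (rule embed_eqI) (simp_all add: Rep_amb_simps rng Rep_embed rng_zero)

lemma embed_uminus: "x : carrier R ==> embed R (\<ominus>\<^bsub>R\<^esub> x) = - embed R x"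
 by (rule embed_eqI) (simp_all add: Rep_amb_simps rng Rep_embed rng_zero)

lemma embed_diff: "x : carrier R ==> y : carrier R ==> embed R (x \<ominus>\<^bsub>R\<^esub> y) = embed R x - embed R y"
 by (simp add: a_minus_def embed_add embed_uminus)

lemma embed_mult: "x : carrier R ==> y : carrier R ==> embed R (x \<otimes>\<^bsub>R\<^esub> y) = embed R x * embed R y"
 by (rule embed_eqI) (simp_all add: Rep_amb_simps rng Rep_embed rng_zero)

lemma embed_inject: "x : carrier R ==> y : carrier R ==> embed R x = embed R y \<longleftrightarrow> x = y"
 by (metis proj_embed)

lemma embed_finsum: "f : A \<rightarrow> carrier R ==> embed R (finsum R f A) = (\<Sum>a\<in>A. embed R (f a))"
proof (induction A rule: infinite_finite_induct)
 case (insert x A)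
 then have "f : A \<rightarrow> carrier R" "f x : carrier R" by auto
 then show ?case using insert by (simp add: finsum_insert embed_add)
qed (simp_all add: finsum_infinite)

text \<open>An embedded factor annihilates the coordinates at all other rings. With the unit of
  \<open>R\<close> as \<open>x\<close>, an element fixed by this multiplication is recognized as
  lying in the image of \<open>embed\<close>.\<close>

lemma embed_proj_mult: "embed R x * F = embed R x * embed R (pick R F)"
proof (rule amb_eqI)
 fix R' :: "'a ring" assume r: "rng R'"
 interpret R': abelian_group R' using r by (rule rngD(1))
 have z: "\<zero>\<^bsub>R'\<^esub> \<otimes>\<^bsub>R'\<^esub> y = \<zero>\<^bsub>R'\<^esub>" if "y : carrier R'" for y
  using rngD(5)[OF r, of "\<zero>\<^bsub>R'\<^esub>" "\<zero>\<^bsub>R'\<^esub>" y] that rngD(2)[OF r, of "\<zero>\<^bsub>R'\<^esub>" y]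
  by (metis R'.add.r_cancel_one R'.zero_closed R'.r_zero)
 show "Rep_amb (embed R x * F) R' = Rep_amb (embed R x * embed R (pick R F)) R'"
  using rng by (auto simp: Rep_amb_simps r Rep_embed z Rep_amb_carrier pick_def)
qed

end

text \<open>A bare abelian group is turned into a ring with zero multiplication.\<close>
definition null_ring :: "('a, 'r) ring_scheme => 'a ring"
 where "null_ring M = \<lparr>carrier = carrier M, mult = (%x y. zero M), one = zero M, zero = zero M, add = add M\<rparr>"

lemma null_ring_simps [simp]:
 "carrier (null_ring M) = carrier M" "zero (null_ring M) = zero M" "add (null_ring M) = add M"
 by (simp_all add: null_ring_def)

lemma a_inv_null_ring [simp]: "a_inv (null_ring M) = a_inv M"
 by (rule ext) (simp add: a_inv_def null_ring_def m_inv_def)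

lemma a_minus_null_ring [simp]: "a_minus (null_ring M) x y = a_minus M x y"
 by (simp add: a_minus_def)

lemma finsum_null_ring [simp]: "finsum (null_ring M) f A = finsum M f A"
 by (simp add: finsum_def null_ring_def finprod_def)

lemma rng_null_ring:
 assumes "abelian_group M"
 shows "rng (null_ring M)"
proof -
 interpret abelian_group M by fact
 have "abelian_group (null_ring M)"
  by (rule abelian_groupI) (auto simp: null_ring_def a_assoc intro: a_comm l_neg)
 then show ?thesis by (auto simp: rng_def) (simp_all add: null_ring_def)
qed

lemma rng_cring: "cring K ==> rng K"
 by (simp add: rng_def cring.axioms ring.is_abelian_group[OF cring.axioms(1)] cring.cring_simprules)

section \<open>Alternating forms and the Chevalley--Eilenberg differential\<close>

definition sgn_pow :: "nat => 'b::ab_group_add => 'b"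
 where "sgn_pow k v = (if even k then v else - v)"

lemma sgn_pow_simps [simp]: "sgn_pow 0 v = v" "sgn_pow (Suc k) v = - sgn_pow k v" "sgn_pow k 0 = 0"
 "sgn_pow k (- v) = - sgn_pow k v"
 by (auto simp: sgn_pow_def)

definition tups :: "'g set => nat => 'g list set"
 where "tups A n = {xs. length xs = n & set xs <= A}"

lemma tups_simps [simp]: "xs : tups A 0 \<longleftrightarrow> xs = []" "[] : tups A n \<longleftrightarrow> n = 0"
 "x # xs : tups A (Suc n) \<longleftrightarrow> x : A & xs : tups A n"
 "x # xs : tups A n \<longleftrightarrow> x : A & (EX m. n = Suc m & xs : tups A m)"
 by (auto simp: tups_def)

lemma tups_SucE:
 assumes "xs : tups A (Suc n)"
 obtains x ys where "xs = x # ys" "x : A" "ys : tups A n"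
 using assms by (cases xs) (auto simp: tups_def)

lemma tups_mono: "A <= B ==> xs : tups A n ==> xs : tups B n"
 by (auto simp: tups_def)

text \<open>\<open>th u D f\<close> is the action on forms of an operator \<open>u\<close> of the module together with an
  operator \<open>D\<close> of the arguments. In \<open>dd\<close> the differential is computed from Cartan's formula
  $\iota_x d = \theta_x - d \iota_x$ by recursion on the list of arguments.\<close>

fun th :: "('b::ab_group_add => 'b) => ('g => 'g) => ('g list => 'b) => 'g list => 'b" where
 "th u D f [] = u (f [])"
| "th u D f (x # xs) = th u D (%ys. f (x # ys)) xs - f (D x # xs)"

fun dd :: "('g => 'b::ab_group_add => 'b) => ('g => 'g => 'g) => ('g list => 'b) => 'g list => 'b" where
 "dd act br f [] = 0"
| "dd act br f (x # xs) = th (act x) (br x) f xs - dd act br (%ys. f (x # ys)) xs"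

text \<open>The product of the linear form \<open>c\<close> with the form \<open>g\<close>, computed
  from iota_x (c wedge g) = c(x) g - c wedge (iota_x g).\<close>

fun wedge :: "('k => 'b::ab_group_add => 'b) => ('g => 'k) => ('g list => 'b) => 'g list => 'b" where
 "wedge sc c g [] = 0"
| "wedge sc c g (x # xs) = sc (c x) (g xs) - wedge sc c (%ys. g (x # ys)) xs"

lemma th_cong:
 "(!!ys. ys : tups A n ==> f ys = g ys) ==> D ` A <= A ==> xs : tups A n ==> th u D f xs = th u D g xs"
proof (induction n arbitrary: f g xs)
 case (Suc n)
 from Suc.prems(3) obtain x ys where x: "xs = x # ys" "x : A" "ys : tups A n" by (rule tups_SucE)
 have "th u D (%ys. f (x # ys)) ys = th u D (%ys. g (x # ys)) ys"
  by (rule Suc.IH) (use Suc.prems x in auto)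
 moreover have "f (D x # ys) = g (D x # ys)" by (rule Suc.prems) (use Suc.prems x in auto)
 ultimately show ?case by (simp add: x)
qed auto

lemma th_cong_op:
 "(!!v. u v = u' v) ==> (!!x. x : A ==> D x = D' x) ==> xs : tups A n ==> th u D f xs = th u' D' f xs"
proof (induction n arbitrary: f xs)
 case (Suc n)
 from Suc.prems(3) obtain x ys where x: "xs = x # ys" "x : A" "ys : tups A n" by (rule tups_SucE)
 then show ?case using Suc by simp
qed auto

lemma dd_cong:
 "(!!ys. ys : tups A n ==> f ys = g ys) ==> (!!x y. x : A ==> y : A ==> br x y : A) ==>
  xs : tups A (Suc n) ==> dd act br f xs = dd act br g xs"
proof (induction n arbitrary: f g xs)
 case 0
 then obtain x where "xs = [x]" by (auto elim: tups_SucE)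
 then show ?case using 0 by simp
next
 case (Suc n)
 from Suc.prems(3) obtain x ys where x: "xs = x # ys" "x : A" "ys : tups A (Suc n)" by (rule tups_SucE)
 have "dd act br (%ys. f (x # ys)) ys = dd act br (%ys. g (x # ys)) ys"
  by (rule Suc.IH) (use Suc.prems x in auto)
 moreover have "th (act x) (br x) f ys = th (act x) (br x) g ys"
  by (rule th_cong[of A "Suc n"]) (use Suc.prems x in auto)
 ultimately show ?case by (simp add: x)
qed

lemma additive0: "(!!v w. u (v + w) = u v + u w) ==> u (0::'b::ab_group_add) = (0::'c::ab_group_add)"
 by (metis add_cancel_left_right)

lemma additive_minus: 
 fixes u :: "'b::ab_group_add => 'c::ab_group_add"
 assumes "!!v w. u (v + w) = u v + u w" shows "u (- v) = - u v" "u (v - w) = u v - u w"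
proof -
 have "u (- v) + u v = 0" for v using assms[of "- v" v] additive0[of u, OF assms] by simp
 then show *: "u (- v) = - u v" for v by (simp add: add_eq_0_iff2)
 show "u (v - w) = u v - u w" using assms[of v "- w"] by (simp add: *)
qed

lemma additive_sum: 
 fixes u :: "'b::ab_group_add => 'c::ab_group_add"
 assumes "!!v w. u (v + w) = u v + u w" shows "u (sum f S) = (\<Sum>x\<in>S. u (f x))"
 by (induction S rule: infinite_finite_induct) (simp_all add: assms additive0[of u, OF assms])

lemma th_add:
 assumes "!!v w. u (v + w) = u v + u w"
 shows "th u D (%xs. f xs + g xs) xs = th u D f xs + th u D g xs"
 by (induction xs arbitrary: f g) (simp_all add: assms)

lemma th_zero:
 assumes "!!v w. u (v + w) = u v + u w"
 shows "th u D (%xs. 0) xs = 0"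
 by (induction xs) (simp_all add: additive0[of u, OF assms])

lemma th_diff:
 assumes "!!v w. u (v + w) = u v + u w"
 shows "th u D (%xs. f xs - g xs) xs = th u D f xs - th u D g xs"
 by (induction xs arbitrary: f g) (simp_all add: additive_minus[of u, OF assms])

lemma th_hom:
 assumes "!!v w. s (v + w) = s v + s w" "!!v. u' (s v) = s (u v)"
 shows "th u' D (%xs. s (f xs)) xs = s (th u D f xs)"
 by (induction xs arbitrary: f) (simp_all add: assms(2) additive_minus[of s, OF assms(1)])

lemma dd_diff:
 assumes "!!x v w. x : set xs ==> act x (v + w) = act x v + act x w"
 shows "dd act br (%xs. f xs - g xs) xs = dd act br f xs - dd act br g xs"
 using assms
proof (induction xs arbitrary: f g)
 case (Cons x xs)
 have "th (act x) (br x) (%xs. f xs - g xs) xs = th (act x) (br x) f xs - th (act x) (br x) g xs"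
  by (rule th_diff) (simp add: Cons.prems)
 then show ?case using Cons.IH[of "%ys. f (x # ys)" "%ys. g (x # ys)"] Cons.prems by simp
qed simp

lemma dd_zero:
 assumes "!!x v w. x : set xs ==> act x (v + w) = act x v + act x w"
 shows "dd act br (%xs. 0) xs = 0"
 using dd_diff[of xs act br "%xs. 0" "%xs. 0", OF assms] by simp

lemma dd_add:
 assumes "!!x v w. x : set xs ==> act x (v + w) = act x v + act x w"
 shows "dd act br (%xs. f xs + g xs) xs = dd act br f xs + dd act br g xs"
 using dd_diff[of xs act br f "%xs. 0 - g xs", OF assms] dd_diff[of xs act br "%xs. 0" g, OF assms]
  dd_zero[of xs act br, OF assms] by simp

lemma dd_hom:
 assumes "!!v w. s (v + w) = s v + s w" "!!x v. x : set xs ==> act x (s v) = s (act x v)"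
 shows "dd act br (%xs. s (f xs)) xs = s (dd act br f xs)"
 using assms(2)
proof (induction xs arbitrary: f)
 case Nil
 then show ?case by (simp add: additive0[of s, OF assms(1)])
next
 case (Cons x xs)
 have "th (act x) (br x) (%xs. s (f xs)) xs = s (th (act x) (br x) f xs)"
  by (rule th_hom) (simp_all add: Cons.prems assms(1))
 then show ?case using Cons.IH[of "%ys. f (x # ys)"] Cons.prems by (simp add: additive_minus[of s, OF assms(1)])
qed

lemma th_map:
 assumes "!!x. x : A ==> h (D x) = D' (h x)" "xs : tups A n"
 shows "th u D (%xs. f (map h xs)) xs = th u D' f (map h xs)"
 using assms(2)
proof (induction n arbitrary: f xs)
 case (Suc n)
 from Suc.prems obtain x ys where x: "xs = x # ys" "x : A" "ys : tups A n" by (rule tups_SucE)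
 then show ?case using Suc.IH[of ys "%ys. f (h x # ys)"] assms(1) by simp
qed simp

lemma dd_map:
 assumes "!!x y. x : A ==> y : A ==> h (br x y) = br' (h x) (h y)"
  "!!x v. x : A ==> act x v = act' (h x) v" "xs : tups A n"
 shows "dd act br (%xs. f (map h xs)) xs = dd act' br' f (map h xs)"
 using assms(3)
proof (induction n arbitrary: f xs)
 case (Suc n)
 from Suc.prems obtain x ys where x: "xs = x # ys" "x : A" "ys : tups A n" by (rule tups_SucE)
 have "th (act x) (br x) (%xs. f (map h xs)) ys = th (act x) (br' (h x)) f (map h ys)"
  by (rule th_map) (use x assms(1) in auto)
 moreover have "act x = act' (h x)" using assms(2) x by auto
 ultimately show ?case using Suc.IH[of ys "%ys. f (h x # ys)"] x by simp
qed simp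

lemma th_explicit: "th u D f xs = u (f xs) - (\<Sum>i<length xs. f (xs[i := D (xs ! i)]))"
 by (induction xs arbitrary: f) (simp_all del: sum.lessThan_Suc add: sum.lessThan_Suc_shift)

text \<open>Here \<open>ad\<close> is the addition of arguments, not the adjoint action;
  \<open>sm\<close> is their scalar multiplication and \<open>KK\<close> the set of scalars.
  Arguments are elements of sets with operations, because record-based Lie algebras and their
  subspaces have to be treated, whereas values lie in a type-class group on which scalars act
  through \<open>sc\<close>.\<close>

locale alt_forms =
 fixes ad :: "'g => 'g => 'g" and sm :: "'k => 'g => 'g" and KK :: "'k set"
  and sc :: "'k => 'b::ab_group_add => 'b"
 assumes sc_add: "a : KK ==> sc a (v + w) = sc a v + sc a w"
begin

lemma sc_simps: "a : KK ==> sc a 0 = 0" "a : KK ==> sc a (- v) = - sc a v" "a : KK ==> sc a (v - w) = sc a v - sc a w"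
 using additive0[of "sc a"] additive_minus[of "sc a"] sc_add by auto

definition subsp_on :: "'g set => bool"
 where "subsp_on A \<longleftrightarrow> (ALL x:A. ALL y:A. ad x y : A) & (ALL a:KK. ALL x:A. sm a x : A)"

definition lin_on :: "'g set => ('g => 'g) => bool"
 where "lin_on A D \<longleftrightarrow> (ALL x:A. D x : A) & (ALL x:A. ALL y:A. D (ad x y) = ad (D x) (D y)) &
  (ALL a:KK. ALL x:A. D (sm a x) = sm a (D x))"

definition lin_op :: "('b => 'b) => bool"
 where "lin_op u \<longleftrightarrow> (ALL v w. u (v + w) = u v + u w) & (ALL a:KK. ALL v. u (sc a v) = sc a (u v))"

text \<open>Linearity and alternation are tested on the leading arguments only and reach the other
  slots through contraction with each \<open>x : A\<close>. In the last clause \<open>x # xs\<close>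
  has length n, so that this clause is empty for forms in one variable.\<close>

primrec altf :: "'g set => nat => ('g list => 'b) => bool" where
 "altf A 0 f \<longleftrightarrow> True"
| "altf A (Suc n) f \<longleftrightarrow> (ALL x:A. altf A n (%xs. f (x # xs))) &
  (ALL x:A. ALL y:A. ALL xs:tups A n. f (ad x y # xs) = f (x # xs) + f (y # xs)) &
  (ALL a:KK. ALL x:A. ALL xs:tups A n. f (sm a x # xs) = sc a (f (x # xs))) &
  (ALL x:A. ALL xs. x # xs : tups A n --> f (x # x # xs) = 0)"

lemma altf_mono: "A <= B ==> altf B n f ==> altf A n f"
proof (induction n arbitrary: f)
 case (Suc n)
 have "!!xs m. xs : tups A m ==> xs : tups B m" using Suc.prems(1) by (rule tups_mono)
 then show ?case using Suc by (auto simp: subset_iff)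
qed simp

lemma altf_cong: "(!!xs. xs : tups A n ==> f xs = g xs) ==> subsp_on A ==> altf A n f ==> altf A n g"
proof (induction n arbitrary: f g)
 case (Suc n)
 have *: "f (x # xs) = g (x # xs)" if "x : A" "xs : tups A n" for x xs using Suc.prems that by simp
 have "altf A n (%xs. g (x # xs))" if "x : A" for x
  by (rule Suc.IH[of "%xs. f (x # xs)"]) (use * Suc.prems that in auto)
 moreover have "g (x # x # xs) = 0" if "x : A" "x # xs : tups A n" for x xs
  using *[of x "x # xs"] that Suc.prems(3) by simp
 ultimately show ?case using Suc.prems * by (simp add: subsp_on_def)
qed simp

lemma altf_zero: "altf A n (%xs. 0)"
 by (induction n) (auto simp: sc_simps)

lemma altf_diff: "altf A n f ==> altf A n g ==> altf A n (%xs. f xs - g xs)"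
 by (induction n arbitrary: f g) (auto simp: sc_simps)

lemma altf_add: "altf A n f ==> altf A n g ==> altf A n (%xs. f xs + g xs)"
 using altf_diff[of A n f "%xs. 0 - g xs"] altf_diff[of A n "%xs. 0" g] altf_zero[of A n] by simp

lemma altf_hom:
 assumes "!!v w. s (v + w) = s v + s w" "!!a v. a : KK ==> s (sc a v) = sc a (s v)"
 shows "altf A n f ==> altf A n (%xs. s (f xs))"
 by (induction n arbitrary: f) (auto simp: assms additive0[of s, OF assms(1)])

lemma altf_head: "altf A (Suc n) f ==> x : A ==> altf A n (%xs. f (x # xs))"
 by simp

lemma altf_dup: "altf A (Suc (Suc n)) f ==> x : A ==> xs : tups A n ==> f (x # x # xs) = 0"
 by simp

text \<open>Polarization of f(x+y, x+y, ...) = 0.\<close>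

lemma altf_swap:
 assumes "subsp_on A" "altf A (Suc (Suc n)) f" "x : A" "y : A" "xs : tups A n"
 shows "f (x # y # xs) = - f (y # x # xs)"
proof -
 have xy: "ad x y : A" using assms by (simp add: subsp_on_def)
 have 1: "f (ad x y # z # xs) = f (x # z # xs) + f (y # z # xs)" if "z : A" for z
  using assms(2-) that by simp
 have 2: "f (z # ad x y # xs) = f (z # x # xs) + f (z # y # xs)" if "z : A" for z
  using altf_head[OF assms(2) that] assms(3-) by simp
 have "0 = f (ad x y # ad x y # xs)" using altf_dup[OF assms(2) xy assms(5)] by simp
 also have "... = f (x # x # xs) + f (x # y # xs) + (f (y # x # xs) + f (y # y # xs))"
  using 1[OF xy] 2 assms(3,4) by simp
 also have "... = f (x # y # xs) + f (y # x # xs)" using altf_dup[OF assms(2) _ assms(5)] assms(3,4) by simp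
 finally show ?thesis by (simp add: eq_neg_iff_add_eq_0)
qed

lemma altf_move:
 assumes "subsp_on A" "altf A n f" "x : A" "Suc (length as + length bs) = n" "set as <= A" "set bs <= A"
 shows "f (x # as @ bs) = sgn_pow (length as) (f (as @ x # bs))"
 using assms(2-)
proof (induction as arbitrary: f n)
 case (Cons a as)
 then obtain m where n: "n = Suc (Suc m)" by (cases n; cases "n - 1") auto
 have "f (x # a # as @ bs) = - f (a # x # as @ bs)"
  by (rule altf_swap[OF assms(1), of m]) (use Cons n in "auto simp: tups_def")
 also have "f (a # x # as @ bs) = sgn_pow (length as) (f (a # as @ x # bs))"
  using Cons.IH[of "Suc m" "%ys. f (a # ys)"] Cons.prems n by simp
 finally show ?case by simp
qed simp

text \<open>A repetition inside the tail is handled by induction. Otherwise the repeated entry is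
  the head, and its second copy can be moved next to it at the cost of a sign.\<close>

lemma altf_not_distinct:
 assumes "subsp_on A"
 shows "altf A n f ==> xs : tups A n ==> ~ distinct xs ==> f xs = 0"
proof (induction n arbitrary: f xs)
 case (Suc n)
 from Suc.prems(2) obtain x ys where x: "xs = x # ys" "x : A" "ys : tups A n" by (rule tups_SucE)
 show ?case
 proof (cases "distinct ys")
  case True
  then obtain as bs where ys: "ys = as @ x # bs" using Suc.prems(3) x by (auto simp: in_set_conv_decomp)
  from x(3) ys obtain m where m: "n = Suc m" by (cases n) (auto simp: tups_def)
  have "f (x # x # as @ bs) = sgn_pow (length as) (f (x # as @ x # bs))"
  using altf_move[OF assms, of n "%ys. f (x # ys)" x as bs] Suc.prems x ys by (auto simp: tups_def)
  moreover have "f (x # x # as @ bs) = 0"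
  by (rule altf_dup[of A m]) (use Suc.prems x ys m in "auto simp: tups_def")
  ultimately show ?thesis using x ys by (auto simp: sgn_pow_def split: if_splits)
 next
  case False
  then show ?thesis using Suc.IH[of "%ys. f (x # ys)" ys] x Suc.prems by simp
 qed
qed simp

lemma altf_slot_add:
 "altf A n f ==> xs : tups A n ==> i < n ==> x : A ==> y : A ==>
  f (xs[i := ad x y]) = f (xs[i := x]) + f (xs[i := y])"
proof (induction n arbitrary: f xs i)
 case (Suc n)
 from Suc.prems(2) obtain z ys where z: "xs = z # ys" "z : A" "ys : tups A n" by (rule tups_SucE)
 show ?case
  using Suc.IH[of "%ys. f (z # ys)" ys "i - 1"] z Suc.prems by (cases i) auto
qed simp

lemma altf_slot_smult:
 "altf A n f ==> xs : tups A n ==> i < n ==> x : A ==> a : KK ==>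
  f (xs[i := sm a x]) = sc a (f (xs[i := x]))"
proof (induction n arbitrary: f xs i)
 case (Suc n)
 from Suc.prems(2) obtain z ys where z: "xs = z # ys" "z : A" "ys : tups A n" by (rule tups_SucE)
 show ?case
  using Suc.IH[of "%ys. f (z # ys)" ys "i - 1"] z Suc.prems by (cases i) auto
qed simp

text \<open>Converse of the two slot rules: it ties the recursive notion to slotwise multilinearity,
  the form in which cochains and exterior powers are given.\<close>

lemma altf_intro:
 assumes add: "!!xs i x y. xs : tups A n ==> i < n ==> x : A ==> y : A ==>
  f (xs[i := ad x y]) = f (xs[i := x]) + f (xs[i := y])"
  and smult: "!!xs i a x. xs : tups A n ==> i < n ==> a : KK ==> x : A ==>
  f (xs[i := sm a x]) = sc a (f (xs[i := x]))"
  and dup: "!!xs. xs : tups A n ==> ~ distinct xs ==> f xs = 0"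
 shows "altf A n f"
 using assms
proof (induction n arbitrary: f)
 case (Suc n)
 have "altf A n (%xs. f (x # xs))" if x: "x : A" for x
 proof (rule Suc.IH)
  fix xs i y z assume "xs : tups A n" "i < n" "y : A" "z : A"
  then show "f (x # xs[i := ad y z]) = f (x # xs[i := y]) + f (x # xs[i := z])"
  using Suc.prems(1)[of "x # xs" "Suc i" y z] x by simp
 next
  fix xs i a y assume "xs : tups A n" "i < n" "y : A" "a : KK"
  then show "f (x # xs[i := sm a y]) = sc a (f (x # xs[i := y]))"
  using Suc.prems(2)[of "x # xs" "Suc i" a y] x by simp
 next
  fix xs assume "xs : tups A n" "~ distinct xs"
  then show "f (x # xs) = 0" using Suc.prems(3)[of "x # xs"] x by simp
 qed
 moreover have "f (ad x y # xs) = f (x # xs) + f (y # xs)" if "x : A" "y : A" "xs : tups A n" for x y xs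
  using Suc.prems(1)[of "x # xs" 0 x y] that by simp
 moreover have "f (sm a x # xs) = sc a (f (x # xs))" if "x : A" "a : KK" "xs : tups A n" for a x xs
  using Suc.prems(2)[of "x # xs" 0 a x] that by simp
 moreover have "f (x # x # xs) = 0" if "x # xs : tups A n" for x xs
  using Suc.prems(3)[of "x # x # xs"] that by auto
 ultimately show ?case by simp
qed simp

text \<open>Linearity of the result follows from that of f, u and D. For a repeated first argument
  the terms f(Dx, x, ...) and f(x, Dx, ...) cancel by antisymmetry.\<close>

lemma altf_th:
 assumes "subsp_on A" "lin_op u" "lin_on A D"
 shows "altf A n f ==> altf A n (th u D f)"
proof (induction n arbitrary: f)
 case (Suc n)
 have DA: "D ` A <= A" and Dx: "!!x. x : A ==> D x : A" using assms(3) by (auto simp: lin_on_def)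
 have uadd: "!!v w. u (v + w) = u v + u w" using assms(2) by (simp add: lin_op_def)
 have "altf A n (%xs. th u D f (x # xs))" if x: "x : A" for x
  using x Suc.prems Dx[of x] by (simp add: altf_diff Suc.IH)
 moreover have "th u D f (ad x y # xs) = th u D f (x # xs) + th u D f (y # xs)"
  if x: "x : A" "y : A" "xs : tups A n" for x y xs
 proof -
  have "th u D (%xs. f (ad x y # xs)) xs = th u D (%xs. f (x # xs) + f (y # xs)) xs"
  by (rule th_cong[of A n]) (use Suc.prems x DA in auto)
  then have "th u D (%xs. f (ad x y # xs)) xs = th u D (%xs. f (x # xs)) xs + th u D (%xs. f (y # xs)) xs"
  by (simp add: th_add[OF uadd])
  moreover have "D (ad x y) = ad (D x) (D y)" using assms(3) x by (simp add: lin_on_def)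
  ultimately show ?thesis using Suc.prems x Dx by simp
 qed
 moreover have "th u D f (sm a x # xs) = sc a (th u D f (x # xs))"
  if x: "x : A" "a : KK" "xs : tups A n" for a x xs
 proof -
  have "th u D (%xs. f (sm a x # xs)) xs = th u D (%xs. sc a (f (x # xs))) xs"
  by (rule th_cong[of A n]) (use Suc.prems x DA in auto)
  also have "... = sc a (th u D (%xs. f (x # xs)) xs)"
  by (rule th_hom) (use assms(2) x sc_add in "auto simp: lin_op_def")
  finally show ?thesis using Suc.prems x Dx assms(3) by (simp add: lin_on_def sc_simps)
 qed
 moreover have "th u D f (x # x # xs) = 0" if x: "x : A" "x # xs : tups A n" for x xs
 proof -
  obtain m where m: "n = Suc m" "xs : tups A m" using x by auto
  have "th u D (%xs. f (x # x # xs)) xs = th u D (%xs. 0) xs"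
  by (rule th_cong[of A m]) (use Suc.prems x m DA in auto)
  moreover have "f (D x # x # xs) = - f (x # D x # xs)"
  by (rule altf_swap[OF assms(1), of m]) (use Suc.prems x m Dx in auto)
  ultimately show ?thesis by (simp add: th_zero[OF uadd])
 qed
 ultimately show ?case by simp
qed simp

lemma th_add_op:
 assumes "lin_on A D" "lin_on A D'" "lin_on A D''"
  and "!!v. u'' v = u v + u' v" "!!x. x : A ==> D'' x = ad (D x) (D' x)"
 shows "altf A n f ==> xs : tups A n ==> th u'' D'' f xs = th u D f xs + th u' D' f xs"
proof (induction n arbitrary: f xs)
 case (Suc n)
 from Suc.prems(2) obtain x ys where x: "xs = x # ys" "x : A" "ys : tups A n" by (rule tups_SucE)
 then show ?case using Suc.IH[of "%ys. f (x # ys)" ys] Suc.prems assms by (simp add: lin_on_def)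
qed (simp add: assms)

lemma th_smult_op:
 assumes "lin_on A D" "a : KK" "!!v. u' v = sc a (u v)" "!!x. x : A ==> D' x = sm a (D x)"
 shows "altf A n f ==> xs : tups A n ==> th u' D' f xs = sc a (th u D f xs)"
proof (induction n arbitrary: f xs)
 case (Suc n)
 from Suc.prems(2) obtain x ys where x: "xs = x # ys" "x : A" "ys : tups A n" by (rule tups_SucE)
 then show ?case using Suc.IH[of "%ys. f (x # ys)" ys] Suc.prems assms by (simp add: lin_on_def sc_simps)
qed (simp add: assms)

text \<open>The commutator of two Lie derivatives is the Lie derivative of the commutators. For the
  arguments the relation D'' = D D' - D' D is written additively, as \<open>ad\<close> comes without
  a negation; for the coefficients it is asked for at the values of f.\<close>

lemma th_comm:
 assumes "subsp_on A" "lin_op u" "lin_op u'" "lin_on A D" "lin_on A D'" "!!x. x : A ==> D'' x : A"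
  and "!!x. x : A ==> ad (D'' x) (D' (D x)) = D (D' x)"
 shows "altf A n f ==> xs : tups A n ==> (!!xs. u'' (f xs) = u (u' (f xs)) - u' (u (f xs))) ==>
  th u D (th u' D' f) xs - th u' D' (th u D f) xs = th u'' D'' f xs"
proof (induction n arbitrary: f xs)
 case (Suc n)
 from Suc.prems(2) obtain x ys where x: "xs = x # ys" "x : A" "ys : tups A n" by (rule tups_SucE)
 have Dx: "!!x. x : A ==> D x : A" "!!x. x : A ==> D' x : A" using assms by (auto simp: lin_on_def)
 have add: "!!v w. u (v + w) = u v + u w" "!!v w. u' (v + w) = u' v + u' w"
  using assms by (simp_all add: lin_op_def)
 have IH: "th u D (th u' D' (%ys. f (x # ys))) ys - th u' D' (th u D (%ys. f (x # ys))) ys = th u'' D'' (%ys. f (x # ys)) ys"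
  by (rule Suc.IH) (use Suc.prems x in auto)
 have "f (D (D' x) # ys) = f (D'' x # ys) + f (D' (D x) # ys)"
  unfolding assms(7)[OF x(2), symmetric] using Suc.prems(1) x Dx assms(6) by simp
 then show ?case using IH by (simp add: x th_diff[OF add(1)] th_diff[OF add(2)])
qed simp

text \<open>Linearity of \<open>c\<close> is expressed through the operators
  \<open>sc (c x)\<close>, because scalars carry no type-class structure. For a repeated first
  argument the two terms c(x) g(x, ...) cancel and leave the product of c with the double
  contraction of g, which is zero.\<close>

lemma altf_wedge:
 assumes "subsp_on A" "!!x. x : A ==> c x : KK"
  and "!!x y v. x : A ==> y : A ==> sc (c (ad x y)) v = sc (c x) v + sc (c y) v"
  and "!!a x v. a : KK ==> x : A ==> sc (c (sm a x)) v = sc a (sc (c x) v)"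
  and "!!a b v. a : KK ==> b : KK ==> sc a (sc b v) = sc b (sc a v)"
 shows "altf A n g ==> altf A (Suc n) (wedge sc c g)"
proof (induction n arbitrary: g)
 case 0
 have "altf A (Suc 0) (%xs. wedge sc c g xs)" using assms by (auto simp: sc_simps)
 then show ?case by simp
next
 case (Suc n)
 have wadd: "wedge sc c (%xs. f xs + g xs) xs = wedge sc c f xs + wedge sc c g xs" if "xs : tups A m" for f g xs m
  using that by (induction m arbitrary: xs f g) (auto elim!: tups_SucE simp: sc_add assms(2))
 have wsc: "wedge sc c (%xs. sc a (g xs)) xs = sc a (wedge sc c g xs)" if "xs : tups A m" "a : KK" for a g xs m
  using that by (induction m arbitrary: xs g) (auto elim!: tups_SucE simp: sc_simps assms(2) assms(5)[of a])
 have wcong: "wedge sc c f xs = wedge sc c g xs" if "xs : tups A (Suc m)" "!!xs. xs : tups A m ==> f xs = g xs" for f g xs m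
  using that
 proof (induction m arbitrary: xs f g)
  case (Suc m)
  from Suc.prems(1) obtain x ys where x: "xs = x # ys" "x : A" "ys : tups A (Suc m)" by (rule tups_SucE)
  have "wedge sc c (%zs. f (x # zs)) ys = wedge sc c (%zs. g (x # zs)) ys"
  by (rule Suc.IH) (use x Suc.prems in auto)
  then show ?case using x Suc.prems by simp
 qed (auto elim!: tups_SucE)
 have w0: "wedge sc c (%xs. 0) xs = 0" if "xs : tups A m" for xs m
  using that by (induction m arbitrary: xs) (auto elim!: tups_SucE simp: sc_simps assms(2))
 have "altf A (Suc n) (%xs. wedge sc c g (x # xs))" if x: "x : A" for x
 proof -
  have "altf A (Suc n) (%xs. sc (c x) (g xs))"
  by (rule altf_hom[of "sc (c x)"]) (use Suc.prems x assms(2)[OF x] assms(5) in "simp_all add: sc_add")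
  moreover have "altf A (Suc n) (wedge sc c (%ys. g (x # ys)))"
  by (rule Suc.IH) (use Suc.prems x in simp)
  ultimately show ?thesis by (simp only: wedge.simps altf_diff)
 qed
 moreover have "wedge sc c g (ad x y # xs) = wedge sc c g (x # xs) + wedge sc c g (y # xs)"
  if x: "x : A" "y : A" "xs : tups A (Suc n)" for x y xs
  using wcong[of xs n "%ys. g (ad x y # ys)" "%ys. g (x # ys) + g (y # ys)"] Suc.prems x
  by (simp add: assms(3) wadd)
 moreover have "wedge sc c g (sm a x # xs) = sc a (wedge sc c g (x # xs))"
  if x: "x : A" "a : KK" "xs : tups A (Suc n)" for a x xs
  using wcong[of xs n "%ys. g (sm a x # ys)" "%ys. sc a (g (x # ys))"] Suc.prems x
  by (simp add: assms(4) wsc sc_simps)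
 moreover have "wedge sc c g (x # x # xs) = 0" if x: "x : A" "x # xs : tups A (Suc n)" for x xs
 proof -
  have "wedge sc c (%ys. g (x # x # ys)) xs = 0"
  proof (cases n)
  case 0
  then show ?thesis using x by simp
  next
  case (Suc m)
  have "wedge sc c (%ys. g (x # x # ys)) xs = wedge sc c (%ys. 0) xs"
  by (rule wcong[of _ m]) (use Suc Suc.prems x in auto)
  then show ?thesis using w0 x by auto
  qed
  then show ?thesis by simp
 qed
 ultimately show ?case unfolding altf.simps(2)[of A "Suc n"] by blast
qed

end

text \<open>\<open>B\<close> is the whole Lie algebra with bracket \<open>br\<close> and zero
  \<open>zr\<close>, acting on the values through \<open>act\<close>. The Jacobi identity has the
  derivation form [x,[y,z]] = [[x,y],z] + [y,[x,z]], in which no argument is negated.\<close>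

locale lie_forms = alt_forms ad sm KK sc
 for ad :: "'g => 'g => 'g" and sm :: "'k => 'g => 'g" and KK :: "'k set"
  and sc :: "'k => 'b::ab_group_add => 'b" +
 fixes B :: "'g set" and br :: "'g => 'g => 'g" and act :: "'g => 'b => 'b" and zr :: 'g
 assumes B: "subsp_on B"
  and zr: "zr : B" "x : B ==> ad zr x = x"
  and br_lin: "x : B ==> lin_on B (br x)"
  and br_add: "x : B ==> y : B ==> z : B ==> br (ad x y) z = ad (br x z) (br y z)"
  and br_smult: "a : KK ==> x : B ==> z : B ==> br (sm a x) z = sm a (br x z)"
  and br_self: "x : B ==> br x x = zr"
  and br_jacobi: "x : B ==> y : B ==> z : B ==> ad (br (br x y) z) (br y (br x z)) = br x (br y z)"
  and act_lin: "x : B ==> lin_op (act x)"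
  and act_add_op: "x : B ==> y : B ==> act (ad x y) v = act x v + act y v"
  and act_smult_op: "a : KK ==> x : B ==> act (sm a x) v = sc a (act x v)"
  and act_br: "x : B ==> y : B ==> act (br x y) v = act x (act y v) - act y (act x v)"
begin

definition subalg_on :: "'g set => bool"
 where "subalg_on A \<longleftrightarrow> A <= B & subsp_on A & (ALL x:A. ALL y:A. br x y : A)"

lemma subalgD:
 assumes "subalg_on A"
 shows "x : A ==> x : B" "subsp_on A" "x : A ==> y : A ==> br x y : A"
  "x : A ==> lin_on A (br x)"
 using assms br_lin by (auto simp: subalg_on_def lin_on_def) blast+

lemma act_add: "x : B ==> act x (v + w) = act x v + act x w"
 using act_lin by (simp add: lin_op_def)

lemma altf_zr:
 assumes "altf A (Suc n) f" "zr : A" "A <= B" "xs : tups A n"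
 shows "f (zr # xs) = 0"
proof -
 have "ad zr zr = zr" using zr by simp
 moreover have "f (ad zr zr # xs) = f (zr # xs) + f (zr # xs)" using assms by simp
 ultimately show ?thesis by simp
qed

lemma th_act_comm:
 assumes A: "subalg_on A" and x: "x : A" "y : A" and f: "altf A n f" "xs : tups A n"
 shows "th (act x) (br x) (th (act y) (br y) f) xs - th (act y) (br y) (th (act x) (br x) f) xs =
  th (act (br x y)) (br (br x y)) f xs"
proof (rule th_comm[of A])
 show "!!z. z : A ==> ad (br (br x y) z) (br y (br x z)) = br x (br y z)"
  using br_jacobi subalgD(1)[OF A] x by blast
qed (use A x f subalgD[OF A] in "auto simp: act_lin act_br")

text \<open>Induction through contraction with y. The ingredients are iota_y d = theta_y - d iota_y,
  the commutator of theta_x and iota_y, which is iota_[x,y], and that of theta_x and theta_y, which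
  is theta_[x,y].\<close>

lemma dd_th:
 assumes A: "subalg_on A" and x: "x : A"
 shows "altf A n f ==> xs : tups A (Suc n) ==>
  dd act br (th (act x) (br x) f) xs = th (act x) (br x) (dd act br f) xs"
proof (induction n arbitrary: f xs)
 case 0
 then obtain y where xs: "xs = [y]" "y : A" by (auto elim: tups_SucE)
 have "x : B" "y : B" using x xs subalgD(1)[OF A] by auto
 then show ?case using xs by (simp add: act_br)
next
 case (Suc n)
 from Suc.prems(2) obtain y ys where y: "xs = y # ys" "y : A" "ys : tups A (Suc n)" by (rule tups_SucE)
 let ?t = "%x. th (act x) (br x)" and ?d = "dd act br"
 have xB: "x : B" "y : B" and ysB: "!!z. z : set ys ==> z : B"
  using x y subalgD(1)[OF A] by (auto simp: tups_def)
 have xy: "br x y : A" using A x y by (simp add: subalgD)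
 have IH: "?d (?t x (%ys. f (y # ys))) ys = ?t x (?d (%ys. f (y # ys))) ys"
  by (rule Suc.IH) (use Suc.prems y in auto)
 have 1: "?t x (%zs. ?d f (y # zs)) ys = ?t x (?t y f) ys - ?t x (?d (%zs. f (y # zs))) ys"
  by (simp add: th_diff act_add xB)
 have 2: "?d (%zs. ?t x f (y # zs)) ys = ?d (?t x (%zs. f (y # zs))) ys - ?d (%zs. f (br x y # zs)) ys"
  by (simp add: dd_diff act_add ysB)
 have 3: "?t x (?t y f) ys - ?t y (?t x f) ys = ?t (br x y) f ys"
  by (rule th_act_comm[OF A x y(2)]) (use Suc.prems y in auto)
 have 4: "?d (?t x f) xs = ?t y (?t x f) ys - ?d (%zs. ?t x f (y # zs)) ys"
  "?t x (?d f) xs = ?t x (%zs. ?d f (y # zs)) ys - ?d f (br x y # ys)"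
  "?d f (br x y # ys) = ?t (br x y) f ys - ?d (%zs. f (br x y # zs)) ys"
  by (simp_all only: y dd.simps th.simps)
 show ?case unfolding 4 1 2 IH 3[symmetric] by (simp only: algebra_simps)
qed

text \<open>Contraction with y turns d d into theta_y d - d theta_y + d d iota_y; the first two
  terms cancel by \<open>dd_th\<close>, the last one is zero by induction.\<close>

lemma dd_dd:
 assumes A: "subalg_on A"
 shows "altf A n f ==> xs : tups A (Suc (Suc n)) ==> dd act br (dd act br f) xs = 0"
proof (induction n arbitrary: f xs)
 case 0
 then obtain x y where xs: "xs = [x, y]" "x : A" "y : A" by (auto elim!: tups_SucE)
 have "dd act br (th (act x) (br x) f) [y] = th (act x) (br x) (dd act br f) [y]"
  by (rule dd_th[OF A, of _ 0]) (use xs in auto)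
 then show ?case using xs subalgD(1)[OF A] act_add[of x "act y (f [])"] additive0[of "act y"] act_add by simp
next
 case (Suc n)
 from Suc.prems(2) obtain y ys where y: "xs = y # ys" "y : A" "ys : tups A (Suc (Suc n))" by (rule tups_SucE)
 let ?t = "%x. th (act x) (br x)" and ?d = "dd act br"
 have ysB: "!!z. z : set ys ==> z : B" using y subalgD(1)[OF A] by (auto simp: tups_def)
 have "?d (%zs. ?d f (y # zs)) ys = ?d (?t y f) ys - ?d (?d (%zs. f (y # zs))) ys"
  by (simp add: dd_diff act_add ysB)
 moreover have "?d (?d (%zs. f (y # zs))) ys = 0" by (rule Suc.IH) (use Suc.prems y in auto)
 moreover have "?d (?t y f) ys = ?t y (?d f) ys" by (rule dd_th[OF A y(2) Suc.prems(1) y(3)])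
 ultimately show ?case by (simp add: y)
qed

lemma altf_dd:
 assumes A: "subalg_on A" and zA: "zr : A"
 shows "altf A n f ==> altf A (Suc n) (dd act br f)"
proof (induction n arbitrary: f)
 case 0
 have "altf A (Suc 0) (%xs. dd act br f xs)"
  using subalgD(1)[OF A] by (auto simp: act_add_op act_smult_op)
 then show ?case by simp
next
 case (Suc n)
 let ?t = "%x. th (act x) (br x)" and ?d = "dd act br"
 note AB = subalgD(1)[OF A] and AA = subalgD(3)[OF A] and sub = subalgD(2)[OF A] and lin = subalgD(4)[OF A]
 have LB: "!!xs n z. xs : tups A n ==> z : set xs ==> z : B" using AB by (auto simp: tups_def)
 have adA: "!!x y. x : A ==> y : A ==> ad x y : A" and smA: "!!a x. a : KK ==> x : A ==> sm a x : A"
  using sub by (auto simp: subsp_on_def)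
 have "altf A (Suc n) (%xs. ?d f (x # xs))" if x: "x : A" for x
 proof -
  have "altf A (Suc n) (?t x f)" by (rule altf_th[OF sub _ _ Suc.prems]) (use x AB lin act_lin in auto)
  moreover have "altf A (Suc n) (?d (%xs. f (x # xs)))" by (rule Suc.IH) (use Suc.prems x in simp)
  ultimately show ?thesis by (simp only: dd.simps altf_diff)
 qed
 moreover have "?d f (ad x y # xs) = ?d f (x # xs) + ?d f (y # xs)"
  if x: "x : A" "y : A" "xs : tups A (Suc n)" for x y xs
 proof -
  have "?t (ad x y) f xs = ?t x f xs + ?t y f xs"
  by (rule th_add_op[OF _ _ _ _ _ Suc.prems x(3)]) (use x AB adA lin in "auto simp: br_add act_add_op")
  moreover have "?d (%zs. f (ad x y # zs)) xs = ?d (%zs. f (x # zs) + f (y # zs)) xs"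
  by (rule dd_cong[of A n]) (use Suc.prems x AA in auto)
  moreover have "... = ?d (%zs. f (x # zs)) xs + ?d (%zs. f (y # zs)) xs"
  by (rule dd_add) (use LB[OF x(3)] act_add in blast)
  ultimately show ?thesis by simp
 qed
 moreover have "?d f (sm a x # xs) = sc a (?d f (x # xs))"
  if x: "x : A" "a : KK" "xs : tups A (Suc n)" for a x xs
 proof -
  have "?t (sm a x) f xs = sc a (?t x f xs)"
  by (rule th_smult_op[OF _ _ _ _ Suc.prems x(3)]) (use x AB lin in "auto simp: br_smult act_smult_op")
  moreover have "?d (%zs. f (sm a x # zs)) xs = ?d (%zs. sc a (f (x # zs))) xs"
  by (rule dd_cong[of A n]) (use Suc.prems x AA in auto)
  moreover have "... = sc a (?d (%zs. f (x # zs)) xs)"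
  by (rule dd_hom) (use LB[OF x(3)] act_lin x sc_add in "auto simp: lin_op_def")
  ultimately show ?thesis using x by (simp add: sc_simps)
 qed
 \<comment> \<open>Unfolding twice, the terms theta_x (iota_x f) cancel; what remains is -f([x,x],
   ...) and d of the double contraction, and both vanish.\<close>
 moreover have "?d f (x # x # xs) = 0" if x: "x : A" "x # xs : tups A (Suc n)" for x xs
 proof -
  have xs: "xs : tups A n" using x by simp
  have "f (br x x # xs) = 0" using altf_zr[OF Suc.prems zA _ xs] AB br_self x by auto
  moreover have "?d (%zs. f (x # x # zs)) xs = 0"
  proof (cases n)
  case 0
  then show ?thesis using xs by simp
  next
  case (Suc m)
  have "?d (%zs. f (x # x # zs)) xs = ?d (%zs. 0) xs"
  by (rule dd_cong[of A m]) (use Suc Suc.prems x xs AA in auto)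
  then show ?thesis using dd_zero[of xs act br] LB[OF xs] act_add by simp
  qed
  ultimately show ?thesis by simp
 qed
 ultimately show ?case unfolding altf.simps(2)[of A "Suc n"] by blast
qed

definition ce_sum :: "nat => ('g list => 'b) => 'g list => 'b"
 where "ce_sum n f xs = (\<Sum>i\<le>n. sgn_pow i (act (xs ! i) (f (del_nth i xs)))) +
  (\<Sum>(i, j) \<in> {(i, j). i < j & j <= n}. sgn_pow (i + j) (f (br (xs ! i) (xs ! j) # del_nth i (del_nth j xs))))"

lemma del_nth_simps [simp]: "del_nth 0 (x # xs) = xs" "del_nth (Suc i) (x # xs) = x # del_nth i xs"
 by (simp_all add: del_nth_def)

lemma tups_del_nth: "xs : tups A (Suc n) ==> i <= n ==> del_nth i xs : tups A n"
 by (auto simp: tups_def del_nth_def dest: in_set_takeD in_set_dropD)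

lemma sum_uminus_sgn: "(\<Sum>i\<in>I. sgn_pow (Suc (k i)) (F i)) = - (\<Sum>i\<in>I. sgn_pow (k i) (F i :: 'b))"
 by (simp add: sum_negf)

text \<open>In the classical formula the terms in which the first argument x takes part as x_0,
  either acting or inside a bracket, add up to theta_x f. The others form minus the differential of
  iota_x f, once the bracket [x_i, x_j] has been exchanged with the x that now follows it.\<close>

lemma ce_sum_eq_dd:
 assumes A: "subalg_on A"
 shows "altf A n f ==> xs : tups A (Suc n) ==> ce_sum n f xs = dd act br f xs"
proof (induction n arbitrary: f xs)
 case 0
 then obtain x where "xs = [x]" by (auto elim: tups_SucE)
 moreover have e: "{(i, j). i < j & j <= (0::nat)} = {}" by auto
 ultimately show ?case unfolding ce_sum_def e by simp
next
 case (Suc n)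
 note AA = subalgD(3)[OF A] and sub = subalgD(2)[OF A]
 from Suc.prems(2) obtain x ys where x: "xs = x # ys" "x : A" "ys : tups A (Suc n)" by (rule tups_SucE)
 let ?f = "%ys. f (x # ys)"
 let ?P = "{(i, j). i < j & j <= n}"
 have IH: "ce_sum n ?f ys = dd act br ?f ys" by (rule Suc.IH) (use Suc.prems x in auto)
 have split: "{(i, j). i < j & j <= Suc n} = (%j. (0, Suc j)) ` {..n} \<union> (%(i, j). (Suc i, Suc j)) ` ?P"
 proof (intro equalityI subsetI)
  fix p assume "p : {(i, j). i < j & j <= Suc n}"
  then obtain i j where p: "p = (i, j)" "i < j" "j <= Suc n" by auto
  then show "p : (%j. (0, Suc j)) ` {..n} \<union> (%(i, j). (Suc i, Suc j)) ` ?P"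
  by (cases i; cases j) (auto simp: image_iff)
 qed auto
 have fin: "finite ?P" by (rule finite_subset[of _ "{..n} \<times> {..n}"]) auto
 let ?G = "%(i, j). sgn_pow (i + j) (f (br (xs ! i) (xs ! j) # del_nth i (del_nth j xs)))"
 have inj2: "inj_on (%(i, j). (Suc i, Suc j)) ?P" by (auto simp: inj_on_def)
 have inj1: "inj_on (%j. (0::nat, Suc j)) {..n}" by (auto simp: inj_on_def)
 have "sum ?G {(i, j). i < j & j <= Suc n} = sum ?G ((%j. (0, Suc j)) ` {..n}) + sum ?G ((%(i, j). (Suc i, Suc j)) ` ?P)"
  unfolding split by (rule sum.union_disjoint) (use fin in auto)
 also have "sum ?G ((%j. (0, Suc j)) ` {..n}) = (\<Sum>j\<le>n. - sgn_pow j (f (br x (ys ! j) # del_nth j ys)))"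
  by (subst sum.reindex[OF inj1]) (simp add: x)
 also have "sum ?G ((%(i, j). (Suc i, Suc j)) ` ?P) =
  (\<Sum>(i, j)\<in>?P. sgn_pow (i + j) (f (br (ys ! i) (ys ! j) # x # del_nth i (del_nth j ys))))"
  by (subst sum.reindex[OF inj2]) (auto simp: x intro!: sum.cong)
 also have "... = (\<Sum>(i, j)\<in>?P. - sgn_pow (i + j) (?f (br (ys ! i) (ys ! j) # del_nth i (del_nth j ys))))"
 proof (rule sum.cong)
  fix p assume "p : ?P"
  then obtain i j where p: "p = (i, j)" "i < j" "j <= n" by auto
  then obtain m where m: "n = Suc m" by (cases n) auto
  have "del_nth j ys : tups A (Suc m)" using x p m by (simp add: tups_del_nth)
  then have "del_nth i (del_nth j ys) : tups A m" using p m by (simp add: tups_del_nth)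
  moreover have "ys ! i : A" "ys ! j : A" using x p by (auto simp: tups_def)
  ultimately have "f (br (ys ! i) (ys ! j) # x # del_nth i (del_nth j ys)) =
  - f (x # br (ys ! i) (ys ! j) # del_nth i (del_nth j ys))"
  by (intro altf_swap[OF sub, of m]) (use Suc.prems m x AA in auto)
  then show "(case p of (i, j) => sgn_pow (i + j) (f (br (ys ! i) (ys ! j) # x # del_nth i (del_nth j ys)))) =
  (case p of (i, j) => - sgn_pow (i + j) (?f (br (ys ! i) (ys ! j) # del_nth i (del_nth j ys))))"
  using p by simp
 qed simp
 finally have 2: "sum ?G {(i, j). i < j & j <= Suc n} =
  - (\<Sum>j\<le>n. sgn_pow j (f (br x (ys ! j) # del_nth j ys)))
  - (\<Sum>(i, j)\<in>?P. sgn_pow (i + j) (?f (br (ys ! i) (ys ! j) # del_nth i (del_nth j ys))))"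
  by (simp add: sum_negf case_prod_unfold)
 have 1: "(\<Sum>i\<le>Suc n. sgn_pow i (act (xs ! i) (f (del_nth i xs)))) =
  act x (f ys) - (\<Sum>i\<le>n. sgn_pow i (act (ys ! i) (?f (del_nth i ys))))"
  by (subst sum.atMost_Suc_shift) (simp add: x sum_negf)
 \<comment> \<open>Moving [x, y_j] from the front to slot j costs the sign (-1)^j. This identifies
   the unrolled \<open>th\<close> with the alternating sum.\<close>
 have 3: "th (act x) (br x) f ys = act x (f ys) - (\<Sum>j\<le>n. sgn_pow j (f (br x (ys ! j) # del_nth j ys)))"
 proof -
  have "(\<Sum>j<length ys. f (ys[j := br x (ys ! j)])) = (\<Sum>j\<le>n. sgn_pow j (f (br x (ys ! j) # del_nth j ys)))"
  proof (rule sum.cong)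
  show "{..<length ys} = {..n}" using x by (auto simp: tups_def)
  fix j assume j: "j : {..n}"
  have len: "length ys = Suc n" "set ys <= A" using x by (auto simp: tups_def)
  have yj: "ys ! j : A" using j len by auto
  have "f (br x (ys ! j) # take j ys @ drop (Suc j) ys) = sgn_pow (length (take j ys)) (f (take j ys @ br x (ys ! j) # drop (Suc j) ys))"
  by (rule altf_move[OF sub Suc.prems(1)])
  (use x j len yj AA in "auto dest: in_set_takeD in_set_dropD")
  moreover have "take j ys @ br x (ys ! j) # drop (Suc j) ys = ys[j := br x (ys ! j)]"
  using j len by (simp add: upd_conv_take_nth_drop)
  moreover have "length (take j ys) = j" using j len by simp
  ultimately show "f (ys[j := br x (ys ! j)]) = sgn_pow j (f (br x (ys ! j) # del_nth j ys))"
  by (simp add: del_nth_def sgn_pow_def)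
  qed
  then show ?thesis by (simp add: th_explicit)
 qed
 have 4: "dd act br f xs = th (act x) (br x) f ys - dd act br ?f ys"
  by (simp only: x dd.simps)
 show ?case unfolding 4 3 IH[symmetric] ce_sum_def 1 2
  by (simp only: algebra_simps add_minus_cancel)
qed

end

section \<open>Powers of derivations in characteristic p\<close>

definition nsc :: "nat => 'b::ab_group_add => 'b"
 where "nsc k v = (\<Sum>i<k. v)"

lemma nsc_simps [simp]: "nsc 0 v = 0" "nsc (Suc k) v = nsc k v + v" "nsc k 0 = 0"
 by (simp_all add: nsc_def)

lemma nsc_add: "nsc (a + b) v = nsc a v + nsc b v"
 by (induction b) (simp_all add: algebra_simps)

lemma nsc_mult: "nsc (a * b) v = nsc a (nsc b v)"
 by (induction a) (simp_all add: nsc_add algebra_simps)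

lemma nsc_additive: "(!!v w. u (v + w) = u v + u w) ==> u (nsc k v) = nsc k (u v)"
 by (induction k) (simp_all add: additive0[of u])

lemma nsc_fun: "nsc k f = (%x. nsc k (f x))"
 by (induction k) (auto simp: fun_eq_iff)

lemma funpow_additive:
 fixes u :: "'b::ab_group_add => 'b"
 shows "(!!v w. u (v + w) = u v + u w) ==> (u ^^ k) (v + w) = (u ^^ k) v + (u ^^ k) w"
 by (induction k) simp_all

lemma funpow_commute:
 fixes u w :: "'b => 'b"
 shows "(!!v. u (w v) = w (u v)) ==> u ((w ^^ k) v) = (w ^^ k) (u v)"
 by (induction k) simp_all

lemma commuting_binomial:
 fixes B C :: "'b::ab_group_add => 'b"
 assumes B: "!!v w. B (v + w) = B v + B w" and C: "!!v w. C (v + w) = C v + C w"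
  and comm: "!!v. B (C v) = C (B v)"
 shows "((%v. B v + C v) ^^ n) v = (\<Sum>k\<le>n. nsc (n choose k) ((B ^^ k) ((C ^^ (n - k)) v)))"
proof (induction n)
 case (Suc n)
 define T where "T k m = (B ^^ k) ((C ^^ m) v)" for k m
 have BT: "B (T k m) = T (Suc k) m" for k m by (simp add: T_def)
 have CT: "C (T k m) = T k (Suc m)" for k m
  using funpow_commute[of C B k "(C ^^ m) v"] comm by (simp add: T_def)
 have "((%v. B v + C v) ^^ Suc n) v = B (\<Sum>k\<le>n. nsc (n choose k) (T k (n - k))) + C (\<Sum>k\<le>n. nsc (n choose k) (T k (n - k)))"
  by (simp add: Suc.IH T_def)
 also have "... = (\<Sum>k\<le>n. nsc (n choose k) (T (Suc k) (n - k))) + (\<Sum>k\<le>n. nsc (n choose k) (T k (Suc (n - k))))"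
  by (simp add: additive_sum[of B, OF B] additive_sum[of C, OF C] nsc_additive[of B, OF B] nsc_additive[of C, OF C] BT CT)
 also have "(\<Sum>k\<le>n. nsc (n choose k) (T k (Suc (n - k)))) = (\<Sum>k\<le>Suc n. nsc (n choose k) (T k (Suc n - k)))"
  by (simp add: Suc_diff_le binomial_eq_0)
 also have "... = T 0 (Suc n) + (\<Sum>k\<le>n. nsc (n choose Suc k) (T (Suc k) (n - k)))"
  by (subst sum.atMost_Suc_shift) simp
 also have "(\<Sum>k\<le>n. nsc (n choose k) (T (Suc k) (n - k))) + (T 0 (Suc n) + (\<Sum>k\<le>n. nsc (n choose Suc k) (T (Suc k) (n - k))))
  = T 0 (Suc n) + (\<Sum>k\<le>n. nsc (Suc n choose Suc k) (T (Suc k) (n - k)))"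
  by (simp add: nsc_add sum.distrib algebra_simps)
 also have "... = (\<Sum>k\<le>Suc n. nsc (Suc n choose k) (T k (Suc n - k)))"
  by (subst sum.atMost_Suc_shift) (simp only: binomial_n_0 diff_Suc_Suc diff_zero nsc_simps add_0_left One_nat_def)
 finally show ?case by (simp only: T_def)
qed simp

text \<open>The inner binomial coefficients are divisible by p. As the group \<open>amb\<close> is
  not killed by p, torsion is asked of the vector v alone; additivity passes it on to all vectors
  obtained from v by powers of B and C.\<close>

lemma commuting_frobenius:
 fixes B C :: "'b::ab_group_add => 'b"
 assumes B: "!!v w. B (v + w) = B v + B w" and C: "!!v w. C (v + w) = C v + C w"
  and comm: "!!v. B (C v) = C (B v)" and p: "prime p" "nsc p v = 0"
 shows "((%v. B v + C v) ^^ p) v = (B ^^ p) v + (C ^^ p) v"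
proof -
 have p0: "p > 0" using p prime_gt_0_nat by blast
 have "nsc (p choose k) ((B ^^ k) ((C ^^ (p - k)) v)) = 0" if k: "k : {..p} - {0, p}" for k
 proof -
  have "p dvd p choose k" using k p by (intro dvd_choose_prime) auto
  then obtain q where q: "p choose k = q * p" by (metis dvd_def mult.commute)
  have "nsc p ((B ^^ k) ((C ^^ (p - k)) v)) = (B ^^ k) ((C ^^ (p - k)) (nsc p v))"
  by (simp add: nsc_additive[of "B ^^ k"] nsc_additive[of "C ^^ (p - k)"] funpow_additive[of B, OF B]
  funpow_additive[of C, OF C])
  also have "... = 0" using p additive0[of "B ^^ k"] additive0[of "C ^^ (p - k)"]
  by (simp add: funpow_additive[of B, OF B] funpow_additive[of C, OF C])
  finally show ?thesis by (simp add: q nsc_mult)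
 qed
 then have "(\<Sum>k\<le>p. nsc (p choose k) ((B ^^ k) ((C ^^ (p - k)) v))) =
  (\<Sum>k\<in>{0, p}. nsc (p choose k) ((B ^^ k) ((C ^^ (p - k)) v)))"
  by (intro sum.mono_neutral_right) auto
 then show ?thesis using p0 by (simp add: commuting_binomial[OF B C comm] add.commute)
qed

text \<open>This is (ad A)^p = ad (A^p). With B = ad A and C the composition with A from the right,
  B + C is the composition with A from the left. Applying Frobenius to this sum, instead of to a
  difference, avoids the sign (-1)^p.\<close>

lemma commutator_power:
 fixes A F :: "'b::ab_group_add => 'b"
 assumes A: "!!v w. A (v + w) = A v + A w" and p: "prime p" "!!v. nsc p (F v) = 0"
 shows "((%F v. A (F v) - F (A v)) ^^ p) F v = (A ^^ p) (F v) - F ((A ^^ p) v)"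
proof -
 define B where "B = (%F v. A (F v) - F (A v))"
 define C where "C = (%(F :: 'b => 'b) v. F (A v))"
 have "((%F. B F + C F) ^^ p) F = (B ^^ p) F + (C ^^ p) F"
 proof (rule commuting_frobenius)
  show "B (v + w) = B v + B w" for v w by (auto simp: B_def A fun_eq_iff)
  show "C (v + w) = C v + C w" for v w by (auto simp: C_def fun_eq_iff)
  show "B (C v) = C (B v)" for v by (simp add: B_def C_def)
  show "prime p" by fact
  show "nsc p F = 0" by (simp add: nsc_fun p fun_eq_iff)
 qed
 moreover have "(%F. B F + C F) = (%F v. A (F v))" by (auto simp: B_def C_def fun_eq_iff)
 moreover have "((%F v. A (F v)) ^^ k) F = (%v. (A ^^ k) (F v))" for k by (induction k) auto
 moreover have "(C ^^ k) F = (%v. F ((A ^^ k) v))" for k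
  by (induction k) (auto simp: C_def funpow_swap1)
 ultimately have "(A ^^ p) (F v) = (B ^^ p) F v + F ((A ^^ p) v)" by (metis plus_fun_apply)
 then show ?thesis by (simp add: B_def algebra_simps)
qed

text \<open>Splitting off the first argument, \<open>th\<close> is a difference of two commuting operators, so
  that its powers are governed by the preceding lemma, one argument at a time.\<close>

lemma th_power:
 fixes u :: "'b::ab_group_add => 'b" and f :: "'g list => 'b"
 assumes u: "!!v w. u (v + w) = u v + u w" and p: "prime p" "!!xs. nsc p (f xs) = 0"
 shows "(th u D ^^ p) f xs = th (u ^^ p) (D ^^ p) f xs"
 using p(2)
proof (induction xs arbitrary: f)
 case Nil
 have "(th u D ^^ k) f [] = (u ^^ k) (f [])" for k by (induction k) auto
 then show ?case by simp
next
 case (Cons x xs)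
 \<comment> \<open>\<open>A\<close> is \<open>th\<close> with the first argument passive and
   \<open>C\<close> applies D to the first argument. Frobenius is used for A = B + C and solved for
   the p-th power of B; the power of A is known by induction on the list, that of C is
   explicit.\<close>
 define B where "B = th u D"
 define C where "C = (%(f :: 'g list => 'b) xs. case xs of [] => 0 | x # ys => f (D x # ys))"
 define A where "A = (%(f :: 'g list => 'b) xs. case xs of [] => u (f []) | x # ys => th u D (%ys. f (x # ys)) ys)"
 have frob: "((%f. B f + C f) ^^ p) f = (B ^^ p) f + (C ^^ p) f"
 proof (rule commuting_frobenius)
  show "B (v + w) = B v + B w" for v w by (auto simp: B_def th_add u fun_eq_iff plus_fun_def)
  show "C (v + w) = C v + C w" for v w by (auto simp: C_def fun_eq_iff split: list.split)
  show "B (C v) = C (B v)" for v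
  by (auto simp: B_def C_def fun_eq_iff additive0[of u, OF u] split: list.split)
  show "prime p" by fact
  show "nsc p f = 0" by (simp add: nsc_fun Cons.prems fun_eq_iff)
 qed
 have ABC: "(%f. B f + C f) = A" by (auto simp: A_def B_def C_def fun_eq_iff split: list.split)
 have Ak: "(A ^^ k) f (x # xs) = (th u D ^^ k) (%ys. f (x # ys)) xs" for k f
  by (induction k arbitrary: f) (auto simp: A_def funpow_swap1 simp del: funpow.simps(2) simp: funpow_Suc_right)
 have Ck: "(C ^^ k) f (y # xs) = f ((D ^^ k) y # xs)" for k y
 proof (induction k arbitrary: y)
  case (Suc k)
  have Cy: "C g (y # xs) = g (D y # xs)" for g by (simp add: C_def)
  have "(C ^^ Suc k) f (y # xs) = C ((C ^^ k) f) (y # xs)" by simp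
  also have "... = (C ^^ k) f (D y # xs)" by (rule Cy)
  also have "... = f ((D ^^ k) (D y) # xs)" by (rule Suc)
  also have "(D ^^ k) (D y) = (D ^^ Suc k) y" by (simp add: funpow_swap1)
  finally show ?case .
 qed (simp only: funpow.simps id_apply)
 have IH: "(th u D ^^ p) (%ys. f (x # ys)) xs = th (u ^^ p) (D ^^ p) (%ys. f (x # ys)) xs"
  by (rule Cons.IH) (rule Cons.prems)
 have "(A ^^ p) f (x # xs) = ((B ^^ p) f + (C ^^ p) f) (x # xs)" by (simp only: frob ABC[symmetric])
 then have "th (u ^^ p) (D ^^ p) (%ys. f (x # ys)) xs = (B ^^ p) f (x # xs) + f ((D ^^ p) x # xs)"
  by (simp only: plus_fun_apply Ak Ck IH)
 then show ?case by (simp add: B_def algebra_simps)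
qed

section \<open>Forms determined on generators\<close>

text \<open>Pullback of forms along a linear map. Two argument spaces occur, hence two instances of
  the locale over the same values.\<close>

lemma altf_map:
 assumes L: "alt_forms KK sc"
  and h: "!!x. x : A ==> h x : A'" "!!x y. x : A ==> y : A ==> h (ad x y) = ad' (h x) (h y)"
  "!!a x. a : KK ==> x : A ==> h (sm a x) = sm' a (h x)"
 shows "alt_forms.altf ad' sm' KK sc A' n f ==> alt_forms.altf ad sm KK sc A n (%xs. f (map h xs))"
proof -
 interpret A: alt_forms ad sm KK sc by (rule L)
 interpret B: alt_forms ad' sm' KK sc by (rule L)
 have l: "map h xs : tups A' m" if "xs : tups A m" for xs m
  using that h(1) by (auto simp: tups_def)
 show "B.altf A' n f ==> A.altf A n (%xs. f (map h xs))"
 proof (induction n arbitrary: f)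
  case (Suc n)
  have "A.altf A n (%xs. f (h x # map h xs))" if "x : A" for x
  using Suc.IH[of "%xs. f (h x # xs)"] Suc.prems h(1)[OF that] by simp
  then show ?case using Suc.prems h l by (auto simp: l)
 qed simp
qed

lemma wedge_zero: "(!!y v. y : set ys ==> sc (c y) v = 0) ==> wedge sc c g ys = 0"
 by (induction ys arbitrary: g) auto

context alt_forms
begin

text \<open>That P spans A is stated as an induction principle. If f vanishes whenever all entries
  lie in P, then for entries of P in the tail the admissible first entries form a subspace
  containing P, so they are all of A; the tail is treated by induction.\<close>

lemma altf_zero_on_generators:
 assumes P: "P <= A" "!!T. P <= T ==> T <= A ==> (!!x y. x : T ==> y : T ==> ad x y : T) ==>
  (!!a x. a : KK ==> x : T ==> sm a x : T) ==> A <= T" and A: "subsp_on A"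
 shows "altf A n f ==> (!!ps. ps : tups P n ==> f ps = 0) ==> xs : tups A n ==> f xs = 0"
proof (induction n arbitrary: f xs)
 case (Suc n)
 from Suc.prems(3) obtain x ys where x: "xs = x # ys" "x : A" "ys : tups A n" by (rule tups_SucE)
 define T where "T = {x : A. ALL ps : tups P n. f (x # ps) = 0}"
 have PA: "ps : tups A n" if "ps : tups P n" for ps using P(1) that by (rule tups_mono)
 have "A <= T"
  by (rule P(2)) (use Suc.prems P(1) A PA in "auto simp: T_def subsp_on_def sc_simps")
 then have "f (x # ps) = 0" if "ps : tups P n" for ps using x that by (auto simp: T_def)
 then show ?case using Suc.IH[of "%ys. f (x # ys)" ys] Suc.prems x by simp
qed simp

text \<open>In a tuple with entries in H or equal to x, either x is repeated, and f vanishes, or x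
  occurs at most once and can be moved to the front.\<close>

lemma altf_zero_extension:
 assumes A: "subsp_on A" and H: "insert x H <= A"
  and gen: "!!T. insert x H <= T ==> T <= A ==> (!!x y. x : T ==> y : T ==> ad x y : T) ==>
  (!!a x. a : KK ==> x : T ==> sm a x : T) ==> A <= T"
  and f: "altf A n f" "!!hs. hs : tups H n ==> f hs = 0"
  "!!hs m. n = Suc m ==> hs : tups H m ==> f (x # hs) = 0"
  and xs: "xs : tups A n"
 shows "f xs = 0"
proof (rule altf_zero_on_generators[OF H gen A f(1) _ xs])
 fix ps assume ps: "ps : tups (insert x H) n"
 show "f ps = 0"
 proof (cases "x : set ps")
  case False
  then show ?thesis using ps f(2)[of ps] by (auto simp: tups_def)
 next
  case True
  then obtain as bs where s: "ps = as @ x # bs" by (auto simp: in_set_conv_decomp)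
  then obtain m where m: "n = Suc m" using ps by (cases n) (auto simp: tups_def)
  show ?thesis
  proof (cases "distinct ps")
  case True
  then have "as @ bs : tups H m" using ps s m by (auto simp: tups_def)
  then have "f (x # as @ bs) = 0" using f(3) m by blast
  moreover have "f (x # as @ bs) = sgn_pow (length as) (f (as @ x # bs))"
  by (rule altf_move[OF A f(1)]) (use ps s H in "auto simp: tups_def")
  ultimately show ?thesis using s by (auto simp: sgn_pow_def split: if_splits)
  next
  case False
  then show ?thesis using altf_not_distinct[OF A f(1)] tups_mono[OF H ps] by simp
  qed
 qed
qed auto

lemma insort_split: "EX as bs. js = as @ bs & insort i js = as @ i # bs"
proof (induction js)
 case (Cons j js)
 then obtain as bs where "js = as @ bs" "insort i js = as @ i # bs" by blast
 then show ?case by (cases "i <= j") (auto intro: exI[of _ "[]"] exI[of _ "j # as"])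
qed simp

lemma altf_sort:
 assumes A: "subsp_on A"
 shows "altf A n f ==> length js = n ==> b ` set js <= A ==>
  EX k. f (map b js) = sgn_pow k (f (map b (sort js)))"
proof (induction js arbitrary: n f)
 case Nil
 then show ?case by (intro exI[of _ 0]) simp
next
 case (Cons j js)
 then obtain m where m: "n = Suc m" by (cases n) auto
 obtain k where k: "f (b j # map b js) = sgn_pow k (f (b j # map b (sort js)))"
  using Cons.IH[of m "%ys. f (b j # ys)"] Cons.prems m by auto
 obtain as bs where s: "sort js = as @ bs" "insort j (sort js) = as @ j # bs" using insort_split by blast
 have len: "length js = length as + length bs" "set js = set as \<union> set bs"
  using s(1) by (metis length_append length_sort, metis set_append set_sort)
 have "f (b j # map b as @ map b bs) = sgn_pow (length (map b as)) (f (map b as @ b j # map b bs))"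
  by (rule altf_move[OF A Cons.prems(1)]) (use Cons.prems len in auto)
 then have "f (map b (j # js)) = sgn_pow (k + length as) (f (map b (sort (j # js))))"
  using k s by (simp add: sgn_pow_def)
 then show ?case by blast
qed

text \<open>By multilinearity tuples of spanning vectors suffice; those with a repetition give zero,
  and the remaining ones can be sorted up to sign.\<close>

lemma altf_zero_on_increasing:
 fixes b :: "nat => 'g"
 assumes A: "subsp_on A" and b: "b ` {..<d} <= A"
  and gen: "!!T. b ` {..<d} <= T ==> T <= A ==> (!!x y. x : T ==> y : T ==> ad x y : T) ==>
  (!!a x. a : KK ==> x : T ==> sm a x : T) ==> A <= T"
  and f: "altf A n f" "!!js. js : tups {..<d} n ==> sorted_wrt (<) js ==> f (map b js) = 0"
  and xs: "xs : tups A n"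
 shows "f xs = 0"
proof (rule altf_zero_on_generators[OF b gen A f(1) _ xs])
 fix ps assume ps: "ps : tups (b ` {..<d}) n"
 then have "set ps <= b ` {..<d}" by (auto simp: tups_def)
 then have "ps : lists (b ` {..<d})" by auto
 then have "ps : map b ` lists {..<d}" by (simp only: lists_image)
 then obtain js where js: "ps = map b js" "set js <= {..<d}" by (auto simp: lists_eq_set)
 show "f ps = 0"
 proof (cases "distinct js")
  case True
  then have "f (map b (sort js)) = 0"
  by (intro f(2)) (use js ps in "auto simp: tups_def strict_sorted_iff")
  moreover have "b ` set js <= A" using js b by auto
  then obtain k where "f (map b js) = sgn_pow k (f (map b (sort js)))"
  using altf_sort[OF A f(1), of js b] js ps by (auto simp: tups_def)
  ultimately show ?thesis by (simp add: js)
 next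
  case False
  then have "~ distinct ps" by (simp add: js distinct_map)
  then show ?thesis using altf_not_distinct[OF A f(1)] tups_mono[OF b ps] by simp
 qed
qed auto

end

section \<open>Relative dimensions\<close>

definition linsub :: "('k, 'e) ring_scheme => ('k, 'v, 'r) module_scheme => 'v set => bool"
 where "linsub K V Z \<longleftrightarrow> Z <= carrier V & \<zero>\<^bsub>V\<^esub> : Z & (ALL x:Z. ALL y:Z. x \<oplus>\<^bsub>V\<^esub> y : Z) &
  (ALL a:carrier K. ALL x:Z. a \<odot>\<^bsub>V\<^esub> x : Z)"

definition linear_on ::
  "('k, 'e) ring_scheme => ('k, 'v, 'r) module_scheme => ('k, 'w, 's) module_scheme => 'v set => ('v => 'w) => bool"
 where "linear_on K V W Z f \<longleftrightarrow> (ALL x:Z. f x : carrier W) & (ALL x:Z. ALL y:Z. f (x \<oplus>\<^bsub>V\<^esub> y) = f x \<oplus>\<^bsub>W\<^esub> f y) &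
  (ALL a:carrier K. ALL x:Z. f (a \<odot>\<^bsub>V\<^esub> x) = a \<odot>\<^bsub>W\<^esub> f x)"

text \<open>\<open>qdim K V Z B J\<close>: the quotient \<open>Z/B\<close> has a basis indexed by \<open>J\<close>, given through its coordinates.\<close>
definition qdim :: "('k, 'e) ring_scheme => ('k, 'v, 'r) module_scheme => 'v set => 'v set => 'j set => bool"
 where "qdim K V Z B J \<longleftrightarrow> (EX \<pi>. linear_on K V (free_space K J) Z \<pi> & \<pi> ` Z = carrier (free_space K J) &
  (ALL z:Z. \<pi> z = (%j. zero K) \<longleftrightarrow> z : B))"

abbreviation has_basis :: "('k, 'e) ring_scheme => ('k, 'v, 'r) module_scheme => 'j set => bool"
 where "has_basis K V J == qdim K V (carrier V) {zero V} J"

lemma vectorspaceI: "field K ==> module K V ==> vectorspace K V"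
 by (simp add: vectorspace_def)

lemma linsubD:
 assumes "linsub K V Z"
 shows "x : Z ==> x : carrier V" "zero V : Z" "x : Z ==> y : Z ==> x \<oplus>\<^bsub>V\<^esub> y : Z"
  "a : carrier K ==> x : Z ==> a \<odot>\<^bsub>V\<^esub> x : Z"
 using assms by (auto simp: linsub_def)

lemma linear_onD:
 assumes "linear_on K V W Z f"
 shows "x : Z ==> f x : carrier W" "x : Z ==> y : Z ==> f (x \<oplus>\<^bsub>V\<^esub> y) = f x \<oplus>\<^bsub>W\<^esub> f y"
  "a : carrier K ==> x : Z ==> f (a \<odot>\<^bsub>V\<^esub> x) = a \<odot>\<^bsub>W\<^esub> f x"
 using assms by (auto simp: linear_on_def)

lemma free_space_simps:
 "f : carrier (free_space K S) \<longleftrightarrow> (ALL x. f x : carrier K) & (ALL x. x ~: S --> f x = zero K) & finite {x. f x ~= zero K}"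
 "\<zero>\<^bsub>free_space K S\<^esub> = (%x. zero K)" "f \<oplus>\<^bsub>free_space K S\<^esub> g = (%x. f x \<oplus>\<^bsub>K\<^esub> g x)"
 "a \<odot>\<^bsub>free_space K S\<^esub> f = (%x. a \<otimes>\<^bsub>K\<^esub> f x)"
 by (simp_all add: free_space_def)

lemma free_space_vs:
 fixes K :: "('k, 'e) ring_scheme" and S :: "'s set"
 assumes "field K"
 shows "vectorspace K (free_space K S)"
proof (rule vectorspaceI[OF assms])
 interpret field K by fact
 have fin: "finite {x. f x \<oplus>\<^bsub>K\<^esub> g x ~= zero K}" if "finite {x. f x ~= zero K}" "finite {x. g x ~= zero K}" for f g :: "'s => 'k"
  by (rule finite_subset[of _ "{x. f x ~= zero K} \<union> {x. g x ~= zero K}"]) (use that in auto)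
 have fin2: "finite {x. a \<otimes>\<^bsub>K\<^esub> f x ~= zero K}" if "finite {x. f x ~= zero K}" "a : carrier K" for f :: "'s => 'k" and a
  by (rule finite_subset[of _ "{x. f x ~= zero K}"]) (use that in auto)
 have neg: "EX g:carrier (free_space K S). f \<oplus>\<^bsub>free_space K S\<^esub> g = \<zero>\<^bsub>free_space K S\<^esub>"
  if f: "f : carrier (free_space K S)" for f
 proof
  show "(%x. \<ominus>\<^bsub>K\<^esub> f x) : carrier (free_space K S)"
  using f by (auto simp: free_space_simps intro: finite_subset[rotated])
  show "f \<oplus>\<^bsub>free_space K S\<^esub> (%x. \<ominus>\<^bsub>K\<^esub> f x) = \<zero>\<^bsub>free_space K S\<^esub>"
  using f by (auto simp: free_space_simps r_neg)
 qed
 show "module K (free_space K S)"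
 proof (rule module_criteria)
  show "ALL v:carrier (free_space K S). EX w:carrier (free_space K S). v \<oplus>\<^bsub>free_space K S\<^esub> w = \<zero>\<^bsub>free_space K S\<^esub>"
  using neg by blast
 qed (auto simp: free_space_simps fin fin2 is_cring m_assoc l_distr r_distr intro!: ext a_comm a_assoc)
qed

lemma free_space_mono: "J <= J' ==> f : carrier (free_space K J) ==> f : carrier (free_space K J')"
 by (auto simp: free_space_simps)

context vectorspace
begin

lemma linsub_carrier: "linsub K V (carrier V)"
 by (auto simp: linsub_def)

lemma linsub_zero: "linsub K V {zero V}"
 by (auto simp: linsub_def)

lemma neg_smult: "x : carrier V ==> (\<ominus>\<^bsub>K\<^esub> \<one>\<^bsub>K\<^esub>) \<odot>\<^bsub>V\<^esub> x = \<ominus>\<^bsub>V\<^esub> x"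
 by (simp add: smult_l_minus)

lemma diff_self: "x : carrier V ==> x \<ominus>\<^bsub>V\<^esub> x = zero V"
 by (simp add: a_minus_def M.r_neg)

lemma diff_zero_iff: "x : carrier V ==> y : carrier V ==> x \<ominus>\<^bsub>V\<^esub> y = zero V \<longleftrightarrow> x = y"
 by (metis M.minus_equality M.minus_minus M.a_inv_closed a_minus_def diff_self)

lemma diff_add_cancel: "x : carrier V ==> y : carrier V ==> (x \<ominus>\<^bsub>V\<^esub> y) \<oplus>\<^bsub>V\<^esub> y = x"
 "x : carrier V ==> y : carrier V ==> (x \<oplus>\<^bsub>V\<^esub> y) \<ominus>\<^bsub>V\<^esub> y = x"
 by (simp_all add: a_minus_def M.a_assoc M.l_neg M.r_neg)

lemma linsub_neg: "linsub K V Z ==> x : Z ==> \<ominus>\<^bsub>V\<^esub> x : Z"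
 using linsubD(4)[of K V Z "\<ominus>\<^bsub>K\<^esub> \<one>\<^bsub>K\<^esub>" x] linsubD(1)[of K V Z x] neg_smult by simp

lemma linsub_diff: "linsub K V Z ==> x : Z ==> y : Z ==> x \<ominus>\<^bsub>V\<^esub> y : Z"
 by (simp add: a_minus_def linsub_neg linsubD)

lemma linsub_add_iff:
 assumes "linsub K V Z" "y : Z" "x : carrier V"
 shows "x \<oplus>\<^bsub>V\<^esub> y : Z \<longleftrightarrow> x : Z" "y \<oplus>\<^bsub>V\<^esub> x : Z \<longleftrightarrow> x : Z" "x \<ominus>\<^bsub>V\<^esub> y : Z \<longleftrightarrow> x : Z"
proof -
 have y: "y : carrier V" using assms by (simp add: linsubD)
 have "x = (x \<oplus>\<^bsub>V\<^esub> y) \<ominus>\<^bsub>V\<^esub> y" using y assms by (simp add: diff_add_cancel)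
 then show 1: "x \<oplus>\<^bsub>V\<^esub> y : Z \<longleftrightarrow> x : Z" using assms linsub_diff linsubD(3) by metis
 then show "y \<oplus>\<^bsub>V\<^esub> x : Z \<longleftrightarrow> x : Z" using assms y by (simp add: M.a_comm)
 have "x = (x \<ominus>\<^bsub>V\<^esub> y) \<oplus>\<^bsub>V\<^esub> y" using y assms by (simp add: diff_add_cancel)
 then show "x \<ominus>\<^bsub>V\<^esub> y : Z \<longleftrightarrow> x : Z" using assms linsub_diff linsubD(3) by metis
qed

lemma vs_linsub: "linsub K V Z ==> vectorspace K (V\<lparr>carrier := Z\<rparr>)"
 by (rule vectorspaceI, rule field_axioms, rule submodule_is_module)
  (auto simp: submodule_def linsub_def module_axioms)

lemma linear_on_diff:
 assumes "vectorspace K W" "linear_on K V W Z f" "linsub K V Z" "x : Z" "y : Z"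
 shows "f (x \<ominus>\<^bsub>V\<^esub> y) = f x \<ominus>\<^bsub>W\<^esub> f y"
proof -
 interpret W: vectorspace K W by fact
 have "f (\<ominus>\<^bsub>V\<^esub> y) = \<ominus>\<^bsub>W\<^esub> f y"
  using linear_onD(3)[OF assms(2), of "\<ominus>\<^bsub>K\<^esub> \<one>\<^bsub>K\<^esub>" y] assms neg_smult[of y] W.neg_smult[of "f y"]
  by (simp add: linsubD[OF assms(3)] linear_onD[OF assms(2)])
 then show ?thesis using linear_onD(2)[OF assms(2), of x "\<ominus>\<^bsub>V\<^esub> y"] assms by (simp add: a_minus_def linsub_neg)
qed

lemma linear_on_zero:
 assumes "vectorspace K W" "linear_on K V W Z f" "linsub K V Z"
 shows "f \<zero>\<^bsub>V\<^esub> = zero W"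
proof -
 interpret W: vectorspace K W by fact
 have z: "zero V : Z" using assms by (simp add: linsubD)
 show ?thesis using linear_on_diff[OF assms z z] linear_onD(1)[OF assms(2) z] by (simp add: W.diff_self diff_self)
qed

text \<open>Here Z is Z' plus the line through x. The coefficient of x in z is unique because x lies
  outside Z' and scalars are invertible; it becomes the new coordinate with index n, the others
  being those of the remainder in Z'.\<close>

lemma qdim_step:
 assumes Z: "linsub K V Z" and Z': "linsub K V Z'" "Z' <= Z" "B <= Z'" and q: "qdim K V Z' B {..<n::nat}"
  and x: "x : Z" "x ~: Z'" and cod: "!!z. z : Z ==> EX a:carrier K. z \<ominus>\<^bsub>V\<^esub> a \<odot>\<^bsub>V\<^esub> x : Z'"
 shows "qdim K V Z B {..<Suc n}"
proof -
 let ?F = "free_space K {..<n}" and ?F' = "free_space K {..<Suc n}"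
 from q obtain \<pi> where \<pi>: "linear_on K V ?F Z' \<pi>" "\<pi> ` Z' = carrier ?F" "!!z. z : Z' ==> \<pi> z = (%j. zero K) \<longleftrightarrow> z : B"
  unfolding qdim_def by blast
 have xV: "x : carrier V" and ZV: "!!z. z : Z ==> z : carrier V" using Z x by (auto simp: linsubD)
 define c where "c z = (SOME a. a : carrier K & z \<ominus>\<^bsub>V\<^esub> a \<odot>\<^bsub>V\<^esub> x : Z')" for z
 have c: "c z : carrier K" "z \<ominus>\<^bsub>V\<^esub> c z \<odot>\<^bsub>V\<^esub> x : Z'" if "z : Z" for z
  using someI_ex[of "%a. a : carrier K & z \<ominus>\<^bsub>V\<^esub> a \<odot>\<^bsub>V\<^esub> x : Z'"] cod[OF that] by (auto simp: c_def)
 have c_eq: "c z = a" if z: "z : Z" "a : carrier K" "z \<ominus>\<^bsub>V\<^esub> a \<odot>\<^bsub>V\<^esub> x : Z'" for z a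
 proof (rule ccontr)
  assume ne: "c z ~= a"
  let ?d = "a \<ominus>\<^bsub>K\<^esub> c z"
  have d: "?d : carrier K" "?d ~= zero K" using ne z c[OF z(1)] by auto
  have "(z \<ominus>\<^bsub>V\<^esub> c z \<odot>\<^bsub>V\<^esub> x) \<ominus>\<^bsub>V\<^esub> (z \<ominus>\<^bsub>V\<^esub> a \<odot>\<^bsub>V\<^esub> x) = ?d \<odot>\<^bsub>V\<^esub> x"
  proof -
  have "(z \<ominus>\<^bsub>V\<^esub> c z \<odot>\<^bsub>V\<^esub> x) \<ominus>\<^bsub>V\<^esub> (z \<ominus>\<^bsub>V\<^esub> a \<odot>\<^bsub>V\<^esub> x) = (z \<ominus>\<^bsub>V\<^esub> z) \<oplus>\<^bsub>V\<^esub> (a \<odot>\<^bsub>V\<^esub> x \<ominus>\<^bsub>V\<^esub> c z \<odot>\<^bsub>V\<^esub> x)"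
  using z c[OF z(1)] xV ZV[OF z(1)] by (simp add: a_minus_def M.minus_add M.a_ac)
  then show ?thesis using z c[OF z(1)] xV ZV[OF z(1)]
  by (simp add: diff_self smult_l_distr smult_l_minus a_minus_def M.r_neg)
  qed
  then have "?d \<odot>\<^bsub>V\<^esub> x : Z'" using linsub_diff[OF Z'(1) c(2)[OF z(1)] z(3)] by simp
  moreover have u: "?d : Units K" using d field_Units by auto
  ultimately have "inv\<^bsub>K\<^esub> ?d \<odot>\<^bsub>V\<^esub> (?d \<odot>\<^bsub>V\<^esub> x) : Z'" using R.Units_inv_closed[OF u] linsubD(4)[OF Z'(1)] by blast
  moreover have "inv\<^bsub>K\<^esub> ?d \<odot>\<^bsub>V\<^esub> (?d \<odot>\<^bsub>V\<^esub> x) = x"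
  using u d(1) xV by (simp add: smult_assoc1[symmetric] R.Units_inv_closed R.Units_l_inv)
  ultimately show False using x by simp
 qed
 define r where "r z = z \<ominus>\<^bsub>V\<^esub> c z \<odot>\<^bsub>V\<^esub> x" for z
 have r: "r z : Z'" if "z : Z" for z using c(2)[OF that] by (simp add: r_def)
 define \<rho> where "\<rho> z = (\<pi> (r z))(n := c z)" for z
 have fn: "f n = zero K" if "f : carrier ?F" for f using that by (simp add: free_space_simps)
 have upd: "f(n := a) : carrier ?F'" if "f : carrier ?F" "a : carrier K" for f a
  using that by (auto simp: free_space_simps intro!: finite_subset[of "{x. (x = n --> a ~= zero K) & (x ~= n --> f x ~= zero K)}" "insert n {x. f x ~= zero K}"])
 have add: "\<rho> (z \<oplus>\<^bsub>V\<^esub> w) = \<rho> z \<oplus>\<^bsub>?F'\<^esub> \<rho> w" if z: "z : Z" "w : Z" for z w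
 proof -
  have e: "(z \<oplus>\<^bsub>V\<^esub> w) \<ominus>\<^bsub>V\<^esub> (c z \<oplus>\<^bsub>K\<^esub> c w) \<odot>\<^bsub>V\<^esub> x = r z \<oplus>\<^bsub>V\<^esub> r w"
  using z c[OF z(1)] c[OF z(2)] xV ZV by (simp add: r_def a_minus_def M.minus_add M.a_ac smult_l_distr)
  have "c (z \<oplus>\<^bsub>V\<^esub> w) = c z \<oplus>\<^bsub>K\<^esub> c w"
  by (rule c_eq) (use z c e r Z Z' in "auto simp: linsubD")
  then show ?thesis using e r z linear_onD(2)[OF \<pi>(1), of "r z" "r w"]
  by (auto simp: \<rho>_def r_def[of "z \<oplus>\<^bsub>V\<^esub> w"] free_space_simps)
 qed
 have sm: "\<rho> (a \<odot>\<^bsub>V\<^esub> z) = a \<odot>\<^bsub>?F'\<^esub> \<rho> z" if z: "z : Z" "a : carrier K" for z a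
 proof -
  have e: "(a \<odot>\<^bsub>V\<^esub> z) \<ominus>\<^bsub>V\<^esub> (a \<otimes>\<^bsub>K\<^esub> c z) \<odot>\<^bsub>V\<^esub> x = a \<odot>\<^bsub>V\<^esub> r z"
  using z c[OF z(1)] xV ZV by (simp add: r_def a_minus_def smult_r_distr smult_r_minus smult_assoc1)
  have "c (a \<odot>\<^bsub>V\<^esub> z) = a \<otimes>\<^bsub>K\<^esub> c z"
  by (rule c_eq) (use z c e r Z Z' in "auto simp: linsubD")
  then show ?thesis using e r z linear_onD(3)[OF \<pi>(1), of a "r z"]
  by (auto simp: \<rho>_def r_def[of "a \<odot>\<^bsub>V\<^esub> z"] free_space_simps)
 qed
 have cl: "\<rho> z : carrier ?F'" if "z : Z" for z
  using upd[of "\<pi> (r z)" "c z"] linear_onD(1)[OF \<pi>(1)] r c that by (simp add: \<rho>_def)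
 have c0: "c z = zero K & r z = z" if "z : Z'" for z
 proof -
  have "z \<ominus>\<^bsub>V\<^esub> \<zero>\<^bsub>K\<^esub> \<odot>\<^bsub>V\<^esub> x = z" using that xV ZV Z' by (auto simp: a_minus_def)
  then show ?thesis using c_eq[of z "zero K"] that Z' by (auto simp: r_def)
 qed
 have surj: "f : \<rho> ` Z" if f: "f : carrier ?F'" for f
 proof -
  have "f(n := zero K) : carrier ?F"
  using f by (auto simp: free_space_simps less_Suc_eq intro: finite_subset[of _ "{x. f x ~= zero K}"])
  then obtain y where y: "y : Z'" "\<pi> y = f(n := zero K)" using \<pi>(2) by (metis (no_types, lifting) imageE)
  let ?z = "y \<oplus>\<^bsub>V\<^esub> f n \<odot>\<^bsub>V\<^esub> x"
  have fnK: "f n : carrier K" using f by (simp add: free_space_simps)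
  have z: "?z : Z" using y Z' x fnK by (intro linsubD[OF Z]) auto
  have e: "?z \<ominus>\<^bsub>V\<^esub> f n \<odot>\<^bsub>V\<^esub> x = y" using y Z' xV ZV fnK by (auto simp: a_minus_def M.a_assoc M.r_neg)
  have "c ?z = f n" by (rule c_eq[OF z fnK]) (use e y in simp)
  then have "\<rho> ?z = f" using e y by (simp add: \<rho>_def r_def)
  then show ?thesis using imageI[OF z, of \<rho>] by simp
 qed
 have ker: "\<rho> z = (%j. zero K) \<longleftrightarrow> z : B" if z: "z : Z" for z
 proof
  assume 0: "\<rho> z = (%j. zero K)"
  have cz: "c z = zero K" using fun_cong[OF 0, of n] by (simp add: \<rho>_def)
  then have rz: "r z = z" using z xV ZV by (auto simp: r_def a_minus_def)
  have "\<pi> z = (%j. zero K)"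
  proof
  fix j show "\<pi> z j = zero K"
  using fun_cong[OF 0, of j] fn[OF linear_onD(1)[OF \<pi>(1), of z]] r[OF z] rz by (cases "j = n") (auto simp: \<rho>_def)
  qed
  then show "z : B" using \<pi>(3)[of z] r[OF z] rz by simp
 next
  assume "z : B"
  then have "z : Z'" using Z' by auto
  then show "\<rho> z = (%j. zero K)" using c0[of z] \<pi>(3)[of z] \<open>z : B\<close> by (auto simp: \<rho>_def)
 qed
 have "linear_on K V ?F' Z \<rho>" using cl add sm by (simp add: linear_on_def)
 moreover have "\<rho> ` Z = carrier ?F'" using cl surj by blast
 ultimately show ?thesis using ker unfolding qdim_def by blast
qed

lemma qdim_trivial:
 assumes "linsub K V B"
 shows "qdim K V B B ({} :: 'z set)"
proof -
 have "carrier (free_space K {}) = {%j::'z. zero K}" by (auto simp: free_space_simps)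
 then have "linear_on K V (free_space K ({} :: 'z set)) B (%z j. zero K)" "(%z j. zero K) ` B = carrier (free_space K ({} :: 'z set))"
  using linsubD(2)[OF assms] by (auto simp: linear_on_def free_space_simps)
 then show ?thesis unfolding qdim_def by blast
qed

lemma qdim_reindex:
 assumes q: "qdim K V Z B J" and h: "bij_betw h J' J" and J: "finite J"
 shows "qdim K V Z B J'"
proof -
 from q obtain \<pi> where \<pi>: "linear_on K V (free_space K J) Z \<pi>" "\<pi> ` Z = carrier (free_space K J)" "!!z. z : Z ==> \<pi> z = (%j. zero K) \<longleftrightarrow> z : B"
  unfolding qdim_def by blast
 have J': "finite J'" using h J by (simp add: bij_betw_finite)
 have hJ: "!!j. j : J' ==> h j : J" using h by (auto simp: bij_betw_def)
 define \<rho> where "\<rho> z = (%j. if j : J' then \<pi> z (h j) else zero K)" for z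
 have lin: "linear_on K V (free_space K J') Z \<rho>"
  using linear_onD[OF \<pi>(1)]
  by (auto simp: linear_on_def \<rho>_def free_space_simps fun_eq_iff intro: finite_subset[OF _ J'])
 have "f : \<rho> ` Z" if f: "f : carrier (free_space K J')" for f
 proof -
  let ?g = "%j. if j : J then f (inv_into J' h j) else zero K"
  have "?g : carrier (free_space K J)" using f by (auto simp: free_space_simps intro: finite_subset[OF _ J])
  then obtain z where z: "z : Z" "\<pi> z = ?g" using \<pi>(2) by (metis (no_types, lifting) imageE)
  have "\<rho> z = f" using z f hJ h by (auto simp: \<rho>_def fun_eq_iff free_space_simps bij_betw_def inv_into_f_f)
  then show ?thesis using z by blast
 qed
 then have "\<rho> ` Z = carrier (free_space K J')" using lin by (auto simp: linear_on_def)
 moreover have "\<rho> z = (%j. zero K) \<longleftrightarrow> z : B" if z: "z : Z" for z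
 proof -
  have "\<rho> z = (%j. zero K) \<longleftrightarrow> \<pi> z = (%j. zero K)"
  proof
  assume 0: "\<rho> z = (%j. zero K)"
  have o: "\<pi> z j = zero K" if "j ~: J" for j using linear_onD(1)[OF \<pi>(1) z] that by (simp add: free_space_simps)
  show "\<pi> z = (%j. zero K)"
  proof
  fix j show "\<pi> z j = zero K"
  proof (cases "j : J")
  case True
  then obtain i where "i : J'" "j = h i" using h by (auto simp: bij_betw_def)
  then show ?thesis using fun_cong[OF 0, of i] by (simp add: \<rho>_def)
  qed (rule o)
  qed
  qed (auto simp: \<rho>_def)
  then show ?thesis using \<pi>(3)[OF z] by simp
 qed
 ultimately show ?thesis using lin unfolding qdim_def by blast
qed

lemma qdim_card:
 assumes "qdim K V Z B J" "finite J" "finite J'" "card J = card J'"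
 shows "qdim K V Z B J'"
 using assms finite_same_card_bij[of J' J] qdim_reindex by metis

end

context vectorspace begin
lemma diff_diff_diff: "x : carrier V ==> y : carrier V ==> z : carrier V ==>
  (x \<ominus>\<^bsub>V\<^esub> y) \<oplus>\<^bsub>V\<^esub> (y \<ominus>\<^bsub>V\<^esub> z) = x \<ominus>\<^bsub>V\<^esub> z"
 using diff_add_cancel(1)[of x y] by (simp add: a_minus_def M.a_assoc[symmetric])

lemma diff_add_add: "x : carrier V ==> y : carrier V ==> x' : carrier V ==> y' : carrier V ==>
  (x \<oplus>\<^bsub>V\<^esub> y) \<ominus>\<^bsub>V\<^esub> (x' \<oplus>\<^bsub>V\<^esub> y') = (x \<ominus>\<^bsub>V\<^esub> x') \<oplus>\<^bsub>V\<^esub> (y \<ominus>\<^bsub>V\<^esub> y')"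
 by (simp add: a_minus_def M.minus_add M.a_ac)

lemma smult_diff: "a : carrier K ==> x : carrier V ==> y : carrier V ==>
  a \<odot>\<^bsub>V\<^esub> (x \<ominus>\<^bsub>V\<^esub> y) = a \<odot>\<^bsub>V\<^esub> x \<ominus>\<^bsub>V\<^esub> a \<odot>\<^bsub>V\<^esub> y"
 by (simp add: a_minus_def smult_r_distr smult_r_minus)

lemma mem_coset:
 assumes B: "linsub K V B" and x: "x : carrier V"
 shows "y : B +>\<^bsub>V\<^esub> x \<longleftrightarrow> y : carrier V & y \<ominus>\<^bsub>V\<^esub> x : B"
proof
 assume "y : B +>\<^bsub>V\<^esub> x"
 then obtain h where "h : B" "y = h \<oplus>\<^bsub>V\<^esub> x" by (auto simp: a_r_coset_def')
 then show "y : carrier V & y \<ominus>\<^bsub>V\<^esub> x : B" using x by (simp add: diff_add_cancel linsubD[OF B])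
next
 assume "y : carrier V & y \<ominus>\<^bsub>V\<^esub> x : B"
 then show "y : B +>\<^bsub>V\<^esub> x" using x diff_add_cancel(1)[of y x] by (force simp: a_r_coset_def')
qed

lemma coset_eq:
 assumes B: "linsub K V B" and x: "x : carrier V" "y : carrier V"
 shows "B +>\<^bsub>V\<^esub> x = B +>\<^bsub>V\<^esub> y \<longleftrightarrow> x \<ominus>\<^bsub>V\<^esub> y : B"
proof
 assume "B +>\<^bsub>V\<^esub> x = B +>\<^bsub>V\<^esub> y"
 moreover have "x : B +>\<^bsub>V\<^esub> x" using x by (simp add: mem_coset[OF B] diff_self linsubD[OF B])
 ultimately show "x \<ominus>\<^bsub>V\<^esub> y : B" using x by (simp add: mem_coset[OF B])
next
 assume xy: "x \<ominus>\<^bsub>V\<^esub> y : B"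
 have "z \<ominus>\<^bsub>V\<^esub> x : B \<longleftrightarrow> z \<ominus>\<^bsub>V\<^esub> y : B" if "z : carrier V" for z
  using diff_diff_diff[of z x y] linsub_add_iff(1)[OF B xy, of "z \<ominus>\<^bsub>V\<^esub> x"] x that by simp
 then show "B +>\<^bsub>V\<^esub> x = B +>\<^bsub>V\<^esub> y" using x by (auto simp: mem_coset[OF B])
qed

lemma quot_space_simps:
 assumes B: "linsub K V B"
 shows "carrier (quot_space V B) = (%x. B +>\<^bsub>V\<^esub> x) ` carrier V"
  "\<zero>\<^bsub>quot_space V B\<^esub> = B +>\<^bsub>V\<^esub> \<zero>\<^bsub>V\<^esub>"
  "x : carrier V ==> y : carrier V ==> (B +>\<^bsub>V\<^esub> x) \<oplus>\<^bsub>quot_space V B\<^esub> (B +>\<^bsub>V\<^esub> y) = B +>\<^bsub>V\<^esub> (x \<oplus>\<^bsub>V\<^esub> y)"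
  "a : carrier K ==> x : carrier V ==> a \<odot>\<^bsub>quot_space V B\<^esub> (B +>\<^bsub>V\<^esub> x) = B +>\<^bsub>V\<^esub> (a \<odot>\<^bsub>V\<^esub> x)"
proof -
 show "carrier (quot_space V B) = (%x. B +>\<^bsub>V\<^esub> x) ` carrier V"
  by (auto simp: quot_space_def A_RCOSETS_def')
 have "B +>\<^bsub>V\<^esub> \<zero>\<^bsub>V\<^esub> = B" using linsubD(1)[OF B] by (force simp: a_r_coset_def')
 then show "\<zero>\<^bsub>quot_space V B\<^esub> = B +>\<^bsub>V\<^esub> \<zero>\<^bsub>V\<^esub>" by (simp add: quot_space_def)
next
 assume x: "x : carrier V" "y : carrier V"
 have "z : (B +>\<^bsub>V\<^esub> x) <+>\<^bsub>V\<^esub> (B +>\<^bsub>V\<^esub> y) \<longleftrightarrow> z : B +>\<^bsub>V\<^esub> (x \<oplus>\<^bsub>V\<^esub> y)" for z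
 proof
  assume "z : (B +>\<^bsub>V\<^esub> x) <+>\<^bsub>V\<^esub> (B +>\<^bsub>V\<^esub> y)"
  then obtain u v where "u : B +>\<^bsub>V\<^esub> x" "v : B +>\<^bsub>V\<^esub> y" "z = u \<oplus>\<^bsub>V\<^esub> v" by (auto simp: set_add_def')
  then show "z : B +>\<^bsub>V\<^esub> (x \<oplus>\<^bsub>V\<^esub> y)" using x by (simp add: mem_coset[OF B] diff_add_add linsubD(3)[OF B])
 next
  assume "z : B +>\<^bsub>V\<^esub> (x \<oplus>\<^bsub>V\<^esub> y)"
  then have z: "z : carrier V" "z \<ominus>\<^bsub>V\<^esub> (x \<oplus>\<^bsub>V\<^esub> y) : B" using x by (simp_all add: mem_coset[OF B])
  have "(z \<ominus>\<^bsub>V\<^esub> y) \<ominus>\<^bsub>V\<^esub> x = z \<ominus>\<^bsub>V\<^esub> (x \<oplus>\<^bsub>V\<^esub> y)" using x z by (simp add: a_minus_def M.minus_add M.a_ac)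
  then have "z \<ominus>\<^bsub>V\<^esub> y : B +>\<^bsub>V\<^esub> x" using x z by (simp add: mem_coset[OF B])
  moreover have "y : B +>\<^bsub>V\<^esub> y" using x by (simp add: mem_coset[OF B] diff_self linsubD(2)[OF B])
  moreover have "z = (z \<ominus>\<^bsub>V\<^esub> y) \<oplus>\<^bsub>V\<^esub> y" using x z by (simp add: diff_add_cancel)
  ultimately show "z : (B +>\<^bsub>V\<^esub> x) <+>\<^bsub>V\<^esub> (B +>\<^bsub>V\<^esub> y)" by (auto simp: set_add_def')
 qed
 then have "(B +>\<^bsub>V\<^esub> x) <+>\<^bsub>V\<^esub> (B +>\<^bsub>V\<^esub> y) = B +>\<^bsub>V\<^esub> (x \<oplus>\<^bsub>V\<^esub> y)" by blast
 then show "(B +>\<^bsub>V\<^esub> x) \<oplus>\<^bsub>quot_space V B\<^esub> (B +>\<^bsub>V\<^esub> y) = B +>\<^bsub>V\<^esub> (x \<oplus>\<^bsub>V\<^esub> y)" by (simp add: quot_space_def)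
next
 assume x: "a : carrier K" "x : carrier V"
 have c: "B +>\<^bsub>V\<^esub> (a \<odot>\<^bsub>V\<^esub> y) = B +>\<^bsub>V\<^esub> (a \<odot>\<^bsub>V\<^esub> x)" if "y : B +>\<^bsub>V\<^esub> x" for y
  using that x by (simp add: mem_coset[OF B] coset_eq[OF B] smult_diff[symmetric] linsubD(4)[OF B])
 have "x : B +>\<^bsub>V\<^esub> x" using x by (simp add: mem_coset[OF B] diff_self linsubD(2)[OF B])
 then have "(\<Union>y\<in>B +>\<^bsub>V\<^esub> x. B +>\<^bsub>V\<^esub> (a \<odot>\<^bsub>V\<^esub> x)) = B +>\<^bsub>V\<^esub> (a \<odot>\<^bsub>V\<^esub> x)" by blast
 moreover have "(\<Union>y\<in>B +>\<^bsub>V\<^esub> x. B +>\<^bsub>V\<^esub> (a \<odot>\<^bsub>V\<^esub> y)) = (\<Union>y\<in>B +>\<^bsub>V\<^esub> x. B +>\<^bsub>V\<^esub> (a \<odot>\<^bsub>V\<^esub> x))"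
  by (rule SUP_cong[OF refl c])
 ultimately show "a \<odot>\<^bsub>quot_space V B\<^esub> (B +>\<^bsub>V\<^esub> x) = B +>\<^bsub>V\<^esub> (a \<odot>\<^bsub>V\<^esub> x)" by (simp add: quot_space_def)
qed

lemma quot_space_vs:
 assumes B: "linsub K V B"
 shows "vectorspace K (quot_space V B)"
proof (rule vectorspaceI[OF field_axioms], rule module_criteria)
 note Q = quot_space_simps[OF B]
 show "ALL v:carrier (quot_space V B). EX w:carrier (quot_space V B). v \<oplus>\<^bsub>quot_space V B\<^esub> w = \<zero>\<^bsub>quot_space V B\<^esub>"
 proof
  fix v assume "v : carrier (quot_space V B)"
  then obtain x where x: "x : carrier V" "v = B +>\<^bsub>V\<^esub> x" by (auto simp: Q)
  then have "v \<oplus>\<^bsub>quot_space V B\<^esub> (B +>\<^bsub>V\<^esub> (\<ominus>\<^bsub>V\<^esub> x)) = \<zero>\<^bsub>quot_space V B\<^esub>" by (simp add: Q M.r_neg)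
  then show "EX w:carrier (quot_space V B). v \<oplus>\<^bsub>quot_space V B\<^esub> w = \<zero>\<^bsub>quot_space V B\<^esub>" using x by (auto simp: Q(1))
 qed
qed (use quot_space_simps[OF B] in "auto simp: R.is_cring M.a_ac smult_l_distr smult_r_distr smult_assoc1")

lemma linear_on_coset: "linsub K V B ==> linear_on K V (quot_space V B) (carrier V) (%x. B +>\<^bsub>V\<^esub> x)"
 by (auto simp: linear_on_def quot_space_simps)

lemma qdim_diff_iff:
 assumes Z: "linsub K V Z" and \<pi>: "linear_on K V (free_space K J) Z \<pi>" "!!z. z : Z ==> \<pi> z = (%j. zero K) \<longleftrightarrow> z : B"
  and x: "x : Z" "y : Z"
 shows "\<pi> x = \<pi> y \<longleftrightarrow> x \<ominus>\<^bsub>V\<^esub> y : B"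
proof -
 interpret F: vectorspace K "free_space K J" by (rule free_space_vs) (rule field_axioms)
 have "\<pi> (x \<ominus>\<^bsub>V\<^esub> y) = \<pi> x \<ominus>\<^bsub>free_space K J\<^esub> \<pi> y"
  by (rule linear_on_diff[OF F.vectorspace_axioms \<pi>(1) Z x])
 moreover have "\<pi> x : carrier (free_space K J)" "\<pi> y : carrier (free_space K J)" using linear_onD(1)[OF \<pi>(1)] x by auto
 ultimately have "\<pi> (x \<ominus>\<^bsub>V\<^esub> y) = \<zero>\<^bsub>free_space K J\<^esub> \<longleftrightarrow> \<pi> x = \<pi> y" by (simp add: F.diff_zero_iff)
 then show ?thesis using \<pi>(2)[OF linsub_diff[OF Z x]] by (simp add: free_space_simps(2))
qed

lemma diff_zero_right: "x : carrier V ==> x \<ominus>\<^bsub>V\<^esub> \<zero>\<^bsub>V\<^esub> = x"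
 using diff_add_cancel(2)[of x "zero V"] by simp

lemma has_basis_quot_iff:
 assumes B: "linsub K V B"
 shows "has_basis K (quot_space V B) J \<longleftrightarrow> qdim K V (carrier V) B J"
proof
 note Q = quot_space_simps[OF B]
 assume "has_basis K (quot_space V B) J"
 then obtain \<pi> where \<pi>: "linear_on K (quot_space V B) (free_space K J) (carrier (quot_space V B)) \<pi>"
  "\<pi> ` carrier (quot_space V B) = carrier (free_space K J)"
  "!!z. z : carrier (quot_space V B) ==> \<pi> z = (%j. zero K) \<longleftrightarrow> z : {\<zero>\<^bsub>quot_space V B\<^esub>}"
  unfolding qdim_def by blast
 let ?\<rho> = "%x. \<pi> (B +>\<^bsub>V\<^esub> x)"
 have "linear_on K V (free_space K J) (carrier V) ?\<rho>"
  using \<pi>(1) by (auto simp: linear_on_def Q)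
 moreover have "?\<rho> ` carrier V = carrier (free_space K J)" using \<pi>(2) by (simp add: Q(1) image_image)
 moreover have "?\<rho> x = (%j. zero K) \<longleftrightarrow> x : B" if "x : carrier V" for x
  using \<pi>(3)[of "B +>\<^bsub>V\<^esub> x"] that coset_eq[OF B that, of "zero V"] by (simp add: Q(1,2) diff_zero_right)
 ultimately show "qdim K V (carrier V) B J" unfolding qdim_def by blast
next
 note Q = quot_space_simps[OF B]
 assume "qdim K V (carrier V) B J"
 then obtain \<pi> where \<pi>: "linear_on K V (free_space K J) (carrier V) \<pi>" "\<pi> ` carrier V = carrier (free_space K J)"
  "!!z. z : carrier V ==> \<pi> z = (%j. zero K) \<longleftrightarrow> z : B" unfolding qdim_def by blast
 \<comment> \<open>The coordinates of a coset are those of a chosen element; congruent elements have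
   equal coordinates, so the choice is immaterial.\<close>
 define \<rho> where "\<rho> X = \<pi> (SOME x. x : X)" for X
 have \<rho>: "\<rho> (B +>\<^bsub>V\<^esub> x) = \<pi> x" if x: "x : carrier V" for x
 proof -
  have "x : B +>\<^bsub>V\<^esub> x" using x by (simp add: mem_coset[OF B] diff_self linsubD(2)[OF B])
  then have "(SOME y. y : B +>\<^bsub>V\<^esub> x) : B +>\<^bsub>V\<^esub> x" by (rule someI)
  then show ?thesis using x qdim_diff_iff[OF linsub_carrier \<pi>(1) \<pi>(3)] by (simp add: \<rho>_def mem_coset[OF B])
 qed
 have "linear_on K (quot_space V B) (free_space K J) (carrier (quot_space V B)) \<rho>"
  using \<pi>(1) by (auto simp: linear_on_def Q \<rho>)
 moreover have "\<rho> ` carrier (quot_space V B) = carrier (free_space K J)"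
  unfolding \<pi>(2)[symmetric] Q(1) image_image by (rule image_cong) (simp_all add: \<rho>)
 moreover have "\<rho> X = (%j. zero K) \<longleftrightarrow> X : {\<zero>\<^bsub>quot_space V B\<^esub>}" if X: "X : carrier (quot_space V B)" for X
 proof -
  obtain x where x: "x : carrier V" "X = B +>\<^bsub>V\<^esub> x" using X by (auto simp: Q)
  then show ?thesis using \<pi>(3)[OF x(1)] \<rho>[OF x(1)] coset_eq[OF B x(1), of "zero V"] by (simp add: Q(2) diff_zero_right)
 qed
 ultimately show "has_basis K (quot_space V B) J" unfolding qdim_def by blast
qed

lemma vs_isoI:
 assumes W: "vectorspace K W" and "has_basis K V J" "has_basis K W J"
 shows "vs_iso K V W"
proof -
 interpret W: vectorspace K W by fact
 obtain \<pi> where \<pi>: "linear_on K V (free_space K J) (carrier V) \<pi>" "\<pi> ` carrier V = carrier (free_space K J)"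
  "!!z. z : carrier V ==> \<pi> z = (%j. zero K) \<longleftrightarrow> z : {zero V}" using assms(2) unfolding qdim_def by blast
 obtain \<rho> where \<rho>: "linear_on K W (free_space K J) (carrier W) \<rho>" "\<rho> ` carrier W = carrier (free_space K J)"
  "!!z. z : carrier W ==> \<rho> z = (%j. zero K) \<longleftrightarrow> z : {zero W}" using assms(3) unfolding qdim_def by blast
 have embed\<pi>: "inj_on \<pi> (carrier V)"
  by (rule inj_onI) (simp add: qdim_diff_iff[OF linsub_carrier \<pi>(1) \<pi>(3)] diff_zero_iff)
 have embed\<rho>: "inj_on \<rho> (carrier W)"
  by (rule inj_onI) (simp add: W.qdim_diff_iff[OF W.linsub_carrier \<rho>(1) \<rho>(3)] W.diff_zero_iff)
 let ?g = "inv_into (carrier W) \<rho>"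
 define f where "f x = ?g (\<pi> x)" for x
 have f: "f x : carrier W" "\<rho> (f x) = \<pi> x" if "x : carrier V" for x
  using that \<pi>(2) \<rho>(2) linear_onD(1)[OF \<pi>(1) that] by (auto simp: f_def inv_into_into f_inv_into_f)
 have f_eqI: "f x = w" if "x : carrier V" "w : carrier W" "\<rho> w = \<pi> x" for x w
  using f[OF that(1)] that embed\<rho> by (metis inj_onD)
 have "f : module_hom K V W"
  unfolding module_hom_def using f linear_onD[OF \<pi>(1)] linear_onD[OF \<rho>(1)] by (auto intro!: f_eqI)
 then have "linear_map K V W f"
  by (simp add: linear_map_def vectorspace_axioms W.vectorspace_axioms mod_hom_def mod_hom_axioms_def module_axioms W.module_axioms)
 moreover have "bij_betw f (carrier V) (carrier W)"
  unfolding bij_betw_def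
 proof (intro conjI equalityI subsetI)
  show "inj_on f (carrier V)" by (rule inj_onI) (metis f(2) embed\<pi> inj_onD)
  fix w assume "w : carrier W"
  then obtain x where "x : carrier V" "\<pi> x = \<rho> w" using \<pi>(2) linear_onD(1)[OF \<rho>(1)] by (metis imageE)
  then show "w : f ` carrier V" using f_eqI[of x w] \<open>w : carrier W\<close> by (metis imageI)
 qed (use f in auto)
 ultimately show ?thesis unfolding vs_iso_def by blast
qed

text \<open>Finitely many functionals with common kernel inside B bound the dimension of Z/B.
  \<open>S k\<close> collects the elements that agree modulo B with one killed by all functionals of
  index at least k; then S 0 = B, S N = Z, and each step adds at most one dimension. A functional is
  encoded as a linear map into the free space on the one-element type \<open>unit\<close>.\<close>

lemma qdim_exists:
 assumes Z: "linsub K V Z" and B: "linsub K V B" "B <= Z"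
  and l: "!!i. i < (N::nat) ==> linear_on K V (free_space K UNIV) Z (%x j::unit. l i x)"
  and ker: "!!z. z : Z ==> (!!i. i < N ==> l i z = zero K) ==> z : B"
 shows "EX n. qdim K V Z B {..<n::nat}"
proof -
 have ZV: "!!z. z : Z ==> z : carrier V" using Z by (rule linsubD)
 have BZ: "!!z. z : B ==> z : Z" using B by auto
 have lK: "l i x : carrier K" if "i < N" "x : Z" for i x
  using linear_onD(1)[OF l[OF that(1)] that(2)] by (auto simp: free_space_simps)
 have ladd: "l i (x \<oplus>\<^bsub>V\<^esub> y) = l i x \<oplus>\<^bsub>K\<^esub> l i y" if "i < N" "x : Z" "y : Z" for i x y
  using linear_onD(2)[OF l[OF that(1)] that(2,3)] by (auto simp: free_space_simps fun_eq_iff)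
 have lsm: "l i (a \<odot>\<^bsub>V\<^esub> x) = a \<otimes>\<^bsub>K\<^esub> l i x" if "i < N" "x : Z" "a : carrier K" for i x a
  using linear_onD(3)[OF l[OF that(1)] that(3,2)] by (auto simp: free_space_simps fun_eq_iff)
 have l0: "l i \<zero>\<^bsub>V\<^esub> = zero K" if "i < N" for i
  using lsm[of i "zero V" "zero K"] that linsubD(2)[OF Z] lK[OF that] by simp
 have ldiff: "l i (x \<ominus>\<^bsub>V\<^esub> y) = l i x \<ominus>\<^bsub>K\<^esub> l i y" if "i < N" "x : Z" "y : Z" for i x y
 proof -
  have "l i (\<ominus>\<^bsub>V\<^esub> y) = \<ominus>\<^bsub>K\<^esub> l i y"
  using lsm[of i y "\<ominus>\<^bsub>K\<^esub> \<one>\<^bsub>K\<^esub>"] that neg_smult[of y] lK ZV by (simp add: R.l_minus)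
  then show ?thesis using ladd[of i x "\<ominus>\<^bsub>V\<^esub> y"] that linsub_neg[OF Z] by (simp add: a_minus_def)
 qed
 define S where "S k = {z : Z. EX b:B. ALL i. k <= i & i < N --> l i (z \<ominus>\<^bsub>V\<^esub> b) = zero K}" for k
 have Sub: "linsub K V (S k)" for k
  unfolding linsub_def
 proof (intro conjI ballI)
  show "S k <= carrier V" using ZV by (auto simp: S_def)
  show "zero V : S k" using linsubD(2)[OF Z] linsubD(2)[OF B(1)] by (auto simp: S_def diff_self l0 intro!: bexI[of _ "zero V"])
 next
  fix x y assume "x : S k" "y : S k"
  then obtain b b' where b: "x : Z" "y : Z" "b : B" "b' : B"
  "ALL i. k <= i & i < N --> l i (x \<ominus>\<^bsub>V\<^esub> b) = zero K" "ALL i. k <= i & i < N --> l i (y \<ominus>\<^bsub>V\<^esub> b') = zero K"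
  by (auto simp: S_def)
  have "(x \<oplus>\<^bsub>V\<^esub> y) \<ominus>\<^bsub>V\<^esub> (b \<oplus>\<^bsub>V\<^esub> b') = (x \<ominus>\<^bsub>V\<^esub> b) \<oplus>\<^bsub>V\<^esub> (y \<ominus>\<^bsub>V\<^esub> b')" using b ZV BZ by (simp add: diff_add_add)
  then have "ALL i. k <= i & i < N --> l i ((x \<oplus>\<^bsub>V\<^esub> y) \<ominus>\<^bsub>V\<^esub> (b \<oplus>\<^bsub>V\<^esub> b')) = zero K"
  using b BZ by (auto simp: ladd linsub_diff[OF Z])
  then show "x \<oplus>\<^bsub>V\<^esub> y : S k" using b linsubD(3)[OF Z] linsubD(3)[OF B(1)] by (auto simp: S_def)
 next
  fix x a assume a: "a : carrier K" and "x : S k"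
  then obtain b where b: "x : Z" "b : B" "ALL i. k <= i & i < N --> l i (x \<ominus>\<^bsub>V\<^esub> b) = zero K" by (auto simp: S_def)
  have "(a \<odot>\<^bsub>V\<^esub> x) \<ominus>\<^bsub>V\<^esub> (a \<odot>\<^bsub>V\<^esub> b) = a \<odot>\<^bsub>V\<^esub> (x \<ominus>\<^bsub>V\<^esub> b)" using a b ZV BZ by (simp add: smult_diff)
  then have "ALL i. k <= i & i < N --> l i ((a \<odot>\<^bsub>V\<^esub> x) \<ominus>\<^bsub>V\<^esub> (a \<odot>\<^bsub>V\<^esub> b)) = zero K"
  using a b BZ by (auto simp: lsm linsub_diff[OF Z])
  then show "a \<odot>\<^bsub>V\<^esub> x : S k" using a b linsubD(4)[OF Z] linsubD(4)[OF B(1)] by (auto simp: S_def)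
 qed
 have BS: "B <= S k" for k
  using ZV BZ by (auto simp: S_def diff_self l0 intro!: bexI)
 have S0: "S 0 = B"
 proof (intro equalityI subsetI)
  fix z assume "z : S 0"
  then obtain b where b: "z : Z" "b : B" "ALL i. i < N --> l i (z \<ominus>\<^bsub>V\<^esub> b) = zero K" by (auto simp: S_def)
  then have "z \<ominus>\<^bsub>V\<^esub> b : B" using ker BZ by (simp add: linsub_diff[OF Z])
  then show "z : B" using linsub_add_iff(3)[OF B(1) b(2)] ZV b by simp
 qed (use BS in auto)
 have "EX n. qdim K V (S k) B {..<n::nat}" if "k <= N" for k
  using that
 proof (induction k)
  case 0
  show ?case using qdim_trivial[OF B(1), where 'z = nat] S0 by (intro exI[of _ 0]) simp
 next
  case (Suc k)
  then obtain n where n: "qdim K V (S k) B {..<n::nat}" by auto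
  have mono: "S k <= S (Suc k)" using Suc_leD unfolding S_def by blast
  show ?case
  proof (cases "S (Suc k) <= S k")
  case True
  then show ?thesis using n mono by auto
  next
  case False
  then obtain x where x: "x : S (Suc k)" "x ~: S k" by auto
  then obtain b where b: "x : Z" "b : B" "ALL i. Suc k <= i & i < N --> l i (x \<ominus>\<^bsub>V\<^esub> b) = zero K" by (auto simp: S_def)
  let ?c = "l k (x \<ominus>\<^bsub>V\<^esub> b)"
  have k: "k < N" using Suc.prems by simp
  have xb: "x \<ominus>\<^bsub>V\<^esub> b : Z" using b BZ by (simp add: linsub_diff[OF Z])
  have c: "?c : carrier K" using lK k xb by simp
  have "?c ~= zero K"
  proof
  assume c0: "?c = zero K"
  have "l i (x \<ominus>\<^bsub>V\<^esub> b) = zero K" if "k <= i" "i < N" for i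
  by (cases "i = k") (use c0 b(3) that in auto)
  then have "x : S k" unfolding S_def using b(1,2) by blast
  then show False using x(2) by blast
  qed
  then have u: "?c : Units K" using c field_Units by auto
  have "qdim K V (S (Suc k)) B {..<Suc n}"
  proof (rule qdim_step[OF Sub Sub mono BS n x])
  fix z assume "z : S (Suc k)"
  then obtain b' where b': "z : Z" "b' : B" "ALL i. Suc k <= i & i < N --> l i (z \<ominus>\<^bsub>V\<^esub> b') = zero K" by (auto simp: S_def)
  \<comment> \<open>The quotient of the values of functional k, chosen so that this functional
    vanishes on the difference; the functionals of larger index vanish on both vectors
    anyway.\<close>
  let ?a = "l k (z \<ominus>\<^bsub>V\<^esub> b') \<otimes>\<^bsub>K\<^esub> inv\<^bsub>K\<^esub> ?c"
  have zb: "z \<ominus>\<^bsub>V\<^esub> b' : Z" using b' BZ by (simp add: linsub_diff[OF Z])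
  have a: "?a : carrier K" using lK[OF k zb] R.Units_inv_closed[OF u] by simp
  have aZ: "?a \<odot>\<^bsub>V\<^esub> x : Z" "?a \<odot>\<^bsub>V\<^esub> b : B" "?a \<odot>\<^bsub>V\<^esub> (x \<ominus>\<^bsub>V\<^esub> b) : Z"
  using a b xb by (auto intro: linsubD(4)[OF Z] linsubD(4)[OF B(1)])
  have e: "(z \<ominus>\<^bsub>V\<^esub> ?a \<odot>\<^bsub>V\<^esub> x) \<ominus>\<^bsub>V\<^esub> (b' \<ominus>\<^bsub>V\<^esub> ?a \<odot>\<^bsub>V\<^esub> b) = (z \<ominus>\<^bsub>V\<^esub> b') \<ominus>\<^bsub>V\<^esub> ?a \<odot>\<^bsub>V\<^esub> (x \<ominus>\<^bsub>V\<^esub> b)"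
  using a b b' ZV BZ by (simp add: smult_diff) (simp add: a_minus_def M.minus_add M.a_ac)
  have "l i ((z \<ominus>\<^bsub>V\<^esub> b') \<ominus>\<^bsub>V\<^esub> ?a \<odot>\<^bsub>V\<^esub> (x \<ominus>\<^bsub>V\<^esub> b)) = zero K" if i: "k <= i" "i < N" for i
  proof -
  have "l i ((z \<ominus>\<^bsub>V\<^esub> b') \<ominus>\<^bsub>V\<^esub> ?a \<odot>\<^bsub>V\<^esub> (x \<ominus>\<^bsub>V\<^esub> b)) = l i (z \<ominus>\<^bsub>V\<^esub> b') \<ominus>\<^bsub>K\<^esub> ?a \<otimes>\<^bsub>K\<^esub> l i (x \<ominus>\<^bsub>V\<^esub> b)"
  using i zb aZ xb a by (simp add: ldiff lsm)
  also have "... = zero K"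
  proof (cases "i = k")
  case True
  have "?a \<otimes>\<^bsub>K\<^esub> ?c = l k (z \<ominus>\<^bsub>V\<^esub> b')"
  using lK[OF k zb] c u R.Units_inv_closed[OF u] by (simp add: R.m_assoc R.Units_l_inv)
  then show ?thesis unfolding True a_minus_def[of K] using R.r_neg[OF lK[OF k zb]] by (simp only:)
  next
  case False
  then have "l i (x \<ominus>\<^bsub>V\<^esub> b) = zero K" "l i (z \<ominus>\<^bsub>V\<^esub> b') = zero K"
  using b(3) b'(3) i by auto
  then show ?thesis unfolding a_minus_def[of K] using a by simp
  qed
  finally show ?thesis .
  qed
  moreover have "b' \<ominus>\<^bsub>V\<^esub> ?a \<odot>\<^bsub>V\<^esub> b : B" using b' aZ by (intro linsub_diff[OF B(1)])
  moreover have "z \<ominus>\<^bsub>V\<^esub> ?a \<odot>\<^bsub>V\<^esub> x : Z" using b' aZ by (intro linsub_diff[OF Z])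
  ultimately have "z \<ominus>\<^bsub>V\<^esub> ?a \<odot>\<^bsub>V\<^esub> x : S k"
  unfolding S_def using e by (intro CollectI conjI bexI[of _ "b' \<ominus>\<^bsub>V\<^esub> ?a \<odot>\<^bsub>V\<^esub> b"]) auto
  then show "EX a:carrier K. z \<ominus>\<^bsub>V\<^esub> a \<odot>\<^bsub>V\<^esub> x : S k" using a by blast
  qed
  then show ?thesis by blast
  qed
 qed
 moreover have "S N = Z"
  using linsubD(2)[OF B(1)] by (auto simp: S_def)
 ultimately show ?thesis by (metis order_refl)
qed

lemma linsub_submodule: "linsub K V Z \<longleftrightarrow> submodule K Z V"
 unfolding linsub_def submodule_def using module_axioms by blast

lemma linsub_span: "S <= carrier V ==> linsub K V (span S)"
 by (simp add: linsub_submodule span_is_submodule)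

lemma span_least: "S <= Z ==> linsub K V Z ==> span S <= Z"
 by (simp add: linsub_submodule span_is_subset)

lemma fin_dim_has_basis:
 assumes fin_dim
 shows "EX n. has_basis K V {..<n::nat}"
proof -
 obtain A where A: "finite A" "A <= carrier V" "span A = carrier V" using assms unfolding fin_dim_def by blast
 from A(1,2) have "EX n. qdim K V (span A) {zero V} {..<n::nat}"
 proof (induction A)
  case empty
  show ?case using qdim_trivial[OF linsub_zero, where 'z = nat] by (intro exI[of _ 0]) (simp add: span_empty)
 next
  case (insert a A)
  then obtain n where n: "qdim K V (span A) {zero V} {..<n::nat}" by auto
  have aV: "a : carrier V" and AV: "A <= carrier V" using insert.prems by auto
  let ?S = "span A" and ?S' = "span (insert a A)"
  have S: "linsub K V ?S" "linsub K V ?S'" using insert.prems by (auto intro: linsub_span)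
  have mono: "?S <= ?S'" by (rule span_is_monotone) auto
  have a': "a : ?S'" using in_own_span[of "insert a A"] insert.prems by auto
  \<comment> \<open>The sum of the span of A and the line through a. It is a subspace containing the
    enlarged generating set, hence contains its span.\<close>
  let ?T = "{z : carrier V. EX c:carrier K. z \<ominus>\<^bsub>V\<^esub> c \<odot>\<^bsub>V\<^esub> a : ?S}"
  have "linsub K V ?T"
  unfolding linsub_def
  proof (intro conjI ballI)
  show "zero V : ?T" using linsubD(2)[OF S(1)] aV by (auto simp: diff_self intro!: bexI[of _ "zero K"])
  next
  fix x y assume "x : ?T" "y : ?T"
  then obtain c d where c: "x : carrier V" "y : carrier V" "c : carrier K" "d : carrier K"
  "x \<ominus>\<^bsub>V\<^esub> c \<odot>\<^bsub>V\<^esub> a : ?S" "y \<ominus>\<^bsub>V\<^esub> d \<odot>\<^bsub>V\<^esub> a : ?S" by auto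
  have "(x \<oplus>\<^bsub>V\<^esub> y) \<ominus>\<^bsub>V\<^esub> (c \<oplus>\<^bsub>K\<^esub> d) \<odot>\<^bsub>V\<^esub> a = (x \<ominus>\<^bsub>V\<^esub> c \<odot>\<^bsub>V\<^esub> a) \<oplus>\<^bsub>V\<^esub> (y \<ominus>\<^bsub>V\<^esub> d \<odot>\<^bsub>V\<^esub> a)"
  using c aV by (simp add: smult_l_distr diff_add_add)
  then show "x \<oplus>\<^bsub>V\<^esub> y : ?T" using c linsubD(3)[OF S(1)] by (auto intro!: bexI[of _ "c \<oplus>\<^bsub>K\<^esub> d"])
  next
  fix x b assume b: "b : carrier K" and "x : ?T"
  then obtain c where c: "x : carrier V" "c : carrier K" "x \<ominus>\<^bsub>V\<^esub> c \<odot>\<^bsub>V\<^esub> a : ?S" by auto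
  have "(b \<odot>\<^bsub>V\<^esub> x) \<ominus>\<^bsub>V\<^esub> (b \<otimes>\<^bsub>K\<^esub> c) \<odot>\<^bsub>V\<^esub> a = b \<odot>\<^bsub>V\<^esub> (x \<ominus>\<^bsub>V\<^esub> c \<odot>\<^bsub>V\<^esub> a)"
  using b c aV by (simp add: smult_assoc1 smult_diff)
  then show "b \<odot>\<^bsub>V\<^esub> x : ?T" using b c linsubD(4)[OF S(1)] by (auto intro!: bexI[of _ "b \<otimes>\<^bsub>K\<^esub> c"])
  qed auto
  moreover have "insert a A <= ?T"
  proof
  fix x assume x: "x : insert a A"
  show "x : ?T"
  proof (cases "x = a")
  case True
  then show ?thesis using aV linsubD(2)[OF S(1)] by (auto simp: diff_self intro!: bexI[of _ "\<one>\<^bsub>K\<^esub>"])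
  next
  case False
  then have "x : ?S" using x in_own_span[OF AV] by auto
  then show ?thesis using x aV AV False by (auto simp: diff_zero_right intro!: bexI[of _ "zero K"])
  qed
  qed
  ultimately have T: "?S' <= ?T" by (intro span_least)
  show ?case
  proof (cases "a : ?S")
  case True
  then have "insert a A <= ?S" using in_own_span[OF AV] by auto
  then have "?S' = ?S" using span_least[OF _ S(1)] mono by blast
  then show ?thesis using n by auto
  next
  case False
  have "qdim K V ?S' {zero V} {..<Suc n}"
  by (rule qdim_step[OF S(2) S(1) mono _ n a' False]) (use T linsubD(2)[OF S(1)] in auto)
  then show ?thesis by blast
  qed
 qed
 then show ?thesis by (simp add: A(3))
qed

end

text \<open>Additivity of the dimension on a short exact sequence
 \<open>0 \<rightarrow> Z\<^sub>2/B\<^sub>2 \<rightarrow> Z/B \<rightarrow> Z\<^sub>1/B\<^sub>1 \<rightarrow> 0\<close>.\<close>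

lemma qdim_exact:
 assumes V: "vectorspace K V" and V1: "vectorspace K V1" and V2: "vectorspace K V2"
  and Z: "linsub K V Z" "linsub K V B" "B <= Z"
  and Z1: "linsub K V1 Z1" "linsub K V1 B1" "B1 <= Z1"
  and Z2: "linsub K V2 Z2"
  and r: "linear_on K V V1 Z r" "r ` Z <= Z1" "r ` B <= B1"
  and j: "linear_on K V2 V Z2 j" "j ` Z2 <= Z"
  and surj: "!!f. f : Z1 ==> EX F:Z. r F \<ominus>\<^bsub>V1\<^esub> f : B1"
  and exact: "!!z. z : Z ==> r z : B1 ==> EX g:Z2. z \<ominus>\<^bsub>V\<^esub> j g : B" "!!g. g : Z2 ==> r (j g) : B1"
  and embed: "!!g. g : Z2 ==> j g : B \<longleftrightarrow> g : B2"
  and q1: "qdim K V1 Z1 B1 {..<a::nat}" and q2: "qdim K V2 Z2 B2 {..<b::nat}"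
 shows "qdim K V Z B {..<b + a}"
proof -
 interpret V: vectorspace K V by (rule V)
 interpret V1: vectorspace K V1 by (rule V1)
 interpret V2: vectorspace K V2 by (rule V2)
 note fl = V.field_axioms
 obtain \<pi>1 where p1: "linear_on K V1 (free_space K {..<a}) Z1 \<pi>1" "\<pi>1 ` Z1 = carrier (free_space K {..<a})"
  "!!z. z : Z1 ==> \<pi>1 z = (%j. zero K) \<longleftrightarrow> z : B1" using q1 unfolding qdim_def by blast
 obtain \<pi>2 where p2: "linear_on K V2 (free_space K {..<b}) Z2 \<pi>2" "\<pi>2 ` Z2 = carrier (free_space K {..<b})"
  "!!z. z : Z2 ==> \<pi>2 z = (%j. zero K) \<longleftrightarrow> z : B2" using q2 unfolding qdim_def by blast
 have rZ: "r z : Z1" if "z : Z" for z using r that by auto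
 have jZ: "j g : Z" if "g : Z2" for g using j that by auto
 have ZV: "z : carrier V" if "z : Z" for z using linsubD(1)[OF Z(1) that] .
 \<comment> \<open>The preimages of the subspaces spanned by the first k basis vectors of Z1/B1.
   \<open>S 0\<close> modulo B is identified with Z2/B2 by j, and each further step is made by
   lifting one basis vector.\<close>
 define S where "S k = {z : Z. \<pi>1 (r z) : carrier (free_space K {..<k})}" for k :: nat
 have lr: "linear_on K V (free_space K {..<a}) Z (%z. \<pi>1 (r z))"
  unfolding linear_on_def
 proof (intro conjI ballI)
  fix x y assume x: "x : Z" "y : Z"
  show "\<pi>1 (r x) : carrier (free_space K {..<a})" using linear_onD(1)[OF p1(1)] rZ x by simp
  show "\<pi>1 (r (x \<oplus>\<^bsub>V\<^esub> y)) = \<pi>1 (r x) \<oplus>\<^bsub>free_space K {..<a}\<^esub> \<pi>1 (r y)"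
  unfolding linear_onD(2)[OF r(1) x] by (rule linear_onD(2)[OF p1(1) rZ[OF x(1)] rZ[OF x(2)]])
 next
  fix c x assume c: "c : carrier K" "x : Z"
  show "\<pi>1 (r (c \<odot>\<^bsub>V\<^esub> x)) = c \<odot>\<^bsub>free_space K {..<a}\<^esub> \<pi>1 (r x)"
  unfolding linear_onD(3)[OF r(1) c] by (rule linear_onD(3)[OF p1(1) c(1) rZ[OF c(2)]])
 qed
 have S: "linsub K V (S k)" for k
  unfolding linsub_def
 proof (intro conjI ballI)
  interpret Fa: vectorspace K "free_space K {..<a}" by (rule free_space_vs[OF fl])
  interpret Fk: vectorspace K "free_space K {..<k}" by (rule free_space_vs[OF fl])
  show "S k <= carrier V" using ZV by (auto simp: S_def)
  show "zero V : S k"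
  using linsubD(2)[OF Z(1)] V.linear_on_zero[OF Fa.vectorspace_axioms lr Z(1)] by (simp add: S_def free_space_simps)
  show "x \<oplus>\<^bsub>V\<^esub> y : S k" if "x : S k" "y : S k" for x y
  proof -
  have x: "x : Z" "y : Z" "\<pi>1 (r x) : carrier (free_space K {..<k})" "\<pi>1 (r y) : carrier (free_space K {..<k})"
  using that by (auto simp: S_def)
  have "\<pi>1 (r (x \<oplus>\<^bsub>V\<^esub> y)) = \<pi>1 (r x) \<oplus>\<^bsub>free_space K {..<k}\<^esub> \<pi>1 (r y)"
  using linear_onD(2)[OF lr x(1,2)] by (simp only: free_space_simps(3))
  then show ?thesis using x Fk.M.a_closed[OF x(3,4)] linsubD(3)[OF Z(1) x(1,2)] by (simp only: S_def mem_Collect_eq)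
  qed
  show "c \<odot>\<^bsub>V\<^esub> x : S k" if "c : carrier K" "x : S k" for c x
  proof -
  have x: "x : Z" "\<pi>1 (r x) : carrier (free_space K {..<k})"
  using that by (auto simp: S_def)
  have "\<pi>1 (r (c \<odot>\<^bsub>V\<^esub> x)) = c \<odot>\<^bsub>free_space K {..<k}\<^esub> \<pi>1 (r x)"
  using linear_onD(3)[OF lr that(1) x(1)] by (simp only: free_space_simps(4))
  then show ?thesis using x Fk.smult_closed[OF that(1) x(2)] linsubD(4)[OF Z(1) that(1) x(1)] by (simp only: S_def mem_Collect_eq)
  qed
 qed
 have f0: "f : carrier (free_space K {..<0::nat}) \<longleftrightarrow> f = (%j. zero K)" for f
  by (auto simp: free_space_simps)
 have S0: "z : S 0 \<longleftrightarrow> z : Z & r z : B1" for z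
  unfolding S_def f0 using p1(3) rZ by blast
 have BS: "B <= S k" for k
 proof
  fix z assume "z : B"
  then have z: "z : Z" "r z : B1" using Z(3) r(3) by auto
  then have "\<pi>1 (r z) = (%j. zero K)" using p1(3)[OF rZ] by simp
  then show "z : S k" using z by (simp add: S_def free_space_simps)
 qed
 have base: "qdim K V (S 0) B {..<b}"
 proof -
  \<comment> \<open>A preimage under j modulo B. By \<open>embed\<close> it is unique modulo B2, so
    its coordinates do not depend on the choice.\<close>
  define g where "g z = (SOME g. g : Z2 & z \<ominus>\<^bsub>V\<^esub> j g : B)" for z
  have g: "g z : Z2" "z \<ominus>\<^bsub>V\<^esub> j (g z) : B" if "z : S 0" for z
  using someI_ex[of "%g. g : Z2 & z \<ominus>\<^bsub>V\<^esub> j g : B"] exact(1)[of z] that unfolding S0 g_def by blast+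
  have geq: "\<pi>2 (g z) = \<pi>2 h" if z: "z : S 0" "h : Z2" "z \<ominus>\<^bsub>V\<^esub> j h : B" for z h
  proof -
  have zV: "z : carrier V" "j h : carrier V" "j (g z) : carrier V"
  using z g(1)[OF z(1)] by (auto simp: S0 intro: ZV jZ)
  have "(z \<ominus>\<^bsub>V\<^esub> j h) \<ominus>\<^bsub>V\<^esub> (z \<ominus>\<^bsub>V\<^esub> j (g z)) : B" using z(3) g(2)[OF z(1)] by (rule V.linsub_diff[OF Z(2)])
  moreover have "(z \<ominus>\<^bsub>V\<^esub> j h) \<ominus>\<^bsub>V\<^esub> (z \<ominus>\<^bsub>V\<^esub> j (g z)) = (z \<ominus>\<^bsub>V\<^esub> z) \<oplus>\<^bsub>V\<^esub> (j (g z) \<ominus>\<^bsub>V\<^esub> j h)"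
  using zV by (simp add: a_minus_def V.M.minus_add V.M.a_ac)
  moreover have "j (g z \<ominus>\<^bsub>V2\<^esub> h) = j (g z) \<ominus>\<^bsub>V\<^esub> j h"
  by (rule V2.linear_on_diff[OF V j(1) Z2 g(1)[OF z(1)] z(2)])
  ultimately have "j (g z \<ominus>\<^bsub>V2\<^esub> h) : B" using zV by (simp add: V.diff_self)
  then have "g z \<ominus>\<^bsub>V2\<^esub> h : B2" using embed V2.linsub_diff[OF Z2 g(1)[OF z(1)] z(2)] by simp
  then show ?thesis using V2.qdim_diff_iff[OF Z2 p2(1) p2(3) g(1)[OF z(1)] z(2)] by simp
  qed
  have jadd: "(x \<oplus>\<^bsub>V\<^esub> y) \<ominus>\<^bsub>V\<^esub> j (g x \<oplus>\<^bsub>V2\<^esub> g y) : B" if x: "x : S 0" "y : S 0" for x y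
  proof -
  have c: "x : carrier V" "y : carrier V" "j (g x) : carrier V" "j (g y) : carrier V"
  using x g(1) by (auto simp: S0 intro: ZV jZ)
  show ?thesis unfolding linear_onD(2)[OF j(1) g(1)[OF x(1)] g(1)[OF x(2)]] V.diff_add_add[OF c]
  by (rule linsubD(3)[OF Z(2) g(2)[OF x(1)] g(2)[OF x(2)]])
  qed
  have jsm: "(c \<odot>\<^bsub>V\<^esub> x) \<ominus>\<^bsub>V\<^esub> j (c \<odot>\<^bsub>V2\<^esub> g x) : B" if x: "c : carrier K" "x : S 0" for c x
  proof -
  have c: "x : carrier V" "j (g x) : carrier V" using x g(1) by (auto simp: S0 intro: ZV jZ)
  show ?thesis unfolding linear_onD(3)[OF j(1) x(1) g(1)[OF x(2)]] V.smult_diff[OF x(1) c, symmetric]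
  by (rule linsubD(4)[OF Z(2) x(1) g(2)[OF x(2)]])
  qed
  let ?F = "free_space K {..<b}"
  have "linear_on K V ?F (S 0) (%z. \<pi>2 (g z))"
  unfolding linear_on_def
  proof (intro conjI ballI)
  fix x y assume x: "x : S 0" "y : S 0"
  show "\<pi>2 (g x) : carrier ?F" by (rule linear_onD(1)[OF p2(1) g(1)[OF x(1)]])
  have "\<pi>2 (g (x \<oplus>\<^bsub>V\<^esub> y)) = \<pi>2 (g x \<oplus>\<^bsub>V2\<^esub> g y)"
  by (rule geq[OF linsubD(3)[OF S x] linsubD(3)[OF Z2 g(1)[OF x(1)] g(1)[OF x(2)]] jadd[OF x]])
  then show "\<pi>2 (g (x \<oplus>\<^bsub>V\<^esub> y)) = \<pi>2 (g x) \<oplus>\<^bsub>?F\<^esub> \<pi>2 (g y)"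
  using linear_onD(2)[OF p2(1) g(1)[OF x(1)] g(1)[OF x(2)]] by simp
  next
  fix c x assume x: "c : carrier K" "x : S 0"
  have "\<pi>2 (g (c \<odot>\<^bsub>V\<^esub> x)) = \<pi>2 (c \<odot>\<^bsub>V2\<^esub> g x)"
  by (rule geq[OF linsubD(4)[OF S x] linsubD(4)[OF Z2 x(1) g(1)[OF x(2)]] jsm[OF x]])
  then show "\<pi>2 (g (c \<odot>\<^bsub>V\<^esub> x)) = c \<odot>\<^bsub>?F\<^esub> \<pi>2 (g x)"
  using linear_onD(3)[OF p2(1) x(1) g(1)[OF x(2)]] by simp
  qed
  moreover have "(%z. \<pi>2 (g z)) ` S 0 = carrier ?F"
  proof (intro equalityI subsetI)
  fix f assume "f : carrier ?F"
  then obtain h where h: "h : Z2" "f = \<pi>2 h" using p2(2) by blast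
  have jh: "j h : S 0" unfolding S0 using jZ[OF h(1)] exact(2)[OF h(1)] by simp
  have "\<pi>2 (g (j h)) = f" unfolding h(2)
  by (rule geq[OF jh h(1)]) (simp add: V.diff_self ZV[OF jZ[OF h(1)]] linsubD(2)[OF Z(2)])
  then show "f : (%z. \<pi>2 (g z)) ` S 0" using jh by (metis (no_types) imageI)
  qed (use linear_onD(1)[OF p2(1) g(1)] in auto)
  moreover have "\<pi>2 (g z) = (%j. zero K) \<longleftrightarrow> z : B" if z: "z : S 0" for z
  proof -
  have "\<pi>2 (g z) = (%j. zero K) \<longleftrightarrow> j (g z) : B" using p2(3)[OF g(1)[OF z]] embed[OF g(1)[OF z]] by simp
  also have "... \<longleftrightarrow> z : B"
  using V.linsub_add_iff(1)[OF Z(2) g(2)[OF z], of "j (g z)"] V.linsub_add_iff(2)[OF Z(2) g(2)[OF z], of "j (g z)"]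
  V.diff_add_cancel(1)[of z "j (g z)"] ZV[OF jZ[OF g(1)[OF z]]] ZV z
  by (simp add: S0)
  finally show ?thesis .
  qed
  ultimately show ?thesis unfolding qdim_def by blast
 qed
 have "qdim K V (S k) B {..<b + k}" if "k <= a" for k
  using that
 proof (induction k)
  case 0
  then show ?case using base by simp
 next
  case (Suc k)
  then have IH: "qdim K V (S k) B {..<b + k}" and k: "k < a" by simp_all
  have mono: "S k <= S (Suc k)" using free_space_mono[of "{..<k}" "{..<Suc k}"] unfolding S_def by auto
  have "free_gen K k : carrier (free_space K {..<a})"
  using k by (auto simp: free_space_simps free_gen_def)
  then obtain f where f: "f : Z1" "\<pi>1 f = free_gen K k" using p1(2) by (metis (no_types) imageE)
  obtain x where x: "x : Z" "r x \<ominus>\<^bsub>V1\<^esub> f : B1" using surj[OF f(1)] by blast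
  have px: "\<pi>1 (r x) = free_gen K k"
  using V1.qdim_diff_iff[OF Z1(1) p1(1) p1(3) rZ[OF x(1)] f(1)] x(2) f(2) by simp
  have "qdim K V (S (Suc k)) B {..<Suc (b + k)}"
  proof (rule V.qdim_step[OF S S mono BS IH])
  show "x : S (Suc k)" using x px by (auto simp: S_def free_space_simps free_gen_def)
  show "x ~: S k"
  proof
  assume "x : S k"
  then have "\<pi>1 (r x) k = zero K" by (auto simp: S_def free_space_simps)
  then show False using px by (simp add: free_gen_def)
  qed
  fix z assume z: "z : S (Suc k)"
  then have zZ: "z : Z" by (simp add: S_def)
  let ?c = "\<pi>1 (r z) k"
  have zc: "\<pi>1 (r z) : carrier (free_space K {..<Suc k})" using z by (simp add: S_def)
  have c: "?c : carrier K" using zc by (simp add: free_space_simps)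
  have cx: "?c \<odot>\<^bsub>V\<^esub> x : Z" by (rule linsubD(4)[OF Z(1) c x(1)])
  interpret Fa: vectorspace K "free_space K {..<a}" by (rule free_space_vs[OF fl])
  have d: "\<pi>1 (r (z \<ominus>\<^bsub>V\<^esub> ?c \<odot>\<^bsub>V\<^esub> x)) = \<pi>1 (r z) \<ominus>\<^bsub>free_space K {..<a}\<^esub> \<pi>1 (r (?c \<odot>\<^bsub>V\<^esub> x))"
  by (rule V.linear_on_diff[OF Fa.vectorspace_axioms lr Z(1) zZ cx])
  then have d2: "\<pi>1 (r (z \<ominus>\<^bsub>V\<^esub> ?c \<odot>\<^bsub>V\<^esub> x)) \<oplus>\<^bsub>free_space K {..<a}\<^esub> \<pi>1 (r (?c \<odot>\<^bsub>V\<^esub> x)) = \<pi>1 (r z)"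
  using Fa.diff_add_cancel(1) linear_onD(1)[OF lr zZ] linear_onD(1)[OF lr cx] by simp
  have e: "\<pi>1 (r (?c \<odot>\<^bsub>V\<^esub> x)) = (%i. if i = k then ?c else zero K)"
  unfolding linear_onD(3)[OF lr c x(1)] px using c by (auto simp: free_space_simps free_gen_def)
  have dK: "\<pi>1 (r (z \<ominus>\<^bsub>V\<^esub> ?c \<odot>\<^bsub>V\<^esub> x)) i : carrier K" for i
  using linear_onD(1)[OF lr V.linsub_diff[OF Z(1) zZ cx]] by (simp add: free_space_simps)
  have d3: "\<pi>1 (r (z \<ominus>\<^bsub>V\<^esub> ?c \<odot>\<^bsub>V\<^esub> x)) i \<oplus>\<^bsub>K\<^esub> (if i = k then ?c else zero K) = \<pi>1 (r z) i" for i
  using fun_cong[OF d2, of i] unfolding e by (simp add: free_space_simps)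
  have "\<pi>1 (r (z \<ominus>\<^bsub>V\<^esub> ?c \<odot>\<^bsub>V\<^esub> x)) i = zero K" if "~ i < k" for i
  proof (cases "i = k")
  case True
  then show ?thesis using d3[of k] dK[of k] c by (simp add: V.R.add.r_cancel_one V.R.add.l_cancel_one)
  next
  case False
  then have "\<pi>1 (r z) i = zero K" using zc that by (simp add: free_space_simps)
  then show ?thesis using d3[of i] dK[of i] False by simp
  qed
  moreover have "finite {i. \<pi>1 (r (z \<ominus>\<^bsub>V\<^esub> ?c \<odot>\<^bsub>V\<^esub> x)) i ~= zero K}"
  using linear_onD(1)[OF lr V.linsub_diff[OF Z(1) zZ cx]] by (simp add: free_space_simps)
  ultimately have "z \<ominus>\<^bsub>V\<^esub> ?c \<odot>\<^bsub>V\<^esub> x : S k"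
  using dK V.linsub_diff[OF Z(1) zZ cx] by (simp add: S_def free_space_simps)
  then show "EX c:carrier K. z \<ominus>\<^bsub>V\<^esub> c \<odot>\<^bsub>V\<^esub> x : S k" using c by blast
  qed
  then show ?case by simp
 qed
 moreover have "S a = Z"
  using linear_onD(1)[OF lr] by (auto simp: S_def)
 ultimately show ?thesis by (metis order_refl)
qed

lemma has_basis_induct:
 assumes V: "vectorspace K V" and \<pi>: "linear_on K V (free_space K J) (carrier V) \<pi>" "\<pi> ` carrier V = carrier (free_space K J)"
  "!!z. z : carrier V ==> \<pi> z = (%j. zero K) \<longleftrightarrow> z : {zero V}"
  and J: "finite J" and Z: "linsub K V Z" "!!j z. j : J ==> z : carrier V ==> \<pi> z = free_gen K j ==> z : Z"
 shows "carrier V <= Z"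
proof -
 interpret V: vectorspace K V by fact
 have *: "z : Z" if "finite T" "T <= J" "z : carrier V" "!!j. j ~: T ==> \<pi> z j = zero K" for T z
  using that
 proof (induction T arbitrary: z)
  case empty
  then have "\<pi> z = (%j. zero K)" by auto
  then show ?case using \<pi>(3)[OF empty(2)] linsubD(2)[OF Z(1)] by simp
 next
  case (insert t T)
  have "free_gen K t : carrier (free_space K J)" using insert.prems by (auto simp: free_space_simps free_gen_def)
  then obtain b where b: "b : carrier V" "\<pi> b = free_gen K t" using \<pi>(2) by (metis (no_types) imageE)
  have bZ: "b : Z" using Z(2)[OF _ b] insert.prems by simp
  have zt: "\<pi> z t : carrier K" using linear_onD(1)[OF \<pi>(1) insert.prems(2)] by (simp add: free_space_simps)
  let ?b = "\<pi> z t \<odot>\<^bsub>V\<^esub> b"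
  have b': "?b : carrier V" "?b : Z" using zt b bZ by (auto intro: linsubD(4)[OF Z(1)])
  interpret F: vectorspace K "free_space K J" by (rule free_space_vs[OF V.field_axioms])
  have "\<pi> (z \<ominus>\<^bsub>V\<^esub> ?b) = \<pi> z \<ominus>\<^bsub>free_space K J\<^esub> \<pi> ?b"
  by (rule V.linear_on_diff[OF F.vectorspace_axioms \<pi>(1) V.linsub_carrier insert.prems(2) b'(1)])
  then have d2: "\<pi> (z \<ominus>\<^bsub>V\<^esub> ?b) \<oplus>\<^bsub>free_space K J\<^esub> \<pi> ?b = \<pi> z"
  using F.diff_add_cancel(1) linear_onD(1)[OF \<pi>(1)] insert.prems(2) b'(1) by simp
  have pb: "\<pi> ?b = (%i. if i = t then \<pi> z t else zero K)"
  unfolding linear_onD(3)[OF \<pi>(1) zt b(1)] b(2) using zt by (auto simp: free_space_simps free_gen_def)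
  have e: "\<pi> (z \<ominus>\<^bsub>V\<^esub> ?b) i \<oplus>\<^bsub>K\<^esub> (if i = t then \<pi> z t else zero K) = \<pi> z i" for i
  using fun_cong[OF d2, of i] unfolding pb by (simp add: free_space_simps(3))
  have dV: "z \<ominus>\<^bsub>V\<^esub> ?b : carrier V" using insert.prems(2) b'(1) by simp
  have dK: "\<pi> (z \<ominus>\<^bsub>V\<^esub> ?b) i : carrier K" for i
  using linear_onD(1)[OF \<pi>(1) dV] by (simp add: free_space_simps)
  have "z \<ominus>\<^bsub>V\<^esub> ?b : Z"
  proof (rule insert.IH[OF _ dV])
  show "T <= J" using insert.prems by simp
  fix j assume j: "j ~: T"
  show "\<pi> (z \<ominus>\<^bsub>V\<^esub> ?b) j = zero K"
  proof (cases "j = t")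
  case True
  then show ?thesis using e[of t] dK[of t] zt by (simp add: V.R.add.r_cancel_one V.R.add.l_cancel_one)
  next
  case False
  then show ?thesis using e[of j] dK[of j] insert.prems(3)[of j] j by simp
  qed
  qed
  then show ?case using V.linsub_add_iff(3)[OF Z(1) b'(2) insert.prems(2)] by simp
 qed
 show ?thesis
 proof
  fix z assume z: "z : carrier V"
  show "z : Z" by (rule *[OF J order_refl z]) (use linear_onD(1)[OF \<pi>(1) z] in "simp add: free_space_simps")
 qed
qed

lemma free_gen_closed: "field K ==> s : S ==> free_gen K s : carrier (free_space K S)"
 by (auto simp: free_space_simps free_gen_def field.is_ring ring.ring_simprules)

lemma free_space_induct:
 assumes K: "field K" and Z: "linsub K (free_space K S) Z" "!!s. s : S ==> free_gen K s : Z"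
 shows "carrier (free_space K S) <= Z"
proof -
 interpret F: vectorspace K "free_space K S" by (rule free_space_vs[OF K])
 have *: "f : Z" if "finite T" "f : carrier (free_space K S)" "!!x. x ~: T ==> f x = zero K" for T f
  using that
 proof (induction T arbitrary: f)
  case empty
  then have "f = \<zero>\<^bsub>free_space K S\<^esub>" by (auto simp: free_space_simps(2))
  then show ?case using linsubD(2)[OF Z(1)] by simp
 next
  case (insert t T)
  show ?case
  proof (cases "t : S")
  case False
  then have "f t = zero K" using insert.prems by (simp add: free_space_simps)
  then show ?thesis using insert.IH[of f] insert.prems by (metis insertE)
  next
  case True
  have ft: "f t : carrier K" using insert.prems by (simp add: free_space_simps)
  have f0: "f(t := zero K) : carrier (free_space K S)"
  using insert.prems(1) by (auto simp: free_space_simps intro: finite_subset[of _ "{x. f x ~= zero K}"])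
  have 1: "f(t := zero K) : Z" by (rule insert.IH[OF f0]) (use insert.prems(2) in auto)
  have 2: "f t \<odot>\<^bsub>free_space K S\<^esub> free_gen K t : Z" by (rule linsubD(4)[OF Z(1) ft Z(2)[OF True]])
  have "f(t := zero K) \<oplus>\<^bsub>free_space K S\<^esub> (f t \<odot>\<^bsub>free_space K S\<^esub> free_gen K t) = f"
  using insert.prems(1) by (auto simp: free_space_simps free_gen_def)
  then show ?thesis using linsubD(3)[OF Z(1) 1 2] by simp
  qed
 qed
 show ?thesis
 proof
  fix f assume f: "f : carrier (free_space K S)"
  show "f : Z" by (rule *[of "{x. f x ~= zero K}", OF _ f]) (use f in "auto simp: free_space_simps")
 qed
qed

text \<open>The linear functional on a free space with prescribed values on the generators; the
  finite sum is formed in \<open>amb\<close> and projected back to the field.\<close>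

definition free_ext :: "'k ring => ('s => 'k) => ('s => 'k) => 'k"
 where "free_ext K b f = pick K (\<Sum>x | f x ~= zero K. embed K (f x) * embed K (b x))"

lemma free_ext_props:
 fixes K :: "'k ring"
 assumes K: "field K" and b: "!!x. x : S ==> b x : carrier K"
 shows "free_ext K b f : carrier K"
  "f : carrier (free_space K S) ==> g : carrier (free_space K S) ==>
  free_ext K b (f \<oplus>\<^bsub>free_space K S\<^esub> g) = free_ext K b f \<oplus>\<^bsub>K\<^esub> free_ext K b g"
  "a : carrier K ==> f : carrier (free_space K S) ==>
  free_ext K b (a \<odot>\<^bsub>free_space K S\<^esub> f) = a \<otimes>\<^bsub>K\<^esub> free_ext K b f"
  "s : S ==> free_ext K b (free_gen K s) = b s"
proof -
 interpret field K by fact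
 interpret rng_emb K by unfold_locales (rule rng_cring[OF is_cring])
 let ?T = "%f. \<Sum>x | f x ~= zero K. embed K (f x) * embed K (b x)"
 have ext: "?T f = (\<Sum>x\<in>X. embed K (f x) * embed K (b x))" if "finite X" "{x. f x ~= zero K} <= X" for f X
  by (rule sum.mono_neutral_left) (use that in auto)
 show "free_ext K b f : carrier K" by (simp add: free_ext_def)
 show "free_ext K b (f \<oplus>\<^bsub>free_space K S\<^esub> g) = free_ext K b f \<oplus>\<^bsub>K\<^esub> free_ext K b g"
  if f: "f : carrier (free_space K S)" and g: "g : carrier (free_space K S)"
 proof -
  let ?X = "{x. f x ~= zero K} \<union> {x. g x ~= zero K}"
  have X: "finite ?X" and c: "f x : carrier K" "g x : carrier K" for x using f g by (auto simp: free_space_simps)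
  have 1: "?T (%x. f x \<oplus>\<^bsub>K\<^esub> g x) = (\<Sum>x\<in>?X. embed K (f x \<oplus>\<^bsub>K\<^esub> g x) * embed K (b x))"
  by (rule ext[OF X]) (auto simp: c)
  have "?T (%x. f x \<oplus>\<^bsub>K\<^esub> g x) = ?T f + ?T g"
  unfolding 1 by (subst (1 2) ext[OF X]) (auto simp: embed_add c distrib_right sum.distrib)
  then show ?thesis by (simp add: free_ext_def free_space_simps(3) proj_hom(2)[symmetric])
 qed
 show "free_ext K b (a \<odot>\<^bsub>free_space K S\<^esub> f) = a \<otimes>\<^bsub>K\<^esub> free_ext K b f"
  if a: "a : carrier K" and f: "f : carrier (free_space K S)"
 proof -
  let ?X = "{x. f x ~= zero K}"
  have X: "finite ?X" and c: "f x : carrier K" for x using f by (auto simp: free_space_simps)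
  have 1: "?T (%x. a \<otimes>\<^bsub>K\<^esub> f x) = (\<Sum>x\<in>?X. embed K (a \<otimes>\<^bsub>K\<^esub> f x) * embed K (b x))"
  by (rule ext[OF X]) (use a in auto)
  have "?T (%x. a \<otimes>\<^bsub>K\<^esub> f x) = embed K a * ?T f"
  unfolding 1 by (simp add: embed_mult a c sum_distrib_left mult.assoc)
  then show ?thesis using a by (simp add: free_ext_def free_space_simps(4) proj_hom(5))
 qed
 show "free_ext K b (free_gen K s) = b s" if s: "s : S"
 proof -
  have "{x. free_gen K s x ~= zero K} = {s}" by (auto simp: free_gen_def)
  then have "?T (free_gen K s) = embed K (\<one>\<^bsub>K\<^esub> \<otimes>\<^bsub>K\<^esub> b s)"
  using b[OF s] by (simp add: free_gen_def embed_mult del: l_one)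
  then show ?thesis using b[OF s] by (simp add: free_ext_def)
 qed
qed

text \<open>A presentation by generators and relations has dimension \<open>|J|\<close> as soon as there are
 functionals \<open>\<beta>\<^sub>j\<close> killing the relations, dual to some of the generators, and such that every
 generator \<open>x\<close> is congruent to \<open>\<Sum>\<^sub>j \<beta>\<^sub>j(x) s\<^sub>j\<close>. The latter combination is \<open>free_comb\<close>.\<close>

definition free_comb :: "('k, 'e) ring_scheme => 'j set => ('j => 's) => ('j => 'k) => 's => 'k"
 where "free_comb K J s c = (%x. if x : s ` J then c (inv_into J s x) else zero K)"

lemma free_comb_props:
 assumes K: "field K" and J: "finite J" "inj_on s J" "s ` J <= S"
 shows "c ` J <= carrier K ==> free_comb K J s c : carrier (free_space K S)"
  "free_comb K J s (%j. c j \<oplus>\<^bsub>K\<^esub> d j) = free_comb K J s c \<oplus>\<^bsub>free_space K S\<^esub> free_comb K J s d"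
  "a : carrier K ==> free_comb K J s (%j. a \<otimes>\<^bsub>K\<^esub> c j) = a \<odot>\<^bsub>free_space K S\<^esub> free_comb K J s c"
  "j : J ==> (!!i. i : J ==> c i = (if i = j then one K else zero K)) ==> free_comb K J s c = free_gen K (s j)"
  "(!!i. i : J ==> c i = d i) ==> free_comb K J s c = free_comb K J s d"
proof -
 interpret field K by fact
 show "c ` J <= carrier K ==> free_comb K J s c : carrier (free_space K S)"
  using J by (auto simp: free_comb_def free_space_simps inv_into_f_f
  intro: finite_subset[of _ "s ` J"])
 show "free_comb K J s (%j. c j \<oplus>\<^bsub>K\<^esub> d j) = free_comb K J s c \<oplus>\<^bsub>free_space K S\<^esub> free_comb K J s d"
  by (auto simp: free_comb_def free_space_simps)
 show "a : carrier K ==> free_comb K J s (%j. a \<otimes>\<^bsub>K\<^esub> c j) = a \<odot>\<^bsub>free_space K S\<^esub> free_comb K J s c"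
  by (auto simp: free_comb_def free_space_simps)
 show "free_comb K J s c = free_gen K (s j)" if "j : J" "!!i. i : J ==> c i = (if i = j then one K else zero K)"
 proof
  fix x show "free_comb K J s c x = free_gen K (s j) x"
  proof (cases "x : s ` J")
  case True
  then obtain i where i: "i : J" "x = s i" by auto
  then have "s i = s j \<longleftrightarrow> i = j" using J(2) that(1) by (meson inj_onD)
  then show ?thesis using i J(2) that by (simp add: free_comb_def free_gen_def inv_into_f_f)
  next
  case False
  then show ?thesis using that(1) by (auto simp: free_comb_def free_gen_def)
  qed
 qed
 show "(!!i. i : J ==> c i = d i) ==> free_comb K J s c = free_comb K J s d"
  by (auto simp: free_comb_def fun_eq_iff inv_into_into)
qed

lemma qdim_free_quotient:
 fixes K :: "'k ring"
 assumes K: "field K" and R: "linsub K (free_space K S) B"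
  and J: "finite J" "s ` J <= S"
  and \<beta>: "!!j x. j : J ==> x : S ==> \<beta> j x : carrier K"
  "!!i j. i : J ==> j : J ==> \<beta> i (s j) = (if i = j then one K else zero K)"
  "!!j f. j : J ==> f : B ==> free_ext K (\<beta> j) f = zero K"
  and cong: "!!x. x : S ==> free_gen K x \<ominus>\<^bsub>free_space K S\<^esub> free_comb K J s (%j. \<beta> j x) : B"
 shows "qdim K (free_space K S) (carrier (free_space K S)) B J"
proof -
 interpret field K by fact
 let ?F = "free_space K S"
 interpret F: vectorspace K ?F by (rule free_space_vs[OF K])
 have injs: "inj_on s J"
 proof (rule inj_onI)
  fix i j assume "i : J" "j : J" "s i = s j"
  then show "i = j" using \<beta>(2)[of i i] \<beta>(2)[of i j] by (metis one_not_zero)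
 qed
 define \<pi> where "\<pi> f = (%j. if j : J then free_ext K (\<beta> j) f else zero K)" for f
 have E: "free_ext K (\<beta> j) f : carrier K" if "j : J" for j f by (rule free_ext_props(1)[OF K \<beta>(1)[OF that]])
 note S = free_comb_props[OF K J(1) injs J(2)]
 have lin: "linear_on K ?F (free_space K J) (carrier ?F) \<pi>"
  unfolding linear_on_def
 proof (intro conjI ballI)
  show "\<pi> f : carrier (free_space K J)" for f
  using E by (auto simp: \<pi>_def free_space_simps intro: finite_subset[OF _ J(1)])
  show "\<pi> (f \<oplus>\<^bsub>?F\<^esub> g) = \<pi> f \<oplus>\<^bsub>free_space K J\<^esub> \<pi> g" if "f : carrier ?F" "g : carrier ?F" for f g
  using free_ext_props(2)[OF K \<beta>(1) that] by (auto simp: \<pi>_def free_space_simps(3) fun_eq_iff)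
  show "\<pi> (a \<odot>\<^bsub>?F\<^esub> f) = a \<odot>\<^bsub>free_space K J\<^esub> \<pi> f" if "a : carrier K" "f : carrier ?F" for a f
  using free_ext_props(3)[OF K \<beta>(1) that] that(1) by (auto simp: \<pi>_def free_space_simps(4) fun_eq_iff)
 qed
 have \<pi>gen: "\<pi> (free_gen K x) = (%j. if j : J then \<beta> j x else zero K)" if "x : S" for x
  using free_ext_props(4)[OF K \<beta>(1) that] by (auto simp: \<pi>_def fun_eq_iff)
 have \<sigma>lin: "linear_on K (free_space K J) ?F (carrier (free_space K J)) (free_comb K J s)"
  using S(1-3) by (auto simp: linear_on_def free_space_simps(3,4)) (auto simp: free_space_simps intro!: S(1)[simplified free_space_simps])
 \<comment> \<open>The elements congruent to the combination given by their own coordinates. They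
   form a subspace, so it is enough to find the generators in it.\<close>
 let ?Z = "{f : carrier ?F. f \<ominus>\<^bsub>?F\<^esub> free_comb K J s (\<pi> f) : B}"
 have cl: "free_comb K J s (\<pi> f) : carrier ?F" if "f : carrier ?F" for f
  by (rule linear_onD(1)[OF \<sigma>lin linear_onD(1)[OF lin that]])
 have "linsub K ?F ?Z"
  unfolding linsub_def
 proof (intro conjI ballI)
  interpret FJ: vectorspace K "free_space K J" by (rule free_space_vs[OF K])
  have "\<pi> \<zero>\<^bsub>?F\<^esub> = \<zero>\<^bsub>free_space K J\<^esub>" by (rule F.linear_on_zero[OF FJ.vectorspace_axioms lin F.linsub_carrier])
  moreover have "free_comb K J s \<zero>\<^bsub>free_space K J\<^esub> = \<zero>\<^bsub>?F\<^esub>"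
  by (rule FJ.linear_on_zero[OF F.vectorspace_axioms \<sigma>lin FJ.linsub_carrier])
  ultimately show "\<zero>\<^bsub>?F\<^esub> : ?Z" using linsubD(2)[OF R] by (simp add: F.diff_self)
 next
  fix f g assume "f : ?Z" "g : ?Z"
  then have f: "f : carrier ?F" "g : carrier ?F" "f \<ominus>\<^bsub>?F\<^esub> free_comb K J s (\<pi> f) : B" "g \<ominus>\<^bsub>?F\<^esub> free_comb K J s (\<pi> g) : B" by auto
  have "free_comb K J s (\<pi> (f \<oplus>\<^bsub>?F\<^esub> g)) = free_comb K J s (\<pi> f) \<oplus>\<^bsub>?F\<^esub> free_comb K J s (\<pi> g)"
  unfolding linear_onD(2)[OF lin f(1,2)] using linear_onD(2)[OF \<sigma>lin] linear_onD(1)[OF lin] f by simp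
  then show "f \<oplus>\<^bsub>?F\<^esub> g : ?Z" using f cl linsubD(3)[OF R f(3,4)] by (simp add: F.diff_add_add)
 next
  fix a f assume a: "a : carrier K" "f : ?Z"
  then have f: "f : carrier ?F" "f \<ominus>\<^bsub>?F\<^esub> free_comb K J s (\<pi> f) : B" by auto
  have "free_comb K J s (\<pi> (a \<odot>\<^bsub>?F\<^esub> f)) = a \<odot>\<^bsub>?F\<^esub> free_comb K J s (\<pi> f)"
  unfolding linear_onD(3)[OF lin a(1) f(1)] using linear_onD(3)[OF \<sigma>lin a(1)] linear_onD(1)[OF lin] f by simp
  then show "a \<odot>\<^bsub>?F\<^esub> f : ?Z" using f a cl linsubD(4)[OF R a(1) f(2)] by (simp add: F.smult_diff)
 qed auto
 moreover have "free_gen K x : ?Z" if x: "x : S" for x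
 proof -
  have "free_comb K J s (\<pi> (free_gen K x)) = free_comb K J s (%j. \<beta> j x)"
  by (rule S(5)) (simp add: \<pi>gen[OF x])
  then show ?thesis using cong[OF x] free_gen_closed[OF K x] by simp
 qed
 ultimately have all: "carrier ?F <= ?Z" by (rule free_space_induct[OF K])
 have ker: "\<pi> f = (%j. zero K) \<longleftrightarrow> f : B" if f: "f : carrier ?F" for f
 proof
  assume "\<pi> f = (%j. zero K)"
  then have "free_comb K J s (\<pi> f) = \<zero>\<^bsub>?F\<^esub>" by (auto simp: free_comb_def free_space_simps(2))
  then show "f : B" using all f F.diff_zero_right[OF f] by auto
 next
  assume "f : B"
  then show "\<pi> f = (%j. zero K)" using \<beta>(3) by (auto simp: \<pi>_def)
 qed
 have "c : \<pi> ` carrier ?F" if c: "c : carrier (free_space K J)" for c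
 proof -
  let ?Y = "{c : carrier (free_space K J). \<pi> (free_comb K J s c) = c}"
  interpret FJ: vectorspace K "free_space K J" by (rule free_space_vs[OF K])
  have "linsub K (free_space K J) ?Y"
  unfolding linsub_def
  proof (intro conjI ballI)
  show "\<zero>\<^bsub>free_space K J\<^esub> : ?Y"
  using F.linear_on_zero[OF FJ.vectorspace_axioms lin F.linsub_carrier]
  FJ.linear_on_zero[OF F.vectorspace_axioms \<sigma>lin FJ.linsub_carrier] by simp
  qed (use linear_onD[OF lin] linear_onD[OF \<sigma>lin] in simp_all)
  moreover have "free_gen K j : ?Y" if j: "j : J" for j
  proof -
  have "free_comb K J s (free_gen K j) = free_gen K (s j)"
  by (rule S(4)[OF j]) (simp add: free_gen_def)
  moreover have "\<pi> (free_gen K (s j)) = free_gen K j"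
  using J(2) j \<pi>gen[of "s j"] \<beta>(2)[OF _ j] by (auto simp: free_gen_def fun_eq_iff)
  ultimately show ?thesis using free_gen_closed[OF K j] by simp
  qed
  ultimately have "carrier (free_space K J) <= ?Y" by (rule free_space_induct[OF K])
  then have "\<pi> (free_comb K J s c) = c" using c by auto
  then show ?thesis using linear_onD(1)[OF \<sigma>lin c] by (metis imageI)
 qed
 then have "\<pi> ` carrier ?F = carrier (free_space K J)" using linear_onD(1)[OF lin] by auto
 then show ?thesis using lin ker unfolding qdim_def by blast
qed

lemma free_ext_vanishes_on_span:
 fixes K :: "'k ring"
 assumes K: "field K" and b: "!!x. x : S ==> b x : carrier K"
  and R: "R <= carrier (free_space K S)" "!!f. f : R ==> free_ext K b f = zero K"
  and f: "f : LinearCombinations.module.span K (free_space K S) R"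
 shows "free_ext K b f = zero K"
proof -
 interpret field K by fact
 note P = free_ext_props[where S = S and b = b, OF K b]
 let ?F = "free_space K S"
 interpret F: vectorspace K ?F by (rule free_space_vs[OF K])
 have "free_ext K b \<zero>\<^bsub>?F\<^esub> = zero K"
 proof -
  have "free_ext K b (\<zero>\<^bsub>K\<^esub> \<odot>\<^bsub>?F\<^esub> \<zero>\<^bsub>?F\<^esub>) = zero K \<otimes>\<^bsub>K\<^esub> free_ext K b \<zero>\<^bsub>?F\<^esub>"
  by (rule P(3)) auto
  then show ?thesis using P(1) by simp
 qed
 then have "linsub K ?F {f : carrier ?F. free_ext K b f = zero K}"
  using P(2,3) by (auto simp: linsub_def)
 then have "F.span R <= {f : carrier ?F. free_ext K b f = zero K}"
  by (rule F.span_least[rotated]) (use R in auto)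
 then show ?thesis using f by auto
qed

lemma free_ext_diff:
 fixes K :: "'k ring"
 assumes K: "field K" and b: "!!x. x : S ==> b x : carrier K"
  and f: "f : carrier (free_space K S)" "g : carrier (free_space K S)"
 shows "free_ext K b (f \<ominus>\<^bsub>free_space K S\<^esub> g) = free_ext K b f \<ominus>\<^bsub>K\<^esub> free_ext K b g"
proof -
 interpret field K by fact
 note P = free_ext_props[where S = S and b = b, OF K b]
 interpret F: vectorspace K "free_space K S" by (rule free_space_vs[OF K])
 have "free_ext K b (f \<ominus>\<^bsub>free_space K S\<^esub> g) \<oplus>\<^bsub>K\<^esub> free_ext K b g = free_ext K b f"
  using P(2)[of "f \<ominus>\<^bsub>free_space K S\<^esub> g" g] f by (simp add: F.diff_add_cancel)
 moreover have "free_ext K b h : carrier K" for h by (rule P(1))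
 ultimately show ?thesis by (simp add: a_minus_def add.inv_solve_right)
qed

context vectorspace
begin

lemma cong_add:
 assumes B: "linsub K V B" and u: "u : carrier V" "u1 : carrier V" "u2 : carrier V" "s1 : carrier V" "s2 : carrier V"
  and h: "u \<ominus>\<^bsub>V\<^esub> (u1 \<oplus>\<^bsub>V\<^esub> u2) : B" "u1 \<ominus>\<^bsub>V\<^esub> s1 : B" "u2 \<ominus>\<^bsub>V\<^esub> s2 : B"
 shows "u \<ominus>\<^bsub>V\<^esub> (s1 \<oplus>\<^bsub>V\<^esub> s2) : B"
proof -
 have "(u1 \<oplus>\<^bsub>V\<^esub> u2) \<ominus>\<^bsub>V\<^esub> (s1 \<oplus>\<^bsub>V\<^esub> s2) : B"
  using linsubD(3)[OF B h(2,3)] u by (simp add: diff_add_add)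
 from linsubD(3)[OF B h(1) this] show ?thesis using u by (simp add: diff_diff_diff)
qed

lemma cong_smult:
 assumes B: "linsub K V B" and u: "u : carrier V" "u1 : carrier V" "s1 : carrier V" "a : carrier K"
  and h: "u \<ominus>\<^bsub>V\<^esub> a \<odot>\<^bsub>V\<^esub> u1 : B" "u1 \<ominus>\<^bsub>V\<^esub> s1 : B"
 shows "u \<ominus>\<^bsub>V\<^esub> a \<odot>\<^bsub>V\<^esub> s1 : B"
proof -
 have "a \<odot>\<^bsub>V\<^esub> u1 \<ominus>\<^bsub>V\<^esub> a \<odot>\<^bsub>V\<^esub> s1 : B"
  using linsubD(4)[OF B u(4) h(2)] u by (simp add: smult_diff)
 from linsubD(3)[OF B h(1) this] show ?thesis using u by (simp add: diff_diff_diff)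
qed

end

lemma (in field) diff_eq_zero: "x : carrier R ==> x \<ominus> x = \<zero>"
 by (simp add: a_minus_def r_neg)

section \<open>Bases of tensor products\<close>

definition basis_vec :: "('k, 'e) ring_scheme => ('k, 'v, 'r) module_scheme => ('v => 'j => 'k) => 'j => 'v"
 where "basis_vec K V \<pi> j = (SOME v. v : carrier V & \<pi> v = free_gen K j)"

lemma basis_vec:
 assumes "field K" "\<pi> ` carrier V = carrier (free_space K J)" "j : J"
 shows "basis_vec K V \<pi> j : carrier V" "\<pi> (basis_vec K V \<pi> j) = free_gen K j"
proof -
 have "free_gen K j : \<pi> ` carrier V" using assms by (simp add: free_gen_closed)
 then have "EX v. v : carrier V & \<pi> v = free_gen K j" by (metis imageE)
 then show "basis_vec K V \<pi> j : carrier V" "\<pi> (basis_vec K V \<pi> j) = free_gen K j"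
  unfolding basis_vec_def using someI_ex[of "%v. v : carrier V & \<pi> v = free_gen K j"] by auto
qed

lemma tensor_rels_sub: "field K ==> vectorspace K V ==> vectorspace K W ==>
  tensor_rels K V W <= carrier (free_space K (carrier V \<times> carrier W))"
proof -
 assume K: "field K" and V: "vectorspace K V" and W: "vectorspace K W"
 let ?F = "free_space K (carrier V \<times> carrier W)"
 interpret F: vectorspace K ?F by (rule free_space_vs[OF K])
 interpret V: vectorspace K V by (rule V)
 interpret W: vectorspace K W by (rule W)
 have g: "free_gen K (v, w) : carrier ?F" if "v : carrier V" "w : carrier W" for v w
  by (rule free_gen_closed[OF K]) (use that in simp)
 show ?thesis unfolding tensor_rels_def Let_def using g by (auto simp: F.M.minus_closed)
qed

text \<open>The functionals required by \<open>qdim_free_quotient\<close> are the products of a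
  coordinate of v with a coordinate of w. Their bilinearity makes them kill the relations, and they
  are dual to the pairs of basis vectors.\<close>

lemma has_basis_tensor:
 fixes K :: "'k ring"
 assumes K: "field K" and V: "vectorspace K V" and W: "vectorspace K W"
  and hV: "has_basis K V J1" "finite J1" and hW: "has_basis K W J2" "finite J2"
 shows "vectorspace K (tensor_space K V W)" "has_basis K (tensor_space K V W) (J1 \<times> J2)"
proof -
 interpret field K by fact
 let ?S = "carrier V \<times> carrier W"
 let ?F = "free_space K ?S"
 interpret F: vectorspace K ?F by (rule free_space_vs[OF K])
 interpret V: vectorspace K V by (rule V)
 interpret W: vectorspace K W by (rule W)
 let ?R = "tensor_rels K V W"
 let ?B = "F.span ?R"
 have R: "?R <= carrier ?F" by (rule tensor_rels_sub[OF K V W])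
 have B: "linsub K ?F ?B" by (rule F.linsub_span[OF R])
 have RB: "f : ?B" if "f : ?R" for f using F.in_own_span[OF R] that by auto
 obtain p where p: "linear_on K V (free_space K J1) (carrier V) p" "p ` carrier V = carrier (free_space K J1)"
  "!!z. z : carrier V ==> p z = (%j. zero K) \<longleftrightarrow> z : {zero V}" using hV unfolding qdim_def by blast
 obtain q where q: "linear_on K W (free_space K J2) (carrier W) q" "q ` carrier W = carrier (free_space K J2)"
  "!!z. z : carrier W ==> q z = (%j. zero K) \<longleftrightarrow> z : {zero W}" using hW unfolding qdim_def by blast
 have pK: "p v j : carrier K" if "v : carrier V" for v j using linear_onD(1)[OF p(1) that] by (simp add: free_space_simps)
 have qK: "q v j : carrier K" if "v : carrier W" for v j using linear_onD(1)[OF q(1) that] by (simp add: free_space_simps)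
 have padd: "p (x \<oplus>\<^bsub>V\<^esub> y) j = p x j \<oplus>\<^bsub>K\<^esub> p y j" if "x : carrier V" "y : carrier V" for x y j
  using linear_onD(2)[OF p(1) that] by (simp add: free_space_simps)
 have qadd: "q (x \<oplus>\<^bsub>W\<^esub> y) j = q x j \<oplus>\<^bsub>K\<^esub> q y j" if "x : carrier W" "y : carrier W" for x y j
  using linear_onD(2)[OF q(1) that] by (simp add: free_space_simps)
 have psm: "p (a \<odot>\<^bsub>V\<^esub> y) j = a \<otimes>\<^bsub>K\<^esub> p y j" if "a : carrier K" "y : carrier V" for a y j
  using linear_onD(3)[OF p(1) that] by (simp add: free_space_simps)
 have qsm: "q (a \<odot>\<^bsub>W\<^esub> y) j = a \<otimes>\<^bsub>K\<^esub> q y j" if "a : carrier K" "y : carrier W" for a y j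
  using linear_onD(3)[OF q(1) that] by (simp add: free_space_simps)
 define \<beta> where "\<beta> = (%(i, j) (v, w). p v i \<otimes>\<^bsub>K\<^esub> q w j)"
 define s where "s = (%(i, j). (basis_vec K V p i, basis_vec K W q j))"
 have \<beta>K: "\<beta> ij x : carrier K" if "x : ?S" for ij x using that pK qK by (auto simp: \<beta>_def split: prod.splits)
 note E = free_ext_props(4)[OF K] and Eadd = free_ext_props(2)[OF K] and Esm = free_ext_props(3)[OF K]
 let ?J = "J1 \<times> J2"
 let ?e = "%v w. free_gen K (v, w)"
 have e: "?e v w : carrier ?F" if "v : carrier V" "w : carrier W" for v w
  by (rule free_gen_closed[OF K]) (use that in simp)
 have fin: "finite ?J" using hV hW by simp
 have sS: "s ` ?J <= ?S" using basis_vec[OF K p(2)] basis_vec[OF K q(2)] by (auto simp: s_def)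
 have delta: "\<beta> i (s j) = (if i = j then one K else zero K)" if "i : ?J" "j : ?J" for i j
  using that basis_vec[OF K p(2)] basis_vec[OF K q(2)] by (auto simp: s_def \<beta>_def free_gen_def split: prod.splits)
 have injs: "inj_on s ?J"
 proof (rule inj_onI)
  fix i j assume "i : ?J" "j : ?J" "s i = s j"
  then show "i = j" using delta[of i i] delta[of i j] by (metis one_not_zero)
 qed
 note C = free_comb_props[OF K fin injs sS]
 let ?c = "%v w. free_comb K ?J s (%j. \<beta> j (v, w))"
 have cF: "?c v w : carrier ?F" if "v : carrier V" "w : carrier W" for v w
  by (rule C(1)) (use \<beta>K[of "(v, w)"] that in auto)
 have kill: "free_ext K (\<beta> j) f = zero K" if f: "f : ?R" for j f
 proof -
  have b: "!!x. x : ?S ==> \<beta> j x : carrier K" by (rule \<beta>K)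
  obtain j1 j2 where j: "j = (j1, j2)" by (cases j)
  note D = free_ext_diff[where S = ?S and b = "\<beta> j", OF K b] and A = free_ext_props(2)[where S = ?S and b = "\<beta> j", OF K b]
  and Sm = free_ext_props(3)[where S = ?S and b = "\<beta> j", OF K b] and G = free_ext_props(4)[where S = ?S and b = "\<beta> j", OF K b]
  have cl: "?e v w : carrier ?F" "free_ext K (\<beta> j) (?e v w) = p v j1 \<otimes>\<^bsub>K\<^esub> q w j2" if "v : carrier V" "w : carrier W" for v w
  using e that G[of "(v, w)"] by (auto simp: j \<beta>_def)
  from f consider
  (1) x y w where "f = ?e (x \<oplus>\<^bsub>V\<^esub> y) w \<ominus>\<^bsub>?F\<^esub> (?e x w \<oplus>\<^bsub>?F\<^esub> ?e y w)" "x : carrier V" "y : carrier V" "w : carrier W"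
  | (2) v x y where "f = ?e v (x \<oplus>\<^bsub>W\<^esub> y) \<ominus>\<^bsub>?F\<^esub> (?e v x \<oplus>\<^bsub>?F\<^esub> ?e v y)" "v : carrier V" "x : carrier W" "y : carrier W"
  | (3) a v w where "f = ?e (a \<odot>\<^bsub>V\<^esub> v) w \<ominus>\<^bsub>?F\<^esub> (a \<odot>\<^bsub>?F\<^esub> ?e v w)" "a : carrier K" "v : carrier V" "w : carrier W"
  | (4) a v w where "f = ?e v (a \<odot>\<^bsub>W\<^esub> w) \<ominus>\<^bsub>?F\<^esub> (a \<odot>\<^bsub>?F\<^esub> ?e v w)" "a : carrier K" "v : carrier V" "w : carrier W"
  unfolding tensor_rels_def Let_def by blast
  then show ?thesis
  proof cases
  case 1
  then show ?thesis by (simp add: D A cl padd pK qK l_distr diff_eq_zero)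
  next
  case 2
  then show ?thesis by (simp add: D A cl qadd pK qK r_distr diff_eq_zero)
  next
  case 3
  then show ?thesis by (simp add: D Sm cl psm pK qK m_assoc diff_eq_zero)
  next
  case 4
  then show ?thesis by (simp add: D Sm cl qsm pK qK m_lcomm diff_eq_zero)
  qed
 qed
 have kill': "free_ext K (\<beta> j) f = zero K" if "f : ?B" for j f
  by (rule free_ext_vanishes_on_span[OF K \<beta>K R kill that])
 have r1: "?e (x \<oplus>\<^bsub>V\<^esub> y) w \<ominus>\<^bsub>?F\<^esub> (?e x w \<oplus>\<^bsub>?F\<^esub> ?e y w) : ?B" if "x : carrier V" "y : carrier V" "w : carrier W" for x y w
  by (rule RB) (use that in "unfold tensor_rels_def Let_def, blast")
 have r2: "?e v (x \<oplus>\<^bsub>W\<^esub> y) \<ominus>\<^bsub>?F\<^esub> (?e v x \<oplus>\<^bsub>?F\<^esub> ?e v y) : ?B" if "v : carrier V" "x : carrier W" "y : carrier W" for v x y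
  by (rule RB) (use that in "unfold tensor_rels_def Let_def, blast")
 have r3: "?e (a \<odot>\<^bsub>V\<^esub> v) w \<ominus>\<^bsub>?F\<^esub> (a \<odot>\<^bsub>?F\<^esub> ?e v w) : ?B" if "a : carrier K" "v : carrier V" "w : carrier W" for a v w
  by (rule RB) (use that in "unfold tensor_rels_def Let_def, blast")
 have r4: "?e v (a \<odot>\<^bsub>W\<^esub> w) \<ominus>\<^bsub>?F\<^esub> (a \<odot>\<^bsub>?F\<^esub> ?e v w) : ?B" if "a : carrier K" "v : carrier V" "w : carrier W" for a v w
  by (rule RB) (use that in "unfold tensor_rels_def Let_def, blast")
 have c1: "?c (x \<oplus>\<^bsub>V\<^esub> y) w = ?c x w \<oplus>\<^bsub>?F\<^esub> ?c y w" if "x : carrier V" "y : carrier V" "w : carrier W" for x y w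
  unfolding C(2)[symmetric] by (rule C(5)) (use that in "auto simp: \<beta>_def padd pK qK l_distr")
 have c2: "?c v (x \<oplus>\<^bsub>W\<^esub> y) = ?c v x \<oplus>\<^bsub>?F\<^esub> ?c v y" if "v : carrier V" "x : carrier W" "y : carrier W" for v x y
  unfolding C(2)[symmetric] by (rule C(5)) (use that in "auto simp: \<beta>_def qadd pK qK r_distr")
 have c3: "?c (a \<odot>\<^bsub>V\<^esub> v) w = a \<odot>\<^bsub>?F\<^esub> ?c v w" if "a : carrier K" "v : carrier V" "w : carrier W" for a v w
  unfolding C(3)[OF that(1), symmetric] by (rule C(5)) (use that in "auto simp: \<beta>_def psm pK qK m_assoc")
 have c4: "?c v (a \<odot>\<^bsub>W\<^esub> w) = a \<odot>\<^bsub>?F\<^esub> ?c v w" if "a : carrier K" "v : carrier V" "w : carrier W" for a v w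
  unfolding C(3)[OF that(1), symmetric] by (rule C(5)) (use that in "auto simp: \<beta>_def qsm pK qK m_lcomm")
 let ?D = "%v w. ?e v w \<ominus>\<^bsub>?F\<^esub> ?c v w"
 have z: "x : carrier V ==> \<zero>\<^bsub>K\<^esub> \<odot>\<^bsub>V\<^esub> x = zero V" "y : carrier W ==> \<zero>\<^bsub>K\<^esub> \<odot>\<^bsub>W\<^esub> y = zero W" for x y by simp_all
 have T1: "linsub K V {v : carrier V. ?D v w : ?B}" if w: "w : carrier W" for w
  unfolding linsub_def
 proof (intro conjI ballI)
  have sm: "?D (a \<odot>\<^bsub>V\<^esub> v) w : ?B" if "a : carrier K" "v : carrier V" "?D v w : ?B" for a v
  using F.cong_smult[OF B _ _ _ _ r3 that(3)] that e cF w by (simp add: c3)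
  have "?D \<zero>\<^bsub>V\<^esub> w : ?B"
  proof -
  have "?D (\<zero>\<^bsub>K\<^esub> \<odot>\<^bsub>V\<^esub> \<zero>\<^bsub>V\<^esub>) w : ?B"
  using r3[of "zero K" "zero V" w] c3[of "zero K" "zero V" w] e cF w by simp
  then show ?thesis by simp
  qed
  then show "zero V : {v : carrier V. ?D v w : ?B}" by simp
  show "x \<oplus>\<^bsub>V\<^esub> y : {v : carrier V. ?D v w : ?B}" if "x : {v : carrier V. ?D v w : ?B}" "y : {v : carrier V. ?D v w : ?B}" for x y
  using F.cong_add[OF B _ _ _ _ _ r1, of x y w "?c x w" "?c y w"] that e cF w by (simp add: c1)
  show "a \<odot>\<^bsub>V\<^esub> x : {v : carrier V. ?D v w : ?B}" if "a : carrier K" "x : {v : carrier V. ?D v w : ?B}" for a x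
  using sm that by simp
 qed auto
 have T2: "linsub K W {w : carrier W. ?D v w : ?B}" if v: "v : carrier V" for v
  unfolding linsub_def
 proof (intro conjI ballI)
  have sm: "?D v (a \<odot>\<^bsub>W\<^esub> w) : ?B" if "a : carrier K" "w : carrier W" "?D v w : ?B" for a w
  using F.cong_smult[OF B _ _ _ _ r4 that(3)] that e cF v by (simp add: c4)
  have "?D v \<zero>\<^bsub>W\<^esub> : ?B"
  proof -
  have "?D v (\<zero>\<^bsub>K\<^esub> \<odot>\<^bsub>W\<^esub> \<zero>\<^bsub>W\<^esub>) : ?B"
  using r4[of "zero K" v "zero W"] c4[of "zero K" v "zero W"] e cF v by simp
  then show ?thesis by simp
  qed
  then show "zero W : {w : carrier W. ?D v w : ?B}" by simp
  show "x \<oplus>\<^bsub>W\<^esub> y : {w : carrier W. ?D v w : ?B}" if "x : {w : carrier W. ?D v w : ?B}" "y : {w : carrier W. ?D v w : ?B}" for x y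
  using F.cong_add[OF B _ _ _ _ _ r2, of v x y "?c v x" "?c v y"] that e cF v by (simp add: c2)
  show "a \<odot>\<^bsub>W\<^esub> x : {w : carrier W. ?D v w : ?B}" if "a : carrier K" "x : {w : carrier W. ?D v w : ?B}" for a x
  using sm that by simp
 qed auto
 have base: "?D v w : ?B" if "i : J1" "j : J2" "v : carrier V" "p v = free_gen K i" "w : carrier W" "q w = free_gen K j" for i j v w
 proof -
  have v: "v = basis_vec K V p i"
  using V.qdim_diff_iff[OF V.linsub_carrier p(1) p(3), of v "basis_vec K V p i"] basis_vec[OF K p(2) that(1)] that
  by (simp add: V.diff_zero_iff)
  have w: "w = basis_vec K W q j"
  using W.qdim_diff_iff[OF W.linsub_carrier q(1) q(3), of w "basis_vec K W q j"] basis_vec[OF K q(2) that(2)] that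
  by (simp add: W.diff_zero_iff)
  have sij: "s (i, j) = (v, w)" by (simp add: s_def v w)
  have "?c v w = free_gen K (s (i, j))"
  proof (rule C(4))
  show ij: "(i, j) : ?J" using that by simp
  show "\<beta> k (v, w) = (if k = (i, j) then one K else zero K)" if "k : ?J" for k
  using delta[OF that ij] sij by simp
  qed
  then show ?thesis using sij e[OF that(3,5)] linsubD(2)[OF B] by (simp add: F.diff_self)
 qed
 have D: "?D v w : ?B" if v: "v : carrier V" and w: "w : carrier W" for v w
 proof -
  \<comment> \<open>Linear induction in v for basis vectors w, and after that in w for arbitrary
    v.\<close>
  have "carrier V <= {v : carrier V. ?D v w : ?B}" if j: "j : J2" "w : carrier W" "q w = free_gen K j" for j w
  by (rule has_basis_induct[OF V p hV(2) T1]) (use base j in auto)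
  then have "carrier W <= {w : carrier W. ?D v w : ?B}"
  by (intro has_basis_induct[OF W q hW(2) T2[OF v]]) (use v in auto)
  then show ?thesis using w by auto
 qed
 have "qdim K ?F (carrier ?F) ?B ?J"
  by (rule qdim_free_quotient[where s = s and \<beta> = \<beta>]) (use K B fin sS \<beta>K delta kill' D in auto)
 then have "has_basis K (quot_space ?F ?B) ?J" by (simp add: F.has_basis_quot_iff[OF B])
 then show "has_basis K (tensor_space K V W) ?J" by (simp add: tensor_space_def Let_def)
 show "vectorspace K (tensor_space K V W)" using F.quot_space_vs[OF B] by (simp add: tensor_space_def Let_def)
qed

section \<open>Direct sums and their bases\<close>

lemma dsum_vs:
 assumes K: "field K" and V: "!!i. i : I ==> vectorspace K (V i)" and I: "finite I"
 shows "vectorspace K (dsum I V)"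
proof (rule vectorspaceI[OF K], rule module_criteria)
 have car: "f : carrier (dsum I V) \<longleftrightarrow> f : (\<Pi>\<^sub>E i\<in>I. carrier (V i))" for f using I by (simp add: dsum_def)
 have M: "module K (V i)" if "i : I" for i using V[OF that] by (simp add: vectorspace_def)
 have G: "abelian_group (V i)" if "i : I" for i using M[OF that] by (simp add: module_def)
 have Mo: "abelian_monoid (V i)" if "i : I" for i using G[OF that] by (simp add: abelian_group_def)
 have mem: "f i : carrier (V i)" if "f : (\<Pi>\<^sub>E i\<in>I. carrier (V i))" "i : I" for f i using that by (rule PiE_mem)
 note C = abelian_monoid.a_closed[OF Mo] abelian_monoid.zero_closed[OF Mo] abelian_group.a_inv_closed[OF G]
  module.smult_closed[OF M]
 show "cring K" using K by (simp add: field_def domain_def)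
 show "\<zero>\<^bsub>dsum I V\<^esub> : carrier (dsum I V)" by (simp add: car) (simp add: dsum_def C)
 show "ALL v w. v : carrier (dsum I V) & w : carrier (dsum I V) --> v \<oplus>\<^bsub>dsum I V\<^esub> w : carrier (dsum I V)"
  unfolding car by (auto simp: dsum_def mem C)
 show "ALL v:carrier (dsum I V). EX w:carrier (dsum I V). v \<oplus>\<^bsub>dsum I V\<^esub> w = \<zero>\<^bsub>dsum I V\<^esub>"
 proof
  fix v assume v: "v : carrier (dsum I V)"
  have "(\<lambda>i\<in>I. \<ominus>\<^bsub>V i\<^esub> v i) : carrier (dsum I V)" using v unfolding car by (auto simp: mem C)
  moreover have "v \<oplus>\<^bsub>dsum I V\<^esub> (\<lambda>i\<in>I. \<ominus>\<^bsub>V i\<^esub> v i) = \<zero>\<^bsub>dsum I V\<^esub>"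
  using v unfolding car by (auto simp: dsum_def mem abelian_group.r_neg[OF G] fun_eq_iff)
  ultimately show "EX w:carrier (dsum I V). v \<oplus>\<^bsub>dsum I V\<^esub> w = \<zero>\<^bsub>dsum I V\<^esub>" by blast
 qed
 show "ALL c v. c : carrier K & v : carrier (dsum I V) --> c \<odot>\<^bsub>dsum I V\<^esub> v : carrier (dsum I V)"
  unfolding car by (auto simp: dsum_def mem C)
 have add: "v \<oplus>\<^bsub>dsum I V\<^esub> w = (\<lambda>i\<in>I. v i \<oplus>\<^bsub>V i\<^esub> w i)" and sm: "a \<odot>\<^bsub>dsum I V\<^esub> v = (\<lambda>i\<in>I. a \<odot>\<^bsub>V i\<^esub> v i)"
  and zero: "\<zero>\<^bsub>dsum I V\<^esub> = (\<lambda>i\<in>I. \<zero>\<^bsub>V i\<^esub>)" for a v w by (simp_all add: dsum_def)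
 have id: "(\<lambda>i\<in>I. v i) = v" if "v : (\<Pi>\<^sub>E i\<in>I. carrier (V i))" for v using that by (rule PiE_restrict)
 show "ALL v w. v : carrier (dsum I V) & w : carrier (dsum I V) --> v \<oplus>\<^bsub>dsum I V\<^esub> w = w \<oplus>\<^bsub>dsum I V\<^esub> v"
  unfolding car add by (intro allI impI restrict_ext abelian_monoid.a_comm[OF Mo]) (simp_all add: mem)
 show "ALL v w x. v : carrier (dsum I V) & w : carrier (dsum I V) & x : carrier (dsum I V) -->
  v \<oplus>\<^bsub>dsum I V\<^esub> w \<oplus>\<^bsub>dsum I V\<^esub> x = v \<oplus>\<^bsub>dsum I V\<^esub> (w \<oplus>\<^bsub>dsum I V\<^esub> x)"
  unfolding car add by (intro allI impI restrict_ext) (simp add: mem abelian_monoid.a_assoc[OF Mo])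
 show "ALL v:carrier (dsum I V). v \<oplus>\<^bsub>dsum I V\<^esub> \<zero>\<^bsub>dsum I V\<^esub> = v"
 proof
  fix v assume v: "v : carrier (dsum I V)"
  have "v \<oplus>\<^bsub>dsum I V\<^esub> \<zero>\<^bsub>dsum I V\<^esub> = (\<lambda>i\<in>I. v i)"
  unfolding add zero by (rule restrict_ext) (use v in "simp add: car mem abelian_monoid.r_zero[OF Mo]")
  then show "v \<oplus>\<^bsub>dsum I V\<^esub> \<zero>\<^bsub>dsum I V\<^esub> = v" using id v by (simp add: car)
 qed
 show "ALL a b v. a : carrier K & b : carrier K & v : carrier (dsum I V) -->
  (a \<otimes>\<^bsub>K\<^esub> b) \<odot>\<^bsub>dsum I V\<^esub> v = a \<odot>\<^bsub>dsum I V\<^esub> (b \<odot>\<^bsub>dsum I V\<^esub> v)"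
  unfolding car sm by (intro allI impI restrict_ext) (simp add: mem module.smult_assoc1[OF M])
 show "ALL v:carrier (dsum I V). one K \<odot>\<^bsub>dsum I V\<^esub> v = v"
 proof
  fix v assume v: "v : carrier (dsum I V)"
  have "\<one>\<^bsub>K\<^esub> \<odot>\<^bsub>dsum I V\<^esub> v = (\<lambda>i\<in>I. v i)"
  unfolding sm by (rule restrict_ext) (use v in "simp add: car mem module.smult_one[OF M]")
  then show "\<one>\<^bsub>K\<^esub> \<odot>\<^bsub>dsum I V\<^esub> v = v" using id v by (simp add: car)
 qed
 show "ALL a b v. a : carrier K & b : carrier K & v : carrier (dsum I V) -->
  (a \<oplus>\<^bsub>K\<^esub> b) \<odot>\<^bsub>dsum I V\<^esub> v = a \<odot>\<^bsub>dsum I V\<^esub> v \<oplus>\<^bsub>dsum I V\<^esub> b \<odot>\<^bsub>dsum I V\<^esub> v"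
  unfolding car sm add by (intro allI impI restrict_ext) (simp add: mem module.smult_l_distr[OF M])
 show "ALL a v w. a : carrier K & v : carrier (dsum I V) & w : carrier (dsum I V) -->
  a \<odot>\<^bsub>dsum I V\<^esub> (v \<oplus>\<^bsub>dsum I V\<^esub> w) = a \<odot>\<^bsub>dsum I V\<^esub> v \<oplus>\<^bsub>dsum I V\<^esub> a \<odot>\<^bsub>dsum I V\<^esub> w"
  unfolding car sm add by (intro allI impI restrict_ext) (simp add: mem module.smult_r_distr[OF M])
qed

lemma has_basis_dsum:
 assumes K: "field K" and h: "!!i. i : I ==> has_basis K (V i) (J i)" and I: "finite I" "!!i. i : I ==> finite (J i)"
 shows "has_basis K (dsum I V) (Sigma I J)"
proof -
 interpret field K by fact
 let ?P = "%i \<pi>. linear_on K (V i) (free_space K (J i)) (carrier (V i)) \<pi> & \<pi> ` carrier (V i) = carrier (free_space K (J i)) &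
  (ALL z:carrier (V i). \<pi> z = (%j. zero K) \<longleftrightarrow> z : {\<zero>\<^bsub>V i\<^esub>})"
 have "ALL i:I. EX \<pi>. ?P i \<pi>" using h unfolding qdim_def by blast
 then obtain \<pi> where P: "ALL i:I. ?P i (\<pi> i)" by (rule bchoice[THEN exE])
 have \<pi>: "linear_on K (V i) (free_space K (J i)) (carrier (V i)) (\<pi> i)"
  "\<pi> i ` carrier (V i) = carrier (free_space K (J i))"
  "z : carrier (V i) ==> \<pi> i z = (%j. zero K) \<longleftrightarrow> z = \<zero>\<^bsub>V i\<^esub>" if "i : I" for i z
  using P that by auto
 have car: "f : carrier (dsum I V) \<longleftrightarrow> f : (\<Pi>\<^sub>E i\<in>I. carrier (V i))" for f using I by (simp add: dsum_def)
 have fin: "finite (Sigma I J)" using I by blast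
 define \<rho> where "\<rho> f = (%(i, j). if i : I then \<pi> i (f i) j else zero K)" for f
 have pK: "\<pi> i x : carrier (free_space K (J i))" if "i : I" "x : carrier (V i)" for i x
  using linear_onD(1)[OF \<pi>(1)[OF that(1)] that(2)] .
 have lin: "linear_on K (dsum I V) (free_space K (Sigma I J)) (carrier (dsum I V)) \<rho>"
  unfolding linear_on_def
 proof (intro conjI ballI)
  fix f assume "f : carrier (dsum I V)"
  then have f: "f i : carrier (V i)" if "i : I" for i
  using PiE_mem[of f I "%i. carrier (V i)" i] that unfolding car by simp
  have "\<rho> f x : carrier K" "x ~: Sigma I J ==> \<rho> f x = zero K" for x
  using pK f by (auto simp: \<rho>_def free_space_simps split: prod.splits)
  moreover have "finite {x. \<rho> f x ~= zero K}"
  by (rule finite_subset[OF _ fin]) (use calculation(2) in blast)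
  ultimately show "\<rho> f : carrier (free_space K (Sigma I J))" by (simp add: free_space_simps)
 next
  fix f g assume "f : carrier (dsum I V)" "g : carrier (dsum I V)"
  then have f: "f i : carrier (V i)" "g i : carrier (V i)" if "i : I" for i
  using PiE_mem[of f I "%i. carrier (V i)" i] PiE_mem[of g I "%i. carrier (V i)" i] that unfolding car by simp_all
  show "\<rho> (f \<oplus>\<^bsub>dsum I V\<^esub> g) = \<rho> f \<oplus>\<^bsub>free_space K (Sigma I J)\<^esub> \<rho> g"
  using linear_onD(2)[OF \<pi>(1)] f by (auto simp: \<rho>_def dsum_def free_space_simps(3) fun_eq_iff)
 next
  fix a f assume a: "a : carrier K" "f : carrier (dsum I V)"
  then have f: "f i : carrier (V i)" if "i : I" for i
  using PiE_mem[of f I "%i. carrier (V i)" i] that unfolding car by simp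
  show "\<rho> (a \<odot>\<^bsub>dsum I V\<^esub> f) = a \<odot>\<^bsub>free_space K (Sigma I J)\<^esub> \<rho> f"
  using linear_onD(3)[OF \<pi>(1)] f a by (auto simp: \<rho>_def dsum_def free_space_simps(4) fun_eq_iff)
 qed
 have "c : \<rho> ` carrier (dsum I V)" if c: "c : carrier (free_space K (Sigma I J))" for c
 proof -
  have "EX z. z : carrier (V i) & \<pi> i z = (%j. c (i, j))" if i: "i : I" for i
  proof -
  have "(%j. c (i, j)) : carrier (free_space K (J i))"
  proof -
  have "{j. c (i, j) ~= zero K} <= J i" using c by (auto simp: free_space_simps)
  then have "finite {j. c (i, j) ~= zero K}" by (rule finite_subset) (rule I(2)[OF i])
  then show ?thesis using c by (simp add: free_space_simps)
  qed
  then show ?thesis using \<pi>(2)[OF i] by (metis imageE)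
  qed
  then have "ALL i:I. EX z. z : carrier (V i) & \<pi> i z = (%j. c (i, j))" by blast
  then obtain z where z: "ALL i:I. z i : carrier (V i) & \<pi> i (z i) = (%j. c (i, j))" by (rule bchoice[THEN exE])
  let ?f = "\<lambda>i\<in>I. z i"
  have "?f : carrier (dsum I V)" using z unfolding car by auto
  moreover have "\<rho> ?f = c"
  proof
  fix x show "\<rho> ?f x = c x" using z c by (cases x) (auto simp: \<rho>_def free_space_simps)
  qed
  ultimately show ?thesis by (metis imageI)
 qed
 then have surj: "\<rho> ` carrier (dsum I V) = carrier (free_space K (Sigma I J))" using linear_onD(1)[OF lin] by auto
 have "\<rho> f = (%j. zero K) \<longleftrightarrow> f : {\<zero>\<^bsub>dsum I V\<^esub>}" if f: "f : carrier (dsum I V)" for f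
 proof -
  have fi: "f i : carrier (V i)" if "i : I" for i using f PiE_mem[of f I "%i. carrier (V i)" i] that unfolding car by simp
  have "\<rho> f = (%j. zero K) \<longleftrightarrow> (ALL i:I. \<pi> i (f i) = (%j. zero K))"
  proof
  assume 0: "\<rho> f = (%j. zero K)"
  have "\<pi> i (f i) j = zero K" if "i : I" for i j
  using fun_cong[OF 0, of "(i, j)"] that by (simp add: \<rho>_def)
  then show "ALL i:I. \<pi> i (f i) = (%j. zero K)" by blast
  next
  assume "ALL i:I. \<pi> i (f i) = (%j. zero K)"
  then show "\<rho> f = (%j. zero K)" unfolding \<rho>_def by (intro ext) (simp split: prod.split)
  qed
  also have "... \<longleftrightarrow> (ALL i:I. f i = \<zero>\<^bsub>V i\<^esub>)" using \<pi>(3) fi by (intro ball_cong) simp_all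
  also have "... \<longleftrightarrow> f = (\<lambda>i\<in>I. \<zero>\<^bsub>V i\<^esub>)"
  proof
  assume 0: "ALL i:I. f i = \<zero>\<^bsub>V i\<^esub>"
  show "f = (\<lambda>i\<in>I. \<zero>\<^bsub>V i\<^esub>)"
  proof
  fix i show "f i = (\<lambda>i\<in>I. \<zero>\<^bsub>V i\<^esub>) i"
  using 0 PiE_arb[of f I "%i. carrier (V i)" i] f unfolding car by (cases "i : I") simp_all
  qed
  next
  assume "f = (\<lambda>i\<in>I. \<zero>\<^bsub>V i\<^esub>)"
  then show "ALL i:I. f i = \<zero>\<^bsub>V i\<^esub>" by (metis restrict_apply')
  qed
  also have "(\<lambda>i\<in>I. \<zero>\<^bsub>V i\<^esub>) = \<zero>\<^bsub>dsum I V\<^esub>" by (simp add: dsum_def)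
  finally show ?thesis by simp
 qed
 then show ?thesis using lin surj unfolding qdim_def by blast
qed

section \<open>Bases of exterior powers\<close>

lemma tuples_tups: "tuples V n = tups (carrier V) n"
 by (simp add: tuples_def tups_def)

text \<open>Increasing multi-indices, in bijection with the n-element subsets of {0, ..., d-1}; they
  index the standard basis of the n-th exterior power of a d-dimensional space.\<close>

definition inc_lists :: "nat => nat => nat list set"
 where "inc_lists d n = {js : tups {..<d} n. sorted_wrt (<) js}"

lemma card_inc_lists: "card (inc_lists d n) = d choose n" "finite (inc_lists d n)"
proof -
 have "bij_betw set (inc_lists d n) {A. A <= {..<d} & card A = n}"
 proof (rule bij_betw_byWitness[where f' = sorted_list_of_set])
  show "ALL js:inc_lists d n. sorted_list_of_set (set js) = js"
  by (auto simp: inc_lists_def strict_sorted_iff sorted_list_of_set.idem_if_sorted_distinct)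
  show "ALL A:{A. A <= {..<d} & card A = n}. set (sorted_list_of_set A) = A"
  using finite_subset[OF _ finite_lessThan] by auto
  show "set ` inc_lists d n <= {A. A <= {..<d} & card A = n}"
  by (auto simp: inc_lists_def tups_def strict_sorted_iff distinct_card)
  show "sorted_list_of_set ` {A. A <= {..<d} & card A = n} <= inc_lists d n"
  proof
  fix js assume "js : sorted_list_of_set ` {A. A <= {..<d} & card A = n}"
  then obtain A where A: "js = sorted_list_of_set A" "A <= {..<d}" "card A = n" by blast
  then have "finite A" using finite_subset by blast
  then show "js : inc_lists d n" using A by (auto simp: inc_lists_def tups_def)
  qed
 qed
 then have "card (inc_lists d n) = card {A. A <= {..<d} & card A = n}" by (rule bij_betw_same_card)
 then show "card (inc_lists d n) = d choose n" by (simp add: n_subsets)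
 show "finite (inc_lists d n)"
  by (rule finite_subset[OF _ finite_lists_length_eq[of "{..<d}" n]]) (auto simp: inc_lists_def tups_def)
qed

text \<open>The product of the linear forms \<chi>_j for j in the list, with the value
  \<open>e\<close> in place of 1, as the ring of values is not unital.\<close>

fun dual_form :: "('k => 'b::ab_group_add => 'b) => (nat => 'g => 'k) => 'b => nat list => 'g list => 'b" where
 "dual_form sc \<chi> e [] = (%xs. if xs = [] then e else 0)"
| "dual_form sc \<chi> e (j # js) = wedge sc (\<chi> j) (dual_form sc \<chi> e js)"

lemma wedge_zero_form: "(!!y. y : set ys ==> sc (c y) 0 = 0) ==> wedge sc c (%xs. 0) ys = 0"
 by (induction ys) auto

text \<open>The leading term of the expansion gives the comparison of the heads and, by induction,
  of the tails. The other term vanishes: if j occurs in the tail of the index list, then i < j is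
  smaller than all later arguments, on which \<chi>_i is therefore zero; if it does not occur there,
  already the contraction with b_j is zero.\<close>

lemma dual_form_basis:
 fixes e :: "'b::ab_group_add"
 assumes sc: "!!i j v. j < d ==> sc (\<chi> i (b j)) v = (if i = j then E v else 0)" "!!a. sc a 0 = 0" "E e = e" "E 0 = 0"
 shows "length is = length js ==> sorted_wrt (<) is ==> sorted_wrt (<) js ==> set js <= {..<d} ==>
  dual_form sc \<chi> e is (map b js) = (if is = js then e else 0)"
proof (induction "is" arbitrary: js)
 case (Cons i "is")
 then obtain j ks where js: "js = j # ks" by (cases js) auto
 have absent: "dual_form sc \<chi> e ls (b j # ys) = 0" if "j ~: set ls" "j < d" for j ls ys
  using that
 proof (induction ls arbitrary: ys)
  case (Cons l ls)
  have "(%ys. dual_form sc \<chi> e ls (b j # ys)) = (%ys. 0)" using Cons by auto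
  then show ?case using Cons.prems by (simp add: sc wedge_zero_form)
 qed simp
 have j: "j < d" and ks: "set ks <= {..<d}" "ALL k:set ks. j < k" using Cons.prems js by auto
 have W: "wedge sc (\<chi> i) (%ys. dual_form sc \<chi> e is (b j # ys)) (map b ks) = 0"
 proof (cases "j : set is")
  case True
  then have "i < j" using Cons.prems by auto
  then have "i ~= k" "k < d" if "k : set ks" for k using ks that by auto
  then show ?thesis by (intro wedge_zero) (auto simp: sc)
 next
  case False
  then have "(%ys. dual_form sc \<chi> e is (b j # ys)) = (%ys. 0)" using absent j by auto
  then show ?thesis by (simp add: wedge_zero_form sc)
 qed
 have "dual_form sc \<chi> e is (map b ks) = (if is = ks then e else 0)"
  by (rule Cons.IH) (use Cons.prems js in auto)
 then show ?case using W j by (simp add: js sc)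
qed simp

lemma altf_zero_on_basis:
 fixes sc :: "'k => 'b::ab_group_add => 'b" and V :: "('k, 'v, 'r) module_scheme"
 assumes V: "vectorspace K V" and p: "linear_on K V (free_space K {..<d}) (carrier V) p" "p ` carrier V = carrier (free_space K {..<d})"
  "!!z. z : carrier V ==> p z = (%j. zero K) \<longleftrightarrow> z : {zero V}"
  and L: "alt_forms (carrier K) sc" "!!v. sc \<zero>\<^bsub>K\<^esub> v = 0"
  and f: "alt_forms.altf (add V) (smult V) (carrier K) sc (carrier V) n f"
  "!!js. js : inc_lists d n ==> f (map (basis_vec K V p) js) = 0"
  and xs: "xs : tups (carrier V) n"
 shows "f xs = 0"
proof -
 interpret V: vectorspace K V by (rule V)
 interpret alt_forms "add V" "smult V" "carrier K" sc by (rule L(1))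
 let ?b = "basis_vec K V p"
 note bv = basis_vec[OF V.field_axioms p(2)]
 show ?thesis
 proof (cases "d = 0")
  case True
  \<comment> \<open>Without any basis vector the closure conditions on T below do not force T to
    contain zero. In this case the space is zero, and f vanishes by homogeneity with the scalar 0,
    or, in degree 0, because the empty list is increasing.\<close>
  have V0: "x = zero K \<odot>\<^bsub>V\<^esub> x" if x: "x : carrier V" for x
  proof -
  have "p x = (%j. zero K)" using linear_onD(1)[OF p(1) x] True by (auto simp: free_space_simps)
  then show ?thesis using p(3)[OF x] x by simp
  qed
  show ?thesis
  proof (cases n)
  case 0
  have "[] : inc_lists d n" using 0 by (simp add: inc_lists_def)
  then show ?thesis using f(2)[of "[]"] xs 0 by simp
  next
  case (Suc m)
  from xs[unfolded Suc] obtain x ys where x: "xs = x # ys" "x : carrier V" "ys : tups (carrier V) m" by (rule tups_SucE)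
  have "ALL a:carrier K. ALL x:carrier V. ALL xs:tups (carrier V) m. f (a \<odot>\<^bsub>V\<^esub> x # xs) = sc a (f (x # xs))"
  using f(1) unfolding Suc altf.simps(2) by blast
  then have "f (\<zero>\<^bsub>K\<^esub> \<odot>\<^bsub>V\<^esub> x # ys) = sc \<zero>\<^bsub>K\<^esub> (f (x # ys))"
  using x V.R.zero_closed by blast
  then show ?thesis unfolding x(1) V0[OF x(2), symmetric] by (simp add: L(2))
  qed
 next
  case False
  show ?thesis
  proof (rule altf_zero_on_increasing[OF _ _ _ f(1) _ xs, where b = ?b and d = d])
  show "subsp_on (carrier V)" by (auto simp: subsp_on_def)
  show "?b ` {..<d} <= carrier V" using bv(1) by auto
  show "f (map ?b js) = 0" if "js : tups {..<d} n" "sorted_wrt (<) js" for js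
  using f(2) that by (simp add: inc_lists_def)
  fix T assume T: "?b ` {..<d} <= T" "T <= carrier V" "!!x y. x : T ==> y : T ==> x \<oplus>\<^bsub>V\<^esub> y : T"
  "!!a x. a : carrier K ==> x : T ==> a \<odot>\<^bsub>V\<^esub> x : T"
  have b0: "?b 0 : T" using T(1) False by auto
  then have "zero V : T" using T(4)[of "zero K" "?b 0"] T(2) by auto
  then have lT: "linsub K V T" using T by (simp add: linsub_def)
  show "carrier V <= T"
  proof (rule has_basis_induct[OF V p(1) p(2) p(3) finite_lessThan lT])
  fix j z assume j: "j : {..<d}" "z : carrier V" "p z = free_gen K j"
  have "z = ?b j"
  using V.qdim_diff_iff[OF V.linsub_carrier p(1) p(3), of z "?b j"] bv[OF j(1)] j by (simp add: V.diff_zero_iff)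
  then show "z : T" using T(1) j(1) by auto
  qed
  qed
 qed
qed

lemma exterior_rels_sub:
 assumes K: "field K" and V: "vectorspace K V"
 shows "exterior_rels K n V <= carrier (free_space K (tuples V n))"
proof -
 let ?F = "free_space K (tuples V n)"
 interpret F: vectorspace K ?F by (rule free_space_vs[OF K])
 interpret V: vectorspace K V by (rule V)
 have upd: "xs[i := x] : tuples V n" if "xs : tuples V n" "x : carrier V" for xs i x
  using that set_update_subset_insert[of xs i x] by (auto simp: tuples_def)
 have g: "free_gen K xs : carrier ?F" if "xs : tuples V n" for xs
  by (rule free_gen_closed[OF K that])
 show ?thesis
  unfolding exterior_rels_def Let_def using g upd by (auto simp: F.M.minus_closed)
qed

text \<open>The dual functionals are the forms \<open>dual_form\<close> for the coordinate forms.
  That each generator is congruent to the combination given by these functionals is an identity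
  between two alternating forms with values in the quotient, so it is checked on increasing tuples
  of basis vectors.\<close>

lemma has_basis_exterior:
 fixes K :: "'k ring"
 assumes K: "field K" and V: "vectorspace K V" and hV: "has_basis K V {..<d}"
 shows "vectorspace K (exterior_power K n V)" "has_basis K (exterior_power K n V) (inc_lists d n)"
proof -
 interpret field K by fact
 interpret KR: rng_emb K by unfold_locales (rule rng_cring[OF is_cring])
 let ?S = "tuples V n"
 let ?F = "free_space K ?S"
 interpret F: vectorspace K ?F by (rule free_space_vs[OF K])
 interpret V: vectorspace K V by (rule V)
 let ?R = "exterior_rels K n V"
 let ?B = "F.span ?R"
 have R: "?R <= carrier ?F" by (rule exterior_rels_sub[OF K V])
 have B: "linsub K ?F ?B" by (rule F.linsub_span[OF R])
 have RB: "f : ?B" if "f : ?R" for f using F.in_own_span[OF R] that by auto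
 obtain p where p: "linear_on K V (free_space K {..<d}) (carrier V) p" "p ` carrier V = carrier (free_space K {..<d})"
  "!!z. z : carrier V ==> p z = (%j. zero K) \<longleftrightarrow> z : {zero V}" using hV unfolding qdim_def by blast
 have pK: "p v j : carrier K" if "v : carrier V" for v j using linear_onD(1)[OF p(1) that] by (simp add: free_space_simps)
 have padd: "p (x \<oplus>\<^bsub>V\<^esub> y) j = p x j \<oplus>\<^bsub>K\<^esub> p y j" if "x : carrier V" "y : carrier V" for x y j
  using linear_onD(2)[OF p(1) that] by (simp add: free_space_simps)
 have psm: "p (a \<odot>\<^bsub>V\<^esub> y) j = a \<otimes>\<^bsub>K\<^esub> p y j" if "a : carrier K" "y : carrier V" for a y j
  using linear_onD(3)[OF p(1) that] by (simp add: free_space_simps)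
 let ?b = "basis_vec K V p"
 note bv = basis_vec[OF K p(2)]
 let ?J = "inc_lists d n"
 let ?sc = "%a F. embed K a * F"
 interpret A: alt_forms "add V" "smult V" "carrier K" ?sc by unfold_locales (simp add: distrib_left)
 have sV: "A.subsp_on (carrier V)" by (auto simp: A.subsp_on_def)
 let ?\<omega> = "dual_form ?sc (%i v. p v i) (embed K \<one>\<^bsub>K\<^esub>)"
 have alt: "A.altf (carrier V) (length js) (?\<omega> js)" for js
 proof (induction js)
  case (Cons j js)
  show ?case unfolding dual_form.simps list.size(4) add_Suc_right add_0_right
  by (rule A.altf_wedge[OF sV _ _ _ _ Cons])
  (simp_all add: pK padd psm KR.embed_add KR.embed_mult distrib_right mult.assoc mult.left_commute)
 qed simp
 define \<beta> where "\<beta> js xs = pick K (?\<omega> js xs)" for js xs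
 define s where "s = map ?b"
 have upd: "xs[i := x] : ?S" if "xs : ?S" "x : carrier V" for xs i x
  using that set_update_subset_insert[of xs i x] by (auto simp: tuples_def)
 have \<beta>K: "\<beta> js x : carrier K" for js x by (simp add: \<beta>_def)
 have Jlen: "length js = n" "sorted_wrt (<) js" "set js <= {..<d}" if "js : ?J" for js
  using that by (auto simp: inc_lists_def tups_def)
 have alt': "A.altf (carrier V) n (?\<omega> js)" if "js : ?J" for js using alt[of js] Jlen(1)[OF that] by simp
 have \<beta>add: "\<beta> js (xs[i := x \<oplus>\<^bsub>V\<^esub> y]) = \<beta> js (xs[i := x]) \<oplus>\<^bsub>K\<^esub> \<beta> js (xs[i := y])"
  if "js : ?J" "xs : ?S" "i < n" "x : carrier V" "y : carrier V" for js xs i x y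
  using A.altf_slot_add[OF alt'[OF that(1)]] that(2-) by (simp add: \<beta>_def tuples_tups KR.proj_hom)
 have \<beta>sm: "\<beta> js (xs[i := a \<odot>\<^bsub>V\<^esub> x]) = a \<otimes>\<^bsub>K\<^esub> \<beta> js (xs[i := x])"
  if "js : ?J" "xs : ?S" "i < n" "x : carrier V" "a : carrier K" for js xs i x a
  using A.altf_slot_smult[OF alt'[OF that(1)]] that(2-) by (simp add: \<beta>_def tuples_tups KR.proj_hom)
 have \<beta>dup: "\<beta> js xs = zero K" if "js : ?J" "xs : ?S" "~ distinct xs" for js xs
  using A.altf_not_distinct[OF sV alt'[OF that(1)]] that(2-) by (simp add: \<beta>_def tuples_tups KR.proj_hom)
 have fin: "finite ?J" by (rule card_inc_lists(2))
 have sS: "s ` ?J <= ?S" 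
 proof
  fix x assume "x : s ` ?J"
  then obtain js where js: "js : ?J" "x = map ?b js" by (auto simp: s_def)
  then have "ALL j:set js. ?b j : carrier V" using bv(1) Jlen(3)[OF js(1)] by blast
  then show "x : ?S" using js Jlen(1)[OF js(1)] by (auto simp: tuples_def)
 qed
 have delta: "\<beta> i (s j) = (if i = j then one K else zero K)" if ij: "i : ?J" "j : ?J" for i j
 proof -
  have "?\<omega> i (map ?b j) = (if i = j then embed K \<one>\<^bsub>K\<^esub> else 0)"
  proof (rule dual_form_basis[where d = d and E = "%v. embed K \<one>\<^bsub>K\<^esub> * v"])
  show "embed K (p (?b k) l) * v = (if l = k then embed K \<one>\<^bsub>K\<^esub> * v else 0)" if "k < d" for k l v
  using bv(2)[of k] that by (simp add: free_gen_def)
  show "embed K \<one>\<^bsub>K\<^esub> * embed K \<one>\<^bsub>K\<^esub> = embed K \<one>\<^bsub>K\<^esub>" using KR.embed_mult[of "\<one>\<^bsub>K\<^esub>" "\<one>\<^bsub>K\<^esub>"] by simp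
  qed (use Jlen ij in auto)
  then show ?thesis by (simp add: \<beta>_def s_def KR.proj_hom)
 qed
 have injs: "inj_on s ?J"
 proof (rule inj_onI)
  fix i j assume "i : ?J" "j : ?J" "s i = s j"
  then show "i = j" using delta[of i i] delta[of i j] by (metis one_not_zero)
 qed
 note C = free_comb_props[OF K fin injs sS]
 let ?e = "%xs. free_gen K xs"
 let ?c = "%xs. free_comb K ?J s (%j. \<beta> j xs)"
 have e: "?e xs : carrier ?F" if "xs : ?S" for xs by (rule free_gen_closed[OF K that])
 have cF: "?c xs : carrier ?F" for xs by (rule C(1)) (use \<beta>K in auto)
 have kill: "free_ext K (\<beta> j) f = zero K" if j: "j : ?J" and f: "f : ?R" for j f
 proof -
  have b: "!!x. x : ?S ==> \<beta> j x : carrier K" by (rule \<beta>K)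
  note D = free_ext_diff[where S = ?S and b = "\<beta> j", OF K b] and Ad = free_ext_props(2)[where S = ?S and b = "\<beta> j", OF K b]
  and Sm = free_ext_props(3)[where S = ?S and b = "\<beta> j", OF K b] and G = free_ext_props(4)[where S = ?S and b = "\<beta> j", OF K b]
  from f consider
  (1) xs i x y where "f = ?e (xs[i := x \<oplus>\<^bsub>V\<^esub> y]) \<ominus>\<^bsub>?F\<^esub> (?e (xs[i := x]) \<oplus>\<^bsub>?F\<^esub> ?e (xs[i := y]))"
  "xs : ?S" "i < n" "x : carrier V" "y : carrier V"
  | (2) xs i a x where "f = ?e (xs[i := a \<odot>\<^bsub>V\<^esub> x]) \<ominus>\<^bsub>?F\<^esub> (a \<odot>\<^bsub>?F\<^esub> ?e (xs[i := x]))"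
  "xs : ?S" "i < n" "a : carrier K" "x : carrier V"
  | (3) xs where "f = ?e xs" "xs : ?S" "~ distinct xs"
  unfolding exterior_rels_def Let_def by blast
  then show ?thesis
  proof cases
  case 1
  then show ?thesis by (simp add: D Ad G e upd \<beta>add[OF j] \<beta>K diff_eq_zero)
  next
  case 2
  then show ?thesis by (simp add: D Sm G e upd \<beta>sm[OF j] \<beta>K diff_eq_zero)
  next
  case 3
  then show ?thesis by (simp add: G \<beta>dup[OF j])
  qed
 qed
 have kill': "free_ext K (\<beta> j) f = zero K" if "j : ?J" "f : ?B" for j f
  by (rule free_ext_vanishes_on_span[OF K \<beta>K R kill[OF that(1)] that(2)])
 have r1: "?e (xs[i := x \<oplus>\<^bsub>V\<^esub> y]) \<ominus>\<^bsub>?F\<^esub> (?e (xs[i := x]) \<oplus>\<^bsub>?F\<^esub> ?e (xs[i := y])) : ?B"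
  if "xs : ?S" "i < n" "x : carrier V" "y : carrier V" for xs i x y
  by (rule RB) (use that in "unfold exterior_rels_def Let_def, blast")
 have r2: "?e (xs[i := a \<odot>\<^bsub>V\<^esub> x]) \<ominus>\<^bsub>?F\<^esub> (a \<odot>\<^bsub>?F\<^esub> ?e (xs[i := x])) : ?B"
  if "xs : ?S" "i < n" "a : carrier K" "x : carrier V" for xs i a x
  by (rule RB) (use that in "unfold exterior_rels_def Let_def, blast")
 have r3: "?e xs : ?B" if "xs : ?S" "~ distinct xs" for xs
  by (rule RB) (use that in "unfold exterior_rels_def Let_def, blast")
 have c1: "?c (xs[i := x \<oplus>\<^bsub>V\<^esub> y]) = ?c (xs[i := x]) \<oplus>\<^bsub>?F\<^esub> ?c (xs[i := y])"
  if "xs : ?S" "i < n" "x : carrier V" "y : carrier V" for xs i x y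
  unfolding C(2)[symmetric] by (rule C(5)) (rule \<beta>add[OF _ that])
 have c2: "?c (xs[i := a \<odot>\<^bsub>V\<^esub> x]) = a \<odot>\<^bsub>?F\<^esub> ?c (xs[i := x])"
  if "xs : ?S" "i < n" "a : carrier K" "x : carrier V" for xs i a x
  unfolding C(3)[OF that(3), symmetric] by (rule C(5)) (rule \<beta>sm[OF _ that(1,2,4,3)])
 have c3: "?c xs = \<zero>\<^bsub>?F\<^esub>" if "xs : ?S" "~ distinct xs" for xs
 proof -
  have "?c xs = free_comb K ?J s (%j. zero K)" by (rule C(5)) (rule \<beta>dup[OF _ that])
  then show ?thesis by (auto simp: free_comb_def free_space_simps(2))
 qed
 let ?Q = "quot_space ?F ?B"
 interpret Q: vectorspace K ?Q by (rule F.quot_space_vs[OF B])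
 note QS = F.quot_space_simps[OF B]
 \<comment> \<open>The quotient serves as a space of values: equipped with the zero product it is
   embedded into \<open>amb\<close>, and the theory of alternating forms applies to it.\<close>
 interpret QR: rng_emb "null_ring ?Q" by unfold_locales (rule rng_null_ring[OF Q.abelian_group_axioms])
 let ?scQ = "%a F. embed (null_ring ?Q) (a \<odot>\<^bsub>?Q\<^esub> pick (null_ring ?Q) F)"
 have pc: "pick (null_ring ?Q) F : carrier ?Q" for F using QR.proj_closed[of F] by simp
 have iadd: "embed (null_ring ?Q) (x \<oplus>\<^bsub>?Q\<^esub> y) = embed (null_ring ?Q) x + embed (null_ring ?Q) y" if "x : carrier ?Q" "y : carrier ?Q" for x y
  using QR.embed_add[of x y] that by simp
 have scQ: "alt_forms (carrier K) ?scQ"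
  by unfold_locales (simp add: QR.proj_hom(2) Q.smult_r_distr pc iadd)
 interpret AQ: alt_forms "add V" "smult V" "carrier K" ?scQ by (rule scQ)
 have sV': "AQ.subsp_on (carrier V)" by (auto simp: AQ.subsp_on_def)
 let ?i = "%f. embed (null_ring ?Q) (?B +>\<^bsub>?F\<^esub> f)"
 have clQ: "?B +>\<^bsub>?F\<^esub> f : carrier ?Q" if "f : carrier ?F" for f using that by (simp add: QS)
 have i_add: "?i (f \<oplus>\<^bsub>?F\<^esub> g) = ?i f + ?i g" if "f : carrier ?F" "g : carrier ?F" for f g
  using iadd[OF clQ[OF that(1)] clQ[OF that(2)]] QS(3)[OF that] by simp
 have i_sm: "?i (a \<odot>\<^bsub>?F\<^esub> f) = ?scQ a (?i f)" if "a : carrier K" "f : carrier ?F" for a f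
  using QS(4)[OF that] QR.proj_embed[of "?B +>\<^bsub>?F\<^esub> f"] clQ[OF that(2)] by simp
 have i_cong: "?i f = ?i g" if "f \<ominus>\<^bsub>?F\<^esub> g : ?B" "f : carrier ?F" "g : carrier ?F" for f g
  using F.coset_eq[OF B that(2,3)] that(1) by simp
 have i_zero: "?i \<zero>\<^bsub>?F\<^esub> = 0" using QR.embed_zero QS(2) by simp
 have alt1: "AQ.altf (carrier V) n (%xs. ?i (?e xs))"
 proof (rule AQ.altf_intro)
  fix xs i x y assume x: "xs : tups (carrier V) n" "i < n" "x : carrier V" "y : carrier V"
  then have xs: "xs : ?S" by (simp add: tuples_tups)
  have "?i (?e (xs[i := x \<oplus>\<^bsub>V\<^esub> y])) = ?i (?e (xs[i := x]) \<oplus>\<^bsub>?F\<^esub> ?e (xs[i := y]))"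
  by (rule i_cong) (use r1 x xs e upd in auto)
  then show "?i (?e (xs[i := x \<oplus>\<^bsub>V\<^esub> y])) = ?i (?e (xs[i := x])) + ?i (?e (xs[i := y]))"
  using i_add e upd xs x by simp
 next
  fix xs i a x assume x: "xs : tups (carrier V) n" "i < n" "a : carrier K" "x : carrier V"
  then have xs: "xs : ?S" by (simp add: tuples_tups)
  have "?i (?e (xs[i := a \<odot>\<^bsub>V\<^esub> x])) = ?i (a \<odot>\<^bsub>?F\<^esub> ?e (xs[i := x]))"
  by (rule i_cong) (use r2 x xs e upd in auto)
  then show "?i (?e (xs[i := a \<odot>\<^bsub>V\<^esub> x])) = ?scQ a (?i (?e (xs[i := x])))"
  using i_sm e upd xs x by simp
 next
  fix xs assume x: "xs : tups (carrier V) n" "~ distinct xs"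
  then have xs: "xs : ?S" by (simp add: tuples_tups)
  have "?i (?e xs) = ?i \<zero>\<^bsub>?F\<^esub>"
  by (rule i_cong) (use r3 x xs e F.diff_zero_right in auto)
  then show "?i (?e xs) = 0" by (simp only: i_zero)
 qed
 have alt2: "AQ.altf (carrier V) n (%xs. ?i (?c xs))"
 proof (rule AQ.altf_intro)
  fix xs i x y assume x: "xs : tups (carrier V) n" "i < n" "x : carrier V" "y : carrier V"
  then have xs: "xs : ?S" by (simp add: tuples_tups)
  show "?i (?c (xs[i := x \<oplus>\<^bsub>V\<^esub> y])) = ?i (?c (xs[i := x])) + ?i (?c (xs[i := y]))"
  unfolding c1[OF xs x(2-)] by (rule i_add[OF cF cF])
 next
  fix xs i a x assume x: "xs : tups (carrier V) n" "i < n" "a : carrier K" "x : carrier V"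
  then have xs: "xs : ?S" by (simp add: tuples_tups)
  show "?i (?c (xs[i := a \<odot>\<^bsub>V\<^esub> x])) = ?scQ a (?i (?c (xs[i := x])))"
  unfolding c2[OF xs x(2-)] by (rule i_sm[OF x(3) cF])
 next
  fix xs assume x: "xs : tups (carrier V) n" "~ distinct xs"
  then have xs: "xs : ?S" by (simp add: tuples_tups)
  show "?i (?c xs) = 0" unfolding c3[OF xs x(2)] by (rule i_zero)
 qed
 have D: "?e xs \<ominus>\<^bsub>?F\<^esub> ?c xs : ?B" if xs: "xs : ?S" for xs
 proof -
  have "?i (?e xs) - ?i (?c xs) = 0"
  proof (rule altf_zero_on_basis[OF V p scQ, where f = "%xs. ?i (?e xs) - ?i (?c xs)"])
  show "?scQ \<zero>\<^bsub>K\<^esub> v = 0" for v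
  using QR.embed_zero Q.smult_l_null[OF pc] by simp
  show "AQ.altf (carrier V) n (%xs. ?i (?e xs) - ?i (?c xs))" by (rule AQ.altf_diff[OF alt1 alt2])
  show "xs : tups (carrier V) n" using xs by (simp add: tuples_tups)
  fix js assume js: "js : ?J"
  have "?c (s js) = ?e (s js)" by (rule C(4)[OF js]) (use delta js in auto)
  then show "?i (?e (map ?b js)) - ?i (?c (map ?b js)) = 0" by (simp add: s_def)
  qed
  then have "?B +>\<^bsub>?F\<^esub> ?e xs = ?B +>\<^bsub>?F\<^esub> ?c xs"
  using QR.embed_inject[of "?B +>\<^bsub>?F\<^esub> ?e xs" "?B +>\<^bsub>?F\<^esub> ?c xs"] clQ[OF e[OF xs]] clQ[OF cF] by simp
  then show ?thesis using F.coset_eq[OF B e[OF xs] cF] by simp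
 qed
 have "qdim K ?F (carrier ?F) ?B ?J"
  by (rule qdim_free_quotient[where s = s and \<beta> = \<beta>, OF K B fin sS \<beta>K delta kill' D])
 then have "has_basis K ?Q ?J" by (simp add: F.has_basis_quot_iff[OF B])
 then show "has_basis K (exterior_power K n V) ?J" by (simp add: exterior_power_def Let_def)
 show "vectorspace K (exterior_power K n V)" using F.quot_space_vs[OF B] by (simp add: exterior_power_def Let_def)
qed

section \<open>A faithful representation of a Lie algebra\<close>

text \<open>The Poincare--Birkhoff--Witt representation on the span of the sorted words, for a Lie algebra
  given by structure constants. The idempotent \<open>e\<close> plays the role of the unit of the base ring.\<close>

locale pbw =
 fixes d :: nat and c :: "nat => nat => nat => 'r::comm_ring" and e :: 'r
 assumes ee: "e * e = e" and ec: "e * c i j k = c i j k"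
  and anti: "i < d ==> j < d ==> c i j k = - c j i k" and self: "i < d ==> c i i k = 0"
  and jac: "i < d ==> j < d ==> k < d ==> l < d ==>
  (\<Sum>m<d. c j k m * c i m l + c k i m * c j m l + c i j m * c k m l) = 0"
begin

text \<open>Sorted words stand for ordered monomials; \<open>words n\<close> indexes those of degree
  at most n.\<close>

definition words :: "nat => nat list set"
 where "words n = {S. sorted S & set S <= {..<d} & length S <= n}"

lemma finite_words: "finite (words n)"
 by (rule finite_subset[OF _ finite_lists_length_le[of "{..<d}" n]]) (auto simp: words_def)

lemma words_mono: "n <= m ==> S : words n ==> S : words m"
 by (auto simp: words_def)

lemma words_insort: "S : words n ==> i < d ==> insort i S : words (Suc n)"
 by (auto simp: words_def sorted_insort set_insort_key)

definition monomial :: "nat list => nat list => 'r"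
 where "monomial S = (%T. if T = S then e else 0)"

text \<open>The action of the basis element x_i on an ordered monomial. If the word j T begins with
  j < i, the rule is x_i x_j T = x_j x_i T + [x_i, x_j] T. In x_i T the leading monomial
  \<open>insort i T\<close> is separated off, since x_j merely prefixes it with j; the rest has
  degree at most that of T, so x_j is applied to it by recursion. Restricting the sum to
  \<open>words (length T)\<close> makes the recursion terminate.\<close>

function wact :: "nat => nat list => nat list => 'r" where
 "wact i [] = monomial [i]"
| "wact i (j # T) = (%U. if i <= j then monomial (i # j # T) U else monomial (insort i (j # T)) U
  + (\<Sum>S\<in>words (length T). (wact i T S - monomial (insort i T) S) * wact j S U)
  + (\<Sum>k<d. c i j k * wact k T U))"
 by pat_completeness auto
termination by (relation "measure (%(i, S). length S)") (auto simp: words_def)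

declare wact.simps(2) [simp del]

definition good :: "nat => (nat list => 'r) => bool"
 where "good n f \<longleftrightarrow> (ALL S. f S ~= 0 --> S : words n) & (ALL S. e * f S = f S)"

lemma good_mono: "n <= m ==> good n f ==> good m f"
 using words_mono unfolding good_def by blast

lemma good_add: "good n f ==> good n g ==> good n (%U. f U + g U)"
 unfolding good_def by (metis add_cancel_right_left distrib_left)

lemma good_minus: "good n f ==> good n (%U. - f U)"
 unfolding good_def by simp

lemma good_scale: "good n f ==> good n (%U. a * f U)"
 unfolding good_def by (metis mult.left_commute mult_zero_right)

lemma good_zero: "good n (%U. 0)"
 unfolding good_def by simp

lemma good_sum: "(!!x. x : X ==> good n (F x)) ==> good n (%U. \<Sum>x\<in>X. F x U)"
 by (induction X rule: infinite_finite_induct) (auto simp: good_zero good_add)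

lemma good_mono_word: "S : words n ==> good n (monomial S)"
 unfolding good_def monomial_def by (simp add: ee)

text \<open>The sorted insertion is the leading term: everything else has degree at most
  \<open>length S\<close>. Hence the restricted sum in the definition of \<open>wact\<close> omits
  nothing.\<close>

lemma good_wact_diff:
 "sorted S ==> set S <= {..<d} ==> i < d ==> good (length S) (%U. wact i S U - monomial (insort i S) U)"
proof (induction "length S" arbitrary: S i rule: less_induct)
 case less
 show ?case
 proof (cases S)
  case Nil
  then show ?thesis by (simp add: good_zero)
 next
  case (Cons j T)
  show ?thesis
  proof (cases "i <= j")
  case True
  then show ?thesis by (simp add: Cons wact.simps(2) good_zero)
  next
  case False
  have T: "sorted T" "set T <= {..<d}" "j < d" using less.prems Cons by auto
  have w: "good (Suc (length R)) (wact l R)" if "sorted R" "set R <= {..<d}" "length R <= length T" "l < d" for R l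
  proof -
  have "good (length R) (%U. wact l R U - monomial (insort l R) U)"
  by (rule less.hyps) (use that Cons in auto)
  then have "good (Suc (length R)) (%U. wact l R U - monomial (insort l R) U)" by (rule good_mono[rotated]) simp
  moreover have "good (Suc (length R)) (monomial (insort l R))"
  by (rule good_mono_word, rule words_insort) (use that in "auto simp: words_def")
  ultimately show ?thesis using good_add[of "Suc (length R)"] by fastforce
  qed
  have "good (Suc (length T)) (%U. (\<Sum>R\<in>words (length T). (wact i T R - monomial (insort i T) R) * wact j R U))"
  proof (rule good_sum, rule good_scale)
  fix R assume "R : words (length T)"
  then have R: "sorted R" "set R <= {..<d}" "length R <= length T" by (auto simp: words_def)
  show "good (Suc (length T)) (wact j R)"
  by (rule good_mono[OF _ w[OF R T(3)]]) (use R in simp)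
  qed
  moreover have "good (Suc (length T)) (%U. (\<Sum>k<d. c i j k * wact k T U))"
  by (rule good_sum, rule good_scale, rule w) (use T in auto)
  ultimately have "good (Suc (length T)) (%U. (\<Sum>R\<in>words (length T). (wact i T R - monomial (insort i T) R) * wact j R U)
  + (\<Sum>k<d. c i j k * wact k T U))" by (rule good_add)
  then show ?thesis using False by (simp add: Cons wact.simps(2) add.assoc)
  qed
 qed
qed

lemma good_wact:
 assumes "S : words n" "i < d"
 shows "good (Suc n) (wact i S)"
proof -
 have "good (length S) (%U. wact i S U - monomial (insort i S) U)"
  by (rule good_wact_diff) (use assms in "auto simp: words_def")
 then have "good (Suc n) (%U. wact i S U - monomial (insort i S) U)"
  by (rule good_mono[rotated]) (use assms in "simp add: words_def")
 moreover have "good (Suc n) (monomial (insort i S))" by (rule good_mono_word, rule words_insort) (use assms in auto)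
 ultimately show ?thesis using good_add[of "Suc n" "%U. wact i S U - monomial (insort i S) U" "monomial (insort i S)"] by simp
qed

text \<open>The linear operator of x_i, truncated to words of length at most N so that it is a sum
  over a fixed finite set. On elements of degree n at most N it does not depend on N.\<close>

definition bop :: "nat => nat => (nat list => 'r) => nat list => 'r"
 where "bop N i f U = (\<Sum>S\<in>words N. f S * wact i S U)"

lemma bop_add: "bop N i (%U. f U + g U) U = bop N i f U + bop N i g U"
 by (simp add: bop_def distrib_right sum.distrib)

lemma bop_diff: "bop N i (%U. f U - g U) U = bop N i f U - bop N i g U"
 by (simp add: bop_def left_diff_distrib sum_subtractf)

lemma bop_scale: "bop N i (%U. a * f U) U = a * bop N i f U"
 by (simp add: bop_def sum_distrib_left mult.assoc)

lemma bop_sum: "bop N i (%U. \<Sum>x\<in>X. F x U) U = (\<Sum>x\<in>X. bop N i (F x) U)"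
 unfolding bop_def by (subst sum.swap) (simp add: sum_distrib_right)

lemma bop_good:
 assumes "good n f" "n <= N"
 shows "bop N i f U = (\<Sum>S\<in>words n. f S * wact i S U)"
proof -
 have "f S = 0" if "S ~: words n" for S using assms(1) that unfolding good_def by blast
 then show ?thesis unfolding bop_def
  by (intro sum.mono_neutral_right[OF finite_words]) (use words_mono[OF assms(2)] in auto)
qed

lemma good_bop:
 assumes "good n f" "n <= N" "i < d"
 shows "good (Suc n) (bop N i f)"
proof -
 have "good (Suc n) (%U. \<Sum>S\<in>words n. f S * wact i S U)"
  by (rule good_sum, rule good_scale, rule good_wact) (use assms in auto)
 moreover have "bop N i f = (%U. \<Sum>S\<in>words n. f S * wact i S U)"
  by (rule ext) (rule bop_good[OF assms(1,2)])
 ultimately show ?thesis by simp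
qed

lemma bop_mono:
 assumes "S : words n" "n <= N" "i < d"
 shows "bop N i (monomial S) U = wact i S U"
proof -
 have "bop N i (monomial S) U = (\<Sum>T\<in>words N. if T = S then e * wact i S U else 0)"
  unfolding bop_def monomial_def by (rule sum.cong) auto
 also have "... = e * wact i S U" using words_mono[OF assms(2,1)] by (simp add: finite_words)
 also have "... = wact i S U" using good_wact[OF assms(1,3)] by (simp add: good_def)
 finally show ?thesis .
qed

lemma wact_small: "sorted (i # S) ==> wact i S = monomial (i # S)"
 by (cases S) (auto simp: wact.simps(2) fun_eq_iff)

text \<open>The defining rule of \<open>wact\<close>, read as a relation between operators: the
  leading monomial of x_i T is prefixed with k and stays sorted, because k T is sorted and k <
  i.\<close>

lemma wact_large:
 assumes S: "sorted (k # T)" "set (k # T) <= {..<d}" and i: "k < i" "i < d" and N: "Suc (length T) <= N"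
 shows "wact i (k # T) U = bop N k (wact i T) U + (\<Sum>m<d. c i k m * wact m T U)"
proof -
 have T: "sorted T" "set T <= {..<d}" "k < d" using S by auto
 have insort: "insort i (k # T) = k # insort i T" using i by simp
 have U: "insort i T : words (Suc (length T))" by (rule words_insort) (use T i in "auto simp: words_def")
 have "sorted (k # insort i T)" using S(1) i by (auto simp: sorted_insort set_insort_key)
 then have 1: "bop N k (monomial (insort i T)) U = monomial (insort i (k # T)) U"
  using bop_mono[OF U N T(3)] i by (simp add: wact_small insort)
 have 2: "bop N k (%U. wact i T U - monomial (insort i T) U) U =
  (\<Sum>S\<in>words (length T). (wact i T S - monomial (insort i T) S) * wact k S U)"
  by (rule bop_good[OF good_wact_diff]) (use T i N in auto)
 have "bop N k (wact i T) U = monomial (insort i (k # T)) U + (\<Sum>S\<in>words (length T). (wact i T S - monomial (insort i T) S) * wact k S U)"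
  using 2 unfolding bop_diff 1 by (simp add: algebra_simps)
 then show ?thesis using i by (simp add: wact.simps(2))
qed

lemma bop_comm_extend:
 assumes comm: "!!S. S : words n ==> bop N i (wact j S) U - bop N j (wact i S) U = (\<Sum>k<d. c i j k * wact k S U)"
  and f: "good n f" "n <= N"
 shows "bop N i (bop N j f) U - bop N j (bop N i f) U = (\<Sum>k<d. c i j k * bop N k f U)"
proof -
 have eq: "bop N l f = (%U. \<Sum>S\<in>words n. f S * wact l S U)" for l
  by (rule ext) (rule bop_good[OF f])
 have "bop N i (bop N j f) U - bop N j (bop N i f) U =
  (\<Sum>S\<in>words n. f S * (bop N i (wact j S) U - bop N j (wact i S) U))"
  unfolding eq bop_sum bop_scale by (simp add: right_diff_distrib sum_subtractf)
 also have "... = (\<Sum>S\<in>words n. f S * (\<Sum>k<d. c i j k * wact k S U))"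
  by (rule sum.cong) (simp_all add: comm)
 also have "... = (\<Sum>k<d. c i j k * (\<Sum>S\<in>words n. f S * wact k S U))"
  unfolding sum_distrib_left by (subst sum.swap) (simp add: mult.left_commute)
 finally show ?thesis by (simp only: eq)
qed

text \<open>The core of the Poincare-Birkhoff-Witt theorem, by induction on the degree. If one of i
  and j can be prefixed to S, the relation holds by construction, up to antisymmetry. Otherwise S =
  k T with k smaller than both; x_i and x_j are moved past x_k, the induction hypothesis is applied
  to T, and the remaining terms cancel by the Jacobi identity.\<close>

lemma wact_comm:
 "S : words n ==> n + 2 <= N ==> i < d ==> j < d ==>
  bop N i (wact j S) U - bop N j (wact i S) U = (\<Sum>k<d. c i j k * wact k S U)"
proof (induction n arbitrary: S i j U)
 case 0
 have small: "bop N i (wact j []) U - bop N j (wact i []) U = (\<Sum>k<d. c i j k * wact k [] U)"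
  if "j < i" "i < d" "j < d" for i j
 proof -
  have "bop N i (wact j []) U = wact i [j] U"
  using bop_mono[of "[j]" "Suc 0" N i U] that 0 by (simp add: words_def)
  then show ?thesis using wact_large[of j "[]" i N U] that 0 by simp
 qed
 have S: "S = []" using 0 by (simp add: words_def)
 consider "j < i" | "i < j" | "i = j" by linarith
 then show ?case
 proof cases
  case 1
  then show ?thesis using small 0 S by simp
 next
  case 2
  have "(\<Sum>k<d. c i j k * wact k [] U) = - (\<Sum>k<d. c j i k * wact k [] U)"
  unfolding sum_negf[symmetric] by (rule sum.cong) (use 0 in "simp_all add: anti[of i j]")
  then show ?thesis using small[of i j] 2 0 S by (simp add: algebra_simps)
 next
  case 3
  then show ?thesis using 0 by (simp add: self)
 qed
next
 case (Suc n)
 note IH = Suc.IH and N = Suc.prems(2)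
 have small: "bop N i (wact j S) U - bop N j (wact i S) U = (\<Sum>k<d. c i j k * wact k S U)"
  if "j < i" "sorted (j # S)" "i < d" "j < d" for i j
 proof -
  have jS: "j # S : words (Suc (Suc n))" using that Suc.prems(1) by (auto simp: words_def)
  have "bop N i (wact j S) U = wact i (j # S) U"
  using bop_mono[OF jS, of N i U] that N by (simp add: wact_small)
  then show ?thesis using wact_large[of j S i N U] that Suc.prems(1) N by (simp add: words_def)
 qed
 have flip: "(\<Sum>k<d. c i j k * wact k S U) = - (\<Sum>k<d. c j i k * wact k S U)" if "i < d" "j < d" for i j
  unfolding sum_negf[symmetric] by (rule sum.cong) (use that in "simp_all add: anti[of i j]")
 have i: "i < d" "j < d" using Suc.prems by auto
 consider (eq) "i = j" | (a) "j < i" "sorted (j # S)" | (b) "i < j" "sorted (i # S)"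
  | (main) k T where "S = k # T" "k < i" "k < j"
 proof (cases S)
  case Nil
  then show ?thesis using that by (metis linorder_neqE_nat sorted1)
 next
  case (Cons k T)
  have so: "sorted (l # S)" if "l <= k" for l using that Cons Suc.prems(1) by (auto simp: words_def)
  show ?thesis using that so Cons by (metis linorder_neqE_nat not_less less_trans)
 qed
 then show ?case
 proof cases
  case eq
  then show ?thesis using i by (simp add: self)
 next
  case a
  then show ?thesis using small i by simp
 next
  case b
  then show ?thesis using small[of i j] flip[of i j] i by (simp add: algebra_simps)
 next
  case main
  have kT: "sorted (k # T)" "set (k # T) <= {..<d}" "length T <= n" using Suc.prems(1) main by (auto simp: words_def)
  have k: "k < d" and T: "T : words n" using kT by (auto simp: words_def)
  have nN: "n + 2 <= N" and len: "Suc (length T) <= N" using N kT by simp_all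
  note IHT = IH[OF T nN]
  have IHf: "bop N l (bop N l' f) V - bop N l' (bop N l f) V = (\<Sum>m<d. c l l' m * bop N m f V)"
  if "good n f" "l < d" "l' < d" for l l' f V
  by (rule bop_comm_extend[of n]) (use IH nN that in auto)
  \<comment> \<open>For k < l this is the construction. For l at most k the word k T is x_k T, and
    the commutator of x_l and x_k on T is known by induction.\<close>
  have E1: "wact l (k # T) V = bop N k (wact l T) V + (\<Sum>m<d. c l k m * wact m T V)" if l: "l < d" for l V
  proof (cases "k < l")
  case True
  then show ?thesis by (rule wact_large[OF kT(1,2) _ l len])
  next
  case False
  have kT': "k # T : words (Suc n)" using kT by (auto simp: words_def)
  have "wact l (k # T) V = bop N l (wact k T) V"
  using bop_mono[OF kT', of N l V] l N wact_small[OF kT(1)] by simp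
  then show ?thesis using IHT[OF l k, of V] by (simp add: algebra_simps)
  qed
  \<comment> \<open>The element x_l' T has the degree of S, which is too large for the induction
    hypothesis. It is split into its leading monomial Y and a rest of smaller degree: for the rest
    induction applies, and for Y the word k Y is sorted, so the relation holds by
    construction.\<close>
  have E2: "bop N l (bop N k (wact l' T)) V = bop N k (bop N l (wact l' T)) V + (\<Sum>m<d. c l k m * bop N m (wact l' T) V)"
  if l: "k < l" "k < l'" "l < d" "l' < d" for l l' V
  proof -
  let ?Y = "insort l' T"
  let ?w = "%U. wact l' T U - monomial ?Y U"
  have Y: "?Y : words (Suc n)" by (rule words_insort[OF T l(4)])
  have kY: "sorted (k # ?Y)" "set (k # ?Y) <= {..<d}" using kT l by (auto simp: sorted_insort set_insort_key)
  have kY': "k # ?Y : words (Suc (Suc n))" using kY Y by (auto simp: words_def)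
  have bm: "bop N m (monomial ?Y) = wact m ?Y" if "m < d" for m
  by (rule ext) (rule bop_mono[OF Y _ that], use N in simp)
  have z: "bop N l (bop N k (monomial ?Y)) V = bop N k (bop N l (monomial ?Y)) V + (\<Sum>m<d. c l k m * bop N m (monomial ?Y) V)"
  proof -
  have "bop N l (bop N k (monomial ?Y)) V = wact l (k # ?Y) V"
  unfolding bm[OF k] wact_small[OF kY(1)] by (rule bop_mono[OF kY' _ l(3)]) (use N in simp)
  also have "... = bop N k (wact l ?Y) V + (\<Sum>m<d. c l k m * wact m ?Y V)"
  by (rule wact_large[OF kY l(1,3)]) (use N Y in "simp add: words_def")
  finally show ?thesis by (simp add: bm l)
  qed
  have gw: "good n ?w"
  by (rule good_mono[OF kT(3)], rule good_wact_diff) (use kT l in auto)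
  have w: "bop N l (bop N k ?w) V = bop N k (bop N l ?w) V + (\<Sum>m<d. c l k m * bop N m ?w V)"
  using IHf[OF gw l(3) k, of V] by (simp add: algebra_simps)
  have dec: "bop N m ?w = (%V. bop N m (wact l' T) V - bop N m (monomial ?Y) V)" for m
  by (rule ext) (rule bop_diff)
  have "bop N l (bop N k (wact l' T)) V - bop N l (bop N k (monomial ?Y)) V =
  bop N k (bop N l (wact l' T)) V - bop N k (bop N l (monomial ?Y)) V +
  ((\<Sum>m<d. c l k m * bop N m (wact l' T) V) - (\<Sum>m<d. c l k m * bop N m (monomial ?Y) V))"
  using w unfolding dec bop_diff by (simp add: right_diff_distrib sum_subtractf)
  then show ?thesis using z by (simp add: algebra_simps)
  qed
  have X: "bop N l (wact l' S) U = bop N k (bop N l (wact l' T)) U + (\<Sum>m<d. c l k m * bop N m (wact l' T) U)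
  + (\<Sum>m<d. c l' k m * bop N l (wact m T) U)"
  if l: "k < l" "k < l'" "l < d" "l' < d" for l l'
  proof -
  have "wact l' S = (%V. bop N k (wact l' T) V + (\<Sum>m<d. c l' k m * wact m T V))"
  unfolding main(1) by (rule ext) (rule E1[OF l(4)])
  then show ?thesis using E2[OF l] by (simp only: bop_add bop_sum bop_scale)
  qed
  have kd: "bop N k (bop N i (wact j T)) U - bop N k (bop N j (wact i T)) U = (\<Sum>l<d. c i j l * bop N k (wact l T) U)"
  proof -
  have "(%V. bop N i (wact j T) V - bop N j (wact i T) V) = (%V. \<Sum>l<d. c i j l * wact l T V)"
  by (rule ext) (rule IHT[OF i])
  then have "bop N k (%V. bop N i (wact j T) V - bop N j (wact i T) V) U = bop N k (%V. \<Sum>l<d. c i j l * wact l T V) U"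
  by simp
  then show ?thesis by (simp only: bop_diff bop_sum bop_scale)
  qed
  have s1: "(\<Sum>m<d. c i k m * bop N m (wact j T) U) - (\<Sum>m<d. c i k m * bop N j (wact m T) U) =
  (\<Sum>l<d. (\<Sum>m<d. c i k m * c m j l) * wact l T U)"
  proof -
  have "(\<Sum>m<d. c i k m * bop N m (wact j T) U) - (\<Sum>m<d. c i k m * bop N j (wact m T) U) =
  (\<Sum>m<d. c i k m * (\<Sum>l<d. c m j l * wact l T U))"
  unfolding sum_subtractf[symmetric] right_diff_distrib[symmetric] by (rule sum.cong) (use IHT i in auto)
  also have "... = (\<Sum>l<d. (\<Sum>m<d. c i k m * c m j l) * wact l T U)"
  unfolding sum_distrib_left sum_distrib_right by (subst sum.swap) (simp add: mult.assoc)
  finally show ?thesis .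
  qed
  have s2: "(\<Sum>m<d. c j k m * bop N i (wact m T) U) - (\<Sum>m<d. c j k m * bop N m (wact i T) U) =
  (\<Sum>l<d. (\<Sum>m<d. c j k m * c i m l) * wact l T U)"
  proof -
  have "(\<Sum>m<d. c j k m * bop N i (wact m T) U) - (\<Sum>m<d. c j k m * bop N m (wact i T) U) =
  (\<Sum>m<d. c j k m * (\<Sum>l<d. c i m l * wact l T U))"
  unfolding sum_subtractf[symmetric] right_diff_distrib[symmetric] by (rule sum.cong) (use IHT i in auto)
  also have "... = (\<Sum>l<d. (\<Sum>m<d. c j k m * c i m l) * wact l T U)"
  unfolding sum_distrib_left sum_distrib_right by (subst sum.swap) (simp add: mult.assoc)
  finally show ?thesis .
  qed
  have s3: "(\<Sum>l<d. c i j l * wact l S U) = (\<Sum>l<d. c i j l * bop N k (wact l T) U) + (\<Sum>l<d. (\<Sum>m<d. c i j m * c m k l) * wact l T U)"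
  proof -
  have "(\<Sum>l<d. c i j l * wact l S U) = (\<Sum>l<d. c i j l * bop N k (wact l T) U) + (\<Sum>l<d. c i j l * (\<Sum>m<d. c l k m * wact m T U))"
  unfolding main(1) sum.distrib[symmetric] distrib_left[symmetric] by (rule sum.cong) (use E1 in auto)
  also have "(\<Sum>l<d. c i j l * (\<Sum>m<d. c l k m * wact m T U)) = (\<Sum>l<d. (\<Sum>m<d. c i j m * c m k l) * wact l T U)"
  unfolding sum_distrib_left sum_distrib_right by (subst sum.swap) (simp add: mult.assoc)
  finally show ?thesis .
  qed
  \<comment> \<open>The Jacobi identity in structure constants, with indices exchanged by
    antisymmetry until it matches the coefficients collected above.\<close>
  have jacobi: "(\<Sum>m<d. c i k m * c m j l) + (\<Sum>m<d. c j k m * c i m l) = (\<Sum>m<d. c i j m * c m k l)" if l: "l < d" for l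
  proof -
  have eq: "c j k m * c i m l + c k i m * c j m l + c i j m * c k m l = c i k m * c m j l + c j k m * c i m l - c i j m * c m k l"
  if "m < d" for m
  using that i k by (simp add: anti[of k i] anti[of j m] anti[of k m])
  have "(\<Sum>m<d. c i k m * c m j l + c j k m * c i m l - c i j m * c m k l) =
  (\<Sum>m<d. c j k m * c i m l + c k i m * c j m l + c i j m * c k m l)"
  by (rule sum.cong[OF refl], rule eq[symmetric]) simp
  then have "(\<Sum>m<d. c i k m * c m j l + c j k m * c i m l - c i j m * c m k l) = 0"
  using jac[OF i k l] by (rule trans)
  then show ?thesis by (simp add: sum.distrib sum_subtractf)
  qed
  have s4: "(\<Sum>l<d. (\<Sum>m<d. c i k m * c m j l) * wact l T U) + (\<Sum>l<d. (\<Sum>m<d. c j k m * c i m l) * wact l T U) =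
  (\<Sum>l<d. (\<Sum>m<d. c i j m * c m k l) * wact l T U)"
  proof -
  have "(\<Sum>l<d. (\<Sum>m<d. c i k m * c m j l) * wact l T U) + (\<Sum>l<d. (\<Sum>m<d. c j k m * c i m l) * wact l T U) =
  (\<Sum>l<d. (\<Sum>m<d. c i k m * c m j l) * wact l T U + (\<Sum>m<d. c j k m * c i m l) * wact l T U)"
  by (rule sum.distrib[symmetric])
  also have "... = (\<Sum>l<d. (\<Sum>m<d. c i j m * c m k l) * wact l T U)"
  unfolding distrib_right[symmetric] by (rule sum.cong[OF refl]) (simp only: jacobi lessThan_iff)
  finally show ?thesis .
  qed
  show ?thesis
  unfolding X[OF main(2,3) i] X[OF main(3,2) i(2,1)] s3 s4[symmetric] s1[symmetric] s2[symmetric] kd[symmetric]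
  by (simp add: algebra_simps)
 qed
qed

text \<open>The operator without a degree bound. On elements of finite support it agrees with
  \<open>bop\<close> in every sufficiently high degree.\<close>

definition wop :: "nat => (nat list => 'r) => nat list => 'r"
 where "wop i f U = (\<Sum>S | f S ~= 0. f S * wact i S U)"

lemma wop_bop: "good n f ==> n <= N ==> wop i f = bop N i f"
 unfolding wop_def bop_def
 by (rule ext, rule sum.mono_neutral_left[OF finite_words]) (use words_mono in "auto simp: good_def")

lemma good_wop: "good n f ==> i < d ==> good (Suc n) (wop i f)"
 by (simp add: wop_bop[of n f n] good_bop)

lemma wop_add: "good n f ==> good n g ==> wop i (%U. f U + g U) U = wop i f U + wop i g U"
 by (simp add: wop_bop[of n _ n] good_add bop_add)

lemma wop_scale: "good n f ==> wop i (%U. a * f U) U = a * wop i f U"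
 by (simp add: wop_bop[of n _ n] good_scale bop_scale)

lemma wop_sum: "(!!x. x : X ==> good n (F x)) ==> wop i (%U. \<Sum>x\<in>X. F x U) U = (\<Sum>x\<in>X. wop i (F x) U)"
 by (simp add: wop_bop[of n _ n] good_sum bop_sum)

lemma wop_comm:
 assumes "good n f" "i < d" "j < d"
 shows "wop i (wop j f) U - wop j (wop i f) U = (\<Sum>k<d. c i j k * wop k f U)"
proof -
 let ?N = "n + 2"
 have b: "wop l f = bop ?N l f" for l by (rule wop_bop[OF assms(1)]) simp
 have bb: "wop l (bop ?N l' f) = bop ?N l (bop ?N l' f)" if "l' < d" for l l'
  by (rule wop_bop[OF good_bop[OF assms(1) _ that]]) simp_all
 show ?thesis unfolding b bb[OF assms(2)] bb[OF assms(3)]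
  by (rule bop_comm_extend[of n]) (use wact_comm assms in auto)
qed

lemma wop_empty: "i < d ==> wop i (monomial []) = monomial [i]"
 using wop_bop[OF good_mono_word, of "[]" 0 0] bop_mono[of "[]" 0 0 i] by (auto simp: words_def fun_eq_iff)

end

text \<open>Faithfulness is read off at the empty word: x sends it to the combination of the
  one-letter words whose coefficients are the coordinates of x. The operators are computed with
  coefficients in \<open>amb\<close> and projected back to the field.\<close>

lemma faithful_lie_module:
 fixes K :: "'k ring" and L :: "('k, 'a, 'r) lie_algebra_scheme"
 assumes L: "lie_algebra K L" and fd: "vectorspace.fin_dim K L"
 shows "EX (V :: ('k, nat list => 'k) module) act. lie_module K L V act &
  (ALL x:carrier L. (ALL v:carrier V. act x v = zero V) --> x = zero L)"
proof -
 interpret L: lie_algebra K L by (rule L)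
 have K: "field K" by (rule L.field_axioms)
 have vL: "vectorspace K L" by (rule L.vectorspace_axioms)
 interpret KR: rng_emb K by unfold_locales (rule rng_cring[OF L.R.is_cring])
 obtain d where hd: "has_basis K L {..<d::nat}" using L.fin_dim_has_basis[OF fd] by blast
 then obtain p where p: "linear_on K L (free_space K {..<d}) (carrier L) p" "p ` carrier L = carrier (free_space K {..<d})"
  "!!z. z : carrier L ==> p z = (%j. zero K) \<longleftrightarrow> z : {zero L}" unfolding qdim_def by blast
 have pK: "p v j : carrier K" if "v : carrier L" for v j using linear_onD(1)[OF p(1) that] by (simp add: free_space_simps)
 have padd: "p (x \<oplus>\<^bsub>L\<^esub> y) j = p x j \<oplus>\<^bsub>K\<^esub> p y j" if "x : carrier L" "y : carrier L" for x y j
  using linear_onD(2)[OF p(1) that] by (simp add: free_space_simps)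
 have psm: "p (a \<odot>\<^bsub>L\<^esub> y) j = a \<otimes>\<^bsub>K\<^esub> p y j" if "a : carrier K" "y : carrier L" for a y j
  using linear_onD(3)[OF p(1) that] by (simp add: free_space_simps)
 have p0: "p \<zero>\<^bsub>L\<^esub> j = zero K" for j using p(3)[of "zero L"] by simp
 have pout: "p v j = zero K" if "v : carrier L" "~ j < d" for v j
  using linear_onD(1)[OF p(1) that(1)] that(2) by (simp add: free_space_simps)
 define b where "b = basis_vec K L p"
 have b: "b j : carrier L" "p (b j) = free_gen K j" if "j < d" for j
  using basis_vec[OF K p(2), of j] that by (simp_all add: b_def)
 define P where "P x j = embed K (p x j)" for x j
 have Padd: "P (x \<oplus>\<^bsub>L\<^esub> y) j = P x j + P y j" if "x : carrier L" "y : carrier L" for x y j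
  using that by (simp add: P_def padd KR.embed_add pK)
 have Psm: "P (a \<odot>\<^bsub>L\<^esub> y) j = embed K a * P y j" if "a : carrier K" "y : carrier L" for a y j
  using that by (simp add: P_def psm KR.embed_mult pK)
 have P0: "P \<zero>\<^bsub>L\<^esub> j = 0" for j by (simp add: P_def p0)
 define e where "e = embed K \<one>\<^bsub>K\<^esub>"
 have e_inj: "e * embed K a = embed K a" if "a : carrier K" for a
  using that KR.embed_mult[of "\<one>\<^bsub>K\<^esub>" a] by (simp add: e_def)
 have Pb: "P (b i) j = (if j = i then e else 0)" if "i < d" for i j
  using b(2)[OF that] by (simp add: P_def free_gen_def e_def)
 have br: "bracket L x y : carrier L" if "x : carrier L" "y : carrier L" for x y using that by (rule L.bracket_closed)
 have br0: "bracket L x \<zero>\<^bsub>L\<^esub> = zero L" "bracket L \<zero>\<^bsub>L\<^esub> x = zero L" if "x : carrier L" for x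
  using L.bracket_smult_right[of "zero K" x "zero L"] L.bracket_smult_left[of "zero K" "zero L" x] that br by simp_all
 \<comment> \<open>The value 0 outside the index range ensures e c = c for all indices, as the
   locale \<open>pbw\<close> demands.\<close>
 define c where "c i j k = (if i < d & j < d then P (bracket L (b i) (b j)) k else 0)" for i j k
 have eP: "e * P x k = P x k" if "x : carrier L" for x k using e_inj pK[OF that] by (simp add: P_def)
 have spread1: "P (bracket L (b i) y) k = (\<Sum>j<d. P y j * c i j k)" if i: "i < d" and y: "y : carrier L" for i y k
 proof -
  let ?Z = "{y : carrier L. P (bracket L (b i) y) k = (\<Sum>j<d. P y j * c i j k)}"
  have bi: "b i : carrier L" using b i by simp
  have lZ: "linsub K L ?Z"
  unfolding linsub_def
  proof (intro conjI ballI)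
  show "zero L : ?Z" using bi by (simp add: br0 P0)
  show "x \<oplus>\<^bsub>L\<^esub> y : ?Z" if "x : ?Z" "y : ?Z" for x y
  using that bi by (simp add: L.bracket_add_right Padd br distrib_right sum.distrib)
  show "a \<odot>\<^bsub>L\<^esub> y : ?Z" if "a : carrier K" "y : ?Z" for a y
  using that bi by (simp add: L.bracket_smult_right Psm br sum_distrib_left mult.assoc)
  qed auto
  have "carrier L <= ?Z"
  proof (rule has_basis_induct[OF vL p(1) p(2) p(3) finite_lessThan lZ])
  fix j z assume j: "j : {..<d}" "z : carrier L" "p z = free_gen K j"
  have z: "z = b j"
  using L.qdim_diff_iff[OF L.linsub_carrier p(1) p(3), of z "b j"] b[of j] j by (simp add: L.diff_zero_iff)
  have "(\<Sum>l<d. P (b j) l * c i l k) = (\<Sum>l<d. if l = j then e * c i j k else 0)"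
  by (rule sum.cong) (use j in "auto simp: Pb")
  also have "... = e * c i j k" using j by simp
  also have "... = P (bracket L (b i) (b j)) k" using i j bi b(1)[of j] by (simp add: c_def eP br)
  finally show "z : ?Z" using z j by simp
  qed
  then show ?thesis using y by auto
 qed
 have spread: "P (bracket L x y) k = (\<Sum>i<d. \<Sum>j<d. P x i * P y j * c i j k)" if x: "x : carrier L" and y: "y : carrier L" for x y k
 proof -
  let ?Z = "{x : carrier L. P (bracket L x y) k = (\<Sum>i<d. P x i * P (bracket L (b i) y) k)}"
  have lZ: "linsub K L ?Z"
  unfolding linsub_def
  proof (intro conjI ballI)
  show "zero L : ?Z" using y by (simp add: br0 P0)
  show "x \<oplus>\<^bsub>L\<^esub> x' : ?Z" if "x : ?Z" "x' : ?Z" for x x'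
  using that y by (simp add: L.bracket_add_left Padd br distrib_right sum.distrib)
  show "a \<odot>\<^bsub>L\<^esub> x : ?Z" if "a : carrier K" "x : ?Z" for a x
  using that y by (simp add: L.bracket_smult_left Psm br sum_distrib_left mult.assoc)
  qed auto
  have "carrier L <= ?Z"
  proof (rule has_basis_induct[OF vL p(1) p(2) p(3) finite_lessThan lZ])
  fix j z assume j: "j : {..<d}" "z : carrier L" "p z = free_gen K j"
  have z: "z = b j"
  using L.qdim_diff_iff[OF L.linsub_carrier p(1) p(3), of z "b j"] b[of j] j by (simp add: L.diff_zero_iff)
  have "(\<Sum>l<d. P (b j) l * P (bracket L (b l) y) k) = (\<Sum>l<d. if l = j then e * P (bracket L (b j) y) k else 0)"
  by (rule sum.cong) (use j in "auto simp: Pb")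
  also have "... = P (bracket L (b j) y) k" using j b(1)[of j] y by (simp add: eP br)
  finally show "z : ?Z" using z j by simp
  qed
  then have "P (bracket L x y) k = (\<Sum>i<d. P x i * P (bracket L (b i) y) k)" using x by auto
  also have "... = (\<Sum>i<d. \<Sum>j<d. P x i * P y j * c i j k)"
  by (rule sum.cong[OF refl]) (use y in "simp add: spread1 sum_distrib_left mult.assoc")
  finally show ?thesis .
 qed
 interpret W: pbw d c e
 proof
  show "e * e = e" using e_inj[of "\<one>\<^bsub>K\<^esub>"] by (simp add: e_def)
  show "e * c i j k = c i j k" for i j k using eP br b by (simp add: c_def)
  show "c i i k = 0" if "i < d" for i k using that b by (simp add: c_def L.bracket_self P0)
  show "c i j k = - c j i k" if ij: "i < d" "j < d" for i j k
  proof -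
  let ?x = "b i" and ?y = "b j"
  have xy: "?x : carrier L" "?y : carrier L" using b ij by auto
  have "P (bracket L ?x (?x \<oplus>\<^bsub>L\<^esub> ?y) \<oplus>\<^bsub>L\<^esub> bracket L ?y (?x \<oplus>\<^bsub>L\<^esub> ?y)) k = 0"
  using xy L.bracket_self[of "?x \<oplus>\<^bsub>L\<^esub> ?y"] by (simp add: L.bracket_add_left[symmetric] P0)
  then have "P (bracket L ?x ?y) k + P (bracket L ?y ?x) k = 0"
  using xy by (simp add: L.bracket_add_right Padd br L.bracket_self P0)
  then show ?thesis using ij by (simp add: c_def eq_neg_iff_add_eq_0)
  qed
  show "(\<Sum>m<d. c j k m * c i m l + c k i m * c j m l + c i j m * c k m l) = 0" if ijk: "i < d" "j < d" "k < d" "l < d" for i j k l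
  proof -
  have B: "b i : carrier L" "b j : carrier L" "b k : carrier L" using b ijk by auto
  have "P (bracket L (b i) (bracket L (b j) (b k)) \<oplus>\<^bsub>L\<^esub> bracket L (b j) (bracket L (b k) (b i)) \<oplus>\<^bsub>L\<^esub> bracket L (b k) (bracket L (b i) (b j))) l = 0"
  using B by (simp add: L.jacobi P0)
  then have "P (bracket L (b i) (bracket L (b j) (b k))) l + P (bracket L (b j) (bracket L (b k) (b i))) l + P (bracket L (b k) (bracket L (b i) (b j))) l = 0"
  using B by (simp add: Padd br)
  then show ?thesis using B ijk by (simp add: spread1 br sum.distrib c_def)
  qed
 qed
 define M where "M = {S :: nat list. sorted S & set S <= {..<d}}"
 define V where "V = free_space K M"
 have vV: "vectorspace K V" unfolding V_def by (rule free_space_vs[OF K])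
 interpret V: vectorspace K V by (rule vV)
 define hat where "hat f = (%S. embed K (f S))" for f :: "nat list => 'k"
 define X where "X x F = (%U. \<Sum>i<d. P x i * W.wop i F U)" for x F
 define act where "act x f = (%U. pick K (X x (hat f) U))" for x f
 have fK: "f S : carrier K" if "f : carrier V" for f S using that by (simp add: V_def free_space_simps)
 have good: "EX n. W.good n (hat f)" if f: "f : carrier V" for f
 proof -
  let ?T = "{S. f S ~= zero K}"
  have T: "finite ?T" "?T <= M" using f by (auto simp: V_def free_space_simps)
  obtain n where n: "ALL S:?T. length S <= n" using finite_nat_set_iff_bounded_le[of "length ` ?T"] T(1) by auto
  have "S : W.words n" if "hat f S ~= 0" for S
  proof -
  have "S : ?T" using that by (auto simp: hat_def)
  then show ?thesis using n T(2) by (auto simp: W.words_def M_def)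
  qed
  then have "W.good n (hat f)" unfolding W.good_def using e_inj fK[OF f] by (simp add: hat_def)
  then show ?thesis by blast
 qed
 have goodX: "W.good (Suc n) (X x F)" if "W.good n F" for x F n
  unfolding X_def by (rule W.good_sum, rule W.good_scale, rule W.good_wop) (use that in auto)
 \<comment> \<open>An element fixed by the embedded unit has zero coordinates away from K, so
   projecting to K loses nothing.\<close>
 have inj_proj: "embed K (pick K g) = g" if "e * g = g" for g
  using KR.embed_proj_mult[of "\<one>\<^bsub>K\<^esub>" g] e_inj[of "pick K g"] that by (simp add: e_def)
 have hat_act: "hat (act x f) = X x (hat f)" if f: "f : carrier V" for x f
 proof -
  obtain n where "W.good n (hat f)" using good[OF f] by blast
  then have "e * X x (hat f) U = X x (hat f) U" for U using goodX unfolding W.good_def by blast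
  then have "embed K (pick K (X x (hat f) U)) = X x (hat f) U" for U using inj_proj by blast
  moreover have "hat (act x f) U = embed K (act x f U)" "act x f U = pick K (X x (hat f) U)" for U
  by (simp_all only: hat_def act_def)
  ultimately show ?thesis by (intro ext) simp
 qed
 have hat_eq: "f = g" if "f : carrier V" "g : carrier V" "hat f = hat g" for f g
  using that KR.embed_inject[OF fK[OF that(1)] fK[OF that(2)]] by (auto simp: hat_def fun_eq_iff)
 have closed: "act x f : carrier V" if f: "f : carrier V" for x f
 proof -
  obtain n where "W.good n (hat f)" using good[OF f] by blast
  then have "W.good (Suc n) (X x (hat f))" by (rule goodX)
  then have "X x (hat f) S = 0" if "S ~: W.words (Suc n)" for S using that unfolding W.good_def by blast
  then have 0: "act x f S = zero K" if "S ~: W.words (Suc n)" for S using that by (simp add: act_def KR.proj_hom)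
  moreover have "W.words (Suc n) <= M" by (auto simp: W.words_def M_def)
  moreover have "finite {S. act x f S ~= zero K}" by (rule finite_subset[OF _ W.finite_words[of "Suc n"]]) (use 0 in blast)
  moreover have "act x f S : carrier K" for S by (simp add: act_def)
  ultimately show ?thesis by (auto simp: V_def free_space_simps)
 qed
 have hat_add: "hat (f \<oplus>\<^bsub>V\<^esub> g) = (%U. hat f U + hat g U)" if "f : carrier V" "g : carrier V" for f g
  using fK[OF that(1)] fK[OF that(2)] by (simp add: hat_def V_def free_space_simps(3) KR.embed_add)
 have hat_sm: "hat (a \<odot>\<^bsub>V\<^esub> f) = (%U. embed K a * hat f U)" if "a : carrier K" "f : carrier V" for a f
  using fK[OF that(2)] that(1) by (simp add: hat_def V_def free_space_simps(4) KR.embed_mult)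
 have X_comm: "X (bracket L x y) F U + X y (X x F) U = X x (X y F) U"
  if x: "x : carrier L" "y : carrier L" and F: "W.good n F" for x y F n U
 proof -
  have gw: "W.good (Suc n) (%U. P z j * W.wop j F U)" if "j : {..<d}" for z j
  by (rule W.good_scale, rule W.good_wop[OF F]) (use that in simp)
  have e1: "W.wop i (X z F) U = (\<Sum>j<d. P z j * W.wop i (W.wop j F) U)" for i z
  proof -
  have "W.wop i (X z F) U = (\<Sum>j<d. W.wop i (%U. P z j * W.wop j F U) U)"
  unfolding X_def by (rule W.wop_sum) (rule gw)
  also have "... = (\<Sum>j<d. P z j * W.wop i (W.wop j F) U)"
  by (rule sum.cong[OF refl], rule W.wop_scale[OF W.good_wop[OF F]]) simp
  finally show ?thesis .
  qed
  have 1: "X x (X y F) U = (\<Sum>i<d. \<Sum>j<d. P x i * P y j * W.wop i (W.wop j F) U)"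
  unfolding X_def[of x] e1 sum_distrib_left by (simp add: mult.assoc)
  have 2: "X y (X x F) U = (\<Sum>i<d. \<Sum>j<d. P x i * P y j * W.wop j (W.wop i F) U)"
  unfolding X_def[of y] e1 sum_distrib_left by (subst sum.swap) (simp add: mult.assoc mult.left_commute)
  have "X x (X y F) U - X y (X x F) U = (\<Sum>i<d. \<Sum>j<d. P x i * P y j * (W.wop i (W.wop j F) U - W.wop j (W.wop i F) U))"
  unfolding 1 2 by (simp only: sum_subtractf right_diff_distrib)
  also have "... = (\<Sum>i<d. \<Sum>j<d. \<Sum>k<d. P x i * P y j * c i j k * W.wop k F U)"
  by (intro sum.cong refl) (simp add: W.wop_comm[OF F] sum_distrib_left mult.assoc)
  also have "... = (\<Sum>i<d. \<Sum>k<d. \<Sum>j<d. P x i * P y j * c i j k * W.wop k F U)"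
  by (rule sum.cong[OF refl]) (rule sum.swap)
  also have "... = (\<Sum>k<d. \<Sum>i<d. \<Sum>j<d. P x i * P y j * c i j k * W.wop k F U)"
  by (rule sum.swap)
  also have "... = X (bracket L x y) F U"
  unfolding X_def spread[OF x] by (simp add: sum_distrib_right)
  finally show ?thesis by (simp add: algebra_simps)
 qed
 have X_add: "X x (%U. F U + F' U) = (%U. X x F U + X x F' U)" if "W.good n F" "W.good n F'" for x F F' n
  unfolding X_def using W.wop_add[OF that] by (simp add: distrib_left sum.distrib)
 have "lie_module K L V act"
 proof (intro lie_module.intro lie_module_axioms.intro L vV)
  fix x m assume x: "x : carrier L" and m: "m : carrier V"
  show "act x m : carrier V" by (rule closed[OF m])
  fix y assume y: "y : carrier L"
  show "act (x \<oplus>\<^bsub>L\<^esub> y) m = act x m \<oplus>\<^bsub>V\<^esub> act y m"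
  proof (rule hat_eq)
  show "hat (act (x \<oplus>\<^bsub>L\<^esub> y) m) = hat (act x m \<oplus>\<^bsub>V\<^esub> act y m)"
  unfolding hat_add[OF closed[OF m] closed[OF m]] hat_act[OF m]
  by (simp add: X_def Padd x y distrib_right sum.distrib)
  qed (use closed m in auto)
  have "act (bracket L x y) m \<oplus>\<^bsub>V\<^esub> act y (act x m) = act x (act y m)"
  proof (rule hat_eq)
  obtain n where n: "W.good n (hat m)" using good[OF m] by blast
  show "hat (act (bracket L x y) m \<oplus>\<^bsub>V\<^esub> act y (act x m)) = hat (act x (act y m))"
  unfolding hat_add[OF closed[OF m] closed[OF closed[OF m]]] hat_act[OF closed[OF m]] hat_act[OF m]
  by (rule ext) (rule X_comm[OF x y n])
  qed (use closed m in auto)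
  then show "act (bracket L x y) m = act x (act y m) \<ominus>\<^bsub>V\<^esub> act y (act x m)"
  using V.diff_add_cancel(2)[OF closed[OF m] closed[OF closed[OF m]], of "bracket L x y" y x] by simp
 next
  fix x m m' assume x: "x : carrier L" and m: "m : carrier V" "m' : carrier V"
  show "act x (m \<oplus>\<^bsub>V\<^esub> m') = act x m \<oplus>\<^bsub>V\<^esub> act x m'"
  proof (rule hat_eq)
  obtain n n' where n: "W.good n (hat m)" "W.good n' (hat m')" using good m by metis
  have n': "W.good (max n n') (hat m)" "W.good (max n n') (hat m')"
  using W.good_mono[OF _ n(1), of "max n n'"] W.good_mono[OF _ n(2), of "max n n'"] by auto
  show "hat (act x (m \<oplus>\<^bsub>V\<^esub> m')) = hat (act x m \<oplus>\<^bsub>V\<^esub> act x m')"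
  unfolding hat_add[OF closed[OF m(1)] closed[OF m(2)]] hat_act[OF m(1)] hat_act[OF m(2)] hat_act[OF V.M.a_closed[OF m]] hat_add[OF m]
  by (rule X_add[OF n'])
  qed (use closed m in auto)
 next
  fix a x m assume a: "a : carrier K" and x: "x : carrier L" and m: "m : carrier V"
  show "act (a \<odot>\<^bsub>L\<^esub> x) m = a \<odot>\<^bsub>V\<^esub> act x m"
  proof (rule hat_eq)
  show "hat (act (a \<odot>\<^bsub>L\<^esub> x) m) = hat (a \<odot>\<^bsub>V\<^esub> act x m)"
  unfolding hat_sm[OF a closed[OF m]] hat_act[OF m]
  by (simp add: X_def Psm x a sum_distrib_left mult.assoc)
  qed (use closed m a in auto)
  show "act x (a \<odot>\<^bsub>V\<^esub> m) = a \<odot>\<^bsub>V\<^esub> act x m"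
  proof (rule hat_eq)
  obtain n where n: "W.good n (hat m)" using good[OF m] by blast
  show "hat (act x (a \<odot>\<^bsub>V\<^esub> m)) = hat (a \<odot>\<^bsub>V\<^esub> act x m)"
  unfolding hat_sm[OF a closed[OF m]] hat_act[OF m] hat_act[OF V.smult_closed[OF a m]] hat_sm[OF a m]
  by (simp add: X_def W.wop_scale[OF n] sum_distrib_left mult.left_commute)
  qed (use closed m a in auto)
 qed
 moreover have "x = zero L" if x: "x : carrier L" and 0: "ALL v:carrier V. act x v = zero V" for x
 proof -
  let ?f = "free_gen K ([] :: nat list)"
  have f: "?f : carrier V" unfolding V_def by (rule free_gen_closed[OF K]) (simp add: M_def)
  have hf: "hat ?f = W.monomial []" by (rule ext) (simp add: hat_def W.monomial_def free_gen_def e_def[symmetric])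
  have "p x k = zero K" for k
  proof (cases "k < d")
  case True
  have "X x (hat ?f) [k] = (\<Sum>i<d. if i = k then P x k * e else 0)"
  unfolding X_def hf by (rule sum.cong) (simp_all add: W.wop_empty, auto simp: W.monomial_def)
  also have "... = P x k" using True eP[OF x] by (simp add: mult.commute)
  finally have "X x (hat ?f) [k] = P x k" .
  moreover have "hat (act x ?f) [k] = 0" using 0 f by (simp add: hat_def V_def free_space_simps(2))
  ultimately have "P x k = 0" using hat_act[OF f, of x] by simp
  then show ?thesis using KR.embed_inject[OF pK[OF x], of "zero K"] by (simp add: P_def)
  qed (rule pout[OF x])
  then have "p x = (%j. zero K)" by blast
  then show ?thesis using p(3)[OF x] by simp
 qed
 ultimately show ?thesis by blast
qed

section \<open>Actions of the universal enveloping algebra\<close>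

lemma vs_cong:
 assumes "vectorspace K V" and eq: "carrier W = carrier V" "add W = add V" "zero W = zero V" "smult W = smult V"
 shows "vectorspace K W"
proof -
 interpret V: vectorspace K V by fact
 have "abelian_group W"
 proof (rule abelian_groupI)
  show "EX y:carrier W. y \<oplus>\<^bsub>W\<^esub> x = zero W" if "x : carrier W" for x
  using that V.M.a_inv_closed[of x] V.M.l_neg[of x] by (auto simp: eq)
 qed (simp_all add: eq V.M.a_ac)
 then have "module K W"
  by (intro module.intro module_axioms.intro V.R.is_cring)
  (simp_all add: eq V.smult_l_distr V.smult_r_distr V.smult_assoc1)
 then show ?thesis by (intro vectorspaceI V.field_axioms)
qed

lemma free_algebra_simps:
 "carrier (free_algebra K S) = carrier (free_space K (lists S))"
 "add (free_algebra K S) = add (free_space K (lists S))"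
 "zero (free_algebra K S) = zero (free_space K (lists S))"
 "smult (free_algebra K S) = smult (free_space K (lists S))"
 "one (free_algebra K S) = free_gen K []"
 "(f \<otimes>\<^bsub>free_algebra K S\<^esub> g) w = finsum K (%i. f (take i w) \<otimes>\<^bsub>K\<^esub> g (drop i w)) {..length w}"
 by (simp_all add: free_algebra_def)

lemma free_algebra_vs: "field K ==> vectorspace K (free_algebra K S)"
 by (rule vs_cong[OF free_space_vs]) (simp_all add: free_algebra_simps)

definition conv :: "('s list => 'b::comm_ring) => ('s list => 'b) => 's list => 'b"
 where "conv F G w = (\<Sum>i\<le>length w. F (take i w) * G (drop i w))"

text \<open>In a factorization w = u v either u is empty or u begins with the first letter of w.
  This recursion makes associativity an induction on w.\<close>

lemma conv_simps: "conv F G [] = F [] * G []" "conv F G (x # w) = F [] * G (x # w) + conv (%v. F (x # v)) G w"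
 by (simp_all add: conv_def sum.atMost_Suc_shift del: sum.atMost_Suc)

lemma conv_linear:
 "conv (%v. F v + F' v) G w = conv F G w + conv F' G w" "conv F (%v. G v + G' v) w = conv F G w + conv F G' w"
 "conv (%v. a * F v) G w = a * conv F G w" "conv F (%v. a * G v) w = a * conv F G w"
 by (simp_all add: conv_def distrib_left distrib_right sum.distrib sum_distrib_left mult.assoc mult.left_commute)

lemma conv_assoc: "conv (conv F G) H w = conv F (conv G H) w"
 by (induction w arbitrary: F) (simp_all add: conv_simps conv_linear distrib_left mult.assoc)

lemma conv_zero: "conv (%v. 0) G w = 0"
 by (simp add: conv_def)

definition word_fun :: "'b => 's list => 's list => 'b::comm_ring"
 where "word_fun e u = (%w. if w = u then e else 0)"

lemma word_fun_simps: "word_fun e [] [] = e" "word_fun e [] (x # v) = 0" "word_fun e (x # u) [] = 0"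
 "(%v. word_fun e (x # u) (y # v)) = (if x = y then word_fun e u else (%v. 0))"
 "(%v. word_fun e [] (y # v)) = (%v. 0)"
 by (auto simp: word_fun_def)

lemma conv_word_fun_Nil: "conv (word_fun e []) G w = e * G w" "conv F (word_fun e []) w = F w * e"
 by (cases w; simp add: conv_simps word_fun_simps conv_zero)
  (induction w arbitrary: F; simp add: conv_simps word_fun_simps)

lemma conv_word_fun: "conv (word_fun e u) G w = (if take (length u) w = u then e * G (drop (length u) w) else 0)"
proof (induction u arbitrary: w)
 case Nil
 then show ?case by (simp add: conv_word_fun_Nil)
next
 case (Cons x u)
 then show ?case by (cases w) (auto simp: conv_simps word_fun_simps conv_zero)
qed

context
 fixes K :: "'k ring" and S :: "'s set"
 assumes K: "field K"
begin

interpretation field K by (rule K)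
interpretation KR: rng_emb K by unfold_locales (rule rng_cring[OF is_cring])

abbreviation "FA == free_algebra K S"

interpretation FA: vectorspace K FA by (rule free_algebra_vs[OF K])

definition emb :: "('s list => 'k) => 's list => 'k amb"
 where "emb f = (%w. embed K (f w))"

lemma free_algebra_K: "f : carrier FA ==> f w : carrier K"
 by (simp add: free_algebra_simps free_space_simps)

lemma emb_mult: "f : carrier FA ==> g : carrier FA ==> emb (f \<otimes>\<^bsub>FA\<^esub> g) = conv (emb f) (emb g)"
 by (rule ext) (simp add: emb_def conv_def free_algebra_simps(6) KR.embed_finsum KR.embed_mult free_algebra_K)

lemma free_algebra_mult_closed:
 assumes f: "f : carrier FA" and g: "g : carrier FA"
 shows "f \<otimes>\<^bsub>FA\<^esub> g : carrier FA"
proof -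
 let ?P = "(%(u, v). u @ v) ` ({u. f u ~= zero K} \<times> {v. g v ~= zero K})"
 have c: "(f \<otimes>\<^bsub>FA\<^esub> g) w : carrier K" for w
  unfolding free_algebra_simps(6) using f g by (simp add: free_algebra_K)
 have 0: "(f \<otimes>\<^bsub>FA\<^esub> g) w = zero K" if w: "w ~: ?P" for w
 proof -
  have dis: "f (take i w) = zero K | g (drop i w) = zero K" for i
  proof (rule ccontr)
  assume "~ ?thesis"
  then have "(take i w, drop i w) : {u. f u ~= zero K} \<times> {v. g v ~= zero K}" by simp
  from imageI[OF this, of "%(u, v). u @ v"] show False using w by simp
  qed
  have "f (take i w) \<otimes>\<^bsub>K\<^esub> g (drop i w) = zero K" for i
  using dis[of i] by (rule disjE) (simp_all add: free_algebra_K[OF f] free_algebra_K[OF g])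
  then show ?thesis unfolding free_algebra_simps(6) by simp
 qed
 have supp: "finite {w. h w ~= zero K}" "h w ~= zero K ==> w : lists S" if "h : carrier FA" for h w
  using that unfolding free_algebra_simps(1) free_space_simps by blast+
 have P: "finite ?P" using supp(1)[OF f] supp(1)[OF g] by simp
 moreover have "?P <= lists S"
 proof
  fix w assume "w : ?P"
  then obtain q where q: "w = (%(u, v). u @ v) q" "q : {u. f u ~= zero K} \<times> {v. g v ~= zero K}" by (rule imageE)
  obtain u v where "w = u @ v" "f u ~= zero K" "g v ~= zero K" using q by (cases q) simp
  then show "w : lists S" using supp(2)[OF f, of u] supp(2)[OF g, of v] by simp
 qed
 ultimately have P: "finite ?P" "?P <= lists S" by blast+
 have "finite {w. (f \<otimes>\<^bsub>FA\<^esub> g) w ~= zero K}"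
  by (rule finite_subset[OF _ P(1)]) (use 0 in blast)
 moreover have "(f \<otimes>\<^bsub>FA\<^esub> g) w = zero K" if "w ~: lists S" for w
  by (rule 0) (use that P(2) in blast)
 ultimately show ?thesis using c by (simp add: free_algebra_simps(1) free_space_simps)
qed

lemma emb_eq: "f : carrier FA ==> g : carrier FA ==> emb f = emb g ==> f = g"
 by (rule ext) (use KR.embed_inject free_algebra_K in "auto simp: emb_def fun_eq_iff")

lemma emb_linear:
 "f : carrier FA ==> g : carrier FA ==> emb (f \<oplus>\<^bsub>FA\<^esub> g) = (%w. emb f w + emb g w)"
 "a : carrier K ==> f : carrier FA ==> emb (a \<odot>\<^bsub>FA\<^esub> f) = (%w. embed K a * emb f w)"
 by (simp_all add: emb_def free_algebra_simps(2,4) free_space_simps(3,4) KR.embed_add KR.embed_mult free_algebra_K)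

lemma emb_gen: "emb (free_gen K u) = word_fun (embed K \<one>\<^bsub>K\<^esub>) u"
 by (rule ext) (simp add: emb_def free_gen_def word_fun_def)

lemma free_algebra_gen: "u : lists S ==> free_gen K u : carrier FA"
 using free_gen_closed[OF K] by (simp add: free_algebra_simps)

lemma emb_one: "f : carrier FA ==> embed K \<one>\<^bsub>K\<^esub> * emb f w = emb f w"
 using KR.embed_mult[of "\<one>\<^bsub>K\<^esub>" "f w"] by (simp add: emb_def free_algebra_K)

lemma free_algebra_ring: "ring FA"
proof (rule ringI)
 show "abelian_group FA" by (rule FA.M.abelian_group_axioms)
 have one: "\<one>\<^bsub>FA\<^esub> : carrier FA" using free_algebra_gen[of "[]"] by (simp add: free_algebra_simps(5))
 show "monoid FA"
 proof (rule monoidI)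
  fix f g h assume f: "f : carrier FA"
  show "\<one>\<^bsub>FA\<^esub> \<otimes>\<^bsub>FA\<^esub> f = f"
  by (rule emb_eq[OF free_algebra_mult_closed[OF one f] f])
  (simp add: emb_mult[OF one f], simp add: free_algebra_simps(5) emb_gen fun_eq_iff conv_word_fun_Nil emb_one f)
  show "f \<otimes>\<^bsub>FA\<^esub> \<one>\<^bsub>FA\<^esub> = f"
  by (rule emb_eq[OF free_algebra_mult_closed[OF f one] f])
  (simp add: emb_mult[OF f one], simp add: free_algebra_simps(5) emb_gen fun_eq_iff conv_word_fun_Nil emb_one[OF f, unfolded mult.commute[of "embed K \<one>\<^bsub>K\<^esub>"]])
  assume g: "g : carrier FA"
  show "f \<otimes>\<^bsub>FA\<^esub> g : carrier FA" by (rule free_algebra_mult_closed[OF f g])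
  assume h: "h : carrier FA"
  note c = free_algebra_mult_closed
  show "f \<otimes>\<^bsub>FA\<^esub> g \<otimes>\<^bsub>FA\<^esub> h = f \<otimes>\<^bsub>FA\<^esub> (g \<otimes>\<^bsub>FA\<^esub> h)"
  by (rule emb_eq[OF c[OF c[OF f g] h] c[OF f c[OF g h]]])
  (simp only: emb_mult f g h c, rule ext, rule conv_assoc)
 qed (rule one)
 fix f g h assume f: "f : carrier FA" and g: "g : carrier FA" and h: "h : carrier FA"
 note c = free_algebra_mult_closed
 show "(f \<oplus>\<^bsub>FA\<^esub> g) \<otimes>\<^bsub>FA\<^esub> h = f \<otimes>\<^bsub>FA\<^esub> h \<oplus>\<^bsub>FA\<^esub> g \<otimes>\<^bsub>FA\<^esub> h"
  by (rule emb_eq[OF c[OF FA.M.a_closed[OF f g] h] FA.M.a_closed[OF c[OF f h] c[OF g h]]])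
  (simp only: emb_mult emb_linear f g h c FA.M.a_closed, rule ext, rule conv_linear)
 show "h \<otimes>\<^bsub>FA\<^esub> (f \<oplus>\<^bsub>FA\<^esub> g) = h \<otimes>\<^bsub>FA\<^esub> f \<oplus>\<^bsub>FA\<^esub> h \<otimes>\<^bsub>FA\<^esub> g"
  by (rule emb_eq[OF c[OF h FA.M.a_closed[OF f g]] FA.M.a_closed[OF c[OF h f] c[OF h g]]])
  (simp only: emb_mult emb_linear f g h c FA.M.a_closed, rule ext, rule conv_linear)
qed

lemma free_algebra_smult:
 assumes a: "a : carrier K" and f: "f : carrier FA" and g: "g : carrier FA"
 shows "(a \<odot>\<^bsub>FA\<^esub> f) \<otimes>\<^bsub>FA\<^esub> g = a \<odot>\<^bsub>FA\<^esub> (f \<otimes>\<^bsub>FA\<^esub> g)" "f \<otimes>\<^bsub>FA\<^esub> (a \<odot>\<^bsub>FA\<^esub> g) = a \<odot>\<^bsub>FA\<^esub> (f \<otimes>\<^bsub>FA\<^esub> g)"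
proof -
 note c = free_algebra_mult_closed and s = FA.smult_closed[OF a]
 show "(a \<odot>\<^bsub>FA\<^esub> f) \<otimes>\<^bsub>FA\<^esub> g = a \<odot>\<^bsub>FA\<^esub> (f \<otimes>\<^bsub>FA\<^esub> g)"
  by (rule emb_eq[OF c[OF s[OF f] g] s[OF c[OF f g]]])
  (simp only: emb_mult emb_linear a f g c s, rule ext, rule conv_linear)
 show "f \<otimes>\<^bsub>FA\<^esub> (a \<odot>\<^bsub>FA\<^esub> g) = a \<odot>\<^bsub>FA\<^esub> (f \<otimes>\<^bsub>FA\<^esub> g)"
  by (rule emb_eq[OF c[OF f s[OF g]] s[OF c[OF f g]]])
  (simp only: emb_mult emb_linear a f g c s, rule ext, rule conv_linear)
qed

lemma free_gen_mult:
 assumes u: "u : lists S" and v: "v : lists S"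
 shows "free_gen K u \<otimes>\<^bsub>FA\<^esub> free_gen K v = free_gen K (u @ v)"
proof (rule emb_eq)
 have "conv (word_fun (embed K \<one>\<^bsub>K\<^esub>) u) (word_fun (embed K \<one>\<^bsub>K\<^esub>) v) w = word_fun (embed K \<one>\<^bsub>K\<^esub>) (u @ v) w" for w
 proof -
  have "w = u @ v \<longleftrightarrow> take (length u) w = u & drop (length u) w = v"
  by (metis append_eq_conv_conj append_take_drop_id)
  then show ?thesis
  using KR.embed_mult[of "\<one>\<^bsub>K\<^esub>" "\<one>\<^bsub>K\<^esub>"] unfolding conv_word_fun by (simp add: word_fun_def)
 qed
 then show "emb (free_gen K u \<otimes>\<^bsub>FA\<^esub> free_gen K v) = emb (free_gen K (u @ v))"
  by (simp add: emb_mult free_algebra_gen u v emb_gen fun_eq_iff)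
qed (use free_algebra_mult_closed free_algebra_gen u v in simp_all)

end

text \<open>Restricts \<open>K\<close> to plain ring records, the type for which
  \<open>embed K\<close> is defined.\<close>

locale lie_algebra' = lie_algebra K L
 for K :: "'k ring" and L :: "('k, 'a, 'r) lie_algebra_scheme"

abbreviation (in lie_algebra') "UA == free_algebra K (carrier L)"

locale lie_module' = lie_algebra' K L + lie_module K L M act
 for K :: "'k ring" and L :: "('k, 'a, 'r) lie_algebra_scheme" and M :: "('k, 'm, 's) module_scheme" and act

context lie_module'
begin

lemma foldr_act:
 assumes w: "w : lists (carrier L)"
 shows "m : carrier M ==> foldr act w m : carrier M"
  "m : carrier M ==> m' : carrier M ==> foldr act w (m \<oplus>\<^bsub>M\<^esub> m') = foldr act w m \<oplus>\<^bsub>M\<^esub> foldr act w m'"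
  "a : carrier K ==> m : carrier M ==> foldr act w (a \<odot>\<^bsub>M\<^esub> m) = a \<odot>\<^bsub>M\<^esub> foldr act w m"
proof -
 have 1: "foldr act w m : carrier M" if "m : carrier M" for m
  using w that by (induction w) (simp_all add: act_closed)
 show "m : carrier M ==> foldr act w m : carrier M" by (rule 1)
 have cl: "foldr act w m : carrier M" if "w : lists (carrier L)" "m : carrier M" for w m
  using that by (induction w) (simp_all add: act_closed)
 show "m : carrier M ==> m' : carrier M ==> foldr act w (m \<oplus>\<^bsub>M\<^esub> m') = foldr act w m \<oplus>\<^bsub>M\<^esub> foldr act w m'"
  using w by (induction w) (simp_all add: act_add_right cl)
 show "a : carrier K ==> m : carrier M ==> foldr act w (a \<odot>\<^bsub>M\<^esub> m) = a \<odot>\<^bsub>M\<^esub> foldr act w m"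
  using w by (induction w) (simp_all add: act_smult_right cl)
qed

lemma free_act_closed_term:
 "f : carrier UA ==> m : carrier M ==> f w ~= zero K ==> f w \<odot>\<^bsub>M\<^esub> foldr act w m : carrier M"
 by (rule smult_closed) (auto simp: free_algebra_simps free_space_simps intro!: foldr_act)

lemma free_act_closed: "f : carrier UA ==> m : carrier M ==> free_act K M act f m : carrier M"
 unfolding free_act_def by (rule M.finsum_closed) (simp add: free_act_closed_term Pi_def)

lemma free_act_superset:
 assumes f: "f : carrier UA" and m: "m : carrier M" and W: "finite W" "{w. f w ~= zero K} <= W" "W <= lists (carrier L)"
 shows "free_act K M act f m = finsum M (%w. f w \<odot>\<^bsub>M\<^esub> foldr act w m) W"
 unfolding free_act_def
proof (rule M.add.finprod_mono_neutral_cong_left[OF W(1,2)])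
 show "!!i. i : W - {w. f w ~= zero K} ==> f i \<odot>\<^bsub>M\<^esub> foldr act i m = zero M"
  using subsetD[OF W(3)] foldr_act(1)[OF _ m] by (simp del: in_lists_conv_set)
 show "(%w. f w \<odot>\<^bsub>M\<^esub> foldr act w m) : W \<rightarrow> carrier M"
  by (rule Pi_I, rule smult_closed[OF _ foldr_act(1)[OF subsetD[OF W(3)] m]])
  (use f in "simp_all add: free_algebra_simps free_space_simps")
qed simp

lemma free_algebra_supp:
 "f : carrier UA ==> finite {w. f w ~= zero K}" "f : carrier UA ==> {w. f w ~= zero K} <= lists (carrier L)"
 "f : carrier UA ==> f w : carrier K"
 by (auto simp: free_algebra_simps free_space_simps)

lemma free_act_linear:
 assumes f: "f : carrier UA" and m: "m : carrier M"
 shows "g : carrier UA ==> free_act K M act (f \<oplus>\<^bsub>UA\<^esub> g) m = free_act K M act f m \<oplus>\<^bsub>M\<^esub> free_act K M act g m"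
  "a : carrier K ==> free_act K M act (a \<odot>\<^bsub>UA\<^esub> f) m = a \<odot>\<^bsub>M\<^esub> free_act K M act f m"
  "m' : carrier M ==> free_act K M act f (m \<oplus>\<^bsub>M\<^esub> m') = free_act K M act f m \<oplus>\<^bsub>M\<^esub> free_act K M act f m'"
  "a : carrier K ==> free_act K M act f (a \<odot>\<^bsub>M\<^esub> m) = a \<odot>\<^bsub>M\<^esub> free_act K M act f m"
proof -
 interpret UA: vectorspace K UA by (rule free_algebra_vs[OF field_axioms])
 note fo = foldr_act(1)[OF _ m]
 show "free_act K M act (f \<oplus>\<^bsub>UA\<^esub> g) m = free_act K M act f m \<oplus>\<^bsub>M\<^esub> free_act K M act g m" if g: "g : carrier UA"
 proof -
  let ?W = "{w. f w ~= zero K} \<union> {w. g w ~= zero K}"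
  have W: "finite ?W" "?W <= lists (carrier L)" "{w. f w ~= zero K} <= ?W" "{w. g w ~= zero K} <= ?W"
  using free_algebra_supp[OF f] free_algebra_supp[OF g] by auto
  have s: "{w. (f \<oplus>\<^bsub>UA\<^esub> g) w ~= zero K} <= ?W" by (auto simp: free_algebra_simps free_space_simps)
  have mem: "w : ?W ==> foldr act w m : carrier M" for w using W(2) fo by blast
  show ?thesis
  unfolding free_act_superset[OF UA.M.a_closed[OF f g] m W(1) s W(2)] free_act_superset[OF f m W(1,3,2)] free_act_superset[OF g m W(1,4,2)]
  by (subst M.finsum_addf[symmetric], (rule Pi_I, rule smult_closed[OF free_algebra_supp(3)[OF f] mem], assumption),
  (rule Pi_I, rule smult_closed[OF free_algebra_supp(3)[OF g] mem], assumption))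
  (rule M.finsum_cong', rule refl, (rule Pi_I, intro M.a_closed smult_closed free_algebra_supp(3)[OF f] free_algebra_supp(3)[OF g] mem, assumption+),
  simp add: free_algebra_simps(2) free_space_simps(3) smult_l_distr free_algebra_supp(3)[OF f] free_algebra_supp(3)[OF g] mem)
 qed
 have fin: "finite {w. f w ~= zero K}" by (rule free_algebra_supp(1)[OF f])
 have mem: "w : {w. f w ~= zero K} ==> w : lists (carrier L)" for w using free_algebra_supp(2)[OF f] by blast
 note fk = free_algebra_supp(3)[OF f]
 show "free_act K M act (a \<odot>\<^bsub>UA\<^esub> f) m = a \<odot>\<^bsub>M\<^esub> free_act K M act f m" if a: "a : carrier K"
 proof -
  have s: "{w. (a \<odot>\<^bsub>UA\<^esub> f) w ~= zero K} <= {w. f w ~= zero K}" using a by (auto simp: free_algebra_simps free_space_simps)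
  show ?thesis
  unfolding free_act_superset[OF UA.smult_closed[OF a f] m fin s free_algebra_supp(2)[OF f]] unfolding free_act_def
  by (subst finsum_smult[OF a], (rule Pi_I, rule smult_closed[OF fk fo[OF mem]], assumption))
  (rule M.finsum_cong', rule refl, (rule Pi_I, intro smult_closed a fk fo mem, assumption),
  simp add: free_algebra_simps(4) free_space_simps(4) smult_assoc1 a fk fo[OF mem])
 qed
 show "free_act K M act f (m \<oplus>\<^bsub>M\<^esub> m') = free_act K M act f m \<oplus>\<^bsub>M\<^esub> free_act K M act f m'" if m': "m' : carrier M"
  unfolding free_act_def
  by (subst M.finsum_addf[symmetric], (rule Pi_I, rule smult_closed[OF fk fo[OF mem]], assumption),
  (rule Pi_I, rule smult_closed[OF fk foldr_act(1)[OF mem m']], assumption))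
  (rule M.finsum_cong', rule refl, (rule Pi_I, intro M.a_closed smult_closed fk fo[OF mem] foldr_act(1)[OF mem m'], assumption+),
  simp add: foldr_act(2)[OF mem m m'] smult_r_distr fk fo[OF mem] foldr_act(1)[OF mem m'])
 show "free_act K M act f (a \<odot>\<^bsub>M\<^esub> m) = a \<odot>\<^bsub>M\<^esub> free_act K M act f m" if a: "a : carrier K"
  unfolding free_act_def
  by (subst finsum_smult[OF a], (rule Pi_I, rule smult_closed[OF fk fo[OF mem]], assumption))
  (rule M.finsum_cong', rule refl, (rule Pi_I, intro smult_closed a fk fo mem, assumption),
  simp add: foldr_act(3)[OF mem a m] smult_assoc1[symmetric] m_comm a fk fo[OF mem])
qed

lemma free_act_gen: "w : lists (carrier L) ==> m : carrier M ==> free_act K M act (free_gen K w) m = foldr act w m"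
proof -
 assume w: "w : lists (carrier L)" and m: "m : carrier M"
 have "{v. free_gen K w v ~= zero K} = {w}" by (auto simp: free_gen_def)
 then show ?thesis unfolding free_act_def using foldr_act(1)[OF w m] by (simp add: free_gen_def)
qed

lemma free_act_zero: "m : carrier M ==> free_act K M act \<zero>\<^bsub>UA\<^esub> m = zero M"
 "f : carrier UA ==> free_act K M act f \<zero>\<^bsub>M\<^esub> = zero M"
 using free_act_linear(4)[of f "zero M" "zero K"] free_act_closed[of f "zero M"]
 by (simp_all add: free_act_def free_algebra_simps free_space_simps)

lemma free_algebra_induct:
 assumes Z: "linsub K UA Z" and g: "!!w. w : lists (carrier L) ==> free_gen K w : Z" and f: "f : carrier UA"
 shows "f : Z"
proof -
 have "linsub K (free_space K (lists (carrier L))) Z" using Z unfolding linsub_def free_algebra_simps .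
 from free_space_induct[OF field_axioms this g] show ?thesis using f by (auto simp: free_algebra_simps)
qed

text \<open>Both sides are bilinear in f and g, and on words both are the composition of the actions
  along the concatenation.\<close>

lemma free_act_mult:
 assumes f: "f : carrier UA" and g: "g : carrier UA" and m: "m : carrier M"
 shows "free_act K M act (f \<otimes>\<^bsub>UA\<^esub> g) m = free_act K M act f (free_act K M act g m)"
proof -
 interpret UA: vectorspace K UA by (rule free_algebra_vs[OF field_axioms])
 interpret UR: ring UA by (rule free_algebra_ring[OF field_axioms])
 note sm = free_algebra_smult[OF field_axioms]
 note gen = free_algebra_gen[OF field_axioms]
 let ?P = "%f g. free_act K M act (f \<otimes>\<^bsub>UA\<^esub> g) m = free_act K M act f (free_act K M act g m)"
 have 1: "?P (free_gen K u) g" if u: "u : lists (carrier L)" and g: "g : carrier UA" for u g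
 proof -
  note e = gen[OF u]
  have "linsub K UA {g : carrier UA. ?P (free_gen K u) g}"
  unfolding linsub_def
  proof (intro conjI ballI)
  show "zero UA : {g : carrier UA. ?P (free_gen K u) g}" using m e by (simp add: free_act_zero)
  show "x \<oplus>\<^bsub>UA\<^esub> y : {g : carrier UA. ?P (free_gen K u) g}"
  if "x : {g : carrier UA. ?P (free_gen K u) g}" "y : {g : carrier UA. ?P (free_gen K u) g}" for x y
  using that m e by (simp add: UR.r_distr free_act_linear free_act_closed)
  show "a \<odot>\<^bsub>UA\<^esub> y : {g : carrier UA. ?P (free_gen K u) g}"
  if "a : carrier K" "y : {g : carrier UA. ?P (free_gen K u) g}" for a y
  using that m e by (simp add: sm free_act_linear free_act_closed)
  qed auto
  moreover have "free_gen K v : {g : carrier UA. ?P (free_gen K u) g}" if v: "v : lists (carrier L)" for v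
  proof -
  have uv: "u @ v : lists (carrier L)" using u v by simp
  have "free_act K M act (free_gen K u) (free_act K M act (free_gen K v) m) = free_act K M act (free_gen K (u @ v)) m"
  unfolding free_act_gen[OF v m] free_act_gen[OF uv m] free_act_gen[OF u foldr_act(1)[OF v m]] by simp
  then show ?thesis using gen[OF v] free_gen_mult[OF field_axioms u v] by simp
  qed
  ultimately have "g : {g : carrier UA. ?P (free_gen K u) g}" using g by (rule free_algebra_induct)
  then show ?thesis by simp
 qed
 have "linsub K UA {f : carrier UA. ?P f g}"
  unfolding linsub_def
 proof (intro conjI ballI)
  show "zero UA : {f : carrier UA. ?P f g}" using m g free_act_closed by (simp add: free_act_zero)
  show "x \<oplus>\<^bsub>UA\<^esub> y : {f : carrier UA. ?P f g}"
  if "x : {f : carrier UA. ?P f g}" "y : {f : carrier UA. ?P f g}" for x y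
  using that m g by (simp add: UR.l_distr free_act_linear free_act_closed)
  show "a \<odot>\<^bsub>UA\<^esub> y : {f : carrier UA. ?P f g}" if "a : carrier K" "y : {f : carrier UA. ?P f g}" for a y
  using that m g by (simp add: sm free_act_linear free_act_closed)
 qed auto
 moreover have "free_gen K u : {f : carrier UA. ?P f g}" if u: "u : lists (carrier L)" for u
  using 1[OF u g] gen[OF u] by simp
 ultimately have "f : {f : carrier UA. ?P f g}" using f by (rule free_algebra_induct)
 then show ?thesis by simp
qed

lemma free_act_diff:
 assumes f: "f : carrier UA" and g: "g : carrier UA" and m: "m : carrier M"
 shows "free_act K M act (f \<ominus>\<^bsub>UA\<^esub> g) m = free_act K M act f m \<ominus>\<^bsub>M\<^esub> free_act K M act g m"
proof -
 interpret UA: vectorspace K UA by (rule free_algebra_vs[OF field_axioms])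
 have "linear_on K UA M (carrier UA) (%f. free_act K M act f m)"
  unfolding linear_on_def using free_act_linear(1,2)[OF _ m] free_act_closed[OF _ m] by blast
 from UA.linear_on_diff[OF M.vectorspace_axioms this UA.linsub_carrier f g] show ?thesis .
qed

end

lemma (in vectorspace) linsub_subgroup: "linsub K V Z ==> subgroup Z (add_monoid V)"
 by (rule group.subgroupI[OF M.a_group])
  (auto simp: linsubD linsub_neg simp flip: a_inv_def dest: linsubD(2))

context lie_algebra'
begin

lemma uea_rels_closed: "uea_rels K L <= carrier (UA)"
proof -
 interpret UA: vectorspace K "UA" by (rule free_algebra_vs[OF field_axioms])
 interpret UR: ring "UA" by (rule free_algebra_ring[OF field_axioms])
 have "free_gen K [x] : carrier (UA)" if "x : carrier L" for x
  by (rule free_algebra_gen[OF field_axioms]) (use that in simp)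
 then show ?thesis unfolding uea_rels_def Let_def by (auto simp: bracket_closed)
qed

lemma uea_ideal: "ideal (uea_ideal K L) (UA)"
 unfolding uea_ideal_def by (rule ring.genideal_ideal[OF free_algebra_ring[OF field_axioms] uea_rels_closed])

text \<open>A scalar acts as multiplication by a multiple of 1, so a two-sided ideal is a linear
  subspace.\<close>

lemma linsub_uea_ideal: "linsub K (UA) (uea_ideal K L)"
proof -
 interpret UA: vectorspace K "UA" by (rule free_algebra_vs[OF field_axioms])
 interpret I: ideal "uea_ideal K L" "UA" by (rule uea_ideal)
 let ?UA = "UA"
 have "a \<odot>\<^bsub>?UA\<^esub> f : uea_ideal K L" if a: "a : carrier K" and f: "f : uea_ideal K L" for a f
 proof -
  have fc: "f : carrier ?UA" using I.a_subset f by blast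
  have "(a \<odot>\<^bsub>?UA\<^esub> \<one>\<^bsub>?UA\<^esub>) \<otimes>\<^bsub>?UA\<^esub> f : uea_ideal K L"
  by (rule I.I_l_closed[OF f]) (simp add: a)
  then show ?thesis by (simp add: free_algebra_smult[OF field_axioms] a fc)
 qed
 then show ?thesis unfolding linsub_def using I.a_subset I.zero_closed I.a_closed by blast
qed

lemma uea_vs: "vectorspace K (uea K L)"
 unfolding uea_def by (rule vectorspace.quot_space_vs[OF free_algebra_vs[OF field_axioms] linsub_uea_ideal])

abbreviation "cl f == uea_ideal K L +>\<^bsub>UA\<^esub> f"

lemma uea_simps:
 "carrier (uea K L) = (%f. cl f) ` carrier (UA)"
 "f : carrier (UA) ==> g : carrier (UA) ==>
  cl f \<oplus>\<^bsub>uea K L\<^esub> cl g = cl (f \<oplus>\<^bsub>UA\<^esub> g)"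
 "a : carrier K ==> f : carrier (UA) ==>
  a \<odot>\<^bsub>uea K L\<^esub> cl f = cl (a \<odot>\<^bsub>UA\<^esub> f)"
 "f : carrier (UA) ==> g : carrier (UA) ==>
  cl f \<otimes>\<^bsub>uea K L\<^esub> cl g = cl (f \<otimes>\<^bsub>UA\<^esub> g)"
 "\<one>\<^bsub>uea K L\<^esub> = cl \<one>\<^bsub>UA\<^esub>"
proof -
 note q = vectorspace.quot_space_simps[OF free_algebra_vs[OF field_axioms] linsub_uea_ideal]
 show "carrier (uea K L) = (%f. cl f) ` carrier (UA)" unfolding uea_def by (rule q(1))
 show "f : carrier (UA) ==> g : carrier (UA) ==>
  cl f \<oplus>\<^bsub>uea K L\<^esub> cl g = cl (f \<oplus>\<^bsub>UA\<^esub> g)" unfolding uea_def by (rule q(3))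
 show "a : carrier K ==> f : carrier (UA) ==>
  a \<odot>\<^bsub>uea K L\<^esub> cl f = cl (a \<odot>\<^bsub>UA\<^esub> f)" unfolding uea_def by (rule q(4))
 show "f : carrier (UA) ==> g : carrier (UA) ==>
  cl f \<otimes>\<^bsub>uea K L\<^esub> cl g = cl (f \<otimes>\<^bsub>UA\<^esub> g)"
  unfolding uea_def quot_space_def by (simp add: ideal.rcoset_mult_add[OF uea_ideal])
 show "\<one>\<^bsub>uea K L\<^esub> = cl \<one>\<^bsub>UA\<^esub>" unfolding uea_def quot_space_def by simp
qed

lemma uea_closed:
 "u : carrier (uea K L) ==> v : carrier (uea K L) ==> u \<otimes>\<^bsub>uea K L\<^esub> v : carrier (uea K L)"
 "\<one>\<^bsub>uea K L\<^esub> : carrier (uea K L)"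
 "u : carrier (uea K L) ==> u [^]\<^bsub>uea K L\<^esub> (n::nat) : carrier (uea K L)"
 "x : carrier L ==> uea_incl K L x : carrier (uea K L)"
proof -
 interpret UR: ring "UA" by (rule free_algebra_ring[OF field_axioms])
 show 1: "u \<otimes>\<^bsub>uea K L\<^esub> v : carrier (uea K L)" if "u : carrier (uea K L)" "v : carrier (uea K L)" for u v
  using that by (auto simp: uea_simps(1,4))
 show 2: "\<one>\<^bsub>uea K L\<^esub> : carrier (uea K L)" by (simp add: uea_simps(1,5))
 show "u [^]\<^bsub>uea K L\<^esub> (n::nat) : carrier (uea K L)" if "u : carrier (uea K L)"
  using that by (induction n) (simp_all add: nat_pow_def 1 2)
 show "uea_incl K L x : carrier (uea K L)" if "x : carrier L"
  unfolding uea_incl_def uea_simps(1) by (rule imageI, rule free_algebra_gen[OF field_axioms]) (use that in simp)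
qed

end

context lie_module'
begin

text \<open>The annihilator of M in the free algebra is a two-sided ideal, and it contains the
  defining relations by the axioms of a Lie module.\<close>

lemma free_act_ideal:
 assumes f: "f : uea_ideal K L" and m: "m : carrier M"
 shows "free_act K M act f m = zero M"
proof -
 interpret UA: vectorspace K UA by (rule free_algebra_vs[OF field_axioms])
 interpret UR: ring UA by (rule free_algebra_ring[OF field_axioms])
 let ?I = "{f : carrier UA. ALL m:carrier M. free_act K M act f m = zero M}"
 have "linsub K UA ?I" unfolding linsub_def by (auto simp: free_act_zero free_act_linear)
 then have "ideal ?I UA"
  by (intro idealI[OF UR.ring_axioms] UA.linsub_subgroup) (auto simp: free_act_mult free_act_closed free_act_zero)
 moreover have "uea_rels K L <= ?I"
 proof -
  have g1: "free_gen K [x] : carrier UA" "free_act K M act (free_gen K [x]) m = act x m" if "x : carrier L" "m : carrier M" for x m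
  using that free_algebra_gen[OF field_axioms, of "[x]" "carrier L"] free_act_gen[of "[x]" m] by simp_all
  have g: "free_gen K [x] : carrier UA" if "x : carrier L" for x using g1[OF that M.zero_closed] by simp
  have d: "m \<ominus>\<^bsub>M\<^esub> m = zero M" if "m : carrier M" for m using that by (rule M.diff_self)
  have r1: "free_gen K [x \<oplus>\<^bsub>L\<^esub> y] \<ominus>\<^bsub>UA\<^esub> (free_gen K [x] \<oplus>\<^bsub>UA\<^esub> free_gen K [y]) : ?I" if "x : carrier L" "y : carrier L" for x y
  using that by (simp add: g free_act_diff free_act_linear g1 act_add_left d act_closed)
  have r2: "free_gen K [a \<odot>\<^bsub>L\<^esub> x] \<ominus>\<^bsub>UA\<^esub> (a \<odot>\<^bsub>UA\<^esub> free_gen K [x]) : ?I" if "a : carrier K" "x : carrier L" for a x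
  using that by (simp add: g free_act_diff free_act_linear g1 act_smult_left d act_closed)
  have r3: "(free_gen K [x] \<otimes>\<^bsub>UA\<^esub> free_gen K [y] \<ominus>\<^bsub>UA\<^esub> free_gen K [y] \<otimes>\<^bsub>UA\<^esub> free_gen K [x]) \<ominus>\<^bsub>UA\<^esub> free_gen K [bracket L x y] : ?I"
  if "x : carrier L" "y : carrier L" for x y
  using that by (simp add: g free_act_diff free_act_mult g1 act_bracket d act_closed bracket_closed)
  show ?thesis
  unfolding uea_rels_def Let_def
  by (intro Un_least subsetI) (elim CollectE exE conjE, hypsubst, rule r1 r2 r3, assumption+)+
 qed
 ultimately have "uea_ideal K L <= ?I" unfolding uea_ideal_def by (rule UR.genideal_minimal)
 from subsetD[OF this f] show ?thesis using m by simp
qed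

lemma uea_act_cl:
 assumes f: "f : carrier UA" and m: "m : carrier M"
 shows "uea_act K M act (cl f) m = free_act K M act f m"
proof -
 interpret UA: vectorspace K UA by (rule free_algebra_vs[OF field_axioms])
 note mc = UA.mem_coset[OF linsub_uea_ideal f]
 have "free_act K M act g m = free_act K M act f m" if "g : cl f" for g
 proof -
  have g: "g : carrier UA" "g \<ominus>\<^bsub>UA\<^esub> f : uea_ideal K L" using that mc by auto
  have "free_act K M act g m \<ominus>\<^bsub>M\<^esub> free_act K M act f m = zero M"
  using free_act_ideal[OF g(2) m] free_act_diff[OF g(1) f m] by simp
  then show ?thesis by (rule iffD1[OF M.diff_zero_iff[OF free_act_closed[OF g(1) m] free_act_closed[OF f m]]])
 qed
 then have "(%f. free_act K M act f m) ` cl f = (%g. free_act K M act f m) ` cl f" by (rule image_cong[OF refl])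
 also have "... = {free_act K M act f m}"
  by (rule image_constant[of f]) (use mc f in "simp add: UA.diff_self linsubD(2)[OF linsub_uea_ideal]")
 finally show ?thesis by (simp add: uea_act_def)
qed

lemma uea_act:
 assumes u: "u : carrier (uea K L)" and m: "m : carrier M"
 shows "uea_act K M act u m : carrier M"
  "v : carrier (uea K L) ==> uea_act K M act (u \<oplus>\<^bsub>uea K L\<^esub> v) m = uea_act K M act u m \<oplus>\<^bsub>M\<^esub> uea_act K M act v m"
  "a : carrier K ==> uea_act K M act (a \<odot>\<^bsub>uea K L\<^esub> u) m = a \<odot>\<^bsub>M\<^esub> uea_act K M act u m"
  "m' : carrier M ==> uea_act K M act u (m \<oplus>\<^bsub>M\<^esub> m') = uea_act K M act u m \<oplus>\<^bsub>M\<^esub> uea_act K M act u m'"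
  "a : carrier K ==> uea_act K M act u (a \<odot>\<^bsub>M\<^esub> m) = a \<odot>\<^bsub>M\<^esub> uea_act K M act u m"
  "v : carrier (uea K L) ==> uea_act K M act (u \<otimes>\<^bsub>uea K L\<^esub> v) m = uea_act K M act u (uea_act K M act v m)"
  "v : carrier (uea K L) ==> uea_act K M act (u \<ominus>\<^bsub>uea K L\<^esub> v) m = uea_act K M act u m \<ominus>\<^bsub>M\<^esub> uea_act K M act v m"
  "uea_act K M act (u [^]\<^bsub>uea K L\<^esub> (n::nat)) m = (uea_act K M act u ^^ n) m"
proof -
 interpret UA: vectorspace K UA by (rule free_algebra_vs[OF field_axioms])
 interpret UR: ring UA by (rule free_algebra_ring[OF field_axioms])
 interpret U: vectorspace K "uea K L" by (rule uea_vs)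
 have rep: "EX f:carrier UA. u = cl f" if "u : carrier (uea K L)" for u
  using that unfolding uea_simps(1) by (elim imageE) (rule bexI)
 have cl: "uea_act K M act u m : carrier M" if "u : carrier (uea K L)" "m : carrier M" for u m
 proof -
  note h = that
  obtain f where "f : carrier UA" "u = cl f" using rep[OF h(1)] by blast
  then show ?thesis using h by (simp add: uea_act_cl free_act_closed)
 qed
 have add: "uea_act K M act (u \<oplus>\<^bsub>uea K L\<^esub> v) m = uea_act K M act u m \<oplus>\<^bsub>M\<^esub> uea_act K M act v m"
  if "u : carrier (uea K L)" "v : carrier (uea K L)" "m : carrier M" for u v m
 proof -
  note h = that
  obtain f g where "f : carrier UA" "u = cl f" "g : carrier UA" "v = cl g" using rep[OF h(1)] rep[OF h(2)] by blast
  then show ?thesis using h(3) by (simp add: uea_simps(2) uea_act_cl free_act_linear)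
 qed
 have sm: "uea_act K M act (a \<odot>\<^bsub>uea K L\<^esub> u) m = a \<odot>\<^bsub>M\<^esub> uea_act K M act u m"
  if "a : carrier K" "u : carrier (uea K L)" "m : carrier M" for a u m
 proof -
  note h = that
  obtain f where "f : carrier UA" "u = cl f" using rep[OF h(2)] by blast
  then show ?thesis using h by (simp add: uea_simps(3) uea_act_cl free_act_linear)
 qed
 have mult: "uea_act K M act (u \<otimes>\<^bsub>uea K L\<^esub> v) m = uea_act K M act u (uea_act K M act v m)"
  if "u : carrier (uea K L)" "v : carrier (uea K L)" "m : carrier M" for u v m
 proof -
  note h = that
  obtain f g where "f : carrier UA" "u = cl f" "g : carrier UA" "v = cl g" using rep[OF h(1)] rep[OF h(2)] by blast
  then show ?thesis using h(3) by (simp add: uea_simps(4) uea_act_cl free_act_mult free_act_closed)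
 qed
 show "uea_act K M act u m : carrier M" by (rule cl[OF u m])
 show "v : carrier (uea K L) ==> uea_act K M act (u \<oplus>\<^bsub>uea K L\<^esub> v) m = uea_act K M act u m \<oplus>\<^bsub>M\<^esub> uea_act K M act v m"
  by (rule add[OF u _ m])
 show "a : carrier K ==> uea_act K M act (a \<odot>\<^bsub>uea K L\<^esub> u) m = a \<odot>\<^bsub>M\<^esub> uea_act K M act u m"
  by (rule sm[OF _ u m])
 show "v : carrier (uea K L) ==> uea_act K M act (u \<otimes>\<^bsub>uea K L\<^esub> v) m = uea_act K M act u (uea_act K M act v m)"
  by (rule mult[OF u _ m])
 show "uea_act K M act u (m \<oplus>\<^bsub>M\<^esub> m') = uea_act K M act u m \<oplus>\<^bsub>M\<^esub> uea_act K M act u m'" if "m' : carrier M"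
 proof -
  note h = that
  obtain f where "f : carrier UA" "u = cl f" using rep[OF u] by blast
  then show ?thesis using h m by (simp add: uea_act_cl free_act_linear)
 qed
 show "uea_act K M act u (a \<odot>\<^bsub>M\<^esub> m) = a \<odot>\<^bsub>M\<^esub> uea_act K M act u m" if "a : carrier K"
 proof -
  note h = that
  obtain f where "f : carrier UA" "u = cl f" using rep[OF u] by blast
  then show ?thesis using h m by (simp add: uea_act_cl free_act_linear)
 qed
 have "linear_on K (uea K L) M (carrier (uea K L)) (%u. uea_act K M act u m)"
  unfolding linear_on_def by (intro conjI ballI cl add sm m)
 from U.linear_on_diff[OF M.vectorspace_axioms this U.linsub_carrier u]
 show "v : carrier (uea K L) ==> uea_act K M act (u \<ominus>\<^bsub>uea K L\<^esub> v) m = uea_act K M act u m \<ominus>\<^bsub>M\<^esub> uea_act K M act v m" .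
 show "uea_act K M act (u [^]\<^bsub>uea K L\<^esub> (n::nat)) m = (uea_act K M act u ^^ n) m"
  using m
 proof (induction n arbitrary: m)
  case 0
  have "u [^]\<^bsub>uea K L\<^esub> (0::nat) = cl \<one>\<^bsub>UA\<^esub>" unfolding uea_simps(5)[symmetric] by (simp add: nat_pow_def)
  then have "uea_act K M act (u [^]\<^bsub>uea K L\<^esub> (0::nat)) m = free_act K M act \<one>\<^bsub>UA\<^esub> m"
  by (simp only: uea_act_cl[OF UR.one_closed 0])
  also have "... = m" unfolding free_algebra_simps(5) using free_act_gen[of "[]" m] 0 by simp
  finally show ?case by simp
 next
  case (Suc n)
  have "u [^]\<^bsub>uea K L\<^esub> Suc n = u [^]\<^bsub>uea K L\<^esub> n \<otimes>\<^bsub>uea K L\<^esub> u" by (simp add: nat_pow_def)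
  then have "uea_act K M act (u [^]\<^bsub>uea K L\<^esub> Suc n) m = (uea_act K M act u ^^ n) (uea_act K M act u m)"
  by (simp only: mult[OF uea_closed(3)[OF u] u Suc.prems] Suc.IH[OF cl[OF u Suc.prems]])
  then show ?case by (simp only: funpow_Suc_right o_apply)
 qed
qed

lemma uea_act_incl: "x : carrier L ==> m : carrier M ==> uea_act K M act (uea_incl K L x) m = act x m"
 using free_algebra_gen[OF field_axioms, of "[x]" "carrier L"] free_act_gen[of "[x]" m]
 by (simp add: uea_incl_def uea_act_cl)

end

lemma p_hull_least:
 assumes "vectorspace K U" "linsub K U S" "!!x y. x : S ==> y : S ==> bracket U x y : S" "!!x. x : S ==> pw x : S"
  and "X <= S"
 shows "p_hull K U pw X <= S"
proof -
 have "p_subalgebra K U pw S"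
  unfolding p_subalgebra_def VectorSpace.subspace_def
  by (intro conjI ballI assms(1,3,4) iffD1[OF vectorspace.linsub_submodule[OF assms(1)] assms(2)])
 then show ?thesis unfolding p_hull_def by (intro Inter_lower CollectI conjI assms(5))
qed

lemma commutator_lie_simps:
 "carrier (commutator_lie A) = carrier A" "add (commutator_lie A) = add A" "zero (commutator_lie A) = zero A"
 "smult (commutator_lie A) = smult A" "bracket (commutator_lie A) x y = x \<otimes>\<^bsub>A\<^esub> y \<ominus>\<^bsub>A\<^esub> y \<otimes>\<^bsub>A\<^esub> x"
 by (simp_all add: commutator_lie_def)

section \<open>Extension of a Lie algebra by one dimension\<close>

text \<open>\<open>e\<close> is the projection of the ambient group of values onto the module. The
  operators \<open>act\<close> and \<open>sc\<close> take values in its image, and \<open>ev\<close>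
  singles out the forms with values there.\<close>

locale lie_complex = lie_forms ad sm KK sc B br act zr
 for ad :: "'g => 'g => 'g" and sm :: "'k => 'g => 'g" and KK :: "'k set"
  and sc :: "'k => 'b::ab_group_add => 'b" and B :: "'g set" and br and act and zr +
 fixes e :: "'b => 'b"
 assumes sc_comm: "a : KK ==> b : KK ==> sc a (sc b v) = sc b (sc a v)"
  and e: "e (v + w) = e v + e w" "e (act y v) = act y v" "e (sc a v) = sc a v"
begin

definition ev :: "('g list => 'b) => bool"
 where "ev F \<longleftrightarrow> (ALL xs. e (F xs) = F xs)"

text \<open>Forms are functions on all lists, examined only on tuples from \<open>A\<close>. The
  same function thus represents a cochain on each subalgebra, and restriction does not alter
  it.\<close>

definition cocyc :: "'g set => nat => ('g list => 'b) => bool"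
 where "cocyc A n F \<longleftrightarrow> altf A n F & ev F & (ALL xs:tups A (Suc n). dd act br F xs = 0)"

definition cobd :: "'g set => nat => ('g list => 'b) => bool"
 where "cobd A n F \<longleftrightarrow> altf A n F & ev F & (case n of 0 => F [] = 0
  | Suc m => EX G. altf A m G & ev G & (ALL xs:tups A n. F xs = dd act br G xs))"

lemma e0: "e 0 = 0" "e (- v) = - e v" "e (v - w) = e v - e w"
 by (rule additive0[OF e(1)], rule additive_minus[OF e(1)], rule additive_minus[OF e(1)])

lemma ev_th: "(!!v. e (u v) = u v) ==> ev F ==> ev (th u D F)"
proof -
 assume u: "!!v. e (u v) = u v"
 have "(ALL v. e (u v) = u v) --> (ALL ys. e (F ys) = F ys) --> e (th u D F xs) = th u D F xs" for F xs
  by (induction u D F xs rule: th.induct) (simp_all add: e0)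
 with u show "ev F ==> ev (th u D F)" by (simp add: ev_def)
qed

lemma ev_dd: "ev F ==> ev (dd act br F)"
proof -
 have "ALL F. ev F --> e (dd act br F xs) = dd act br F xs" for xs
 proof (induction xs)
  case (Cons y xs)
  show ?case
  proof (intro allI impI)
  fix F assume F: "ev F"
  have "ev (%ys. F (y # ys))" using F by (simp add: ev_def)
  moreover have "ev (th (act y) (br y) F)" by (rule ev_th[OF e(2) F])
  ultimately show "e (dd act br F (y # xs)) = dd act br F (y # xs)" using Cons by (simp add: e0 ev_def)
  qed
 qed (simp add: e0)
 then show "ev F ==> ev (dd act br F)" by (simp add: ev_def)
qed

lemma alt_forms': "alt_forms KK sc" by unfold_locales (rule sc_add)

lemma in_set_B: "xs : tups A n ==> A <= B ==> y : set xs ==> y : B"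
 by (auto simp: tups_def)

lemma dd0: "A <= B ==> xs : tups A n ==> dd act br (%xs. 0) xs = 0"
 by (rule dd_zero) (rule act_add, rule in_set_B)

lemma dd_minus: "A <= B ==> xs : tups A n ==>
  dd act br (%xs. f xs - g xs) xs = dd act br f xs - dd act br g xs"
 by (rule dd_diff) (rule act_add, rule in_set_B)

lemma dd_plus: "A <= B ==> xs : tups A n ==>
  dd act br (%xs. f xs + g xs) xs = dd act br f xs + dd act br g xs"
 by (rule dd_add) (rule act_add, rule in_set_B)

lemma subB: "subalg_on B"
 using B br_lin unfolding subalg_on_def lin_on_def by blast

lemma cobdI: "altf A (Suc m) F ==> ev F ==> altf A m G ==> ev G ==>
  (!!xs. xs : tups A (Suc m) ==> F xs = dd act br G xs) ==> cobd A (Suc m) F"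
 unfolding cobd_def by auto

lemma cobdE:
 assumes "cobd A (Suc m) F"
 obtains G where "altf A m G" "ev G" "!!xs. xs : tups A (Suc m) ==> F xs = dd act br G xs"
 using assms unfolding cobd_def by auto

lemma cocyc_cong:
 assumes A: "subalg_on A" and eq: "!!xs. xs : tups A n ==> F xs = G xs" and G: "ev G" and F: "cocyc A n F"
 shows "cocyc A n G"
proof -
 have "dd act br G xs = 0" if "xs : tups A (Suc n)" for xs
 proof -
  have "dd act br F xs = dd act br G xs" by (rule dd_cong[OF eq _ that]) (use subalgD(3)[OF A] in auto)
  then show ?thesis using F that by (simp add: cocyc_def)
 qed
 moreover have "altf A n G" by (rule altf_cong[OF eq subalgD(2)[OF A]]) (use F in "simp_all add: cocyc_def")
 ultimately show ?thesis using G by (simp add: cocyc_def)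
qed

lemma cobd_cong:
 assumes A: "subalg_on A" and eq: "!!xs. xs : tups A n ==> F xs = G xs" and G: "ev G" and F: "cobd A n F"
 shows "cobd A n G"
proof -
 have aG: "altf A n G" by (rule altf_cong[OF eq subalgD(2)[OF A]]) (use F in "simp_all add: cobd_def")
 show ?thesis
 proof (cases n)
  case 0
  then show ?thesis using F G eq[of "[]"] by (simp add: cobd_def)
 next
  case (Suc m)
  obtain E where "altf A m E" "ev E" "!!xs. xs : tups A (Suc m) ==> F xs = dd act br E xs"
  using cobdE[OF F[unfolded Suc]] by blast
  then show ?thesis using aG G eq unfolding Suc by (intro cobdI[of A m G E]) auto
 qed
qed

lemma cocyc_add:
 assumes A: "A <= B" and F: "cocyc A n F" and G: "cocyc A n G"
 shows "cocyc A n (%xs. F xs + G xs)"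
 using F G dd_plus[OF A] altf_add by (simp add: cocyc_def ev_def e)

lemma cobd_add:
 assumes A: "A <= B" and F: "cobd A n F" and G: "cobd A n G"
 shows "cobd A n (%xs. F xs + G xs)"
proof -
 have a: "altf A n (%xs. F xs + G xs)" "ev (%xs. F xs + G xs)" using F G altf_add by (simp_all add: cobd_def ev_def e)
 show ?thesis
 proof (cases n)
  case 0
  then show ?thesis using F G a by (simp add: cobd_def)
 next
  case (Suc m)
  obtain E E' where E: "altf A m E" "ev E" "!!xs. xs : tups A (Suc m) ==> F xs = dd act br E xs"
  "altf A m E'" "ev E'" "!!xs. xs : tups A (Suc m) ==> G xs = dd act br E' xs"
  using cobdE[OF F[unfolded Suc]] cobdE[OF G[unfolded Suc]] by metis
  have "ev (%xs. E xs + E' xs)" using E by (simp add: ev_def e)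
  then show ?thesis
  unfolding Suc by (intro cobdI[OF a[unfolded Suc] altf_add[OF E(1,4)]]) (simp_all add: E(3,6) dd_plus[OF A])
 qed
qed

lemma cobd_diff:
 assumes A: "A <= B" and F: "cobd A n F" and G: "cobd A n G"
 shows "cobd A n (%xs. F xs - G xs)"
proof -
 have a: "altf A n (%xs. F xs - G xs)" "ev (%xs. F xs - G xs)" using F G altf_diff by (simp_all add: cobd_def ev_def e0)
 show ?thesis
 proof (cases n)
  case 0
  then show ?thesis using F G a by (simp add: cobd_def)
 next
  case (Suc m)
  obtain E E' where E: "altf A m E" "ev E" "!!xs. xs : tups A (Suc m) ==> F xs = dd act br E xs"
  "altf A m E'" "ev E'" "!!xs. xs : tups A (Suc m) ==> G xs = dd act br E' xs"
  using cobdE[OF F[unfolded Suc]] cobdE[OF G[unfolded Suc]] by metis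
  have "ev (%xs. E xs - E' xs)" using E by (simp add: ev_def e0)
  then show ?thesis
  unfolding Suc by (intro cobdI[OF a[unfolded Suc] altf_diff[OF E(1,4)]]) (simp_all add: E(3,6) dd_minus[OF A])
 qed
qed

lemma dd_sc: "A <= B ==> xs : tups A n ==> a : KK ==> dd act br (%xs. sc a (F xs)) xs = sc a (dd act br F xs)"
 by (rule dd_hom[OF sc_add]) (use act_lin in_set_B in "auto simp: lin_op_def")

lemma altf_sc: "a : KK ==> altf A n F ==> altf A n (%xs. sc a (F xs))"
 by (rule altf_hom[OF sc_add sc_comm])

lemma ev_sc: "ev (%xs. sc a (F xs))"
 by (simp add: ev_def e)

lemma cocyc_sc:
 assumes A: "A <= B" and a: "a : KK" and F: "cocyc A n F"
 shows "cocyc A n (%xs. sc a (F xs))"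
 using F dd_sc[OF A _ a] altf_sc[OF a] ev_sc sc_simps(1)[OF a] by (simp add: cocyc_def)

lemma cobd_sc:
 assumes A: "A <= B" and a: "a : KK" and F: "cobd A n F"
 shows "cobd A n (%xs. sc a (F xs))"
proof (cases n)
 case 0
 then show ?thesis using F altf_sc[OF a] ev_sc sc_simps(1)[OF a] by (simp add: cobd_def)
next
 case (Suc m)
 obtain E where E: "altf A m E" "ev E" "!!xs. xs : tups A (Suc m) ==> F xs = dd act br E xs"
  using cobdE[OF F[unfolded Suc]] by blast
 have "altf A (Suc m) F" using F Suc by (simp add: cobd_def)
 from cobdI[OF altf_sc[OF a this] ev_sc altf_sc[OF a E(1)] ev_sc] show ?thesis
  unfolding Suc by (simp add: E(3) dd_sc[OF A _ a])
qed

lemma cobd_cocyc: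
 assumes A: "subalg_on A" and z: "zr : A" and F: "cobd A n F"
 shows "cocyc A n F"
proof (cases n)
 case 0
 have AB: "A <= B" using A by (simp add: subalg_on_def)
 have "cocyc A n (%xs. 0)" using dd0[OF AB] altf_zero by (simp add: cocyc_def ev_def e0)
 then show ?thesis by (rule cocyc_cong[OF A, rotated 2]) (use F 0 in "simp_all add: cobd_def")
next
 case (Suc m)
 obtain E where E: "altf A m E" "ev E" "!!xs. xs : tups A (Suc m) ==> F xs = dd act br E xs"
  using cobdE[OF F[unfolded Suc]] by blast
 have "cocyc A n (dd act br E)"
  unfolding Suc cocyc_def using altf_dd[OF A z E(1)] ev_dd[OF E(2)] dd_dd[OF A E(1)] by blast
 then show ?thesis by (rule cocyc_cong[OF A, rotated 2]) (use E(3) F Suc in "simp_all add: cobd_def")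
qed

end

text \<open>\<open>B\<close> is the sum of H and the line through x, with projection
  \<open>\<pi>\<close> onto H and coordinate \<open>\<chi>\<close> along x. The coordinate of x acts
  as 1 does, namely on the values as the projection \<open>e\<close>. That x and H span B is stated
  by \<open>gen\<close> as an induction principle.\<close>

locale lie_cone = lie_complex ad sm KK sc B br act zr e
 for ad :: "'g => 'g => 'g" and sm :: "'k => 'g => 'g" and KK :: "'k set"
  and sc :: "'k => 'b::ab_group_add => 'b" and B :: "'g set" and br and act and zr and e +
 fixes H :: "'g set" and \<chi> :: "'g => 'k" and \<pi> :: "'g => 'g" and x :: 'g
 assumes H: "subalg_on H" "zr : H" and x: "x : B" and ideal: "h : H ==> br x h : H"
  and pi: "y : B ==> \<pi> y : H" "h : H ==> \<pi> h = h" "\<pi> x = zr"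
  "y : B ==> z : B ==> \<pi> (ad y z) = ad (\<pi> y) (\<pi> z)" "a : KK ==> y : B ==> \<pi> (sm a y) = sm a (\<pi> y)"
  and chi: "y : B ==> \<chi> y : KK" "y : B ==> z : B ==> sc (\<chi> (ad y z)) v = sc (\<chi> y) v + sc (\<chi> z) v"
  "a : KK ==> y : B ==> sc (\<chi> (sm a y)) v = sc a (sc (\<chi> y) v)" "h : H ==> sc (\<chi> h) v = 0" "sc (\<chi> x) v = e v"
  and gen: "insert x H <= T ==> T <= B ==> (!!y z. y : T ==> z : T ==> ad y z : T) ==>
  (!!a y. a : KK ==> y : T ==> sm a y : T) ==> B <= T"
begin

lemma HB: "H <= B" using H(1) by (simp add: subalg_on_def)

text \<open>The product of \<open>\<chi>\<close> with the pullback of g along \<open>\<pi>\<close>.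
  It represents the pair (0, g): it vanishes on H, and its contraction with x restricts to
  g.\<close>

definition W :: "('g list => 'b) => 'g list => 'b"
 where "W g = wedge sc \<chi> (%xs. g (map \<pi> xs))"

lemma ev_wedge: "ev (wedge sc \<chi> g)"
proof -
 have "e (wedge sc \<chi> g xs) = wedge sc \<chi> g xs" for g xs
  by (induction xs arbitrary: g) (simp_all add: e0 e)
 then show ?thesis by (simp add: ev_def)
qed

lemma altf_pi: "altf H n g ==> altf B n (%xs. g (map \<pi> xs))"
 by (rule altf_map[where h = \<pi> and A = B and A' = H and ad = ad and ad' = ad and sm = sm and sm' = sm, OF alt_forms'])
  (simp_all add: pi)

lemma map_pi: "hs : tups H n ==> map \<pi> hs = hs"
 by (rule map_idI) (auto simp: tups_def pi(2))

lemma W_props: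
 assumes g: "altf H m g" "ev g"
 shows "altf B (Suc m) (W g)" "ev (W g)" "hs : tups H k ==> W g hs = 0"
  "hs : tups H k ==> W g (x # hs) = g hs"
proof -
 show "altf B (Suc m) (W g)"
  unfolding W_def by (rule altf_wedge[OF B chi(1,2,3) sc_comm]) (auto intro: altf_pi g)
 show "ev (W g)" unfolding W_def by (rule ev_wedge)
 have z: "wedge sc \<chi> G hs = 0" if "hs : tups H k" for G hs k
  by (rule wedge_zero) (use that in "auto simp: tups_def chi(4)")
 show "hs : tups H k ==> W g hs = 0" unfolding W_def by (rule z)
 show "hs : tups H k ==> W g (x # hs) = g hs"
  using g(2) by (simp add: W_def z chi(5) map_pi ev_def)
qed

lemma zero_ext:
 assumes "altf B n F" "!!hs. hs : tups H n ==> F hs = 0"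
  "!!hs m. n = Suc m ==> hs : tups H m ==> F (x # hs) = 0" "xs : tups B n"
 shows "F xs = 0"
 by (rule altf_zero_extension[OF B _ gen assms]) (use x HB in auto)

lemma dd_H: "(!!hs. hs : tups H n ==> f hs = g hs) ==> hs : tups H (Suc n) ==> dd act br f hs = dd act br g hs"
 by (rule dd_cong) (use subalgD(3)[OF H(1)] in auto)

lemma th_H: "(!!hs. hs : tups H n ==> f hs = g hs) ==> hs : tups H n ==> th (act x) (br x) f hs = th (act x) (br x) g hs"
 by (rule th_cong) (use ideal in auto)

lemma th0: "th (act x) (br x) (%xs. 0) hs = 0" by (rule th_zero) (rule act_add[OF x])

text \<open>For pairs this says d(0, g) = (0, -dg). The sign is that of iota_x d = theta_x - d
  iota_x, where the term with theta_x vanishes on H.\<close>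

lemma dd_W:
 assumes g: "altf H m g" "ev g"
 shows "hs : tups H k ==> dd act br (W g) hs = 0"
  "hs : tups H (Suc m) ==> dd act br (W g) (x # hs) = - dd act br g hs"
proof -
 note w = W_props[OF g]
 show "dd act br (W g) hs = 0" if "hs : tups H k" for k hs
 proof (cases k)
  case (Suc l)
  then show ?thesis using dd_H[of l "W g" "%xs. 0" hs] w(3) dd0[OF HB] that by simp
 qed (use that in simp)
 show "dd act br (W g) (x # hs) = - dd act br g hs" if hs: "hs : tups H (Suc m)"
  using th_H[of "Suc m" "W g" "%xs. 0", OF w(3) hs] th0 dd_H[of m "%ys. W g (x # ys)" g, OF w(4) hs] by simp
qed

lemma cocyc_restrict: "cocyc B n F ==> cocyc H n F"
 unfolding cocyc_def using altf_mono[OF HB] tups_mono[OF HB] by blast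

lemma cobd_restrict:
 assumes F: "cobd B n F"
 shows "cobd H n F"
proof (cases n)
 case 0
 then show ?thesis using F altf_mono[OF HB] by (simp add: cobd_def)
next
 case (Suc m)
 obtain G where G: "altf B m G" "ev G" "!!xs. xs : tups B (Suc m) ==> F xs = dd act br G xs"
  using cobdE[OF F[unfolded Suc]] by blast
 have F': "altf B (Suc m) F" "ev F" using F Suc by (simp_all add: cobd_def)
 show ?thesis
  unfolding Suc by (rule cobdI[OF altf_mono[OF HB F'(1)] F'(2) altf_mono[OF HB G(1)] G(2) G(3)[OF tups_mono[OF HB]]])
qed

lemma W_cong:
 assumes g: "altf H m g" "ev g" and g': "altf H m g'" "ev g'"
  and eq: "!!hs. hs : tups H m ==> g hs = g' hs" and xs: "xs : tups B (Suc m)"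
 shows "W g xs = W g' xs"
proof -
 note w = W_props[OF g] and w' = W_props[OF g']
 have "W g xs - W g' xs = 0"
  by (rule zero_ext[OF altf_diff[OF w(1) w'(1)] _ _ xs]) (simp_all add: w(3,4) w'(3,4) eq)
 then show ?thesis by simp
qed

lemma W_add:
 assumes g: "altf H m g" "ev g" and g': "altf H m g'" "ev g'" and xs: "xs : tups B (Suc m)"
 shows "W (%ys. g ys + g' ys) xs = W g xs + W g' xs"
proof -
 have "ev (%ys. g ys + g' ys)" using g(2) g'(2) by (simp add: ev_def e)
 note w = W_props[OF g] and w' = W_props[OF g'] and w'' = W_props[OF altf_add[OF g(1) g'(1)] this]
 have "W (%ys. g ys + g' ys) xs - (W g xs + W g' xs) = 0"
  by (rule zero_ext[OF altf_diff[OF w''(1) altf_add[OF w(1) w'(1)]] _ _ xs]) (simp_all add: w(3,4) w'(3,4) w''(3,4))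
 then show ?thesis by simp
qed

lemma W_sc:
 assumes g: "altf H m g" "ev g" and a: "a : KK" and xs: "xs : tups B (Suc m)"
 shows "W (%ys. sc a (g ys)) xs = sc a (W g xs)"
proof -
 note w = W_props[OF g] and w' = W_props[OF altf_sc[OF a g(1)] ev_sc]
 have "W (%ys. sc a (g ys)) xs - sc a (W g xs) = 0"
  by (rule zero_ext[OF altf_diff[OF w'(1) altf_sc[OF a w(1)]] _ _ xs]) (simp_all add: w(3,4) w'(3,4) sc_simps(1)[OF a])
 then show ?thesis by simp
qed

lemma cocyc_W:
 assumes g: "cocyc H m g"
 shows "cocyc B (Suc m) (W g)"
proof -
 have g': "altf H m g" "ev g" "!!xs. xs : tups H (Suc m) ==> dd act br g xs = 0" using g by (auto simp: cocyc_def)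
 have zB: "zr : B" using H(2) HB by blast
 have "dd act br (W g) xs = 0" if "xs : tups B (Suc (Suc m))" for xs
  by (rule zero_ext[OF altf_dd[OF subB zB W_props(1)[OF g'(1,2)]] _ _ that])
  (use dd_W[OF g'(1,2)] g'(3) in simp_all)
 then show ?thesis using W_props[OF g'(1,2)] by (simp add: cocyc_def)
qed

text \<open>A pair (f, g) with df = 0 and theta_x f = dg is closed. It is realized by the pullback
  of f along \<open>\<pi>\<close>, whose contraction with x is zero on H, plus
  \<open>W g\<close>.\<close>

lemma cocyc_extend:
 assumes f: "cocyc H (Suc m) f" and t: "cobd H (Suc m) (th (act x) (br x) f)"
 shows "EX F. cocyc B (Suc m) F & (ALL hs:tups H (Suc m). F hs = f hs)"
proof -
 have f': "altf H (Suc m) f" "ev f" "!!xs. xs : tups H (Suc (Suc m)) ==> dd act br f xs = 0" using f by (auto simp: cocyc_def)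
 obtain g where g: "altf H m g" "ev g" "!!xs. xs : tups H (Suc m) ==> th (act x) (br x) f xs = dd act br g xs"
  using t by (auto simp: cobd_def)
 define F where "F xs = f (map \<pi> xs) + W g xs" for xs
 note w = W_props[OF g(1,2)]
 have F: "altf B (Suc m) F" unfolding F_def by (rule altf_add[OF altf_pi[OF f'(1)] w(1)])
 have zB: "zr : B" using H(2) HB by blast
 have F1: "F hs = f hs" if "hs : tups H k" for hs k using that w(3) by (simp add: F_def map_pi)
 have F2: "F (x # hs) = g hs" if hs: "hs : tups H m" for hs
  using altf_zr[OF f'(1) H(2) HB hs] w(4)[OF hs] by (simp add: F_def pi(3) map_pi[OF hs])
 have "dd act br F xs = 0" if "xs : tups B (Suc (Suc m))" for xs
 proof (rule zero_ext[OF altf_dd[OF subB zB F] _ _ that])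
  show "dd act br F hs = 0" if "hs : tups H (Suc (Suc m))" for hs
  using dd_H[of "Suc m" F f, OF F1 that] f'(3)[OF that] by simp
  show "dd act br F (x # hs) = 0" if "Suc (Suc m) = Suc l" "hs : tups H l" for hs l
  proof -
  have hs: "hs : tups H (Suc m)" using that by simp
  show ?thesis
  using th_H[of "Suc m" F f, OF F1 hs] dd_H[of m "%ys. F (x # ys)" g, OF F2 hs] g(3)[OF hs] by simp
  qed
 qed
 moreover have "ev F" using f'(2) w(2) by (simp add: F_def ev_def e)
 ultimately show ?thesis using F F1 unfolding cocyc_def by blast
qed

text \<open>If F equals dh on H, then h is extended to B along \<open>\<pi>\<close> and its
  differential subtracted. The difference E vanishes on H, so it is the pair (0, g) with g = iota_x
  E, and g is closed because theta_x E vanishes on H.\<close>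

lemma cocyc_split:
 assumes F: "cocyc B (Suc m) F" and b: "cobd H (Suc m) F"
 shows "EX g. cocyc H m g & cobd B (Suc m) (%xs. F xs - W g xs)"
proof -
 have F': "altf B (Suc m) F" "ev F" "!!xs. xs : tups B (Suc (Suc m)) ==> dd act br F xs = 0" using F by (auto simp: cocyc_def)
 obtain h where h: "altf H m h" "ev h" "!!xs. xs : tups H (Suc m) ==> F xs = dd act br h xs"
  using b by (auto simp: cobd_def)
 have zB: "zr : B" using H(2) HB by blast
 define h' where "h' xs = h (map \<pi> xs)" for xs
 have h': "altf B m h'" "ev h'" unfolding h'_def using altf_pi[OF h(1)] h(2) by (simp_all add: ev_def)
 define E where "E xs = F xs - dd act br h' xs" for xs
 have E: "altf B (Suc m) E" unfolding E_def by (rule altf_diff[OF F'(1) altf_dd[OF subB zB h'(1)]])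
 have evE: "ev E" using F'(2) ev_dd[OF h'(2)] by (simp add: E_def ev_def e0)
 have E0: "E hs = 0" if "hs : tups H (Suc m)" for hs
  using h(3)[OF that] dd_H[of m h' h, OF _ that] by (simp add: E_def h'_def map_pi)
 have dE: "dd act br E xs = 0" if "xs : tups B (Suc (Suc m))" for xs
  unfolding E_def using dd_minus[OF order_refl that] F'(3)[OF that] dd_dd[OF subB h'(1) that] by simp
 define g where "g hs = E (x # hs)" for hs
 have g: "altf H m g" "ev g" unfolding g_def using altf_mono[OF HB altf_head[OF E x]] evE by (simp_all add: ev_def)
 have "dd act br g hs = 0" if hs: "hs : tups H (Suc m)" for hs
 proof -
  have "dd act br E (x # hs) = 0" by (rule dE) (use x tups_mono[OF HB hs] in simp)
  then show ?thesis using th_H[of "Suc m" E "%xs. 0", OF E0 hs] th0 by (simp add: g_def[abs_def])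
 qed
 then have cg: "cocyc H m g" using g by (simp add: cocyc_def)
 note w = W_props[OF g]
 have "E xs - W g xs = 0" if "xs : tups B (Suc m)" for xs
  by (rule zero_ext[OF altf_diff[OF E w(1)] _ _ that]) (use E0 w(3,4) in "auto simp: g_def")
 then have "ALL xs:tups B (Suc m). F xs - W g xs = dd act br h' xs" by (simp add: E_def algebra_simps)
 moreover have "altf B (Suc m) (%xs. F xs - W g xs)" by (rule altf_diff[OF F'(1) w(1)])
 moreover have "ev (%xs. F xs - W g xs)" using F'(2) w(2) by (simp add: ev_def e0)
 ultimately have "cobd B (Suc m) (%xs. F xs - W g xs)" using h' unfolding cobd_def by auto
 then show ?thesis using cg by blast
qed

text \<open>Let W g = dk. Then k is closed on H, so theta_x k = ds on H by hypothesis, and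
  contraction with x gives g = theta_x k - d(iota_x k) = d(s - iota_x k). In degree 0 both terms
  vanish.\<close>

lemma cobd_W_imp:
 assumes g: "cocyc H m g" and b: "cobd B (Suc m) (W g)"
  and triv: "!!f. cocyc H m f ==> cobd H m (th (act x) (br x) f)"
 shows "cobd H m g"
proof -
 have g': "altf H m g" "ev g" using g by (auto simp: cocyc_def)
 note w = W_props[OF g']
 obtain k where k: "altf B m k" "ev k" "!!xs. xs : tups B (Suc m) ==> W g xs = dd act br k xs"
  using b by (auto simp: cobd_def)
 have "dd act br k hs = 0" if "hs : tups H (Suc m)" for hs
  using k(3)[OF tups_mono[OF HB that]] w(3)[OF that] by simp
 then have "cocyc H m k" using altf_mono[OF HB k(1)] k(2) by (simp add: cocyc_def)
 from triv[OF this] have t: "cobd H m (th (act x) (br x) k)" .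
 have eq: "g hs = th (act x) (br x) k hs - dd act br (%ys. k (x # ys)) hs" if hs: "hs : tups H m" for hs
  using k(3)[of "x # hs"] w(4)[OF hs] x tups_mono[OF HB hs] by simp
 show ?thesis
 proof (cases m)
  case 0
  then show ?thesis using eq[of "[]"] t g' by (simp add: cobd_def)
 next
  case (Suc l)
  obtain s where s: "altf H l s" "ev s" "!!xs. xs : tups H m ==> th (act x) (br x) k xs = dd act br s xs"
  using t Suc by (auto simp: cobd_def)
  have k': "altf H l (%ys. k (x # ys))" using altf_mono[OF HB altf_head[OF k(1)[unfolded Suc] x]] .
  have "g hs = dd act br (%ys. s ys - k (x # ys)) hs" if hs: "hs : tups H m" for hs
  using eq[OF hs] s(3)[OF hs] dd_minus[OF HB hs, of s "%ys. k (x # ys)"] by simp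
  moreover have "altf H l (%ys. s ys - k (x # ys))" by (rule altf_diff[OF s(1) k'])
  moreover have "ev (%ys. s ys - k (x # ys))" using s(2) k(2) by (simp add: ev_def e0)
  ultimately show ?thesis using g' Suc unfolding cobd_def by auto
 qed
qed

text \<open>For g = ds one has W g = -d(W s), as both sides agree on H and after contraction with x.
  In degree 0 a coboundary is zero, and so is \<open>W g\<close>.\<close>

lemma cobd_W:
 assumes g: "cobd H m g"
 shows "cobd B (Suc m) (W g)"
proof -
 have g': "altf H m g" "ev g" using g by (auto simp: cobd_def)
 note w = W_props[OF g']
 have zB: "zr : B" using H(2) HB by blast
 have ev0: "ev (%xs. 0)" by (simp add: ev_def e0)
 show ?thesis
 proof (cases m)
  case 0
  have "W g xs = 0" if "xs : tups B (Suc m)" for xs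
  by (rule zero_ext[OF w(1) _ _ that]) (use w(3,4) g 0 in "auto simp: cobd_def")
  then have "ALL xs:tups B (Suc m). W g xs = dd act br (%xs. 0) xs" using dd0[OF order_refl] by simp
  then show ?thesis using w(1,2) ev0 altf_zero unfolding cobd_def by auto
 next
  case (Suc l)
  obtain s where s: "altf H l s" "ev s" "!!xs. xs : tups H m ==> g xs = dd act br s xs"
  using g Suc by (auto simp: cobd_def)
  note v = W_props[OF s(1,2)] and dv = dd_W[OF s(1,2)]
  have v1: "altf B m (W s)" using v(1) Suc by simp
  have "W g xs + dd act br (W s) xs = 0" if xs: "xs : tups B (Suc m)" for xs
  proof (rule zero_ext[OF altf_add[OF w(1) altf_dd[OF subB zB v1]] _ _ xs])
  show "W g hs + dd act br (W s) hs = 0" if "hs : tups H (Suc m)" for hs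
  using w(3)[OF that] dv(1)[OF that] by simp
  show "W g (x # hs) + dd act br (W s) (x # hs) = 0" if "Suc m = Suc k" "hs : tups H k" for hs k
  using that w(4)[of hs m] dv(2)[of hs] s(3)[of hs] Suc by simp
  qed
  note sum0 = this
  have "W g xs = dd act br (%xs. 0 - W s xs) xs" if xs: "xs : tups B (Suc m)" for xs
  proof -
  have "dd act br (%xs. 0 - W s xs) xs = - dd act br (W s) xs"
  unfolding dd_minus[OF order_refl xs, of "%xs. 0" "W s"] dd0[OF order_refl xs] by simp
  moreover have "W g xs = - dd act br (W s) xs" using sum0[OF xs] by (rule iffD2[OF eq_neg_iff_add_eq_0])
  ultimately show ?thesis by simp
  qed
  moreover have "altf B m (%xs. 0 - W s xs)" by (rule altf_diff[OF altf_zero v1])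
  moreover have "ev (%xs. 0 - W s xs)" using v(2) by (simp add: ev_def e0)
  ultimately show ?thesis using w(1,2) unfolding cobd_def by auto
 qed
qed

text \<open>A coboundary in degree 0 is zero, so the hypothesis says that x annihilates f; H
  annihilates f because f is closed there.\<close>

lemma cocyc_zero_extend:
 assumes f: "cocyc H 0 f" and t: "cobd H 0 (th (act x) (br x) f)"
 shows "cocyc B 0 f"
proof -
 have f': "altf B 0 f" "ev f" "!!xs. xs : tups H (Suc 0) ==> dd act br f xs = 0" using f by (auto simp: cocyc_def)
 have zB: "zr : B" using H(2) HB by blast
 have "dd act br f xs = 0" if "xs : tups B (Suc 0)" for xs
  by (rule zero_ext[OF altf_dd[OF subB zB f'(1)] _ _ that]) (use f' t in "auto simp: cobd_def")
 then show ?thesis using f' by (simp add: cocyc_def)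
qed

end

section \<open>Cochain spaces\<close>

text \<open>An operator of M transported to \<open>amb\<close>: project to M, apply, embed. The
  identity becomes the projection of \<open>amb\<close> onto M, which plays the role of
  \<open>e\<close> above.\<close>

definition lft :: "('m, 's) ring_scheme => ('m => 'm) => 'm amb => 'm amb"
 where "lft M u F = embed (null_ring M) (u (pick (null_ring M) F))"

text \<open>\<open>hat\<close> reads a cochain as a form with values in \<open>amb\<close>. Its
  inverse \<open>low\<close>, on forms with values in the image of M, cuts the domain back to
  tuples, since cochains are extensional functions.\<close>

definition hat :: "('m, 's) ring_scheme => ('a list => 'm) => 'a list => 'm amb"
 where "hat M f = (%xs. embed (null_ring M) (f xs))"

definition low :: "('a, 'r) ring_scheme => ('m, 's) ring_scheme => nat => ('a list => 'm amb) => 'a list => 'm"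
 where "low A M n F = (\<lambda>xs\<in>tuples A n. pick (null_ring M) (F xs))"

context abelian_group
begin

lemma null_emb: "rng_emb (null_ring G)"
 by unfold_locales (rule rng_null_ring[OF abelian_group_axioms])

interpretation N: rng_emb "null_ring G" by (rule null_emb)

lemma lft_add:
 assumes "!!v. v : carrier G ==> u v : carrier G"
  "!!v w. v : carrier G ==> w : carrier G ==> u (v \<oplus> w) = u v \<oplus> u w"
 shows "lft G u (F + F') = lft G u F + lft G u F'"
 using N.proj_closed N.embed_add by (simp add: lft_def N.proj_hom assms)

lemma lft_comp:
 assumes "!!v. v : carrier G ==> w v : carrier G"
 shows "lft G u (lft G w F) = lft G (%v. u (w v)) F"
 using N.proj_closed by (simp add: lft_def assms)

lemma lft_cong: "(!!v. v : carrier G ==> u v = w v) ==> lft G u F = lft G w F"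
 using N.proj_closed by (simp add: lft_def)

lemma lft_plus:
 assumes "!!v. v : carrier G ==> u v : carrier G" "!!v. v : carrier G ==> w v : carrier G"
 shows "lft G (%v. u v \<oplus> w v) F = lft G u F + lft G w F"
  "lft G (%v. u v \<ominus> w v) F = lft G u F - lft G w F"
 using N.proj_closed N.embed_add N.embed_diff by (simp_all add: lft_def assms)

lemma lft_zero: "lft G (%v. \<zero>) F = 0"
 using N.embed_zero by (simp add: lft_def)

lemma lft_embed: "v : carrier G ==> lft G u (embed (null_ring G) v) = embed (null_ring G) (u v)"
 using N.proj_embed by (simp add: lft_def)

lemma embed_outside: "v ~: carrier G ==> embed (null_ring G) v = 0"
 by (rule amb_eqI) (auto simp: N.Rep_embed Rep_amb_simps)

lemma lft_id_embed: "lft G (%v. v) (embed (null_ring G) v) = embed (null_ring G) v"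
 using lft_embed[of v "%v. v"] embed_outside[of v] N.embed_zero N.proj_hom(1) by (cases "v : carrier G") (simp_all add: lft_def)

lemma lft_id_lft: "lft G (%v. v) (lft G u F) = lft G u F"
 unfolding lft_def[of G u] by (rule lft_id_embed)

text \<open>The exponent is positive because the zeroth powers differ: on the left it is the
  identity of \<open>amb\<close>, on the right the projection onto M.\<close>

lemma lft_pow:
 assumes "!!v. v : carrier G ==> u v : carrier G"
 shows "(lft G u ^^ Suc k) F = lft G (u ^^ Suc k) F"
proof (induction k)
 case (Suc k)
 have "(u ^^ k) v : carrier G" if "v : carrier G" for k v using that by (induction k) (simp_all add: assms)
 then have "lft G u (lft G (u ^^ Suc k) F) = lft G (%v. u ((u ^^ Suc k) v)) F" by (intro lft_comp) blast
 then show ?case using Suc by (simp add: o_def)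
qed simp

end

context lie_algebra
begin

lemma bracket_anti: "x : carrier L ==> y : carrier L ==> bracket L x y \<oplus>\<^bsub>L\<^esub> bracket L y x = zero L"
proof -
 assume xy: "x : carrier L" "y : carrier L"
 have "bracket L x (x \<oplus>\<^bsub>L\<^esub> y) \<oplus>\<^bsub>L\<^esub> bracket L y (x \<oplus>\<^bsub>L\<^esub> y) = zero L"
  using xy bracket_self[of "x \<oplus>\<^bsub>L\<^esub> y"] by (simp add: bracket_add_left[symmetric])
 then show ?thesis using xy by (simp add: bracket_add_right bracket_self bracket_closed)
qed

lemma bracket_flip: "x : carrier L ==> y : carrier L ==> bracket L y x = \<ominus>\<^bsub>L\<^esub> bracket L x y"
 using abelian_group.minus_equality[OF module.axioms(2)[OF vectorspace.axioms(1)[OF lie_algebra.axioms(1)[OF lie_algebra_axioms]]], of "bracket L y x" "bracket L x y"]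
  bracket_anti[of y x] bracket_closed by simp

lemma bracket_minus: "x : carrier L ==> y : carrier L ==> bracket L x (\<ominus>\<^bsub>L\<^esub> y) = \<ominus>\<^bsub>L\<^esub> bracket L x y"
 using bracket_smult_right[of "\<ominus>\<^bsub>K\<^esub> \<one>\<^bsub>K\<^esub>" x y] by (simp add: L.neg_smult bracket_closed)

lemma jacobi': "x : carrier L ==> y : carrier L ==> z : carrier L ==>
  bracket L (bracket L x y) z \<oplus>\<^bsub>L\<^esub> bracket L y (bracket L x z) = bracket L x (bracket L y z)"
proof -
 assume h: "x : carrier L" "y : carrier L" "z : carrier L"
 note c = bracket_closed
 let ?a = "bracket L x (bracket L y z)" and ?b = "bracket L y (bracket L x z)" and ?c = "bracket L (bracket L x y) z"
 have cl: "?a : carrier L" "?b : carrier L" "?c : carrier L" using h c by simp_all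
 have 1: "bracket L y (bracket L z x) = \<ominus>\<^bsub>L\<^esub> ?b" using h by (simp add: bracket_flip[of x z] bracket_minus c)
 have 2: "bracket L z (bracket L x y) = \<ominus>\<^bsub>L\<^esub> ?c" using h by (intro bracket_flip c)
 have "?a \<oplus>\<^bsub>L\<^esub> \<ominus>\<^bsub>L\<^esub> ?b \<oplus>\<^bsub>L\<^esub> \<ominus>\<^bsub>L\<^esub> ?c = zero L" using jacobi[OF h] unfolding 1 2 .
 then have "(?a \<ominus>\<^bsub>L\<^esub> ?b) \<ominus>\<^bsub>L\<^esub> ?c = zero L" by (simp only: a_minus_def)
 then have "?a \<ominus>\<^bsub>L\<^esub> ?b = ?c" using L.diff_zero_iff[of "?a \<ominus>\<^bsub>L\<^esub> ?b" ?c] cl by simp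
 then show ?thesis using L.diff_add_cancel(1)[OF cl(1,2)] by simp
qed

end

lemma (in lie_module) sub_module:
 assumes H: "linsub K L H" and br: "!!y z. y : H ==> z : H ==> bracket L y z : H"
 shows "lie_module K (L\<lparr>carrier := H\<rparr>) M act"
proof -
 have HL: "y : carrier L" if "y : H" for y using linsubD(1)[OF H that] .
 show ?thesis
  by (intro lie_module.intro lie_algebra.intro lie_algebra_axioms.intro lie_module_axioms.intro L.vs_linsub[OF H] M.vectorspace_axioms)
  (simp_all add: HL br bracket_add_left bracket_add_right bracket_smult_left bracket_smult_right bracket_self jacobi
  act_closed act_add_left act_add_right act_smult_left act_smult_right act_bracket)
qed

context lie_module
begin

interpretation N: rng_emb "null_ring M" by (rule M.null_emb)

abbreviation "em == embed (null_ring M)"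
abbreviation "pr == pick (null_ring M)"

lemma pr_closed: "pr F : carrier M" using N.proj_closed by simp

lemma complex: "lie_complex (add L) (smult L) (carrier K) (%a. lft M (smult M a)) (carrier L) (bracket L) (%x. lft M (act x))
  \<zero>\<^bsub>L\<^esub> (lft M (%v. v))"
proof -
 have sc: "lft M (smult M a) (F + F') = lft M (smult M a) F + lft M (smult M a) F'" if "a : carrier K" for a F F'
  using that by (intro M.lft_add) (simp_all add: smult_r_distr)
 interpret F: alt_forms "add L" "smult L" "carrier K" "%a. lft M (smult M a)" by unfold_locales (rule sc)
 show ?thesis
 proof (intro lie_complex.intro lie_forms.intro F.alt_forms_axioms lie_forms_axioms.intro lie_complex_axioms.intro)
  show "F.subsp_on (carrier L)" unfolding F.subsp_on_def by simp
  show "F.lin_on (carrier L) (bracket L x)" if "x : carrier L" for x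
  unfolding F.lin_on_def using that by (simp add: bracket_closed bracket_add_right bracket_smult_right)
  show "F.lin_op (lft M (act x))" if "x : carrier L" for x
  unfolding F.lin_op_def
  proof (intro conjI allI ballI)
  show "lft M (act x) (v + w) = lft M (act x) v + lft M (act x) w" for v w
  using that by (intro M.lft_add) (simp_all add: act_closed act_add_right)
  show "lft M (act x) (lft M (smult M a) v) = lft M (smult M a) (lft M (act x) v)" if "a : carrier K" for a v
  using that \<open>x : carrier L\<close> by (simp add: M.lft_comp act_closed) (rule M.lft_cong, simp add: act_smult_right)
  qed
  show "lft M (act (x \<oplus>\<^bsub>L\<^esub> y)) v = lft M (act x) v + lft M (act y) v" if "x : carrier L" "y : carrier L" for x y v
  using that by (subst M.lft_plus(1)[symmetric]) (auto intro!: M.lft_cong simp: act_closed act_add_left)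
  show "lft M (act (a \<odot>\<^bsub>L\<^esub> x)) v = lft M (smult M a) (lft M (act x) v)" if "a : carrier K" "x : carrier L" for a x v
  using that by (simp add: M.lft_comp act_closed) (rule M.lft_cong, simp add: act_smult_left)
  show "lft M (act (bracket L x y)) v = lft M (act x) (lft M (act y) v) - lft M (act y) (lft M (act x) v)"
  if "x : carrier L" "y : carrier L" for x y v
  using that by (simp add: M.lft_comp act_closed M.lft_plus(2)[symmetric]) (rule M.lft_cong, simp add: act_bracket)
  show "lft M (smult M a) (lft M (smult M b) v) = lft M (smult M b) (lft M (smult M a) v)"
  if "a : carrier K" "b : carrier K" for a b v
  using that by (simp add: M.lft_comp) (rule M.lft_cong, simp add: smult_assoc1[symmetric] R.m_comm)
  show "lft M (%v. v) (v + w) = lft M (%v. v) v + lft M (%v. v) w" for v w by (rule M.lft_add) simp_all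
 qed (simp_all add: bracket_add_left bracket_smult_left bracket_self jacobi' M.lft_id_lft)
qed

sublocale CE: lie_complex "add L" "smult L" "carrier K" "%a. lft M (smult M a)" "carrier L" "bracket L" "%x. lft M (act x)"
  "zero L" "lft M (%v. v)"
 by (rule complex)

abbreviation "dL == dd (%x. lft M (act x)) (bracket L)"

abbreviation "LL == tups (carrier L)"

lemma ev_hat: "CE.ev (hat M f)"
 by (simp add: CE.ev_def hat_def M.lft_id_embed)

lemma cochains_iff: "f : cochains K L M n \<longleftrightarrow> f : tuples L n \<rightarrow>\<^sub>E carrier M & CE.altf (carrier L) n (hat M f)"
proof (cases "f : tuples L n \<rightarrow>\<^sub>E carrier M")
 case True
 have f: "f xs : carrier M" if "xs : LL n" for xs using True that by (auto simp: tuples_tups)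
 have upd: "xs[i := x] : LL n" if "xs : LL n" "x : carrier L" for xs i x
  using that set_update_subset_insert[of xs i x] by (auto simp: tups_def)
 note ij = N.embed_inject[simplified]
 show ?thesis
 proof
  assume "f : cochains K L M n"
  then have a: "!!xs i x y. xs : LL n ==> i < n ==> x : carrier L ==> y : carrier L ==>
  f (xs[i := x \<oplus>\<^bsub>L\<^esub> y]) = f (xs[i := x]) \<oplus>\<^bsub>M\<^esub> f (xs[i := y])"
  and b: "!!xs i a x. xs : LL n ==> i < n ==> a : carrier K ==> x : carrier L ==>
  f (xs[i := a \<odot>\<^bsub>L\<^esub> x]) = a \<odot>\<^bsub>M\<^esub> f (xs[i := x])"
  and c: "!!xs. xs : LL n ==> ~ distinct xs ==> f xs = zero M"
  unfolding cochains_def tuples_tups by blast+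
  have "CE.altf (carrier L) n (hat M f)"
  proof (rule CE.altf_intro)
  show "hat M f (xs[i := x \<oplus>\<^bsub>L\<^esub> y]) = hat M f (xs[i := x]) + hat M f (xs[i := y])"
  if "xs : LL n" "i < n" "x : carrier L" "y : carrier L" for xs i x y
  unfolding hat_def a[OF that] using N.embed_add f[OF upd[OF that(1,3)]] f[OF upd[OF that(1,4)]] by simp
  show "hat M f (xs[i := a \<odot>\<^bsub>L\<^esub> x]) = lft M (smult M a) (hat M f (xs[i := x]))"
  if "xs : LL n" "i < n" "a : carrier K" "x : carrier L" for xs i a x
  unfolding hat_def b[OF that] by (rule M.lft_embed[symmetric]) (rule f[OF upd[OF that(1,4)]])
  show "hat M f xs = 0" if "xs : LL n" "~ distinct xs" for xs
  unfolding hat_def c[OF that] using N.embed_zero by simp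
  qed
  then show "f : tuples L n \<rightarrow>\<^sub>E carrier M & CE.altf (carrier L) n (hat M f)" using True by blast
 next
  assume "f : tuples L n \<rightarrow>\<^sub>E carrier M & CE.altf (carrier L) n (hat M f)"
  then have F: "CE.altf (carrier L) n (hat M f)" by blast
  have "f (xs[i := x \<oplus>\<^bsub>L\<^esub> y]) = f (xs[i := x]) \<oplus>\<^bsub>M\<^esub> f (xs[i := y])"
  if "xs : LL n" "i < n" "x : carrier L" "y : carrier L" for xs i x y
  proof (rule iffD1[OF ij])
  show "em (f (xs[i := x \<oplus>\<^bsub>L\<^esub> y])) = em (f (xs[i := x]) \<oplus>\<^bsub>M\<^esub> f (xs[i := y]))"
  using CE.altf_slot_add[OF F that] N.embed_add f[OF upd[OF that(1,3)]] f[OF upd[OF that(1,4)]] by (simp add: hat_def)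
  qed (use f upd that in simp_all)
  moreover have "f (xs[i := a \<odot>\<^bsub>L\<^esub> x]) = a \<odot>\<^bsub>M\<^esub> f (xs[i := x])"
  if "xs : LL n" "i < n" "a : carrier K" "x : carrier L" for xs i a x
  proof (rule iffD1[OF ij])
  show "em (f (xs[i := a \<odot>\<^bsub>L\<^esub> x])) = em (a \<odot>\<^bsub>M\<^esub> f (xs[i := x]))"
  using CE.altf_slot_smult[OF F that(1,2,4,3)] M.lft_embed[OF f[OF upd[OF that(1,4)]]] by (simp add: hat_def)
  qed (use f upd that in simp_all)
  moreover have "f xs = zero M" if "xs : LL n" "~ distinct xs" for xs
  proof (rule iffD1[OF ij])
  show "em (f xs) = em \<zero>\<^bsub>M\<^esub>" using CE.altf_not_distinct[OF CE.B F that] N.embed_zero by (simp add: hat_def)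
  qed (use f that in simp_all)
  ultimately show "f : cochains K L M n" using True unfolding cochains_def tuples_tups by blast
 qed
qed (simp add: cochains_def)

lemma hat_low: "CE.ev F ==> xs : LL n ==> hat M (low L M n F) xs = F xs"
 by (simp add: hat_def low_def tuples_tups CE.ev_def lft_def)

lemma low_cochain:
 assumes F: "CE.altf (carrier L) n F" "CE.ev F"
 shows "low L M n F : cochains K L M n"
 unfolding cochains_iff
proof
 show "low L M n F : tuples L n \<rightarrow>\<^sub>E carrier M" unfolding low_def by (intro restrict_PiE_iff[THEN iffD2] ballI pr_closed)
 show "CE.altf (carrier L) n (hat M (low L M n F))"
  by (rule CE.altf_cong[OF hat_low[OF F(2), symmetric] CE.B F(1)])
qed

lemma cochain_eq:
 assumes f: "f : cochains K L M n" and g: "g : cochains K L M n"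
  and eq: "!!xs. xs : LL n ==> hat M f xs = hat M g xs"
 shows "f = g"
proof (rule PiE_ext)
 show f': "f : tuples L n \<rightarrow>\<^sub>E carrier M" and g': "g : tuples L n \<rightarrow>\<^sub>E carrier M" using f g by (simp_all add: cochains_iff)
 show "f xs = g xs" if "xs : tuples L n" for xs
  using eq[of xs] N.embed_inject[of "f xs" "g xs"] PiE_mem[OF f' that] PiE_mem[OF g' that] that by (simp add: hat_def tuples_tups)
qed

text \<open>Embedding turns the finite sums of the module into type-class sums, where
  \<open>ce_sum_eq_dd\<close> identifies the explicit differential with the recursive one.\<close>

lemma ce_diff_low:
 assumes f: "f : cochains K L M n"
 shows "ce_diff L M act n f = low L M (Suc n) (dL (hat M f))"
 unfolding ce_diff_def low_def
proof (rule restrict_ext)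
 fix xs assume "xs : tuples L (Suc n)"
 then have xs: "xs : LL (Suc n)" by (simp add: tuples_tups)
 have F: "CE.altf (carrier L) n (hat M f)" and fc: "!!ys. ys : LL n ==> f ys : carrier M"
  using f unfolding cochains_iff tuples_tups by auto
 have sgn: "em (alt_sign M k v) = sgn_pow k (em v)" "alt_sign M k v : carrier M" if "v : carrier M" for k v
  using that N.embed_uminus by (simp_all add: alt_sign_def sgn_pow_def)
 have nth: "xs ! i : carrier L" if "i <= n" for i using xs that by (auto simp: tups_def)
 have d: "del_nth i xs : LL n" if "i <= n" for i using CE.tups_del_nth[OF xs that] .
 have c1: "act (xs ! i) (f (del_nth i xs)) : carrier M" if "i <= n" for i using act_closed nth fc d that by simp
 have d2: "bracket L (xs ! i) (xs ! j) # del_nth i (del_nth j xs) : LL n" if "i < j" "j <= n" for i j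
 proof -
  have "n ~= 0" using that by simp
  then obtain m where m: "n = Suc m" using not0_implies_Suc by blast
  show ?thesis unfolding m using CE.tups_del_nth[of "del_nth j xs" "carrier L" m i] d[OF that(2)] that nth m bracket_closed by simp
 qed
 let ?P = "{(i, j). i < j & j <= n}"
 have "em (finsum M (%i. alt_sign M i (act (xs ! i) (f (del_nth i xs)))) {..n} \<oplus>\<^bsub>M\<^esub>
  finsum M (%(i, j). alt_sign M (i + j) (f (bracket L (xs ! i) (xs ! j) # del_nth i (del_nth j xs)))) ?P) =
  em (finsum M (%i. alt_sign M i (act (xs ! i) (f (del_nth i xs)))) {..n}) +
  em (finsum M (%(i, j). alt_sign M (i + j) (f (bracket L (xs ! i) (xs ! j) # del_nth i (del_nth j xs)))) ?P)"
  by (rule N.embed_add[simplified]) (auto intro!: M.finsum_closed sgn(2) c1 fc d2)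
 also have "em (finsum M (%i. alt_sign M i (act (xs ! i) (f (del_nth i xs)))) {..n}) =
  (\<Sum>i\<le>n. sgn_pow i (lft M (act (xs ! i)) (hat M f (del_nth i xs))))"
  by (subst N.embed_finsum[simplified])
  (auto intro!: sgn(2) c1 sum.cong simp: sgn(1)[OF c1] hat_def M.lft_embed fc d)
 also have "em (finsum M (%(i, j). alt_sign M (i + j) (f (bracket L (xs ! i) (xs ! j) # del_nth i (del_nth j xs)))) ?P) =
  (\<Sum>(i, j)\<in>?P. sgn_pow (i + j) (hat M f (bracket L (xs ! i) (xs ! j) # del_nth i (del_nth j xs))))"
  by (subst N.embed_finsum[simplified])
  (auto intro!: sgn(2) fc d2 sum.cong simp: sgn(1)[OF fc[OF d2]] hat_def)
 also have "(\<Sum>i\<le>n. sgn_pow i (lft M (act (xs ! i)) (hat M f (del_nth i xs)))) +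
  (\<Sum>(i, j)\<in>?P. sgn_pow (i + j) (hat M f (bracket L (xs ! i) (xs ! j) # del_nth i (del_nth j xs)))) = CE.ce_sum n (hat M f) xs"
  unfolding CE.ce_sum_def ..
 also have "... = dL (hat M f) xs" by (rule CE.ce_sum_eq_dd[OF CE.subB F xs])
 finally have "em (finsum M (%i. alt_sign M i (act (xs ! i) (f (del_nth i xs)))) {..n} \<oplus>\<^bsub>M\<^esub>
  finsum M (%(i, j). alt_sign M (i + j) (f (bracket L (xs ! i) (xs ! j) # del_nth i (del_nth j xs)))) ?P) = dL (hat M f) xs" .
 then have "pr (em (finsum M (%i. alt_sign M i (act (xs ! i) (f (del_nth i xs)))) {..n} \<oplus>\<^bsub>M\<^esub>
  finsum M (%(i, j). alt_sign M (i + j) (f (bracket L (xs ! i) (xs ! j) # del_nth i (del_nth j xs)))) ?P)) = pr (dL (hat M f) xs)"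
  by simp
 then show "finsum M (%i. alt_sign M i (act (xs ! i) (f (del_nth i xs)))) {..n} \<oplus>\<^bsub>M\<^esub>
  finsum M (%(i, j). alt_sign M (i + j) (f (bracket L (xs ! i) (xs ! j) # del_nth i (del_nth j xs)))) ?P = pr (dL (hat M f) xs)"
  by (subst (asm) N.proj_embed) (auto intro!: M.a_closed M.finsum_closed sgn(2) c1 fc d2)
qed

end

context lie_module
begin

lemma cocycles_iff: "f : cocycles K L M act n \<longleftrightarrow> f : cochains K L M n & CE.cocyc (carrier L) n (hat M f)"
proof (cases "f : cochains K L M n")
 case True
 interpret N: rng_emb "null_ring M" by (rule M.null_emb)
 have a: "CE.altf (carrier L) n (hat M f)" using True by (simp add: cochains_iff)
 have e: "CE.ev (dL (hat M f))" by (rule CE.ev_dd[OF ev_hat])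
 have "ce_diff L M act n f = \<zero>\<^bsub>cochain_space K L M (Suc n)\<^esub> \<longleftrightarrow>
  (ALL xs:LL (Suc n). dL (hat M f) xs = 0)"
 proof
  assume eq: "ce_diff L M act n f = \<zero>\<^bsub>cochain_space K L M (Suc n)\<^esub>"
  show "ALL xs:LL (Suc n). dL (hat M f) xs = 0"
  proof
  fix xs assume xs: "xs : LL (Suc n)"
  have "dL (hat M f) xs = hat M (ce_diff L M act n f) xs"
  unfolding ce_diff_low[OF True] by (rule hat_low[OF e xs, symmetric])
  also have "... = 0" unfolding eq using xs N.embed_zero by (simp add: hat_def cochain_space_def tuples_tups)
  finally show "dL (hat M f) xs = 0" .
  qed
 next
  assume eq: "ALL xs:LL (Suc n). dL (hat M f) xs = 0"
  show "ce_diff L M act n f = \<zero>\<^bsub>cochain_space K L M (Suc n)\<^esub>"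
  unfolding ce_diff_low[OF True] low_def cochain_space_def
  using eq N.proj_hom(1) by (auto intro!: restrict_ext simp: tuples_tups)
 qed
 then show ?thesis using True a ev_hat by (simp add: cocycles_def CE.cocyc_def)
qed (simp add: cocycles_def)

lemma coboundaries_iff: "f : coboundaries K L M act n \<longleftrightarrow> f : cochains K L M n & CE.cobd (carrier L) n (hat M f)"
proof (cases n)
 case 0
 interpret N: rng_emb "null_ring M" by (rule M.null_emb)
 have t: "tuples L 0 = {[]}" by (auto simp: tuples_def)
 have z: "\<zero>\<^bsub>cochain_space K L M 0\<^esub> = (\<lambda>xs\<in>{[]}. zero M)" by (simp add: cochain_space_def t)
 have zc: "(\<lambda>xs\<in>{[]}. zero M) : cochains K L M 0" by (auto simp: cochains_iff t)
 have "f = (\<lambda>xs\<in>{[]}. zero M) \<longleftrightarrow> hat M f [] = 0" if f: "f : cochains K L M 0"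
 proof
  show "hat M f [] = 0" if "f = (\<lambda>xs\<in>{[]}. zero M)" unfolding that using N.embed_zero by (simp add: hat_def)
  show "f = (\<lambda>xs\<in>{[]}. zero M)" if "hat M f [] = 0"
  by (rule cochain_eq[OF f zc]) (use that N.embed_zero in "simp add: hat_def")
 qed
 then show ?thesis unfolding 0 coboundaries_def using zc ev_hat[of f] by (auto simp: CE.cobd_def z)
next
 case (Suc m)
 show ?thesis
 proof
  assume "f : coboundaries K L M act n"
  then obtain g where g: "g : cochains K L M m" "f = ce_diff L M act m g" by (auto simp: coboundaries_def Suc)
  have a: "CE.altf (carrier L) m (hat M g)" using g(1) by (simp add: cochains_iff)
  have F: "CE.altf (carrier L) (Suc m) (dL (hat M g))"
  "CE.ev (dL (hat M g))"
  by (rule CE.altf_dd[OF CE.subB _ a], simp) (rule CE.ev_dd[OF ev_hat])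
  have f: "f : cochains K L M n" unfolding g(2) ce_diff_low[OF g(1)] Suc by (rule low_cochain[OF F])
  have "CE.cobd (carrier L) (Suc m) (hat M f)"
  proof (rule CE.cobdI[OF _ ev_hat a ev_hat])
  show "CE.altf (carrier L) (Suc m) (hat M f)" using f unfolding Suc by (simp add: cochains_iff)
  show "hat M f xs = dL (hat M g) xs" if "xs : LL (Suc m)" for xs
  unfolding g(2) ce_diff_low[OF g(1)] by (rule hat_low[OF F(2) that])
  qed
  then show "f : cochains K L M n & CE.cobd (carrier L) n (hat M f)" using f Suc by simp
 next
  assume h: "f : cochains K L M n & CE.cobd (carrier L) n (hat M f)"
  then obtain G where G: "CE.altf (carrier L) m G" "CE.ev G"
  "!!xs. xs : LL (Suc m) ==> hat M f xs = dL G xs"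
  using CE.cobdE[of "carrier L" m "hat M f"] Suc by blast
  let ?g = "low L M m G"
  have g: "?g : cochains K L M m" by (rule low_cochain[OF G(1,2)])
  have e: "CE.ev (dL (hat M ?g))" by (rule CE.ev_dd[OF ev_hat])
  have a: "CE.altf (carrier L) m (hat M ?g)" using g by (simp add: cochains_iff)
  have c: "ce_diff L M act m ?g : cochains K L M n" unfolding ce_diff_low[OF g] Suc
  by (rule low_cochain[OF CE.altf_dd[OF CE.subB _ a] e]) simp
  have "f = ce_diff L M act m ?g"
  proof (rule cochain_eq[OF _ c])
  show "f : cochains K L M n" using h by blast
  show "hat M f xs = hat M (ce_diff L M act m ?g) xs" if "xs : LL n" for xs
  proof -
  have xs: "xs : LL (Suc m)" using that Suc by simp
  have "dL G xs = dL (hat M ?g) xs"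
  by (rule dd_cong[OF hat_low[OF G(2), symmetric] bracket_closed xs])
  then show ?thesis unfolding ce_diff_low[OF g] hat_low[OF e xs] using G(3)[OF xs] by simp
  qed
  qed
  then show "f : coboundaries K L M act n" using g by (simp add: coboundaries_def Suc)
 qed
qed

lemma cs_simps: "carrier (cochain_space K L M n) = cochains K L M n"
 "f \<oplus>\<^bsub>cochain_space K L M n\<^esub> g = (\<lambda>xs\<in>tuples L n. f xs \<oplus>\<^bsub>M\<^esub> g xs)"
 "a \<odot>\<^bsub>cochain_space K L M n\<^esub> f = (\<lambda>xs\<in>tuples L n. a \<odot>\<^bsub>M\<^esub> f xs)"
 "\<zero>\<^bsub>cochain_space K L M n\<^esub> = (\<lambda>xs\<in>tuples L n. zero M)"
 by (simp_all add: cochain_space_def)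

lemma cochain_value: "f : cochains K L M n ==> xs : tuples L n ==> f xs : carrier M"
 unfolding cochains_iff by blast

lemma hat_ops:
 assumes f: "f : cochains K L M n"
 shows "g : cochains K L M n ==> xs : LL n ==>
  hat M (f \<oplus>\<^bsub>cochain_space K L M n\<^esub> g) xs = hat M f xs + hat M g xs"
  "xs : LL n ==> hat M (a \<odot>\<^bsub>cochain_space K L M n\<^esub> f) xs = lft M (smult M a) (hat M f xs)"
  "xs : LL n ==> hat M \<zero>\<^bsub>cochain_space K L M n\<^esub> xs = 0"
proof -
 interpret N: rng_emb "null_ring M" by (rule M.null_emb)
 note v = cochain_value[unfolded tuples_tups]
 show "g : cochains K L M n ==> xs : LL n ==>
  hat M (f \<oplus>\<^bsub>cochain_space K L M n\<^esub> g) xs = hat M f xs + hat M g xs"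
  using v[OF f] v[of g] N.embed_add by (simp add: hat_def cs_simps tuples_tups)
 show "xs : LL n ==> hat M (a \<odot>\<^bsub>cochain_space K L M n\<^esub> f) xs = lft M (smult M a) (hat M f xs)"
  using v[OF f] by (simp add: hat_def cs_simps tuples_tups M.lft_embed)
 show "xs : LL n ==> hat M \<zero>\<^bsub>cochain_space K L M n\<^esub> xs = 0"
  using N.embed_zero by (simp add: hat_def cs_simps tuples_tups)
qed

lemma cochains_closed:
 assumes f: "f : cochains K L M n"
 shows "g : cochains K L M n ==> f \<oplus>\<^bsub>cochain_space K L M n\<^esub> g : cochains K L M n"
  "a : carrier K ==> a \<odot>\<^bsub>cochain_space K L M n\<^esub> f : cochains K L M n"
proof -
 have F: "CE.altf (carrier L) n (hat M f)" using f by (simp add: cochains_iff)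
 show "f \<oplus>\<^bsub>cochain_space K L M n\<^esub> g : cochains K L M n" if g: "g : cochains K L M n"
  unfolding cochains_iff
 proof
  show "f \<oplus>\<^bsub>cochain_space K L M n\<^esub> g : tuples L n \<rightarrow>\<^sub>E carrier M"
  unfolding cs_simps by (intro restrict_PiE_iff[THEN iffD2] ballI M.a_closed cochain_value[OF f] cochain_value[OF g])
  show "CE.altf (carrier L) n (hat M (f \<oplus>\<^bsub>cochain_space K L M n\<^esub> g))"
  by (rule CE.altf_cong[OF hat_ops(1)[OF f g, symmetric] CE.B CE.altf_add[OF F]]) (use g in "simp_all add: cochains_iff")
 qed
 show "a \<odot>\<^bsub>cochain_space K L M n\<^esub> f : cochains K L M n" if a: "a : carrier K"
  unfolding cochains_iff
 proof
  show "a \<odot>\<^bsub>cochain_space K L M n\<^esub> f : tuples L n \<rightarrow>\<^sub>E carrier M"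
  unfolding cs_simps by (intro restrict_PiE_iff[THEN iffD2] ballI smult_closed a cochain_value[OF f])
  show "CE.altf (carrier L) n (hat M (a \<odot>\<^bsub>cochain_space K L M n\<^esub> f))"
  by (rule CE.altf_cong[OF hat_ops(2)[OF f, symmetric] CE.B CE.altf_sc[OF a F]])
 qed
qed

lemma zero_cochain: "\<zero>\<^bsub>cochain_space K L M n\<^esub> : cochains K L M n"
proof -
 have "low L M n (%xs. 0) : cochains K L M n"
  by (rule low_cochain[OF CE.altf_zero]) (simp add: CE.ev_def CE.e0)
 moreover have "low L M n (%xs. 0) = \<zero>\<^bsub>cochain_space K L M n\<^esub>"
  using rng_emb.proj_hom(1)[OF M.null_emb] by (simp add: low_def cs_simps)
 ultimately show ?thesis by simp
qed

lemma cochain_space_vs: "vectorspace K (cochain_space K L M n)"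
proof -
 let ?C = "cochain_space K L M n"
 note s = cs_simps and c = cochains_closed and v = cochain_value
 have "abelian_group ?C"
 proof (rule abelian_groupI, unfold cs_simps(1))
  fix f g h assume f: "f : cochains K L M n"
  have "(\<ominus>\<^bsub>K\<^esub> \<one>\<^bsub>K\<^esub>) \<odot>\<^bsub>?C\<^esub> f \<oplus>\<^bsub>?C\<^esub> f = \<zero>\<^bsub>?C\<^esub>"
  unfolding s by (rule restrict_ext) (simp add: M.neg_smult v[OF f] M.l_neg)
  moreover have "(\<ominus>\<^bsub>K\<^esub> \<one>\<^bsub>K\<^esub>) \<odot>\<^bsub>?C\<^esub> f : cochains K L M n" by (rule c(2)[OF f]) simp
  ultimately show "EX y:cochains K L M n. y \<oplus>\<^bsub>?C\<^esub> f = \<zero>\<^bsub>?C\<^esub>" by (rule bexI)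
  show "\<zero>\<^bsub>?C\<^esub> \<oplus>\<^bsub>?C\<^esub> f = f"
  by (rule cochain_eq[OF c(1)[OF zero_cochain f] f]) (simp add: hat_ops(1)[OF zero_cochain f] hat_ops(3)[OF f])
  assume g: "g : cochains K L M n"
  show "f \<oplus>\<^bsub>?C\<^esub> g : cochains K L M n" by (rule c(1)[OF f g])
  show "f \<oplus>\<^bsub>?C\<^esub> g = g \<oplus>\<^bsub>?C\<^esub> f" unfolding s by (rule restrict_ext) (simp add: v[OF f] v[OF g] M.a_comm)
  assume h: "h : cochains K L M n"
  show "f \<oplus>\<^bsub>?C\<^esub> g \<oplus>\<^bsub>?C\<^esub> h = f \<oplus>\<^bsub>?C\<^esub> (g \<oplus>\<^bsub>?C\<^esub> h)"
  unfolding s by (rule restrict_ext) (simp add: v[OF f] v[OF g] v[OF h] M.a_assoc)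
 qed (rule zero_cochain)
 then have "module K ?C"
 proof (intro module.intro module_axioms.intro R.is_cring, unfold cs_simps(1))
  fix a b f g assume f: "f : cochains K L M n"
  show "\<one>\<^bsub>K\<^esub> \<odot>\<^bsub>?C\<^esub> f = f"
  proof (rule cochain_eq[OF c(2)[OF f] f])
  show "hat M (\<one>\<^bsub>K\<^esub> \<odot>\<^bsub>?C\<^esub> f) xs = hat M f xs" if "xs : LL n" for xs
  using v[OF f] that by (simp add: hat_def s tuples_tups)
  qed simp
  assume a: "a : carrier K"
  show "a \<odot>\<^bsub>?C\<^esub> f : cochains K L M n" by (rule c(2)[OF f a])
  show "a \<odot>\<^bsub>?C\<^esub> (f \<oplus>\<^bsub>?C\<^esub> g) = a \<odot>\<^bsub>?C\<^esub> f \<oplus>\<^bsub>?C\<^esub> a \<odot>\<^bsub>?C\<^esub> g" if g: "g : cochains K L M n"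
  unfolding s by (rule restrict_ext) (simp add: v[OF f] v[OF g] a smult_r_distr)
  assume b: "b : carrier K"
  show "(a \<oplus>\<^bsub>K\<^esub> b) \<odot>\<^bsub>?C\<^esub> f = a \<odot>\<^bsub>?C\<^esub> f \<oplus>\<^bsub>?C\<^esub> b \<odot>\<^bsub>?C\<^esub> f"
  unfolding s by (rule restrict_ext) (simp add: v[OF f] a b smult_l_distr)
  show "(a \<otimes>\<^bsub>K\<^esub> b) \<odot>\<^bsub>?C\<^esub> f = a \<odot>\<^bsub>?C\<^esub> (b \<odot>\<^bsub>?C\<^esub> f)"
  unfolding s by (rule restrict_ext) (simp add: v[OF f] a b smult_assoc1)
 qed
 then show ?thesis by (rule vectorspaceI[OF field_axioms])
qed

lemma linsub_cocycles: "linsub K (cochain_space K L M n) (cocycles K L M act n)"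
 and linsub_coboundaries: "linsub K (cochain_space K L M n) (coboundaries K L M act n)"
 and coboundaries_cocycles: "coboundaries K L M act n <= cocycles K L M act n"
proof -
 let ?C = "cochain_space K L M n"
 show "coboundaries K L M act n <= cocycles K L M act n"
  using CE.cobd_cocyc[OF CE.subB] by (auto simp: cocycles_iff coboundaries_iff)
 have ev0: "CE.ev (%xs. 0)" by (simp add: CE.ev_def CE.e0)
 have z: "CE.cobd (carrier L) n (%xs. 0)"
 proof (cases n)
  case (Suc m)
  show ?thesis unfolding Suc by (rule CE.cobdI[OF CE.altf_zero ev0 CE.altf_zero ev0]) (rule CE.dd0[OF order_refl, symmetric])
 qed (simp add: CE.cobd_def ev0)
 have z': "CE.cocyc (carrier L) n (%xs. 0)" by (rule CE.cobd_cocyc[OF CE.subB _ z]) simp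
 note cc = CE.cocyc_cong[OF CE.subB _ ev_hat] and bc = CE.cobd_cong[OF CE.subB _ ev_hat]
 show "linsub K ?C (cocycles K L M act n)"
  unfolding linsub_def cs_simps(1)
 proof (intro conjI ballI subsetI)
  show "\<zero>\<^bsub>?C\<^esub> : cocycles K L M act n"
  unfolding cocycles_iff using cc[OF hat_ops(3)[OF zero_cochain, symmetric] z'] zero_cochain by blast
  fix f assume f: "f : cocycles K L M act n"
  then have f': "f : cochains K L M n" "CE.cocyc (carrier L) n (hat M f)" by (simp_all add: cocycles_iff)
  show "f : cochains K L M n" by (rule f'(1))
  show "a \<odot>\<^bsub>?C\<^esub> f : cocycles K L M act n" if a: "a : carrier K" for a
  unfolding cocycles_iff
  using cc[OF hat_ops(2)[OF f'(1), symmetric] CE.cocyc_sc[OF order_refl a f'(2)]] cochains_closed(2)[OF f'(1) a] by blast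
  fix g assume g: "g : cocycles K L M act n"
  then have g': "g : cochains K L M n" "CE.cocyc (carrier L) n (hat M g)" by (simp_all add: cocycles_iff)
  show "f \<oplus>\<^bsub>?C\<^esub> g : cocycles K L M act n"
  unfolding cocycles_iff
  using cc[OF hat_ops(1)[OF f'(1) g'(1), symmetric] CE.cocyc_add[OF order_refl f'(2) g'(2)]] cochains_closed(1)[OF f'(1) g'(1)] by blast
 qed
 show "linsub K ?C (coboundaries K L M act n)"
  unfolding linsub_def cs_simps(1)
 proof (intro conjI ballI subsetI)
  show "\<zero>\<^bsub>?C\<^esub> : coboundaries K L M act n"
  unfolding coboundaries_iff using bc[OF hat_ops(3)[OF zero_cochain, symmetric] z] zero_cochain by blast
  fix f assume f: "f : coboundaries K L M act n"
  then have f': "f : cochains K L M n" "CE.cobd (carrier L) n (hat M f)" by (simp_all add: coboundaries_iff)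
  show "f : cochains K L M n" by (rule f'(1))
  show "a \<odot>\<^bsub>?C\<^esub> f : coboundaries K L M act n" if a: "a : carrier K" for a
  unfolding coboundaries_iff
  using bc[OF hat_ops(2)[OF f'(1), symmetric] CE.cobd_sc[OF order_refl a f'(2)]] cochains_closed(2)[OF f'(1) a] by blast
  fix g assume g: "g : coboundaries K L M act n"
  then have g': "g : cochains K L M n" "CE.cobd (carrier L) n (hat M g)" by (simp_all add: coboundaries_iff)
  show "f \<oplus>\<^bsub>?C\<^esub> g : coboundaries K L M act n"
  unfolding coboundaries_iff
  using bc[OF hat_ops(1)[OF f'(1) g'(1), symmetric] CE.cobd_add[OF order_refl f'(2) g'(2)]] cochains_closed(1)[OF f'(1) g'(1)] by blast
 qed
qed

text \<open>The n-th cohomology has dimension h, expressed by cochains, so that exact sequences can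
  be treated without passing to quotients.\<close>

definition cdim :: "nat => nat => bool"
 where "cdim n h \<longleftrightarrow> qdim K (cochain_space K L M n) (cocycles K L M act n) (coboundaries K L M act n) {..<h}"

lemma has_basis_cohomology:
 assumes "cdim n h"
 shows "vectorspace K (ce_cohomology K n L M act)" "has_basis K (ce_cohomology K n L M act) {..<h}"
proof -
 interpret C: vectorspace K "cochain_space K L M n" by (rule cochain_space_vs)
 let ?Z = "(cochain_space K L M n)\<lparr>carrier := cocycles K L M act n\<rparr>"
 interpret Z: vectorspace K ?Z by (rule C.vs_linsub[OF linsub_cocycles])
 have B: "linsub K ?Z (coboundaries K L M act n)"
  using linsub_coboundaries[of n] coboundaries_cocycles[of n] by (simp add: linsub_def)
 show "vectorspace K (ce_cohomology K n L M act)" unfolding ce_cohomology_def by (rule Z.quot_space_vs[OF B])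
 show "has_basis K (ce_cohomology K n L M act) {..<h}"
  unfolding ce_cohomology_def Z.has_basis_quot_iff[OF B] using assms by (simp add: cdim_def qdim_def linear_on_def)
qed

end

context lie_module
begin

lemma hat_diff:
 assumes f: "f : cochains K L M n" and g: "g : cochains K L M n" and xs: "xs : LL n"
 shows "hat M (f \<ominus>\<^bsub>cochain_space K L M n\<^esub> g) xs = hat M f xs - hat M g xs"
proof -
 let ?C = "cochain_space K L M n"
 interpret C: vectorspace K ?C by (rule cochain_space_vs)
 have fg: "f : carrier ?C" "g : carrier ?C" using f g by (simp_all add: cs_simps)
 have d: "f \<ominus>\<^bsub>?C\<^esub> g : cochains K L M n" using C.M.minus_closed[OF fg] by (simp add: cs_simps)
 have "hat M f xs = hat M (f \<ominus>\<^bsub>?C\<^esub> g) xs + hat M g xs"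
  unfolding hat_ops(1)[OF d g xs, symmetric] C.diff_add_cancel(1)[OF fg] ..
 then show ?thesis by simp
qed

text \<open>The long exact sequence breaks up into 0 -> H^m(H) -> H^(m+1)(L) -> H^(m+1)(H) -> 0,
  with maps induced by \<open>C.W\<close> and by restriction. Surjectivity is
  \<open>cocyc_extend\<close>, exactness in the middle \<open>cocyc_split\<close>, injectivity
  \<open>cobd_W_imp\<close>; \<open>triv\<close> enters in the first and the last.\<close>

lemma cone_dim:
 assumes H: "linsub K L H" and I: "!!y z. y : carrier L ==> z : carrier L ==> bracket L y z : H"
  and \<chi>: "!!y. y : carrier L ==> \<chi> y : carrier K"
  "!!y z. y : carrier L ==> z : carrier L ==> \<chi> (y \<oplus>\<^bsub>L\<^esub> z) = \<chi> y \<oplus>\<^bsub>K\<^esub> \<chi> z"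
  "!!a y. a : carrier K ==> y : carrier L ==> \<chi> (a \<odot>\<^bsub>L\<^esub> y) = a \<otimes>\<^bsub>K\<^esub> \<chi> y"
  "!!y. y : carrier L ==> y : H \<longleftrightarrow> \<chi> y = zero K"
  and x: "x : carrier L" "\<chi> x = one K"
  and triv: "!!n f. CE.cocyc H n f ==> CE.cobd H n (th (lft M (act x)) (bracket L x) f)"
  and q: "!!n. lie_module.cdim K (L\<lparr>carrier := H\<rparr>) M act n (h n)"
 shows "cdim n (h n + (case n of 0 => 0 | Suc m => h m))"
proof -
 let ?S = "L\<lparr>carrier := H\<rparr>"
 have HL: "y : carrier L" if "y : H" for y using linsubD(1)[OF H that] .
 interpret S: lie_module K ?S M act by (rule sub_module[OF H]) (rule I[OF HL HL])
 have eqs: "add ?S = add L" "smult ?S = smult L" "bracket ?S = bracket L" "zero ?S = zero L" "carrier ?S = H" by simp_all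
 note modL = vectorspace.axioms(1)[OF lie_algebra.axioms(1)[OF lie_algebra_axioms]]
 define \<pi> where "\<pi> z = z \<ominus>\<^bsub>L\<^esub> \<chi> z \<odot>\<^bsub>L\<^esub> x" for z
 have \<pi>c: "\<pi> z : carrier L" if "z : carrier L" for z using that x \<chi>(1) by (simp add: \<pi>_def)
 have split: "\<pi> z \<oplus>\<^bsub>L\<^esub> \<chi> z \<odot>\<^bsub>L\<^esub> x = z" if "z : carrier L" for z
  using that x \<chi>(1) by (simp add: \<pi>_def L.diff_add_cancel)
 have \<pi>H: "\<pi> z : H" if z: "z : carrier L" for z
 proof -
  have "\<pi> z = z \<oplus>\<^bsub>L\<^esub> (\<ominus>\<^bsub>K\<^esub> \<chi> z) \<odot>\<^bsub>L\<^esub> x"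
  unfolding \<pi>_def a_minus_def Module.module.smult_l_minus[OF modL \<chi>(1)[OF z] x(1)] by (rule refl)
  then have "\<chi> (\<pi> z) = \<chi> z \<oplus>\<^bsub>K\<^esub> (\<ominus>\<^bsub>K\<^esub> \<chi> z)" using z x \<chi>(1)[OF z] by (simp add: \<chi>(2,3))
  also have "... = zero K" using \<chi>(1)[OF z] by (rule R.r_neg)
  finally show ?thesis by (rule iffD2[OF \<chi>(4)[OF \<pi>c[OF z]]])
 qed
 interpret C: lie_cone "add L" "smult L" "carrier K" "%a. lft M (smult M a)" "carrier L" "bracket L" "%x. lft M (act x)"
  "zero L" "lft M (%v. v)" H \<chi> \<pi> x
 proof
  show "CE.subalg_on H" unfolding CE.subalg_on_def CE.subsp_on_def 
  by (intro conjI ballI subsetI HL I linsubD(3,4)[OF H])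
  show "zero L : H" by (rule linsubD(2)[OF H])
  show "x : carrier L" by (rule x(1))
  show "bracket L x h : H" if "h : H" for h by (rule I[OF x(1) HL[OF that]])
  show "\<pi> y : H" if "y : carrier L" for y by (rule \<pi>H[OF that])
  show "\<pi> h = h" if "h : H" for h using \<chi>(4)[OF HL[OF that]] that HL x by (simp add: \<pi>_def L.diff_zero_right)
  show "\<pi> x = zero L" using x by (simp add: \<pi>_def L.diff_self)
  show "\<pi> (y \<oplus>\<^bsub>L\<^esub> z) = \<pi> y \<oplus>\<^bsub>L\<^esub> \<pi> z" if "y : carrier L" "z : carrier L" for y z
  using that x \<chi>(1) by (simp add: \<pi>_def \<chi>(2) Module.module.smult_l_distr[OF modL] L.diff_add_add[symmetric])
  show "\<pi> (a \<odot>\<^bsub>L\<^esub> y) = a \<odot>\<^bsub>L\<^esub> \<pi> y" if "a : carrier K" "y : carrier L" for a y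
  using that x \<chi>(1) by (simp add: \<pi>_def \<chi>(3) Module.module.smult_assoc1[OF modL] L.smult_diff)
  show "\<chi> y : carrier K" if "y : carrier L" for y by (rule \<chi>(1)[OF that])
  show "lft M (smult M (\<chi> (y \<oplus>\<^bsub>L\<^esub> z))) v = lft M (smult M (\<chi> y)) v + lft M (smult M (\<chi> z)) v"
  if "y : carrier L" "z : carrier L" for y z v
  using that \<chi>(1) by (subst M.lft_plus(1)[symmetric]) (auto intro!: M.lft_cong simp: \<chi>(2) smult_l_distr)
  show "lft M (smult M (\<chi> (a \<odot>\<^bsub>L\<^esub> y))) v = lft M (smult M a) (lft M (smult M (\<chi> y)) v)"
  if "a : carrier K" "y : carrier L" for a y v
  using that \<chi>(1) by (simp add: M.lft_comp) (rule M.lft_cong, simp add: \<chi>(3) smult_assoc1)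
  show "lft M (smult M (\<chi> h)) v = 0" if "h : H" for h v
  unfolding M.lft_zero[of v, symmetric] using \<chi>(4)[OF HL[OF that]] that by (intro M.lft_cong) simp
  show "lft M (smult M (\<chi> x)) v = lft M (%v. v) v" for v using x by (intro M.lft_cong) simp
  show "carrier L <= T" if T: "insert x H <= T" "T <= carrier L" "!!y z. y : T ==> z : T ==> y \<oplus>\<^bsub>L\<^esub> z : T"
  "!!a y. a : carrier K ==> y : T ==> a \<odot>\<^bsub>L\<^esub> y : T" for T
  proof
  fix z assume z: "z : carrier L"
  have "\<pi> z \<oplus>\<^bsub>L\<^esub> \<chi> z \<odot>\<^bsub>L\<^esub> x : T" using T(1) \<pi>H[OF z] \<chi>(1)[OF z] by (intro T(3) T(4)) auto
  then show "z : T" using split[OF z] by simp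
  qed
 qed
 note zi = S.cocycles_iff[unfolded eqs] and bi = S.coboundaries_iff[unfolded eqs]
 note ci = S.cochains_iff[unfolded eqs] and hl = S.hat_low[unfolded eqs] and lc = S.low_cochain[unfolded eqs]
 note ceq = S.cochain_eq[unfolded eqs] and ho = S.hat_ops[unfolded eqs]
 note sub = C.H(1)
 show ?thesis
 proof (cases n)
  case 0
  \<comment> \<open>In degree 0 the two cohomologies are literally the same space: a 0-cocycle on H
    is also annihilated by x.\<close>
  have t: "tuples ?S 0 = tuples L 0" by (auto simp: tuples_def)
  have c: "cochains K ?S M 0 = cochains K L M 0" by (auto simp: cochains_iff ci t)
  then have cs: "cochain_space K ?S M 0 = cochain_space K L M 0" by (simp add: cochain_space_def t)
  have eq0: "CE.cocyc H 0 f \<longleftrightarrow> CE.cocyc (carrier L) 0 f" for f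
  proof
  show "CE.cocyc (carrier L) 0 f" if f: "CE.cocyc H 0 f" by (rule C.cocyc_zero_extend[OF f triv[OF f]])
  qed (rule C.cocyc_restrict)
  have "cocycles K ?S M act 0 = cocycles K L M act 0"
  proof (rule Set.set_eqI)
  show "f : cocycles K ?S M act 0 \<longleftrightarrow> f : cocycles K L M act 0" for f
  unfolding cocycles_iff zi c eq0 by (rule refl)
  qed
  moreover have "coboundaries K ?S M act 0 = coboundaries K L M act 0" by (simp add: coboundaries_def cs)
  ultimately show ?thesis using q[of 0] cs 0 by (simp add: cdim_def S.cdim_def)
 next
  case (Suc m)
  let ?C = "cochain_space K L M (Suc m)" and ?C1 = "cochain_space K ?S M (Suc m)" and ?C2 = "cochain_space K ?S M m"
  \<comment> \<open>\<open>r\<close> is the restriction to H and \<open>j\<close> the map W, both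
    followed by \<open>low\<close> so that they produce extensional cochains on the correct
    domain.\<close>
  define r where "r F = low ?S M (Suc m) (hat M F)" for F
  define j where "j g = low L M (Suc m) (C.W (hat M g))" for g
  have r: "r F : cochains K ?S M (Suc m)" if "F : cochains K L M (Suc m)" for F
  unfolding r_def by (rule lc[OF CE.altf_mono[OF C.HB] ev_hat]) (use that in "simp add: cochains_iff")
  have hr: "hat M (r F) hs = hat M F hs" if "hs : tups H (Suc m)" for F hs
  unfolding r_def by (rule hl[OF ev_hat that])
  have ga: "CE.altf H k (hat M g)" if "g : cochains K ?S M k" for g k using that by (simp add: ci)
  have j: "j g : cochains K L M (Suc m)" if "g : cochains K ?S M m" for g
  unfolding j_def by (rule low_cochain[OF C.W_props(1,2)[OF ga[OF that] ev_hat]])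
  have hj: "hat M (j g) xs = C.W (hat M g) xs" if "g : cochains K ?S M m" "xs : LL (Suc m)" for g xs
  unfolding j_def by (rule hat_low[OF C.W_props(2)[OF ga[OF that(1)] ev_hat] that(2)])
  have up: "hs : LL k" if "hs : tups H k" for hs k by (rule tups_mono[OF C.HB that])
  have rcoc: "CE.cocyc H (Suc m) (hat M (r F)) = CE.cocyc H (Suc m) (hat M F)" for F
  proof
  show "CE.cocyc H (Suc m) (hat M F)" if "CE.cocyc H (Suc m) (hat M (r F))" by (rule CE.cocyc_cong[OF sub hr ev_hat that])
  show "CE.cocyc H (Suc m) (hat M (r F))" if "CE.cocyc H (Suc m) (hat M F)" by (rule CE.cocyc_cong[OF sub hr[symmetric] ev_hat that])
  qed
  have rcob: "CE.cobd H (Suc m) (hat M (r F)) = CE.cobd H (Suc m) (hat M F)" for F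
  proof
  show "CE.cobd H (Suc m) (hat M F)" if "CE.cobd H (Suc m) (hat M (r F))" by (rule CE.cobd_cong[OF sub hr ev_hat that])
  show "CE.cobd H (Suc m) (hat M (r F))" if "CE.cobd H (Suc m) (hat M F)" by (rule CE.cobd_cong[OF sub hr[symmetric] ev_hat that])
  qed
  have jcoc: "CE.cocyc (carrier L) (Suc m) (C.W (hat M g)) ==> CE.cocyc (carrier L) (Suc m) (hat M (j g))" if "g : cochains K ?S M m" for g
  by (rule CE.cocyc_cong[OF CE.subB hj[OF that, symmetric] ev_hat])
  have jcob: "CE.cobd (carrier L) (Suc m) (C.W (hat M g)) = CE.cobd (carrier L) (Suc m) (hat M (j g))"
  if g: "g : cochains K ?S M m" for g
  proof
  show "CE.cobd (carrier L) (Suc m) (hat M (j g))" if "CE.cobd (carrier L) (Suc m) (C.W (hat M g))"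
  by (rule CE.cobd_cong[OF CE.subB hj[OF g, symmetric] ev_hat that])
  show "CE.cobd (carrier L) (Suc m) (C.W (hat M g))" if "CE.cobd (carrier L) (Suc m) (hat M (j g))"
  by (rule CE.cobd_cong[OF CE.subB hj[OF g] C.W_props(2)[OF ga[OF g] ev_hat] that])
  qed
  interpret C1: vectorspace K ?C1 by (rule S.cochain_space_vs)
  have qd: "qdim K ?C (cocycles K L M act (Suc m)) (coboundaries K L M act (Suc m)) {..<h m + h (Suc m)}"
  proof (rule qdim_exact[where ?V1.0 = ?C1 and ?V2.0 = ?C2 and r = r and j = j
  and ?Z1.0 = "cocycles K ?S M act (Suc m)" and ?B1.0 = "coboundaries K ?S M act (Suc m)"
  and ?Z2.0 = "cocycles K ?S M act m" and ?B2.0 = "coboundaries K ?S M act m"])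
  show "vectorspace K ?C" "vectorspace K ?C1" "vectorspace K ?C2"
  by (rule cochain_space_vs, rule S.cochain_space_vs, rule S.cochain_space_vs)
  show "linsub K ?C (cocycles K L M act (Suc m))" "linsub K ?C (coboundaries K L M act (Suc m))"
  "coboundaries K L M act (Suc m) <= cocycles K L M act (Suc m)"
  by (rule linsub_cocycles, rule linsub_coboundaries, rule coboundaries_cocycles)
  show "linsub K ?C1 (cocycles K ?S M act (Suc m))" "linsub K ?C1 (coboundaries K ?S M act (Suc m))"
  "coboundaries K ?S M act (Suc m) <= cocycles K ?S M act (Suc m)"
  by (rule S.linsub_cocycles, rule S.linsub_coboundaries, rule S.coboundaries_cocycles)
  show "linsub K ?C2 (cocycles K ?S M act m)" by (rule S.linsub_cocycles)
  show "qdim K ?C1 (cocycles K ?S M act (Suc m)) (coboundaries K ?S M act (Suc m)) {..<h (Suc m)}"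
  "qdim K ?C2 (cocycles K ?S M act m) (coboundaries K ?S M act m) {..<h m}"
  using q[of "Suc m"] q[of m] by (simp_all add: S.cdim_def)
  show "linear_on K ?C ?C1 (cocycles K L M act (Suc m)) r"
  unfolding linear_on_def S.cs_simps(1)
  proof (intro conjI ballI)
  fix F assume "F : cocycles K L M act (Suc m)"
  then have F: "F : cochains K L M (Suc m)" by (simp add: cocycles_iff)
  show "r F : cochains K ?S M (Suc m)" by (rule r[OF F])
  show "r (a \<odot>\<^bsub>?C\<^esub> F) = a \<odot>\<^bsub>?C1\<^esub> r F" if a: "a : carrier K" for a
  by (rule ceq[OF r[OF cochains_closed(2)[OF F a]] S.cochains_closed(2)[OF r[OF F] a]])
  (simp add: hr hat_ops(2)[OF F up] ho(2)[OF r[OF F]])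
  fix E assume "E : cocycles K L M act (Suc m)"
  then have E: "E : cochains K L M (Suc m)" by (simp add: cocycles_iff)
  show "r (F \<oplus>\<^bsub>?C\<^esub> E) = r F \<oplus>\<^bsub>?C1\<^esub> r E"
  by (rule ceq[OF r[OF cochains_closed(1)[OF F E]] S.cochains_closed(1)[OF r[OF F] r[OF E]]])
  (simp add: hr hat_ops(1)[OF F E up] ho(1)[OF r[OF F] r[OF E]])
  qed
  show "r ` cocycles K L M act (Suc m) <= cocycles K ?S M act (Suc m)"
  proof (rule image_subsetI)
  fix F assume "F : cocycles K L M act (Suc m)"
  then have F: "F : cochains K L M (Suc m)" "CE.cocyc (carrier L) (Suc m) (hat M F)" by (simp_all add: cocycles_iff)
  show "r F : cocycles K ?S M act (Suc m)" unfolding zi rcoc using r[OF F(1)] C.cocyc_restrict[OF F(2)] by (rule conjI)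
  qed
  show "r ` coboundaries K L M act (Suc m) <= coboundaries K ?S M act (Suc m)"
  proof (rule image_subsetI)
  fix F assume "F : coboundaries K L M act (Suc m)"
  then have F: "F : cochains K L M (Suc m)" "CE.cobd (carrier L) (Suc m) (hat M F)" by (simp_all add: coboundaries_iff)
  show "r F : coboundaries K ?S M act (Suc m)" unfolding bi rcob using r[OF F(1)] C.cobd_restrict[OF F(2)] by (rule conjI)
  qed
  show "linear_on K ?C2 ?C (cocycles K ?S M act m) j"
  unfolding linear_on_def cs_simps(1)
  proof (intro conjI ballI)
  fix g assume "g : cocycles K ?S M act m"
  then have g: "g : cochains K ?S M m" by (simp add: zi)
  show "j g : cochains K L M (Suc m)" by (rule j[OF g])
  show "j (a \<odot>\<^bsub>?C2\<^esub> g) = a \<odot>\<^bsub>?C\<^esub> j g" if a: "a : carrier K" for a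
  proof (rule cochain_eq[OF j[OF S.cochains_closed(2)[OF g a]] cochains_closed(2)[OF j[OF g] a]])
  fix xs assume xs: "xs : LL (Suc m)"
  have "C.W (hat M (a \<odot>\<^bsub>?C2\<^esub> g)) xs = C.W (%ys. lft M (smult M a) (hat M g ys)) xs"
  by (rule C.W_cong[OF ga[OF S.cochains_closed(2)[OF g a]] ev_hat CE.altf_sc[OF a ga[OF g]] CE.ev_sc ho(2)[OF g] xs])
  then show "hat M (j (a \<odot>\<^bsub>?C2\<^esub> g)) xs = hat M (a \<odot>\<^bsub>?C\<^esub> j g) xs"
  by (simp add: hj[OF S.cochains_closed(2)[OF g a] xs] hat_ops(2)[OF j[OF g] xs] hj[OF g xs] C.W_sc[OF ga[OF g] ev_hat a xs])
  qed
  fix g' assume "g' : cocycles K ?S M act m"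
  then have g': "g' : cochains K ?S M m" by (simp add: zi)
  show "j (g \<oplus>\<^bsub>?C2\<^esub> g') = j g \<oplus>\<^bsub>?C\<^esub> j g'"
  proof (rule cochain_eq[OF j[OF S.cochains_closed(1)[OF g g']] cochains_closed(1)[OF j[OF g] j[OF g']]])
  fix xs assume xs: "xs : LL (Suc m)"
  have ea: "CE.ev (%ys. hat M g ys + hat M g' ys)" using ev_hat[of g] ev_hat[of g'] by (simp add: CE.ev_def CE.e)
  have "C.W (hat M (g \<oplus>\<^bsub>?C2\<^esub> g')) xs = C.W (%ys. hat M g ys + hat M g' ys) xs"
  by (rule C.W_cong[OF ga[OF S.cochains_closed(1)[OF g g']] ev_hat CE.altf_add[OF ga[OF g] ga[OF g']] ea ho(1)[OF g g'] xs])
  then show "hat M (j (g \<oplus>\<^bsub>?C2\<^esub> g')) xs = hat M (j g \<oplus>\<^bsub>?C\<^esub> j g') xs"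
  by (simp add: hj[OF S.cochains_closed(1)[OF g g'] xs] hat_ops(1)[OF j[OF g] j[OF g'] xs] hj[OF g xs] hj[OF g' xs]
  C.W_add[OF ga[OF g] ev_hat ga[OF g'] ev_hat xs])
  qed
  qed
  show "j ` cocycles K ?S M act m <= cocycles K L M act (Suc m)"
  proof (rule image_subsetI)
  fix g assume "g : cocycles K ?S M act m"
  then have g: "g : cochains K ?S M m" "CE.cocyc H m (hat M g)" by (simp_all add: zi)
  show "j g : cocycles K L M act (Suc m)" unfolding cocycles_iff using j[OF g(1)] jcoc[OF g(1) C.cocyc_W[OF g(2)]] by (rule conjI)
  qed
  show "EX F:cocycles K L M act (Suc m). r F \<ominus>\<^bsub>?C1\<^esub> f : coboundaries K ?S M act (Suc m)"
  if "f : cocycles K ?S M act (Suc m)" for f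
  proof -
  have f: "f : cochains K ?S M (Suc m)" "CE.cocyc H (Suc m) (hat M f)" using that by (simp_all add: zi)
  obtain F where F: "CE.cocyc (carrier L) (Suc m) F" "ALL hs:tups H (Suc m). F hs = hat M f hs"
  using C.cocyc_extend[OF f(2) triv[OF f(2)]] by blast
  have F': "CE.altf (carrier L) (Suc m) F" "CE.ev F" using F(1) by (simp_all add: CE.cocyc_def)
  let ?F = "low L M (Suc m) F"
  have c: "?F : cochains K L M (Suc m)" by (rule low_cochain[OF F'])
  have "?F : cocycles K L M act (Suc m)"
  unfolding cocycles_iff using c CE.cocyc_cong[OF CE.subB hat_low[OF F'(2), symmetric] ev_hat F(1)] by blast
  moreover have "r ?F = f"
  by (rule ceq[OF r[OF c] f(1)]) (use F(2) hat_low[OF F'(2) up] in "simp add: hr")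
  moreover have "f \<ominus>\<^bsub>?C1\<^esub> f = \<zero>\<^bsub>?C1\<^esub>" by (rule C1.diff_self) (simp add: S.cs_simps f(1))
  ultimately show ?thesis using linsubD(2)[OF S.linsub_coboundaries[of "Suc m"]]
  by (intro bexI[of _ ?F]) simp_all
  qed
  show "EX g:cocycles K ?S M act m. z \<ominus>\<^bsub>?C\<^esub> j g : coboundaries K L M act (Suc m)"
  if z: "z : cocycles K L M act (Suc m)" and rz: "r z : coboundaries K ?S M act (Suc m)" for z
  proof -
  have z': "z : cochains K L M (Suc m)" "CE.cocyc (carrier L) (Suc m) (hat M z)" using z by (simp_all add: cocycles_iff)
  have "CE.cobd H (Suc m) (hat M z)" using rz unfolding bi rcob by (rule conjunct2)
  from C.cocyc_split[OF z'(2) this] obtain g where g: "CE.cocyc H m g" "CE.cobd (carrier L) (Suc m) (%xs. hat M z xs - C.W g xs)"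
  by (elim exE conjE)
  have g': "CE.altf H m g" "CE.ev g" using g(1) unfolding CE.cocyc_def by blast+
  let ?g = "low ?S M m g"
  have c: "?g : cochains K ?S M m" by (rule lc[OF g'])
  have hg: "hat M ?g hs = g hs" if "hs : tups H m" for hs by (rule hl[OF g'(2) that])
  have "?g : cocycles K ?S M act m"
  unfolding zi by (intro conjI c CE.cocyc_cong[OF sub hg[symmetric] ev_hat g(1)])
  moreover have "CE.cobd (carrier L) (Suc m) (hat M (z \<ominus>\<^bsub>?C\<^esub> j ?g))"
  proof (rule CE.cobd_cong[OF CE.subB _ ev_hat g(2)])
  fix xs assume xs: "xs : LL (Suc m)"
  have "C.W (hat M ?g) xs = C.W g xs" by (rule C.W_cong[OF ga[OF c] ev_hat g' hg xs])
  then show "hat M z xs - C.W g xs = hat M (z \<ominus>\<^bsub>?C\<^esub> j ?g) xs"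
  by (simp add: hat_diff[OF z'(1) j[OF c] xs] hj[OF c xs])
  qed
  moreover have "z \<ominus>\<^bsub>?C\<^esub> j ?g : cochains K L M (Suc m)"
  using abelian_group.minus_closed[OF module.axioms(2)[OF vectorspace.axioms(1)[OF cochain_space_vs[of "Suc m"]]], of z "j ?g"]
  z'(1) j[OF c] by (simp add: cs_simps)
  ultimately show ?thesis by (intro bexI[of _ ?g]) (simp_all add: coboundaries_iff)
  qed
  show "r (j g) : coboundaries K ?S M act (Suc m)" if "g : cocycles K ?S M act m" for g
  proof -
  have g: "g : cochains K ?S M m" using that by (simp add: zi)
  have "r (j g) = \<zero>\<^bsub>?C1\<^esub>"
  proof (rule ceq[OF r[OF j[OF g]] S.zero_cochain])
  show "hat M (r (j g)) hs = hat M \<zero>\<^bsub>?C1\<^esub> hs" if hs: "hs : tups H (Suc m)" for hs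
  unfolding hr[OF hs] hj[OF g up[OF hs]] ho(3)[OF r[OF j[OF g]] hs] by (rule C.W_props(3)[OF ga[OF g] ev_hat hs])
  qed
  then show ?thesis using linsubD(2)[OF S.linsub_coboundaries] by simp
  qed
  show "j g : coboundaries K L M act (Suc m) \<longleftrightarrow> g : coboundaries K ?S M act m" if "g : cocycles K ?S M act m" for g
  proof -
  have g: "g : cochains K ?S M m" "CE.cocyc H m (hat M g)" using that by (simp_all add: zi)
  have "CE.cobd (carrier L) (Suc m) (C.W (hat M g)) \<longleftrightarrow> CE.cobd H m (hat M g)"
  by (rule iffI, erule C.cobd_W_imp[OF g(2) _ triv], assumption, erule C.cobd_W)
  then show ?thesis
  unfolding coboundaries_iff bi jcob[OF g(1), symmetric] using j[OF g(1)] g(1) by simp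
  qed
  qed
  have hn: "h (Suc m) + (case Suc m of 0 => 0 | Suc m => h m) = h m + h (Suc m)" by simp
  show ?thesis unfolding cdim_def Suc hn by (rule qd)
 qed
qed

end

section \<open>The action of a $p$-envelope on cohomology\<close>

locale p_env = lie_algebra' K L
 for K :: "'k ring" and L :: "('k, 'l, 'r) lie_algebra_scheme" +
 fixes p :: nat and G :: "('k, 'g) lie_algebra" and pmap :: "'g => 'g" and \<iota> :: "'l => 'g"
  and \<phi> :: "'g => ('l list => 'k) set"
 assumes fd: "vectorspace.fin_dim K L" and env: "p_envelope K p L G pmap \<iota>"
  and phi: "\<phi> : lie_hom K G (universal_p_envelope K p L)"
  and phi_iota: "x : carrier L ==> \<phi> (\<iota> x) = uea_incl K L x"
begin

lemma restricted: "restricted_lie_algebra K G p pmap"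
 using env by (simp add: p_envelope_def)

lemma G_lie: "lie_algebra K G"
 by (rule restricted_lie_algebra.axioms(1)[OF restricted])

lemma G_vs: "vectorspace K G"
 by (rule lie_algebra.axioms(1)[OF G_lie])

lemma p_pos: "p ~= 0"
 using restricted_lie_algebra.prime_p[OF restricted] by (auto dest: prime_gt_0_nat)

lemma iota: "x : carrier L ==> \<iota> x : carrier G"
 "x : carrier L ==> y : carrier L ==> \<iota> (x \<oplus>\<^bsub>L\<^esub> y) = \<iota> x \<oplus>\<^bsub>G\<^esub> \<iota> y"
 "a : carrier K ==> x : carrier L ==> \<iota> (a \<odot>\<^bsub>L\<^esub> x) = a \<odot>\<^bsub>G\<^esub> \<iota> x"
 "x : carrier L ==> y : carrier L ==> \<iota> (bracket L x y) = bracket G (\<iota> x) (\<iota> y)"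
 "inj_on \<iota> (carrier L)"
 using env by (auto simp: p_envelope_def lie_hom_def module_hom_def)

lemma hull: 
 assumes "linsub K G S" "!!x y. x : S ==> y : S ==> bracket G x y : S" "!!x. x : S ==> pmap x : S"
  "\<iota> ` carrier L <= S"
 shows "carrier G <= S"
 using p_hull_least[where U = G and pw = pmap, OF G_vs assms] env by (simp add: p_envelope_def)

lemma commutator_vs: "vectorspace K (commutator_lie (uea K L))"
 by (rule vs_cong[OF uea_vs]) (simp_all add: commutator_lie_simps)

lemma universal_simps:
 "carrier (universal_p_envelope K p L) = p_hull K (commutator_lie (uea K L)) (%u. u [^]\<^bsub>uea K L\<^esub> p) (uea_incl K L ` carrier L)"
 "add (universal_p_envelope K p L) = add (uea K L)" "smult (universal_p_envelope K p L) = smult (uea K L)"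
 "bracket (universal_p_envelope K p L) u v = u \<otimes>\<^bsub>uea K L\<^esub> v \<ominus>\<^bsub>uea K L\<^esub> v \<otimes>\<^bsub>uea K L\<^esub> u"
 by (simp_all add: universal_p_envelope_def Let_def commutator_lie_simps)

text \<open>Minimality of the universal p-envelope as an induction principle: \<phi>(y) lies in the
  p-hull of L in U(L), hence in each subspace that contains L and is closed under commutators and
  p-th powers.\<close>

lemma universal_sub:
 assumes S: "linsub K (uea K L) S" "!!u v. u : S ==> v : S ==> u \<otimes>\<^bsub>uea K L\<^esub> v \<ominus>\<^bsub>uea K L\<^esub> v \<otimes>\<^bsub>uea K L\<^esub> u : S"
  "!!u. u : S ==> u [^]\<^bsub>uea K L\<^esub> p : S" "!!x. x : carrier L ==> uea_incl K L x : S"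
  and y: "y : carrier G"
 shows "\<phi> y : S"
proof -
 have "p_hull K (commutator_lie (uea K L)) (%u. u [^]\<^bsub>uea K L\<^esub> p) (uea_incl K L ` carrier L) <= S"
 proof (rule p_hull_least[OF commutator_vs])
  show "linsub K (commutator_lie (uea K L)) S" using S(1) unfolding linsub_def commutator_lie_simps .
 qed (use S(2-4) in "auto simp: commutator_lie_simps")
 moreover have "\<phi> y : carrier (universal_p_envelope K p L)" using phi y by (auto simp: lie_hom_def module_hom_def)
 ultimately show ?thesis unfolding universal_simps by blast
qed

lemma phi_closed: "y : carrier G ==> \<phi> y : carrier (uea K L)"
proof (rule universal_sub[OF vectorspace.linsub_carrier[OF uea_vs]])
 show "u \<otimes>\<^bsub>uea K L\<^esub> v \<ominus>\<^bsub>uea K L\<^esub> v \<otimes>\<^bsub>uea K L\<^esub> u : carrier (uea K L)"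
  if "u : carrier (uea K L)" "v : carrier (uea K L)" for u v
  by (rule abelian_group.minus_closed[OF module.axioms(2)[OF vectorspace.axioms(1)[OF uea_vs]]]) (use that uea_closed in auto)
qed (use uea_closed in auto)

lemma phi_hom: "x : carrier G ==> y : carrier G ==> \<phi> (x \<oplus>\<^bsub>G\<^esub> y) = \<phi> x \<oplus>\<^bsub>uea K L\<^esub> \<phi> y"
 "a : carrier K ==> x : carrier G ==> \<phi> (a \<odot>\<^bsub>G\<^esub> x) = a \<odot>\<^bsub>uea K L\<^esub> \<phi> x"
 "x : carrier G ==> y : carrier G ==>
  \<phi> (bracket G x y) = \<phi> x \<otimes>\<^bsub>uea K L\<^esub> \<phi> y \<ominus>\<^bsub>uea K L\<^esub> \<phi> y \<otimes>\<^bsub>uea K L\<^esub> \<phi> x"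
 using phi by (simp_all add: lie_hom_def module_hom_def universal_simps(2-4))

lemma G_module:
 fixes N :: "('k, 'n, 's) module_scheme"
 assumes N: "lie_module K L N b"
 shows "lie_module K G N (%y. uea_act K N b (\<phi> y))"
proof -
 interpret N: lie_module' K L N b by (intro lie_module'.intro N lie_algebra'_axioms)
 show ?thesis
  by (intro lie_module.intro G_lie lie_module_axioms.intro N.M.vectorspace_axioms)
  (simp_all add: N.uea_act phi_closed phi_hom uea_closed)
qed

interpretation G: restricted_lie_algebra K G p pmap by (rule restricted)

text \<open>The adjoint representation. It provides the Jacobi identity as a formula for the action
  of a bracket.\<close>

lemma triv_module: "lie_module K G G (bracket G)"
proof (intro lie_module.intro G_lie lie_module_axioms.intro G_vs)
 fix x y m assume h: "x : carrier G" "y : carrier G" "m : carrier G"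
 note c = G.bracket_closed
 show "bracket G (bracket G x y) m = bracket G x (bracket G y m) \<ominus>\<^bsub>G\<^esub> bracket G y (bracket G x m)"
  using vectorspace.diff_add_cancel(2)[OF G_vs c[OF c[OF h(1,2)] h(3)] c[OF h(2) c[OF h(1,3)]]]
  unfolding G.jacobi'[OF h] by (rule sym)
qed (simp_all add: G.bracket_closed G.bracket_add_left G.bracket_add_right G.bracket_smult_left G.bracket_smult_right)

abbreviation "P == \<iota> ` carrier L"

lemma linsub_P: "linsub K G P"
proof -
 note vL = lie_algebra.axioms(1)[OF lie_algebra_axioms]
 have "\<iota> \<zero>\<^bsub>L\<^esub> = zero G"
  by (rule vectorspace.linear_on_zero[OF vL G_vs _ vectorspace.linsub_carrier[OF vL]]) (simp add: linear_on_def iota)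
 then have "zero G : P" using imageI[of "zero L" "carrier L" \<iota>] by simp
 then show ?thesis
  unfolding linsub_def using iota(1) by (auto simp: iota(2,3)[symmetric])
qed

lemma P_G: "y : P ==> y : carrier G" using iota(1) by blast

lemma P_bracket: "y : P ==> z : P ==> bracket G y z : P"
 using bracket_closed by (auto simp: iota(4)[symmetric])

lemma funpow_in: "x : A ==> (!!y. y : A ==> f y : A) ==> (f ^^ k) x : A"
 by (induction k) simp_all

lemma bracket_zero: "x : carrier G ==> bracket G x \<zero>\<^bsub>G\<^esub> = zero G" "x : carrier G ==> bracket G \<zero>\<^bsub>G\<^esub> x = zero G"
 using G.bracket_smult_right[of "zero K" x "zero G"] G.bracket_smult_left[of "zero K" "zero G" x] G.bracket_closed by simp_all

text \<open>The normalizer of L in G is a p-subalgebra, because ad of the p-map of x is (ad x)^p,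
  and it contains L; so it is G.\<close>

lemma G_P: "y : carrier G ==> z : P ==> bracket G y z : P"
proof -
 interpret T: lie_module K G G "bracket G" by (rule triv_module)
 let ?A = "{y : carrier G. ALL z:P. bracket G y z : P}"
 have "carrier G <= ?A"
 proof (rule hull)
  show "linsub K G ?A" unfolding linsub_def
  proof (intro conjI ballI subsetI)
  show "zero G : ?A" using P_G linsubD(2)[OF linsub_P] by (simp add: bracket_zero)
  show "x \<oplus>\<^bsub>G\<^esub> y : ?A" if "x : ?A" "y : ?A" for x y
  using that P_G linsubD(3)[OF linsub_P] by (simp add: G.bracket_add_left)
  show "a \<odot>\<^bsub>G\<^esub> y : ?A" if "a : carrier K" "y : ?A" for a y
  using that P_G linsubD(4)[OF linsub_P] by (simp add: G.bracket_smult_left)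
  qed simp
  show "bracket G x y : ?A" if h: "x : ?A" "y : ?A" for x y
  proof -
  have xy: "x : carrier G" "y : carrier G" and P: "!!z. z : P ==> bracket G x z : P" "!!z. z : P ==> bracket G y z : P"
  using h by blast+
  have "bracket G (bracket G x y) z : P" if z: "z : P" for z
  unfolding T.act_bracket[OF xy P_G[OF z]] by (rule vectorspace.linsub_diff[OF G_vs linsub_P P(1)[OF P(2)[OF z]] P(2)[OF P(1)[OF z]]])
  then show ?thesis using G.bracket_closed[OF xy] by blast
  qed
  show "pmap x : ?A" if h: "x : ?A" for x
  proof -
  have x: "x : carrier G" and P: "!!z. z : P ==> bracket G x z : P" using h by blast+
  have "bracket G (pmap x) z : P" if z: "z : P" for z
  unfolding G.bracket_pmap[OF x P_G[OF z]] by (rule funpow_in[OF z P])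
  then show ?thesis using G.pmap_closed[OF x] by blast
  qed
  show "P <= ?A" using P_G P_bracket by blast
 qed
 then show "y : carrier G ==> z : P ==> bracket G y z : P" by blast
qed

text \<open>The elements y with [y, G] inside L form a p-subalgebra: p being positive, the outermost
  factor of (ad y)^p already ends in L. It contains L because L is an ideal by
  \<open>G_P\<close>.\<close>

lemma G_G: "y : carrier G ==> z : carrier G ==> bracket G y z : P"
proof -
 interpret T: lie_module K G G "bracket G" by (rule triv_module)
 let ?A = "{y : carrier G. ALL z:carrier G. bracket G y z : P}"
 have "carrier G <= ?A"
 proof (rule hull)
  show "linsub K G ?A" unfolding linsub_def
  proof (intro conjI ballI subsetI)
  show "zero G : ?A" using linsubD(2)[OF linsub_P] by (simp add: bracket_zero)
  show "x \<oplus>\<^bsub>G\<^esub> y : ?A" if "x : ?A" "y : ?A" for x y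
  using that linsubD(3)[OF linsub_P] by (simp add: G.bracket_add_left)
  show "a \<odot>\<^bsub>G\<^esub> y : ?A" if "a : carrier K" "y : ?A" for a y
  using that linsubD(4)[OF linsub_P] by (simp add: G.bracket_smult_left)
  qed simp
  show "bracket G x y : ?A" if "x : ?A" "y : ?A" for x y
  using that vectorspace.linsub_diff[OF G_vs linsub_P] by (simp add: T.act_bracket G.bracket_closed)
  show "pmap x : ?A" if x: "x : ?A" for x
  proof -
  obtain k where k: "p = Suc k" using p_pos not0_implies_Suc by blast
  have "(bracket G x ^^ p) z : P" if z: "z : carrier G" for z
  using x funpow_in[OF z, of "bracket G x" k] G.bracket_closed by (simp add: k)
  then show ?thesis using x by (simp add: G.bracket_pmap G.pmap_closed)
  qed
  show "P <= ?A"
  proof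
  fix y assume y: "y : P"
  have "bracket G y z : P" if z: "z : carrier G" for z
  using G.bracket_flip[OF z P_G[OF y]] vectorspace.linsub_neg[OF G_vs linsub_P G_P[OF z y]] by simp
  then show "y : ?A" using P_G[OF y] by simp
  qed
 qed
 then show "y : carrier G ==> z : carrier G ==> bracket G y z : P" by blast
qed

text \<open>The centralizer of w is closed under the p-map, since p is positive and the innermost
  factor of (ad x)^p sends w to 0. Containing L, it is all of G.\<close>

lemma centralizer:
 assumes w: "w : carrier G" and 0: "!!z. z : P ==> bracket G z w = zero G" and z: "z : carrier G"
 shows "bracket G z w = zero G"
proof -
 interpret T: lie_module K G G "bracket G" by (rule triv_module)
 interpret GV: vectorspace K G by (rule G_vs)
 let ?A = "{y : carrier G. bracket G y w = zero G}"
 have "carrier G <= ?A"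
 proof (rule hull)
  show "linsub K G ?A" unfolding linsub_def
  using w by (simp add: bracket_zero G.bracket_add_left G.bracket_smult_left subset_iff)
  show "bracket G x y : ?A" if "x : ?A" "y : ?A" for x y
  using that w by (simp add: T.act_bracket bracket_zero G.bracket_closed vectorspace.diff_self[OF G_vs])
  show "pmap x : ?A" if x: "x : ?A" for x
  proof -
  obtain k where k: "p = Suc k" using p_pos not0_implies_Suc by blast
  have "(bracket G x ^^ k) \<zero>\<^bsub>G\<^esub> = zero G" using x by (induction k) (simp_all add: bracket_zero)
  then have "(bracket G x ^^ p) w = zero G" using x by (simp add: k funpow_Suc_right del: funpow.simps)
  then show ?thesis using x w by (simp add: G.bracket_pmap G.pmap_closed)
  qed
  show "P <= ?A" using 0 P_G by blast
 qed
 then show ?thesis using z by blast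
qed

end

context lie_complex
begin

text \<open>On cocycles theta_l = d iota_l + iota_l d reduces to d iota_l. The contraction is a
  cochain on A only because l itself belongs to A; in degree 0 there is nothing to contract and
  theta_l f = 0.\<close>

lemma cocyc_cartan:
 assumes A: "subalg_on A" and l: "l : A" and f: "cocyc A n f"
 shows "cobd A n (th (act l) (br l) f)"
proof -
 have f': "altf A n f" "ev f" "!!xs. xs : tups A (Suc n) ==> dd act br f xs = 0" using f by (simp_all add: cocyc_def)
 have lB: "l : B" using subalgD(1)[OF A l] .
 have a: "altf A n (th (act l) (br l) f)" by (rule altf_th[OF subalgD(2)[OF A] act_lin[OF lB] subalgD(4)[OF A l] f'(1)])
 have e: "ev (th (act l) (br l) f)" by (rule ev_th[OF e(2) f'(2)])
 have eq: "th (act l) (br l) f xs = dd act br (%ys. f (l # ys)) xs" if xs: "xs : tups A n" for xs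
  using f'(3)[of "l # xs"] l xs by simp
 show ?thesis
 proof (cases n)
  case 0
  then show ?thesis using a e eq[of "[]"] by (simp add: cobd_def)
 next
  case (Suc m)
  show ?thesis
  unfolding Suc
  proof (rule cobdI[OF a[unfolded Suc] e])
  show "altf A m (%ys. f (l # ys))" by (rule altf_head[OF f'(1)[unfolded Suc] l])
  show "ev (%ys. f (l # ys))" using f'(2) by (simp add: ev_def)
  qed (use eq Suc in simp)
 qed
qed

end

lemma (in lie_module) char_nsc:
 assumes "has_char K p"
 shows "nsc p (lft M u F) = 0"
proof -
 interpret N: rng_emb "null_ring M" by (rule M.null_emb)
 define m where "m = (if u (pick (null_ring M) F) : carrier M then u (pick (null_ring M) F) else zero M)"
 have m: "m : carrier M" by (simp add: m_def)
 have eq: "lft M u F = em m" using M.embed_outside[of "u (pick (null_ring M) F)"] N.embed_zero by (simp add: lft_def m_def)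
 have "em (([k] \<cdot>\<^bsub>K\<^esub> \<one>\<^bsub>K\<^esub>) \<odot>\<^bsub>M\<^esub> m) = nsc k (em m)" for k :: nat
 proof (induction k)
  case (Suc k)
  have "[Suc k] \<cdot>\<^bsub>K\<^esub> \<one>\<^bsub>K\<^esub> = [k] \<cdot>\<^bsub>K\<^esub> \<one>\<^bsub>K\<^esub> \<oplus>\<^bsub>K\<^esub> \<one>\<^bsub>K\<^esub>" by simp
  then have "([Suc k] \<cdot>\<^bsub>K\<^esub> \<one>\<^bsub>K\<^esub>) \<odot>\<^bsub>M\<^esub> m = ([k] \<cdot>\<^bsub>K\<^esub> \<one>\<^bsub>K\<^esub>) \<odot>\<^bsub>M\<^esub> m \<oplus>\<^bsub>M\<^esub> m"
  using m by (simp add: smult_l_distr)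
  then show ?case using Suc N.embed_add m by simp
 qed (use m N.embed_zero in simp)
 from this[of p] have "nsc p (em m) = em (([p] \<cdot>\<^bsub>K\<^esub> \<one>\<^bsub>K\<^esub>) \<odot>\<^bsub>M\<^esub> m)" by simp
 moreover have "[p] \<cdot>\<^bsub>K\<^esub> \<one>\<^bsub>K\<^esub> = zero K" using assms dvd_refl[of p] unfolding has_char_def by blast
 ultimately show ?thesis unfolding eq using lmult_0[OF m] N.embed_zero by simp
qed

context p_env
begin

interpretation G: restricted_lie_algebra K G p pmap by (rule restricted)
interpretation T: lie_module K G G "bracket G" by (rule triv_module)

text \<open>As operators on V, the commutators with u agree with ad g on L. For faithful V this is
  enough to compare different g, because [g, z] lies in L and is determined by its action on
  V.\<close>

definition compat :: "('k, 'v, 's) module_scheme => ('l => 'v => 'v) => ('l list => 'k) set => 'g => bool"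
 where "compat V b u g \<longleftrightarrow> (ALL z:P. ALL F. lft V (uea_act K V b u) (lft V (uea_act K V b (\<phi> z)) F) -
  lft V (uea_act K V b (\<phi> z)) (lft V (uea_act K V b u) F) = lft V (uea_act K V b (\<phi> (bracket G g z))) F)"

definition triv :: "('k, 'v, 's) module_scheme => ('l => 'v => 'v) => 'g set => ('l list => 'k) set => 'g => bool"
 where "triv V b H u g \<longleftrightarrow> (ALL n f. lie_complex.cocyc (add G) (smult G) (carrier K) (%a. lft V (smult V a)) (bracket G)
  (%x. lft V (uea_act K V b (\<phi> x))) (lft V (%v. v)) H n f -->
  lie_complex.cobd (add G) (smult G) (carrier K) (%a. lft V (smult V a)) (bracket G)
  (%x. lft V (uea_act K V b (\<phi> x))) (lft V (%v. v)) H n (th (lft V (uea_act K V b u)) (bracket G g) f))"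

context
 fixes V :: "('k, 'v, 's) module_scheme" and b
 assumes V: "lie_module K L V b"
begin

interpretation VL: lie_module' K L V b by (intro lie_module'.intro V lie_algebra'_axioms)
interpretation VG: lie_module K G V "%y. uea_act K V b (\<phi> y)" by (rule G_module[OF V])

abbreviation "X u == lft V (uea_act K V b u)"

lemma X_add: "u : carrier (uea K L) ==> X u (F + F') = X u F + X u F'"
 by (rule VL.M.lft_add) (simp_all add: VL.uea_act)

lemma X_minus: "u : carrier (uea K L) ==> X u (F - F') = X u F - X u F'"
 by (rule additive_minus(2)[OF X_add])

lemma X_plus: "u : carrier (uea K L) ==> v : carrier (uea K L) ==> X (u \<oplus>\<^bsub>uea K L\<^esub> v) F = X u F + X v F"
 by (subst VL.M.lft_plus(1)[symmetric]) (auto intro!: VL.M.lft_cong simp: VL.uea_act)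

lemma X_sc: "a : carrier K ==> u : carrier (uea K L) ==> X (a \<odot>\<^bsub>uea K L\<^esub> u) F = lft V (smult V a) (X u F)"
 by (subst VL.M.lft_comp) (auto intro!: VL.M.lft_cong simp: VL.uea_act)

lemma X_sc': "a : carrier K ==> u : carrier (uea K L) ==> X u (lft V (smult V a) F) = lft V (smult V a) (X u F)"
 by (subst (1 2) VL.M.lft_comp) (auto intro!: VL.M.lft_cong simp: VL.uea_act)

lemma X_comm: "u : carrier (uea K L) ==> v : carrier (uea K L) ==>
  X (u \<otimes>\<^bsub>uea K L\<^esub> v \<ominus>\<^bsub>uea K L\<^esub> v \<otimes>\<^bsub>uea K L\<^esub> u) F = X u (X v F) - X v (X u F)"
 by (subst (1 2) VL.M.lft_comp, simp add: VL.uea_act, simp add: VL.uea_act,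
  subst VL.M.lft_plus(2)[symmetric]) (auto intro!: VL.M.lft_cong simp: VL.uea_act uea_closed)

lemma X_pow: "u : carrier (uea K L) ==> X (u [^]\<^bsub>uea K L\<^esub> p) F = (X u ^^ p) F"
proof -
 assume u: "u : carrier (uea K L)"
 obtain k where k: "p = Suc k" using p_pos not0_implies_Suc by blast
 have "(X u ^^ p) F = lft V (uea_act K V b u ^^ p) F"
  unfolding k by (rule VL.M.lft_pow) (rule VL.uea_act(1)[OF u])
 also have "... = X (u [^]\<^bsub>uea K L\<^esub> p) F" by (rule VL.M.lft_cong) (rule VL.uea_act(8)[OF u, symmetric])
 finally show ?thesis by simp
qed

lemma X_br: "y : carrier G ==> z : carrier G ==> X (\<phi> (bracket G y z)) F = X (\<phi> y) (X (\<phi> z) F) - X (\<phi> z) (X (\<phi> y) F)"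
 by (rule VG.CE.act_br)

lemma compatD: "compat V b u g ==> z : P ==> X u (X (\<phi> z) F) - X (\<phi> z) (X u F) = X (\<phi> (bracket G g z)) F"
 unfolding compat_def by (drule (1) bspec) (erule spec)

lemma compatD': "compat V b u g ==> z : P ==> X u (X (\<phi> z) F) = X (\<phi> z) (X u F) + X (\<phi> (bracket G g z)) F"
 unfolding compatD[symmetric] by simp

lemma compat_add:
 assumes u: "u : carrier (uea K L)" "v : carrier (uea K L)" and g: "g : carrier G" "g' : carrier G"
  and c: "compat V b u g" "compat V b v g'"
 shows "compat V b (u \<oplus>\<^bsub>uea K L\<^esub> v) (g \<oplus>\<^bsub>G\<^esub> g')"
 unfolding compat_def
proof (intro ballI allI)
 fix z F assume z: "z : P"
 have zG: "z : carrier G" by (rule P_G[OF z])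
 have c': "X u (X (\<phi> z) F) - X (\<phi> z) (X u F) = X (\<phi> (bracket G g z)) F"
  "X v (X (\<phi> z) F) - X (\<phi> z) (X v F) = X (\<phi> (bracket G g' z)) F" using compatD[OF c(1) z] compatD[OF c(2) z] by blast+
 show "X (u \<oplus>\<^bsub>uea K L\<^esub> v) (X (\<phi> z) F) - X (\<phi> z) (X (u \<oplus>\<^bsub>uea K L\<^esub> v) F) = X (\<phi> (bracket G (g \<oplus>\<^bsub>G\<^esub> g') z)) F"
  unfolding G.bracket_add_left[OF g zG] phi_hom(1)[OF G.bracket_closed[OF g(1) zG] G.bracket_closed[OF g(2) zG]]
  X_plus[OF u] X_plus[OF phi_closed[OF G.bracket_closed[OF g(1) zG]] phi_closed[OF G.bracket_closed[OF g(2) zG]]]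
  X_add[OF phi_closed[OF zG]] c'[symmetric] by simp
qed

lemma compat_sc:
 assumes a: "a : carrier K" and u: "u : carrier (uea K L)" and g: "g : carrier G" and c: "compat V b u g"
 shows "compat V b (a \<odot>\<^bsub>uea K L\<^esub> u) (a \<odot>\<^bsub>G\<^esub> g)"
 unfolding compat_def
proof (intro ballI allI)
 fix z F assume z: "z : P"
 have zG: "z : carrier G" by (rule P_G[OF z])
 have c': "X u (X (\<phi> z) F) - X (\<phi> z) (X u F) = X (\<phi> (bracket G g z)) F" by (rule compatD[OF c z])
 show "X (a \<odot>\<^bsub>uea K L\<^esub> u) (X (\<phi> z) F) - X (\<phi> z) (X (a \<odot>\<^bsub>uea K L\<^esub> u) F) = X (\<phi> (bracket G (a \<odot>\<^bsub>G\<^esub> g) z)) F"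
  unfolding G.bracket_smult_left[OF a g zG] phi_hom(2)[OF a G.bracket_closed[OF g zG]]
  X_sc[OF a u] X_sc[OF a phi_closed[OF G.bracket_closed[OF g zG]]] X_sc'[OF a phi_closed[OF zG]] c'[symmetric]
  by (rule VG.CE.sc_simps(3)[OF a, symmetric])
qed

lemma compat_comm:
 assumes u: "u : carrier (uea K L)" "v : carrier (uea K L)" and g: "g : carrier G" "g' : carrier G"
  and c: "compat V b u g" "compat V b v g'"
 shows "compat V b (u \<otimes>\<^bsub>uea K L\<^esub> v \<ominus>\<^bsub>uea K L\<^esub> v \<otimes>\<^bsub>uea K L\<^esub> u) (bracket G g g')"
 unfolding compat_def
proof (intro ballI allI)
 fix z F assume z: "z : P"
 have zG: "z : carrier G" by (rule P_G[OF z])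
 have cu: "X u (X (\<phi> z) F) = X (\<phi> z) (X u F) + X (\<phi> (bracket G g z)) F" if "z : P" for z F
  by (rule compatD'[OF c(1) that])
 have cv: "X v (X (\<phi> z) F) = X (\<phi> z) (X v F) + X (\<phi> (bracket G g' z)) F" if "z : P" for z F
  by (rule compatD'[OF c(2) that])
 let ?w = "bracket G g (bracket G g' z)" and ?w' = "bracket G g' (bracket G g z)"
 have w: "?w : carrier G" "?w' : carrier G" using g zG G.bracket_closed by simp_all
 have gz: "bracket G g z : P" "bracket G g' z : P" using G_P[OF _ z] g by simp_all
 have split: "?w = bracket G (bracket G g g') z \<oplus>\<^bsub>G\<^esub> ?w'" using G.jacobi'[OF g zG] by simp
 have "X (\<phi> ?w) F = X (\<phi> (bracket G (bracket G g g') z)) F + X (\<phi> ?w') F"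
  unfolding split using VG.CE.act_add_op[of "bracket G (bracket G g g') z" ?w' F] w g zG G.bracket_closed by simp
 then show "X (u \<otimes>\<^bsub>uea K L\<^esub> v \<ominus>\<^bsub>uea K L\<^esub> v \<otimes>\<^bsub>uea K L\<^esub> u) (X (\<phi> z) F) -
  X (\<phi> z) (X (u \<otimes>\<^bsub>uea K L\<^esub> v \<ominus>\<^bsub>uea K L\<^esub> v \<otimes>\<^bsub>uea K L\<^esub> u) F) = X (\<phi> (bracket G (bracket G g g') z)) F"
  unfolding X_comm[OF u] cu[OF z] cv[OF z] X_add[OF u(1)] X_add[OF u(2)] X_minus[OF phi_closed[OF zG]]
  cu[OF gz(2)] cv[OF gz(1)] cu[OF z] cv[OF z] by (simp add: algebra_simps)
qed

text \<open>The p-fold commutator with u is the commutator with u^p by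
  \<open>commutator_power\<close>, while on the other side (ad g)^p is ad of the p-map of g. The
  iteration never leaves the range of the hypothesis, because [g, z] lies again in L.\<close>

lemma compat_pow:
 assumes u: "u : carrier (uea K L)" and g: "g : carrier G" and c: "compat V b u g"
 shows "compat V b (u [^]\<^bsub>uea K L\<^esub> p) (pmap g)"
 unfolding compat_def
proof (intro ballI allI)
 fix z F assume z: "z : P"
 have zG: "z : carrier G" by (rule P_G[OF z])
 have it: "((%F v. X u (F v) - F (X u v)) ^^ k) (X (\<phi> z)) = X (\<phi> ((bracket G g ^^ k) z))" for k
 proof (induction k)
  case (Suc k)
  have "(bracket G g ^^ k) z : P" by (rule funpow_in[OF z G_P[OF g]])
  from compatD[OF c this] show ?case using Suc by simp
 qed simp
 have "X (\<phi> (bracket G (pmap g) z)) F = ((%F v. X u (F v) - F (X u v)) ^^ p) (X (\<phi> z)) F"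
  unfolding it G.bracket_pmap[OF g zG] ..
 also have "... = (X u ^^ p) (X (\<phi> z) F) - X (\<phi> z) ((X u ^^ p) F)"
  by (rule commutator_power[OF X_add[OF u] G.prime_p VL.char_nsc[OF G.char_p]])
 finally show "X (u [^]\<^bsub>uea K L\<^esub> p) (X (\<phi> z) F) - X (\<phi> z) (X (u [^]\<^bsub>uea K L\<^esub> p) F) = X (\<phi> (bracket G (pmap g) z)) F"
  unfolding X_pow[OF u] by simp
qed

context
 fixes H assumes H: "linsub K G H" "P <= H"
begin

lemma H_sub: "VG.CE.subalg_on H" and H_lin: "g : carrier G ==> VG.CE.lin_on H (bracket G g)"
 and H_G: "H <= carrier G"
proof -
 have HG: "h : carrier G" if "h : H" for h by (rule linsubD(1)[OF H(1) that])
 have i: "bracket G g h : H" if "g : carrier G" "h : H" for g h using G_G[OF that(1) HG[OF that(2)]] H(2) by blast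
 show "H <= carrier G" using HG by blast
 show "VG.CE.subalg_on H" unfolding VG.CE.subalg_on_def VG.CE.subsp_on_def using HG i linsubD(3,4)[OF H(1)] by blast
 show "VG.CE.lin_on H (bracket G g)" if "g : carrier G"
  unfolding VG.CE.lin_on_def using that i HG by (simp add: G.bracket_add_right G.bracket_smult_right)
qed

lemma X_lin: "u : carrier (uea K L) ==> VG.CE.lin_op (X u)"
 unfolding VG.CE.lin_op_def using X_add X_sc' by blast

lemma trivD: "triv V b H u g ==> VG.CE.cocyc H n f ==> VG.CE.cobd H n (th (X u) (bracket G g) f)"
 by (simp add: triv_def)

lemma trivI: "(!!n f. VG.CE.cocyc H n f ==> VG.CE.altf H n f ==> VG.CE.cobd H n (th (X u) (bracket G g) f)) ==> triv V b H u g"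
 unfolding triv_def VG.CE.cocyc_def by blast

lemma ev_thX: "VG.CE.cocyc H n f ==> VG.CE.ev (th (X u) (bracket G g) f)"
 by (rule VG.CE.ev_th[OF VL.M.lft_id_lft]) (simp add: VG.CE.cocyc_def)

lemma triv_add:
 assumes u: "u : carrier (uea K L)" "v : carrier (uea K L)" and g: "g : carrier G" "g' : carrier G"
  and c: "triv V b H u g" "triv V b H v g'"
 shows "triv V b H (u \<oplus>\<^bsub>uea K L\<^esub> v) (g \<oplus>\<^bsub>G\<^esub> g')"
proof (rule trivI)
 fix n f assume f: "VG.CE.cocyc H n f" and a: "VG.CE.altf H n f"
 show "VG.CE.cobd H n (th (X (u \<oplus>\<^bsub>uea K L\<^esub> v)) (bracket G (g \<oplus>\<^bsub>G\<^esub> g')) f)"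
 proof (rule VG.CE.cobd_cong[OF H_sub _ ev_thX[OF f] VG.CE.cobd_add[OF H_G trivD[OF c(1) f] trivD[OF c(2) f]]], rule sym)
  fix xs assume xs: "xs : tups H n"
  show "th (X (u \<oplus>\<^bsub>uea K L\<^esub> v)) (bracket G (g \<oplus>\<^bsub>G\<^esub> g')) f xs = th (X u) (bracket G g) f xs + th (X v) (bracket G g') f xs"
  by (rule VG.CE.th_add_op[OF H_lin[OF g(1)] H_lin[OF g(2)] H_lin X_plus[OF u] _ a xs])
  (use g H_G G.bracket_add_left in auto)
 qed
qed

lemma triv_sc:
 assumes k: "k : carrier K" and u: "u : carrier (uea K L)" and g: "g : carrier G" and c: "triv V b H u g"
 shows "triv V b H (k \<odot>\<^bsub>uea K L\<^esub> u) (k \<odot>\<^bsub>G\<^esub> g)"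
proof (rule trivI)
 fix n f assume f: "VG.CE.cocyc H n f" and a: "VG.CE.altf H n f"
 show "VG.CE.cobd H n (th (X (k \<odot>\<^bsub>uea K L\<^esub> u)) (bracket G (k \<odot>\<^bsub>G\<^esub> g)) f)"
 proof (rule VG.CE.cobd_cong[OF H_sub _ ev_thX[OF f] VG.CE.cobd_sc[OF H_G k trivD[OF c f]]], rule sym)
  fix xs assume xs: "xs : tups H n"
  show "th (X (k \<odot>\<^bsub>uea K L\<^esub> u)) (bracket G (k \<odot>\<^bsub>G\<^esub> g)) f xs = lft V (smult V k) (th (X u) (bracket G g) f xs)"
  by (rule VG.CE.th_smult_op[OF H_lin[OF g] k X_sc[OF k u] _ a xs])
  (use g k H_G G.bracket_smult_left in auto)
 qed
qed

text \<open>Each of the two operators sends a cocycle to a coboundary, which is again a cocycle and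
  can be fed to the other one. Their commutator is the operator of the commutators by
  \<open>th_comm\<close>.\<close>

lemma triv_comm:
 assumes u: "u : carrier (uea K L)" "v : carrier (uea K L)" and g: "g : carrier G" "g' : carrier G"
  and c: "triv V b H u g" "triv V b H v g'"
 shows "triv V b H (u \<otimes>\<^bsub>uea K L\<^esub> v \<ominus>\<^bsub>uea K L\<^esub> v \<otimes>\<^bsub>uea K L\<^esub> u) (bracket G g g')"
proof (rule trivI)
 fix n f assume f: "VG.CE.cocyc H n f" and a: "VG.CE.altf H n f"
 have z: "zero G : H" by (rule linsubD(2)[OF H(1)])
 note cc = VG.CE.cobd_cocyc[OF H_sub z]
 show "VG.CE.cobd H n (th (X (u \<otimes>\<^bsub>uea K L\<^esub> v \<ominus>\<^bsub>uea K L\<^esub> v \<otimes>\<^bsub>uea K L\<^esub> u)) (bracket G (bracket G g g')) f)"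
 proof (rule VG.CE.cobd_cong[OF H_sub _ ev_thX[OF f] VG.CE.cobd_diff[OF H_G
  trivD[OF c(1) cc[OF trivD[OF c(2) f]]] trivD[OF c(2) cc[OF trivD[OF c(1) f]]]]])
  fix xs assume xs: "xs : tups H n"
  show "th (X u) (bracket G g) (th (X v) (bracket G g') f) xs - th (X v) (bracket G g') (th (X u) (bracket G g) f) xs =
  th (X (u \<otimes>\<^bsub>uea K L\<^esub> v \<ominus>\<^bsub>uea K L\<^esub> v \<otimes>\<^bsub>uea K L\<^esub> u)) (bracket G (bracket G g g')) f xs"
  proof (rule VG.CE.th_comm[OF VG.CE.subalgD(2)[OF H_sub] X_lin[OF u(1)] X_lin[OF u(2)] H_lin[OF g(1)] H_lin[OF g(2)] _ _ a xs])
  fix h assume h: "h : H"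
  show "bracket G (bracket G g g') h : H"
  using H_lin[OF G.bracket_closed[OF g]] h by (simp add: VG.CE.lin_on_def)
  show "bracket G (bracket G g g') h \<oplus>\<^bsub>G\<^esub> bracket G g' (bracket G g h) = bracket G g (bracket G g' h)"
  by (rule G.jacobi'[OF g]) (use h H_G in blast)
  qed (rule X_comm[OF u])
 qed
qed

text \<open>By \<open>th_power\<close> the p-th power of the operator is the one formed from u^p and
  (ad g)^p, and the latter is ad of the p-map of g. Powers with positive exponent of an operator
  trivial on cohomology are trivial, as coboundaries are cocycles.\<close>

lemma triv_pow:
 assumes u: "u : carrier (uea K L)" and g: "g : carrier G" and c: "triv V b H u g"
 shows "triv V b H (u [^]\<^bsub>uea K L\<^esub> p) (pmap g)"
proof (rule trivI)
 fix n f assume f: "VG.CE.cocyc H n f" and a: "VG.CE.altf H n f"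
 have z: "zero G : H" by (rule linsubD(2)[OF H(1)])
 have ev: "lft V (%v. v) (f xs) = f xs" for xs using f by (simp add: VG.CE.cocyc_def VG.CE.ev_def)
 have it: "VG.CE.cobd H n ((th (X u) (bracket G g) ^^ Suc k) f)" for k
 proof (induction k)
  case (Suc k)
  then show ?case using trivD[OF c VG.CE.cobd_cocyc[OF H_sub z Suc]] by simp
 qed (use trivD[OF c f] in simp)
 obtain k where k: "p = Suc k" using p_pos not0_implies_Suc by blast
 show "VG.CE.cobd H n (th (X (u [^]\<^bsub>uea K L\<^esub> p)) (bracket G (pmap g)) f)"
 proof (rule VG.CE.cobd_cong[OF H_sub _ ev_thX[OF f] it[of k, folded k]])
  fix xs assume xs: "xs : tups H n"
  have "nsc p (f xs) = 0" for xs using VL.char_nsc[OF G.char_p, of "%v. v" "f xs"] by (simp add: ev)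
  then have "(th (X u) (bracket G g) ^^ p) f xs = th (X u ^^ p) (bracket G g ^^ p) f xs"
  by (rule th_power[OF X_add[OF u] G.prime_p])
  also have "... = th (X (u [^]\<^bsub>uea K L\<^esub> p)) (bracket G (pmap g)) f xs"
  proof (rule th_cong_op[OF X_pow[OF u, symmetric] _ xs])
  show "(bracket G g ^^ p) h = bracket G (pmap g) h" if "h : H" for h
  using G.bracket_pmap[OF g, of h] H_G that by auto
  qed
  finally show "(th (X u) (bracket G g) ^^ p) f xs = th (X (u [^]\<^bsub>uea K L\<^esub> p)) (bracket G (pmap g)) f xs" .
 qed
qed

lemma triv_base:
 assumes l: "l : carrier L"
 shows "triv V b H (uea_incl K L l) (\<iota> l)"
proof (rule trivI)
 fix n f assume f: "VG.CE.cocyc H n f"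
 show "VG.CE.cobd H n (th (X (uea_incl K L l)) (bracket G (\<iota> l)) f)"
  unfolding phi_iota[OF l, symmetric] by (rule VG.CE.cocyc_cartan[OF H_sub _ f]) (use l H(2) in blast)
qed

end

end

text \<open>The element u is controlled on two modules at once: on a faithful module V,
  \<open>compat\<close> keeps track of ad g, and on M, \<open>triv\<close> records the effect on
  cohomology. It is essential that the same g serves for both, since V then transfers what is known
  for g to y.\<close>

lemma triviality:
 assumes M: "lie_module K L M b" and H: "linsub K G H" "P <= H" and y: "y : carrier G"
 shows "triv M b H (\<phi> y) y"
proof -
 obtain V :: "('k, nat list => 'k) module" and a where V: "lie_module K L V a"
  and faith: "!!l. l : carrier L ==> ALL v:carrier V. a l v = zero V ==> l = zero L"
  using faithful_lie_module[OF lie_algebra_axioms fd] by blast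
 interpret VL: lie_module' K L V a by (intro lie_module'.intro V lie_algebra'_axioms)
 interpret UV: vectorspace K "uea K L" by (rule uea_vs)
 note agG = Module.module.axioms(2)[OF vectorspace.axioms(1)[OF G_vs]]
 note G_smult = Module.module.smult_closed[OF vectorspace.axioms(1)[OF G_vs]]
 note G_add = abelian_monoid.a_closed[OF abelian_group.axioms(1)[OF agG]]
 let ?S = "{u : carrier (uea K L). EX g:carrier G. compat V a u g & triv M b H u g}"
 have inc: "uea_incl K L l : ?S" if l: "l : carrier L" for l
 proof -
  have "compat V a (uea_incl K L l) (\<iota> l)"
  unfolding compat_def phi_iota[OF l, symmetric] using X_br[OF V iota(1)[OF l] P_G] by simp
  then show ?thesis by (intro CollectI conjI bexI[of _ "\<iota> l"] uea_closed(4)[OF l] iota(1)[OF l] triv_base[OF M H l])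
 qed
 have sc: "k \<odot>\<^bsub>uea K L\<^esub> u : ?S" if k: "k : carrier K" and u: "u : ?S" for k u
 proof -
  obtain g where g: "g : carrier G" "compat V a u g" "triv M b H u g" using u by blast
  have uc: "u : carrier (uea K L)" using u by blast
  show ?thesis
  by (intro CollectI conjI bexI[of _ "k \<odot>\<^bsub>G\<^esub> g"] compat_sc[OF V] triv_sc[OF M H] UV.smult_closed G_smult k uc g)
 qed
 have "\<phi> y : ?S"
 proof (rule universal_sub[OF _ _ _ _ y])
  show "linsub K (uea K L) ?S" unfolding linsub_def
  proof (intro conjI ballI subsetI)
  have z: "zero L : carrier L" by simp
  have "\<zero>\<^bsub>K\<^esub> \<odot>\<^bsub>uea K L\<^esub> uea_incl K L \<zero>\<^bsub>L\<^esub> : ?S" by (rule sc[OF _ inc[OF z]]) simp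
  then show "\<zero>\<^bsub>uea K L\<^esub> : ?S" unfolding UV.lmult_0[OF uea_closed(4)[OF z]] .
  show "u \<oplus>\<^bsub>uea K L\<^esub> v : ?S" if u: "u : ?S" and v: "v : ?S" for u v
  proof -
  obtain g g' where g: "g : carrier G" "compat V a u g" "triv M b H u g" "g' : carrier G" "compat V a v g'" "triv M b H v g'"
  using u v by blast
  have uc: "u : carrier (uea K L)" "v : carrier (uea K L)" using u v by blast+
  show ?thesis
  by (intro CollectI conjI bexI[of _ "g \<oplus>\<^bsub>G\<^esub> g'"] compat_add[OF V] triv_add[OF M H] UV.M.a_closed G_add uc g)
  qed
  show "u : carrier (uea K L)" if "u : ?S" for u using that by simp
  show "k \<odot>\<^bsub>uea K L\<^esub> u : ?S" if "k : carrier K" "u : ?S" for k u by (rule sc[OF that])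
  qed
  show "u \<otimes>\<^bsub>uea K L\<^esub> v \<ominus>\<^bsub>uea K L\<^esub> v \<otimes>\<^bsub>uea K L\<^esub> u : ?S" if u: "u : ?S" and v: "v : ?S" for u v
  proof -
  obtain g g' where g: "g : carrier G" "compat V a u g" "triv M b H u g" "g' : carrier G" "compat V a v g'" "triv M b H v g'"
  using u v by blast
  have uc: "u : carrier (uea K L)" "v : carrier (uea K L)" using u v by blast+
  show ?thesis
  by (intro CollectI conjI bexI[of _ "bracket G g g'"] compat_comm[OF V] triv_comm[OF M H] UV.M.minus_closed uea_closed(1) G.bracket_closed uc g)
  qed
  show "u [^]\<^bsub>uea K L\<^esub> p : ?S" if u: "u : ?S" for u
  proof -
  obtain g where g: "g : carrier G" "compat V a u g" "triv M b H u g" using u by blast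
  have uc: "u : carrier (uea K L)" using u by blast
  show ?thesis
  by (intro CollectI conjI bexI[of _ "pmap g"] compat_pow[OF V] triv_pow[OF M H] uea_closed(3) G.pmap_closed uc g)
  qed
 qed (rule inc)
 then obtain g where g: "g : carrier G" "compat V a (\<phi> y) g" "triv M b H (\<phi> y) g" by blast
 \<comment> \<open>The commutator of \<phi>(y) with \<phi>(z) acts on V as [g, z] by compatibility
   and as [y, z] because \<phi> is a homomorphism. Both brackets lie in the image of L, whose
   elements V separates.\<close>
 have eqP: "bracket G g z = bracket G y z" if z: "z : P" for z
 proof -
  have gz: "bracket G g z : P" "bracket G y z : P" using G_P[OF _ z] g(1) y by blast+
  then obtain l l' where l: "l : carrier L" "bracket G g z = \<iota> l" "l' : carrier L" "bracket G y z = \<iota> l'" by blast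
  have X: "lft V (uea_act K V a (\<phi> (\<iota> l))) F = lft V (uea_act K V a (\<phi> (\<iota> l'))) F" for F
  unfolding l(2,4)[symmetric] X_br[OF V y P_G[OF z]] by (rule compatD[OF V g(2) z, symmetric])
  have act: "a l v = a l' v" if v: "v : carrier V" for v
  proof -
  interpret N: rng_emb "null_ring V" by (rule VL.M.null_emb)
  have "embed (null_ring V) (a l v) = embed (null_ring V) (a l' v)"
  using X[of "embed (null_ring V) v"] v l(1,3)
  by (simp add: VL.M.lft_embed[OF v] phi_iota VL.uea_act_incl)
  then show ?thesis using N.embed_inject[of "a l v" "a l' v"] VL.act_closed l v by simp
  qed
  note vL = lie_algebra.axioms(1)[OF lie_algebra_axioms]
  have d: "l \<ominus>\<^bsub>L\<^esub> l' : carrier L"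
  by (rule abelian_group.minus_closed[OF Module.module.axioms(2)[OF vectorspace.axioms(1)[OF vL]] l(1,3)])
  have "a (l \<ominus>\<^bsub>L\<^esub> l') v = zero V" if v: "v : carrier V" for v
  proof -
  have "a (l \<ominus>\<^bsub>L\<^esub> l') v \<oplus>\<^bsub>V\<^esub> a l' v = a l v"
  unfolding VL.act_add_left[OF d l(3) v, symmetric] vectorspace.diff_add_cancel(1)[OF vL l(1,3)] ..
  then have "a (l \<ominus>\<^bsub>L\<^esub> l') v \<oplus>\<^bsub>V\<^esub> a l' v = zero V \<oplus>\<^bsub>V\<^esub> a l' v" using act[OF v] VL.act_closed[OF l(3) v] by simp
  then show ?thesis using VL.act_closed[OF d v] VL.act_closed[OF l(3) v] by (simp del: VL.M.l_zero)
  qed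
  then have "l \<ominus>\<^bsub>L\<^esub> l' = zero L" using faith[OF d] by blast
  then have "l = l'" using vectorspace.diff_zero_iff[OF vL l(1,3)] by blast
  then show ?thesis using l by simp
 qed
 have w: "g \<ominus>\<^bsub>G\<^esub> y : carrier G" by (rule abelian_group.minus_closed[OF agG g(1) y])
 have eq: "bracket G g z = bracket G y z" if z: "z : carrier G" for z
 proof -
  have split: "bracket G u (g \<ominus>\<^bsub>G\<^esub> y) \<oplus>\<^bsub>G\<^esub> bracket G u y = bracket G u g" if u: "u : carrier G" for u
  unfolding G.bracket_add_right[OF u w y, symmetric] vectorspace.diff_add_cancel(1)[OF G_vs g(1) y] ..
  have zero: "bracket G u (g \<ominus>\<^bsub>G\<^esub> y) = zero G" if u: "u : P" for u
  proof -
  have uG: "u : carrier G" by (rule P_G[OF u])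
  have "bracket G u g = bracket G u y" using eqP[OF u] G.bracket_flip[OF g(1) uG] G.bracket_flip[OF y uG] by simp
  then have "bracket G u (g \<ominus>\<^bsub>G\<^esub> y) \<oplus>\<^bsub>G\<^esub> bracket G u y = bracket G u y" using split[OF uG] by simp
  then have "bracket G u (g \<ominus>\<^bsub>G\<^esub> y) = bracket G u y \<ominus>\<^bsub>G\<^esub> bracket G u y"
  using vectorspace.diff_add_cancel(2)[OF G_vs G.bracket_closed[OF uG w] G.bracket_closed[OF uG y]] by simp
  then show ?thesis using vectorspace.diff_self[OF G_vs G.bracket_closed[OF uG y]] by simp
  qed
  have "bracket G z g = bracket G z y"
  using split[OF z] centralizer[OF w zero z] G.bracket_closed[OF z y] by simp
  then show ?thesis using G.bracket_flip[OF z g(1)] G.bracket_flip[OF z y] by simp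
 qed
 interpret MG: lie_module K G M "%y. uea_act K M b (\<phi> y)" by (rule G_module[OF M])
 show ?thesis
 proof (rule trivI[OF M H])
  fix n f assume f: "MG.CE.cocyc H n f"
  show "MG.CE.cobd H n (th (lft M (uea_act K M b (\<phi> y))) (bracket G y) f)"
  proof (rule MG.CE.cobd_cong[OF H_sub[OF M H] _ ev_thX[OF M H f] trivD[OF M H g(3) f]])
  show "th (lft M (uea_act K M b (\<phi> y))) (bracket G g) f xs = th (lft M (uea_act K M b (\<phi> y))) (bracket G y) f xs"
  if xs: "xs : tups H n" for xs
  by (rule th_cong_op[OF refl eq xs]) (use H_G[OF M H] in blast)
  qed
 qed
qed

end

section \<open>Finite dimension of the cohomology\<close>

lemma (in lie_module) finite_cdim:
 assumes fL: "vectorspace.fin_dim K L" and fM: "vectorspace.fin_dim K M"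
 shows "EX h. cdim n h"
proof -
 note vL = lie_algebra.axioms(1)[OF lie_algebra_axioms]
 interpret N: rng_emb "null_ring M" by (rule M.null_emb)
 interpret C: vectorspace K "cochain_space K L M n" by (rule cochain_space_vs)
 obtain d where "has_basis K L {..<d::nat}" using vectorspace.fin_dim_has_basis[OF vL fL] by blast
 then obtain p where p: "linear_on K L (free_space K {..<d}) (carrier L) p" "p ` carrier L = carrier (free_space K {..<d})"
  "!!z. z : carrier L ==> p z = (%j. zero K) \<longleftrightarrow> z : {zero L}" unfolding qdim_def by blast
 obtain e where "has_basis K M {..<e::nat}" using M.fin_dim_has_basis[OF fM] by blast
 then obtain q where q: "linear_on K M (free_space K {..<e}) (carrier M) q"
  "!!z. z : carrier M ==> q z = (%j. zero K) \<longleftrightarrow> z : {zero M}" unfolding qdim_def by blast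
 let ?b = "basis_vec K L p"
 let ?I = "inc_lists d n \<times> {..<e}"
 have fin: "finite ?I" using card_inc_lists(2) by simp
 obtain c where c: "bij_betw c {..<card ?I} ?I" using ex_bij_betw_nat_finite[OF fin] atLeast0LessThan by metis
 \<comment> \<open>A cochain is determined by the coordinates of its values on increasing tuples of
   basis vectors. \<open>c\<close> enumerates the pairs of such a tuple and a coordinate, and l_i
   reads off the i-th of these scalars.\<close>
 define l where "l i f = q (f (map ?b (fst (c i)))) (snd (c i))" for i f
 have b: "?b j : carrier L" if "j < d" for j using basis_vec(1)[OF field_axioms p(2)] that by simp
 have t: "map ?b js : tuples L n" if "js : inc_lists d n" for js
  using that b by (auto simp: inc_lists_def tups_def tuples_def)
 have ci: "c i : ?I" if "i < card ?I" for i using c that by (auto simp: bij_betw_def)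
 have "EX h. qdim K (cochain_space K L M n) (cocycles K L M act n) (coboundaries K L M act n) {..<h::nat}"
 proof (rule C.qdim_exists[OF linsub_cocycles linsub_coboundaries coboundaries_cocycles, where N = "card ?I" and l = l])
  fix i assume i: "i < card ?I"
  have ti: "map ?b (fst (c i)) : tuples L n" using t ci[OF i] by auto
  have qK: "q v j : carrier K" if "v : carrier M" for v j using linear_onD(1)[OF q(1) that] by (simp add: free_space_simps)
  show "linear_on K (cochain_space K L M n) (free_space K UNIV) (cocycles K L M act n) (%x j::unit. l i x)"
  unfolding linear_on_def
  proof (intro conjI ballI)
  fix f assume "f : cocycles K L M act n"
  then have f: "f (map ?b (fst (c i))) : carrier M" using cochain_value[OF _ ti] by (simp add: cocycles_iff)
  show "(%j::unit. l i f) : carrier (free_space K UNIV)" using qK[OF f] by (simp add: free_space_simps l_def)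
  show "(%j::unit. l i (a \<odot>\<^bsub>cochain_space K L M n\<^esub> f)) = a \<odot>\<^bsub>free_space K UNIV\<^esub> (%j::unit. l i f)" if a: "a : carrier K" for a
  using linear_onD(3)[OF q(1) a f] ti by (simp add: l_def cs_simps free_space_simps)
  fix g assume "g : cocycles K L M act n"
  then have g: "g (map ?b (fst (c i))) : carrier M" using cochain_value[OF _ ti] by (simp add: cocycles_iff)
  show "(%j::unit. l i (f \<oplus>\<^bsub>cochain_space K L M n\<^esub> g)) = (%j::unit. l i f) \<oplus>\<^bsub>free_space K UNIV\<^esub> (%j::unit. l i g)"
  using linear_onD(2)[OF q(1) f g] ti by (simp add: l_def cs_simps free_space_simps)
  qed
 next
  fix z assume "z : cocycles K L M act n" and 0: "!!i. i < card ?I ==> l i z = zero K"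
  then have z: "z : cochains K L M n" by (simp add: cocycles_iff)
  have a: "CE.altf (carrier L) n (hat M z)" using z by (simp add: cochains_iff)
  have zb: "z (map ?b js) = zero M" if js: "js : inc_lists d n" for js
  proof -
  have zc: "z (map ?b js) : carrier M" by (rule cochain_value[OF z t[OF js]])
  have "q (z (map ?b js)) j = zero K" for j
  proof (cases "j < e")
  case True
  then have "(js, j) : c ` {..<card ?I}" using c js by (simp add: bij_betw_def)
  then obtain i where "i < card ?I" "c i = (js, j)" by auto
  then show ?thesis using 0[of i] by (simp add: l_def)
  next
  case False
  then show ?thesis using linear_onD(1)[OF q(1) zc] by (simp add: free_space_simps)
  qed
  then have "q (z (map ?b js)) = (%j. zero K)" by (rule ext)
  then show ?thesis using q(2)[OF zc] by simp
  qed
  have sc0: "lft M (smult M \<zero>\<^bsub>K\<^esub>) v = 0" for v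
  unfolding M.lft_zero[of v, symmetric] by (rule M.lft_cong) (rule lmult_0)
  have "hat M z xs = 0" if xs: "xs : LL n" for xs
  proof (rule altf_zero_on_basis[OF vL p CE.alt_forms' sc0 a _ xs])
  show "hat M z (map ?b js) = 0" if js: "js : inc_lists d n" for js
  unfolding hat_def zb[OF js] using N.embed_zero by simp
  qed
  then have "z = \<zero>\<^bsub>cochain_space K L M n\<^esub>"
  by (intro cochain_eq[OF z zero_cochain]) (simp add: hat_ops(3)[OF z])
  then show "z : coboundaries K L M act n" using linsubD(2)[OF linsub_coboundaries] by simp
 qed
 then show ?thesis by (simp add: cdim_def)
qed

section \<open>Invariance of cohomology under isomorphism\<close>

definition module_map ::
  "('k, 'e) ring_scheme => ('k, 'a, 'r) lie_algebra_scheme => ('k, 'b, 's) lie_algebra_scheme =>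
  ('k, 'm, 't) module_scheme => ('a => 'm => 'm) => ('b => 'm => 'm) => ('a => 'b) => bool"
 where "module_map K A B M a b h \<longleftrightarrow> (ALL x:carrier A. h x : carrier B) &
  (ALL x:carrier A. ALL y:carrier A. h (x \<oplus>\<^bsub>A\<^esub> y) = h x \<oplus>\<^bsub>B\<^esub> h y) &
  (ALL k:carrier K. ALL x:carrier A. h (k \<odot>\<^bsub>A\<^esub> x) = k \<odot>\<^bsub>B\<^esub> h x) &
  (ALL x:carrier A. ALL y:carrier A. h (bracket A x y) = bracket B (h x) (h y)) &
  (ALL x:carrier A. ALL m:carrier M. a x m = b (h x) m)"

lemma module_mapD:
 assumes "module_map K A B M a b h"
 shows "x : carrier A ==> h x : carrier B" "x : carrier A ==> y : carrier A ==> h (x \<oplus>\<^bsub>A\<^esub> y) = h x \<oplus>\<^bsub>B\<^esub> h y"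
  "k : carrier K ==> x : carrier A ==> h (k \<odot>\<^bsub>A\<^esub> x) = k \<odot>\<^bsub>B\<^esub> h x"
  "x : carrier A ==> y : carrier A ==> h (bracket A x y) = bracket B (h x) (h y)"
  "x : carrier A ==> m : carrier M ==> a x m = b (h x) m"
 using assms by (simp_all add: module_map_def)

lemma cocyc_pullback:
 assumes A: "lie_module K A M a" and B: "lie_module K B M b"
  and mm: "module_map K A B M a b h"
  and f: "f : cochains K B M n"
 shows "low A M n (%xs. hat M f (map h xs)) : cochains K A M n"
  "xs : tups (carrier A) n ==> hat M (low A M n (%xs. hat M f (map h xs))) xs = hat M f (map h xs)"
  "f : cocycles K B M b n ==> low A M n (%xs. hat M f (map h xs)) : cocycles K A M a n"
  "f : coboundaries K B M b n ==> low A M n (%xs. hat M f (map h xs)) : coboundaries K A M a n"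
proof -
 interpret A: lie_module K A M a by (rule A)
 interpret B: lie_module K B M b by (rule B)
 note h = module_mapD[OF mm]
 let ?r = "%F xs. F (map h xs)"
 have alt: "A.CE.altf (carrier A) k (?r F)" if "B.CE.altf (carrier B) k F" for k F
  by (rule altf_map[where A = "carrier A" and A' = "carrier B" and h = h and ad = "add A" and ad' = "add B" and sm = "smult A" and sm' = "smult B",
  OF A.CE.alt_forms' h(1,2,3) that])
 have ev: "A.CE.ev (?r F)" if "B.CE.ev F" for F using that by (simp add: A.CE.ev_def B.CE.ev_def)
 have ml: "map h xs : tups (carrier B) k" if "xs : tups (carrier A) k" for xs k
  using that h(1) by (auto simp: tups_def)
 have ac: "lft M (a x) v = lft M (b (h x)) v" if "x : carrier A" for x v by (rule A.M.lft_cong) (rule h(5)[OF that])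
 have dr: "dd (%x. lft M (a x)) (bracket A) (?r F) xs = dd (%x. lft M (b x)) (bracket B) F (map h xs)"
  if "xs : tups (carrier A) k" for F xs k
  by (rule dd_map[where A = "carrier A" and h = h and br = "bracket A" and br' = "bracket B"
  and act = "%x. lft M (a x)" and act' = "%x. lft M (b x)", OF h(4) ac that])
 have fa: "B.CE.altf (carrier B) n (hat M f)" using f by (simp add: B.cochains_iff)
 note ra = alt[OF fa] and re = ev[OF B.ev_hat[of f]]
 show lc: "low A M n (?r (hat M f)) : cochains K A M n" by (rule A.low_cochain[OF ra re])
 show hl: "hat M (low A M n (?r (hat M f))) xs = hat M f (map h xs)" if "xs : tups (carrier A) n" for xs
  by (rule A.hat_low[OF re that])
 show "low A M n (?r (hat M f)) : cocycles K A M a n" if c: "f : cocycles K B M b n"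
 proof -
  have "!!xs. xs : tups (carrier B) (Suc n) ==> dd (%x. lft M (b x)) (bracket B) (hat M f) xs = 0"
  using c by (simp add: B.cocycles_iff B.CE.cocyc_def)
  then have "A.CE.cocyc (carrier A) n (?r (hat M f))" using ra re dr ml by (simp add: A.CE.cocyc_def)
  from A.CE.cocyc_cong[OF A.CE.subB hl[symmetric] A.ev_hat this] show ?thesis using lc by (simp add: A.cocycles_iff)
 qed
 show "low A M n (?r (hat M f)) : coboundaries K A M a n" if c: "f : coboundaries K B M b n"
 proof -
  have fb: "B.CE.cobd (carrier B) n (hat M f)" using c by (simp add: B.coboundaries_iff)
  have "A.CE.cobd (carrier A) n (?r (hat M f))"
  proof (cases n)
  case 0
  then show ?thesis using fb ra re by (simp add: A.CE.cobd_def B.CE.cobd_def)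
  next
  case (Suc m)
  obtain g where g: "B.CE.altf (carrier B) m g" "B.CE.ev g"
  "!!xs. xs : tups (carrier B) (Suc m) ==> hat M f xs = dd (%x. lft M (b x)) (bracket B) g xs"
  using B.CE.cobdE[OF fb[unfolded Suc]] by blast
  show ?thesis unfolding Suc
  proof (rule A.CE.cobdI[OF ra[unfolded Suc] re alt[OF g(1)] ev[OF g(2)]])
  show "hat M f (map h xs) = dd (%x. lft M (a x)) (bracket A) (?r g) xs" if xs: "xs : tups (carrier A) (Suc m)" for xs
  unfolding g(3)[OF ml[OF xs]] dr[OF xs] by (rule refl)
  qed
  qed
  from A.CE.cobd_cong[OF A.CE.subB hl[symmetric] A.ev_hat this] show ?thesis using lc by (simp add: A.coboundaries_iff)
 qed
qed

text \<open>Serves to pass from L to its copy inside G. Pullback along h and along its inverse both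
  respect cocycles and coboundaries, so coordinates are transported by pullback.\<close>

lemma cdim_transfer:
 assumes A: "lie_module K A M a" and B: "lie_module K B M b"
  and mm: "module_map K A B M a b h"
  and bij: "bij_betw h (carrier A) (carrier B)" and q: "lie_module.cdim K A M a n k"
 shows "lie_module.cdim K B M b n k"
proof -
 interpret A: lie_module K A M a by (rule A)
 interpret B: lie_module K B M b by (rule B)
 note h = module_mapD[OF mm]
 define g where "g = inv_into (carrier A) h"
 have gh: "g (h x) = x" if "x : carrier A" for x
  unfolding g_def by (rule inv_into_f_f) (use bij that in "auto simp: bij_betw_def")
 have hg: "h (g y) = y" and gc: "g y : carrier A" if "y : carrier B" for y
  using f_inv_into_f[of y h "carrier A"] inv_into_into[of y h "carrier A"] bij that by (simp_all add: bij_betw_def g_def)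
 have g: "g (x \<oplus>\<^bsub>B\<^esub> y) = g x \<oplus>\<^bsub>A\<^esub> g y" "g (bracket B x y) = bracket A (g x) (g y)"
  if "x : carrier B" "y : carrier B" for x y
  using gh[of "g x \<oplus>\<^bsub>A\<^esub> g y"] gh[of "bracket A (g x) (g y)"] h(2,4)[OF gc gc, OF that] hg that gc A.bracket_closed by simp_all
 have gs: "g (c \<odot>\<^bsub>B\<^esub> x) = c \<odot>\<^bsub>A\<^esub> g x" if "c : carrier K" "x : carrier B" for c x
  using gh[of "c \<odot>\<^bsub>A\<^esub> g x"] h(3)[OF that(1) gc[OF that(2)]] hg that gc by simp
 have ga: "b x m = a (g x) m" if "x : carrier B" "m : carrier M" for x m
  using h(5)[OF gc[OF that(1)] that(2)] hg[OF that(1)] by simp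
 let ?CA = "cochain_space K A M n" and ?CB = "cochain_space K B M n"
 have mg: "module_map K B A M b a g" unfolding module_map_def by (intro conjI ballI gc g gs ga)
 note pA = cocyc_pullback[OF A B mm] and pB = cocyc_pullback[OF B A mg]
 define r where "r f = low A M n (%xs. hat M f (map h xs))" for f
 define s where "s f = low B M n (%xs. hat M f (map g xs))" for f
 have rs: "r (s f) = f" if f: "f : cochains K A M n" for f
 proof (rule A.cochain_eq[OF _ f])
  show "r (s f) : cochains K A M n" unfolding r_def s_def by (rule pA(1)[OF pB(1)[OF f]])
  fix xs assume xs: "xs : tups (carrier A) n"
  have mx: "map h xs : tups (carrier B) n" "map g (map h xs) = xs"
  using xs h(1) gh by (auto simp: tups_def intro!: map_idI)
  show "hat M (r (s f)) xs = hat M f xs"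
  unfolding r_def s_def pA(2)[OF pB(1)[OF f] xs] pB(2)[OF f mx(1)] mx(2) by (rule refl)
 qed
 have sr: "s (r f) = f" if f: "f : cochains K B M n" for f
 proof (rule B.cochain_eq[OF _ f])
  show "s (r f) : cochains K B M n" unfolding r_def s_def by (rule pB(1)[OF pA(1)[OF f]])
  fix xs assume xs: "xs : tups (carrier B) n"
  have mx: "map g xs : tups (carrier A) n" "map h (map g xs) = xs"
  using xs gc hg by (auto simp: tups_def intro!: map_idI)
  show "hat M (s (r f)) xs = hat M f xs"
  unfolding r_def s_def pB(2)[OF pA(1)[OF f] xs] pA(2)[OF f mx(1)] mx(2) by (rule refl)
 qed
 have zc: "f : cochains K A M n" if "f : cocycles K A M a n" for f using that by (simp add: A.cocycles_iff)
 have zc': "f : cochains K B M n" if "f : cocycles K B M b n" for f using that by (simp add: B.cocycles_iff)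
 have rz: "r f : cocycles K A M a n" if "f : cocycles K B M b n" for f unfolding r_def by (rule pA(3)[OF zc'[OF that] that])
 have bc: "f : cochains K A M n" if "f : coboundaries K A M a n" for f using that by (simp add: A.coboundaries_iff)
 have bc': "f : cochains K B M n" if "f : coboundaries K B M b n" for f using that by (simp add: B.coboundaries_iff)
 obtain \<pi> where \<pi>: "linear_on K ?CA (free_space K {..<k}) (cocycles K A M a n) \<pi>" "\<pi> ` cocycles K A M a n = carrier (free_space K {..<k})"
  "!!z. z : cocycles K A M a n ==> \<pi> z = (%j. zero K) \<longleftrightarrow> z : coboundaries K A M a n"
  using q unfolding A.cdim_def qdim_def by blast
 have mh: "map h xs : tups (carrier B) n" if "xs : tups (carrier A) n" for xs
  using that h(1) by (auto simp: tups_def)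
 have radd: "r (f \<oplus>\<^bsub>?CB\<^esub> f') = r f \<oplus>\<^bsub>?CA\<^esub> r f'" if f: "f : cochains K B M n" "f' : cochains K B M n" for f f'
 proof (rule A.cochain_eq)
  have c: "r f : cochains K A M n" "r f' : cochains K A M n" unfolding r_def by (rule pA(1)[OF f(1)], rule pA(1)[OF f(2)])
  show "r (f \<oplus>\<^bsub>?CB\<^esub> f') : cochains K A M n" unfolding r_def by (rule pA(1)[OF B.cochains_closed(1)[OF f]])
  show "r f \<oplus>\<^bsub>?CA\<^esub> r f' : cochains K A M n" by (rule A.cochains_closed(1)[OF c])
  fix xs assume xs: "xs : tups (carrier A) n"
  show "hat M (r (f \<oplus>\<^bsub>?CB\<^esub> f')) xs = hat M (r f \<oplus>\<^bsub>?CA\<^esub> r f') xs"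
  unfolding A.hat_ops(1)[OF c xs] unfolding r_def pA(2)[OF B.cochains_closed(1)[OF f] xs] pA(2)[OF f(1) xs] pA(2)[OF f(2) xs]
  by (rule B.hat_ops(1)[OF f mh[OF xs]])
 qed
 have rsm: "r (c \<odot>\<^bsub>?CB\<^esub> f) = c \<odot>\<^bsub>?CA\<^esub> r f" if k: "c : carrier K" and f: "f : cochains K B M n" for c f
 proof (rule A.cochain_eq)
  have c: "r f : cochains K A M n" unfolding r_def by (rule pA(1)[OF f])
  show "r (c \<odot>\<^bsub>?CB\<^esub> f) : cochains K A M n" unfolding r_def by (rule pA(1)[OF B.cochains_closed(2)[OF f k]])
  show "c \<odot>\<^bsub>?CA\<^esub> r f : cochains K A M n" by (rule A.cochains_closed(2)[OF c k])
  fix xs assume xs: "xs : tups (carrier A) n"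
  show "hat M (r (c \<odot>\<^bsub>?CB\<^esub> f)) xs = hat M (c \<odot>\<^bsub>?CA\<^esub> r f) xs"
  unfolding A.hat_ops(2)[OF c xs] unfolding r_def pA(2)[OF B.cochains_closed(2)[OF f k] xs] pA(2)[OF f xs]
  by (rule B.hat_ops(2)[OF f mh[OF xs]])
 qed
 show ?thesis
  unfolding B.cdim_def qdim_def
 proof (intro exI[of _ "%f. \<pi> (r f)"] conjI ballI)
  show "linear_on K ?CB (free_space K {..<k}) (cocycles K B M b n) (%f. \<pi> (r f))"
  unfolding linear_on_def
  proof (intro conjI ballI)
  fix f assume f: "f : cocycles K B M b n"
  show "\<pi> (r f) : carrier (free_space K {..<k})" by (rule linear_onD(1)[OF \<pi>(1) rz[OF f]])
  show "\<pi> (r (c \<odot>\<^bsub>?CB\<^esub> f)) = c \<odot>\<^bsub>free_space K {..<k}\<^esub> \<pi> (r f)" if c: "c : carrier K" for c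
  unfolding rsm[OF c zc'[OF f]] by (rule linear_onD(3)[OF \<pi>(1) c rz[OF f]])
  fix f' assume f': "f' : cocycles K B M b n"
  show "\<pi> (r (f \<oplus>\<^bsub>?CB\<^esub> f')) = \<pi> (r f) \<oplus>\<^bsub>free_space K {..<k}\<^esub> \<pi> (r f')"
  unfolding radd[OF zc'[OF f] zc'[OF f']] by (rule linear_onD(2)[OF \<pi>(1) rz[OF f] rz[OF f']])
  qed
  have "r ` cocycles K B M b n = cocycles K A M a n"
  proof
  show "r ` cocycles K B M b n <= cocycles K A M a n" by (rule image_subsetI) (rule rz)
  show "cocycles K A M a n <= r ` cocycles K B M b n"
  proof
  fix f assume f: "f : cocycles K A M a n"
  show "f : r ` cocycles K B M b n"
  by (rule image_eqI[of _ _ "s f"], rule rs[OF zc[OF f], symmetric]) (unfold s_def, rule pB(3)[OF zc[OF f] f])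
  qed
  qed
  then show "(%f. \<pi> (r f)) ` cocycles K B M b n = carrier (free_space K {..<k})" using \<pi>(2) by (simp only: image_image[symmetric])
  fix f assume f: "f : cocycles K B M b n"
  show "\<pi> (r f) = (%j. zero K) \<longleftrightarrow> f : coboundaries K B M b n"
  unfolding \<pi>(3)[OF rz[OF f]]
  proof
  assume "r f : coboundaries K A M a n"
  then have "s (r f) : coboundaries K B M b n" unfolding s_def by (intro pB(4) bc)
  then show "f : coboundaries K B M b n" unfolding sr[OF zc'[OF f]] .
  next
  assume fb: "f : coboundaries K B M b n"
  show "r f : coboundaries K A M a n" unfolding r_def by (rule pA(4)[OF zc'[OF f] fb])
  qed
 qed
qed

section \<open>Counting dimensions\<close>

primrec ext_dim :: "(nat => nat) => nat => nat => nat" where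
 "ext_dim h 0 n = h n"
| "ext_dim h (Suc k) n = ext_dim h k n + (case n of 0 => 0 | Suc m => ext_dim h k m)"

text \<open>The recursion, which is that of \<open>cone_dim\<close>, turns into Pascal's rule for
  the binomial coefficients.\<close>

lemma ext_dim_sum: "ext_dim h k n = (\<Sum>i\<le>n. (k choose i) * h (n - i))"
proof (induction k arbitrary: n)
 case 0
 have "(\<Sum>i\<le>n. (0 choose i) * h (n - i)) = (\<Sum>i\<le>n. if i = 0 then h n else 0)"
  by (rule sum.cong) auto
 then show ?case by simp
next
 case (Suc k)
 show ?case
 proof (cases n)
  case (Suc m)
  have "(\<Sum>i\<le>Suc m. (Suc k choose i) * h (Suc m - i)) = h (Suc m) + (\<Sum>i\<le>m. (Suc k choose Suc i) * h (m - i))"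
  by (subst sum.atMost_Suc_shift) simp
  also have "... = (h (Suc m) + (\<Sum>i\<le>m. (k choose Suc i) * h (m - i))) + (\<Sum>i\<le>m. (k choose i) * h (m - i))"
  by (simp add: add_mult_distrib sum.distrib)
  also have "h (Suc m) + (\<Sum>i\<le>m. (k choose Suc i) * h (m - i)) = (\<Sum>i\<le>Suc m. (k choose i) * h (Suc m - i))"
  by (subst sum.atMost_Suc_shift) simp
  finally show ?thesis using Suc.IH[of "Suc m"] Suc.IH[of m] Suc by simp
 qed (simp add: Suc)
qed

lemma card_bigraded: "card (SIGMA (i, j):{(i, j). i + j = n}. inc_lists d i \<times> {..<h j}) = ext_dim h d n"
proof -
 have eq: "{(i, j). i + j = n} = (%i. (i, n - i)) ` {..n}" by auto
 have "card (SIGMA (i, j):{(i, j). i + j = n}. inc_lists d i \<times> {..<h j}) = (\<Sum>(i, j)\<in>{(i, j). i + j = n}. (d choose i) * h j)"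
  by (subst card_SigmaI) (auto simp: eq card_inc_lists card_cartesian_product intro!: sum.cong)
 also have "... = (\<Sum>i\<le>n. (d choose i) * h (n - i))"
  unfolding eq by (subst sum.reindex) (auto simp: inj_on_def)
 finally show ?thesis by (simp add: ext_dim_sum)
qed

theorem theorem2p4:
  fixes K :: "'k ring" and p :: nat
    and L :: "('k, 'l) lie_algebra" and M :: "('k, 'm) module" and act :: "'l \<Rightarrow> 'm \<Rightarrow> 'm"
    and G :: "('k, 'g) lie_algebra" and pmap :: "'g \<Rightarrow> 'g" and \<iota> :: "'l \<Rightarrow> 'g"
    and \<phi> :: "'g \<Rightarrow> ('l list \<Rightarrow> 'k) set"
  assumes "field K" and "prime p" and "has_char K p"
    and "lie_algebra K L" and "vectorspace.fin_dim K L"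
    and "lie_module K L M act" and "vectorspace.fin_dim K M"
    and "p_envelope K p L G pmap \<iota>"
    and "vectorspace.fin_dim K (quot_space G (\<iota> ` carrier L))"
    and "\<phi> \<in> lie_hom K G (universal_p_envelope K p L)"
    and "\<forall>x\<in>carrier L. \<phi> (\<iota> x) = uea_incl K L x"
  shows "\<forall>n::nat. vs_iso K
    (ce_cohomology K n G M (\<lambda>x. uea_act K M act (\<phi> x)))
    (dsum {(i, j). i + j = n} (\<lambda>(i, j). tensor_space K
       (exterior_power K i (quot_space G (\<iota> ` carrier L)))
       (ce_cohomology K j L M act)))"
proof
 fix n :: nat
 note K = assms(1) and modM = assms(6)
 interpret E: p_env K L p G pmap \<iota> \<phi>
  by (intro p_env.intro lie_algebra'.intro assms(4) p_env_axioms.intro assms(5,8,10)) (use assms(11) in blast)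
 interpret LM: lie_module K L M act by (rule modM)
 let ?a = "%x. uea_act K M act (\<phi> x)"
 interpret MG: lie_module K G M ?a by (rule E.G_module[OF modM])
 interpret GV: vectorspace K G by (rule E.G_vs)
 let ?P = "\<iota> ` carrier L"
 let ?Q = "quot_space G ?P"
 have vQ: "vectorspace K ?Q" by (rule vectorspace.quot_space_vs[OF E.G_vs E.linsub_P])
 obtain d where bQ: "has_basis K ?Q {..<d::nat}" using vectorspace.fin_dim_has_basis[OF vQ assms(9)] by blast
 then have "qdim K G (carrier G) ?P {..<d}" by (simp only: vectorspace.has_basis_quot_iff[OF E.G_vs E.linsub_P])
 then obtain q where q: "linear_on K G (free_space K {..<d}) (carrier G) q" "q ` carrier G = carrier (free_space K {..<d})"
  "!!z. z : carrier G ==> q z = (%j. zero K) \<longleftrightarrow> z : ?P" unfolding qdim_def by blast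
 have qK: "q z j : carrier K" if "z : carrier G" for z j using linear_onD(1)[OF q(1) that] by (simp add: free_space_simps)
 have qadd: "q (y \<oplus>\<^bsub>G\<^esub> z) j = q y j \<oplus>\<^bsub>K\<^esub> q z j" if "y : carrier G" "z : carrier G" for y z j
  using linear_onD(2)[OF q(1) that] by (simp add: free_space_simps)
 have qsm: "q (c \<odot>\<^bsub>G\<^esub> z) j = c \<otimes>\<^bsub>K\<^esub> q z j" if "c : carrier K" "z : carrier G" for c z j
  using linear_onD(3)[OF q(1) that] by (simp add: free_space_simps)
 \<comment> \<open>A flag from L to G: the elements whose coordinates in G/L vanish from position k
   on. Each member contains L, hence [G, G], and is therefore an ideal.\<close>
 define H where "H k = {z : carrier G. ALL j>=k. q z j = zero K}" for k
 have q0: "q \<zero>\<^bsub>G\<^esub> j = zero K" for j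
  using q(3)[OF linsubD(1)[OF E.linsub_P linsubD(2)[OF E.linsub_P]]] linsubD(2)[OF E.linsub_P] by simp
 have subH: "linsub K G (H k)" for k
  unfolding linsub_def H_def
 proof (intro conjI ballI subsetI)
  show "zero G : {z : carrier G. ALL j>=k. q z j = zero K}"
  using q0 linsubD(1)[OF E.linsub_P linsubD(2)[OF E.linsub_P]] by simp
  show "y \<oplus>\<^bsub>G\<^esub> z : {z : carrier G. ALL j>=k. q z j = zero K}"
  if "y : {z : carrier G. ALL j>=k. q z j = zero K}" "z : {z : carrier G. ALL j>=k. q z j = zero K}" for y z
  using that linsubD(3)[OF vectorspace.linsub_carrier[OF E.G_vs]] by (simp add: qadd)
  show "c \<odot>\<^bsub>G\<^esub> z : {z : carrier G. ALL j>=k. q z j = zero K}"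
  if "c : carrier K" "z : {z : carrier G. ALL j>=k. q z j = zero K}" for c z
  using that linsubD(4)[OF vectorspace.linsub_carrier[OF E.G_vs]] by (simp add: qsm)
 qed simp
 have HG: "z : carrier G" if "z : H k" for z k using that by (simp add: H_def)
 have PH: "?P <= H k" for k
 proof
  fix z assume z: "z : ?P"
  then have "q z = (%j. zero K)" using q(3)[OF E.P_G[OF z]] by blast
  then show "z : H k" using E.P_G[OF z] by (simp add: H_def)
 qed
 have H0: "H 0 = ?P"
 proof
  show "H 0 <= ?P"
  proof
  fix z assume z: "z : H 0"
  have "q z = (%j. zero K)" using z by (simp add: H_def fun_eq_iff)
  then show "z : ?P" using q(3)[OF HG[OF z]] by blast
  qed
 qed (rule PH)
 have Hd: "H d = carrier G"
  using linear_onD(1)[OF q(1)] by (auto simp: H_def free_space_simps)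
 have GH: "bracket G y z : H k" if "y : carrier G" "z : carrier G" for y z k using E.G_G[OF that] PH by blast
 have mod: "lie_module K (G\<lparr>carrier := H k\<rparr>) M ?a" for k
  by (rule MG.sub_module[OF subH]) (rule GH[OF HG HG])
 have "ALL j. EX h. LM.cdim j h" using LM.finite_cdim[OF assms(5,7)] by blast
 then obtain h where h: "!!j. LM.cdim j (h j)" by metis
 have dim: "k <= d ==> lie_module.cdim K (G\<lparr>carrier := H k\<rparr>) M ?a n (ext_dim h k n)" for k n
 proof (induction k arbitrary: n)
  case 0
  \<comment> \<open>The bottom of the flag is the image of L, on which the action through \<phi> is
    the given one.\<close>
  have mm: "module_map K L (G\<lparr>carrier := H 0\<rparr>) M act ?a \<iota>"
  unfolding module_map_def H0 using E.iota E.phi_iota lie_module'.uea_act_incl[OF lie_module'.intro[OF E.lie_algebra'_axioms modM]] by simp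
  have bb: "bij_betw \<iota> (carrier L) (carrier (G\<lparr>carrier := H 0\<rparr>))" using E.iota(5) by (simp add: bij_betw_def H0)
  show ?case unfolding ext_dim.simps by (rule cdim_transfer[OF modM mod mm bb h])
 next
  case (Suc k)
  let ?A = "G\<lparr>carrier := H (Suc k)\<rparr>"
  have eqs: "add ?A = add G" "smult ?A = smult G" "bracket ?A = bracket G" "zero ?A = zero G" "carrier ?A = H (Suc k)"
  "?A\<lparr>carrier := H k\<rparr> = G\<lparr>carrier := H k\<rparr>" by simp_all
  interpret A: lie_module K ?A M ?a by (rule mod)
  have kd: "k : {..<d}" using Suc.prems by simp
  \<comment> \<open>A lift of basis vector k of G/L. It spans \<open>H (Suc k)\<close> together with
    \<open>H k\<close>, and coordinate k is the linear form on \<open>H (Suc k)\<close> with kernel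
    \<open>H k\<close>.\<close>
  obtain x where x: "x : carrier G" "q x = free_gen K k"
  using basis_vec[OF K q(2) kd] by blast
  have xH: "x : H (Suc k)" using x by (simp add: H_def free_gen_def)
  have HS: "z : H k \<longleftrightarrow> q z k = zero K" if "z : H (Suc k)" for z
  proof
  assume "q z k = zero K"
  then have "q z j = zero K" if "k <= j" for j
  using that \<open>z : H (Suc k)\<close> by (cases "j = k") (auto simp: H_def)
  then show "z : H k" using that by (simp add: H_def)
  qed (simp add: H_def)
  show ?case
  unfolding ext_dim.simps
  proof (rule A.cone_dim[where \<chi> = "%z. q z k" and x = x and H = "H k" and h = "ext_dim h k", unfolded eqs])
  show "linsub K ?A (H k)" using subH[of k] unfolding linsub_def by (auto simp: H_def)
  show "bracket G y z : H k" if "y : H (Suc k)" "z : H (Suc k)" for y z by (rule GH[OF HG[OF that(1)] HG[OF that(2)]])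
  show "q y k : carrier K" if "y : H (Suc k)" for y by (rule qK[OF HG[OF that]])
  show "q (y \<oplus>\<^bsub>G\<^esub> z) k = q y k \<oplus>\<^bsub>K\<^esub> q z k" if "y : H (Suc k)" "z : H (Suc k)" for y z
  by (rule qadd[OF HG[OF that(1)] HG[OF that(2)]])
  show "q (c \<odot>\<^bsub>G\<^esub> y) k = c \<otimes>\<^bsub>K\<^esub> q y k" if "c : carrier K" "y : H (Suc k)" for c y
  by (rule qsm[OF that(1) HG[OF that(2)]])
  show "y : H k \<longleftrightarrow> q y k = zero K" if "y : H (Suc k)" for y by (rule HS[OF that])
  show "x : H (Suc k)" by (rule xH)
  show "q x k = one K" by (simp add: x(2) free_gen_def)
  \<comment> \<open>The differential and theta use the operations of G only, so triviality proved
    inside G holds verbatim for the subalgebra \<open>H (Suc k)\<close>.\<close>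
  show "MG.CE.cobd (H k) m (th (lft M (?a x)) (bracket G x) f)" if "MG.CE.cocyc (H k) m f" for m f
  using E.triviality[OF modM subH PH x(1)] that unfolding E.triv_def by blast
  show "lie_module.cdim K (G\<lparr>carrier := H k\<rparr>) M ?a m (ext_dim h k m)" for m
  by (rule Suc.IH) (use Suc.prems in simp)
  qed
 qed
 have "MG.cdim n (ext_dim h d n)" using dim[of d n] by (simp add: Hd)
 note LHS = MG.has_basis_cohomology[OF this]
 let ?T = "%(i, j). tensor_space K (exterior_power K i ?Q) (ce_cohomology K j L M act)"
 let ?I = "{(i, j). i + j = n}"
 let ?J = "%(i, j). inc_lists d i \<times> {..<h j}"
 have finI: "finite ?I" by (rule finite_subset[of _ "{..n} \<times> {..n}"]) auto
 note t = has_basis_tensor[OF K has_basis_exterior(1)[OF K vQ bQ] LM.has_basis_cohomology(1)[OF h]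
  has_basis_exterior(2)[OF K vQ bQ] card_inc_lists(2) LM.has_basis_cohomology(2)[OF h] finite_lessThan]
 have T: "vectorspace K (?T i)" "has_basis K (?T i) (?J i)" "finite (?J i)" for i
  using t card_inc_lists(2) by (simp_all split: prod.split)
 have vW: "vectorspace K (dsum ?I ?T)" by (rule dsum_vs[OF K T(1) finI])
 have bW: "has_basis K (dsum ?I ?T) (Sigma ?I ?J)" by (rule has_basis_dsum[OF K T(2) finI T(3)])
 have fJ: "finite (Sigma ?I ?J)" by (rule finite_SigmaI[OF finI T(3)])
 have "card (Sigma ?I ?J) = card {..<ext_dim h d n}" using card_bigraded[of n d h] by simp
 from vectorspace.qdim_card[OF vW bW fJ finite_lessThan this]
 show "vs_iso K (ce_cohomology K n G M ?a) (dsum ?I ?T)"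
  by (rule vectorspace.vs_isoI[OF LHS(1) vW LHS(2)])
qed

end
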